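(* In the setting described in the context, assume that $\mu\ll\mathcal{L}$ with a density that is bounded away from $0$ and $+\infty$ (there are constants $0<M_l\le M_u<\infty$ with $M_l\le\frac{d\mu}{d\mathcal{L}}(x)\le M_u$ for all $x\in X$) and of bounded variation. Assume that the discrete iterates have uniformly bounded basic cell variation, i.e. $$\sup_{n\in2\mathbb{N},\,k\in\mathbb{N}}\mathrm{WTVB}(\pi^{n,k})<+\infty.$$ Then, up to a subsequence in $n$, there exists a trajectory $\boldsymbol{\pi}\in\mathcal{M}_+(\mathbb{R}_+\times X\times Y)$ with $\boldsymbol{\pi}_t\in\Pi(\mu,\nu)$ for all $t\in\mathbb{R}_+$, such that the discrete trajectories satisfy: $\boldsymbol{\pi}^n_t$ converges to $\boldsymbol{\pi}_t$ in $\mathcal{W}$ uniformly in $t\in[0,T]$, for all $T>0$.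
   Context: Notation. $\mathbb{R}_+=[0,\infty)$, $\mathbb{N}=\{0,1,2,\dots\}$, $2\mathbb{N}$ denotes the positive even integers, $\mathcal{L}$ is Lebesgue measure; $\mathcal{M}_+(S)$, $\mathcal{P}(S)$ are the non-negative (Radon) and probability measures on $S$; $\rho|_A$ is the restriction of a measure $\rho$ to $A$; $P_X,P_Y$ denote the marginals on $X$, $Y$; $\Pi(\alpha,\beta)$ is the set of non-negative measures on the product space with first marginal $\alpha$ and second marginal $\beta$. $\mathrm{KL}(\alpha|\beta)=\int\varphi(\frac{d\alpha}{d\beta})\,d\beta$ if $0\le\alpha\ll\beta$ and $+\infty$ otherwise, with $\varphi(s)=s\log s-s+1$ for $s>0$, $\varphi(0)=1$; the convention $0\cdot\infty=0$ is used. $W_Y$ is the Wasserstein-1 metric on $\mathcal{P}(Y)$. Subscripts $t$ or $t,x$ on a measure denote its disintegration with respect to $\mathcal{L}$ (in time) or $\mathcal{L}\otimes\mu$ (in time and $X$). Problem data. $d\ge1$, $X=[0,1]^d$, $Y\subset\mathbb{R}^d$ compact, $\mu\in\mathcal{P}(X)$ with $\mu\ll\mathcal{L}$, $\nu\in\mathcal{P}(Y)$, $c\in C^1(X\times Y)$, $\pi_{\mathrm{init}}\in\Pi(\mu,\nu)$. For $n\in2\mathbb{N}$: the basic cells are $X^n_i=i/n+[0,1/n]^d$, $i\in I^n=\{0,\dots,n-1\}^d$, and it is assumed that $m^n_i:=\mu(X^n_i)>0$. $\mu^n\in\mathcal{P}(X)$ satisfies $\mu^n(X^n_i)=m^n_i$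 for all $i$ and gives no mass to boundaries of basic cells (hence overlaps of closed cells are irrelevant). $\nu^n\in\mathcal{P}(Y)$, $\nu^n\to\nu$ weak*; $\pi^n_{\mathrm{init}}\in\Pi(\mu^n,\nu^n)$, $\pi^n_{\mathrm{init}}\to\pi_{\mathrm{init}}$ weak*. $c^n=c+f^n/n$ is continuous, where $f^n:X\times Y\to\mathbb{R}$ converge uniformly to $0$. $\varepsilon^n\in[0,\infty)$ and $\eta:=\lim_{n\to\infty}n\varepsilon^n$ exists in $[0,\infty]$. Composite cells. $\mathcal{J}^n_A$ is the partition of $I^n$ into the groups of $2^d$ adjacent indices on which $(\lfloor i_\ell/2\rfloor)_{\ell=1}^d$ is constant; $\mathcal{J}^n_B$ is the partition into groups on which $(\lfloor (i_\ell+1)/2\rfloor)_{\ell=1}^d$ is constant (the same grouping shifted by one cell in each direction; boundary groups are smaller). For $J$ in either: $X^n_J=\bigcup_{i\in J}X^n_i$, $\mu^n_J=\mu^n|_{X^n_J}$, $m^n_J=\sum_{i\in J}m^n_i$. Set $\mathcal{J}^{n,k}=\mathcal{J}^n_A$ for $k$ odd and $\mathcal{J}^{n,k}=\mathcal{J}^n_B$ for $k$ even. Domain decomposition iterates. $\pi^{n,0}=\pi^n_{\mathrm{init}}$; for $k\ge1$, $\pi^{n,k}=\sum_{J\in\mathcal{J}^{n,k}}\pi^{n,k}_J$, where $\pi^{n,k}_J$ is a (selected) minimizer of $\int_{X^n_J\times Y}c^n\,d\pi+\varepsilon^n\,\mathrm{KL}(\pi|\mu^n_J\otimes\nu^n)$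 over $\pi\in\Pi(\mu^n_J,P_Y(\pi^{n,k-1}|_{X^n_J\times Y}))$. Set $\nu^{n,k}_i=P_Y(\pi^{n,k}|_{X^n_i\times Y})$, $\nu^{n,k}_J=\sum_{i\in J}\nu^{n,k}_i$, $\rho^{n,k}_i=\nu^{n,k}_i/m^n_i$, $\rho^{n,k}_J=\nu^{n,k}_J/m^n_J$. Discrete trajectory. $\boldsymbol{\pi}^n\in\mathcal{M}_+(\mathbb{R}_+\times X\times Y)$ is defined by its disintegration with respect to $\mathcal{L}\otimes\mu$: for $t\ge0$, $x\in X$, with $k=\lfloor nt\rfloor$ and $J$ the ($\mu$-a.e. unique) cell in $\mathcal{J}^{n,k}$ with $x\in X^n_J$, $\boldsymbol{\pi}^n_{t,x}=\rho^{n,k}_J$. Thus $\boldsymbol{\pi}^n_t=\mu\otimes\boldsymbol{\pi}^n_{t,x}$. Vertical transport metric. For $\pi,\pi'\in\Pi(\mu):=\{\pi\in\mathcal{M}_+(X\times Y):P_X\pi=\mu\}$ with disintegrations $\pi_x,\pi'_x$ with respect to $\mu$: $\mathcal{W}(\pi,\pi')=\int_XW_Y(\pi_x,\pi'_x)\,d\mu(x)$. Basic-cell Wasserstein variation. $\mathrm{WTVB}(\pi^{n,k})=\frac{1}{n^{d-1}}\sum W_Y(\rho^{n,k}_i,\rho^{n,k}_{i'})$, the sum over all pairs $i,i'\in I^n$ with $i-i'\in\{2\mathbf{e}_1,\dots,2\mathbf{e}_d\}$, $\mathbf{e}_\ell$ the $\ell$-th coordinate unit vector. *)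

theory Defs
  imports "HOL-Probability.Probability"
begin

section \<open>Measures, couplings, disintegration\<close>

text \<open>A measure on a subset \<open>S\<close> is represented by a Borel measure on the ambient space that
  gives no mass to the complement of \<open>S\<close>; all sets \<open>S\<close> used below are closed.\<close>

definition prob_on :: "'a::topological_space set \<Rightarrow> 'a measure set" where
  "prob_on S = {M. sets M = sets borel \<and> prob_space M \<and> emeasure M (- S) = 0}"

text \<open>In the locally compact, second countable spaces occurring below, a Borel measure is Radon
  iff it is finite on compact sets.\<close>

definition radon_on :: "'a::topological_space set \<Rightarrow> 'a measure set" where
  "radon_on S = {M. sets M = sets borel \<and> emeasure M (- S) = 0 \<and>
     (\<forall>K. compact K \<longrightarrow> emeasure M K < \<infinity>)}"

definition mrestrict :: "'a measure \<Rightarrow> 'a set \<Rightarrow> 'a measure" where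
  "mrestrict M A = density M (indicator A)"

definition sum_measure :: "('i \<Rightarrow> 'a::topological_space measure) \<Rightarrow> 'i set \<Rightarrow> 'a measure" where
  "sum_measure F I = measure_of UNIV (sets borel) (\<lambda>A. \<Sum>i\<in>I. emeasure (F i) A)"

lemma sets_sum_measure [simp]: "sets (sum_measure F I) = sets borel"
  unfolding sum_measure_def by (metis sets.sets_measure_of_eq space_borel)

lemma emeasure_sum_measure:
  fixes F :: "'i \<Rightarrow> 'a::topological_space measure"
  assumes "\<And>i. i \<in> I \<Longrightarrow> sets (F i) = sets borel" and "A \<in> sets borel"
  shows "emeasure (sum_measure F I) A = (\<Sum>i\<in>I. emeasure (F i) A)"
proof -
  let ?\<mu> = "\<lambda>A. \<Sum>i\<in>I. emeasure (F i) A"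
  have "emeasure (measure_of UNIV (sets borel) ?\<mu>) A = ?\<mu> A"
  proof (rule emeasure_measure_of_sigma)
    show "sigma_algebra UNIV (sets (borel :: 'a measure))"
      using sets.sigma_algebra_axioms[of "borel :: 'a measure"] by simp
    show "positive (sets borel) ?\<mu>" by (simp add: positive_def)
    show "countably_additive (sets borel) ?\<mu>"
    proof (rule countably_additiveI)
      fix B :: "nat \<Rightarrow> 'a set"
      assume B: "range B \<subseteq> sets borel" "disjoint_family B"
      have "(\<Sum>j. ?\<mu> (B j)) = (\<Sum>i\<in>I. \<Sum>j. emeasure (F i) (B j))"
        by (rule suminf_sum) auto
      also have "\<dots> = ?\<mu> (\<Union>j. B j)"
        using B assms(1) by (intro sum.cong refl suminf_emeasure) auto
      finally show "(\<Sum>j. ?\<mu> (B j)) = ?\<mu> (\<Union>j. B j)" .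
    qed
  qed (rule assms(2))
  then show ?thesis by (simp add: sum_measure_def)
qed

definition couplings ::
  "'a::topological_space measure \<Rightarrow> 'b::topological_space measure \<Rightarrow> ('a \<times> 'b) measure set" where
  "couplings \<alpha> \<beta> = {\<pi>. sets \<pi> = sets borel \<and> distr \<pi> borel fst = \<alpha> \<and> distr \<pi> borel snd = \<beta>}"

definition weak_star_conv ::
  "'a::topological_space set \<Rightarrow> (nat \<Rightarrow> 'a measure) \<Rightarrow> 'a measure \<Rightarrow> nat filter \<Rightarrow> bool" where
  "weak_star_conv S M N F \<longleftrightarrow> (\<forall>h :: 'a \<Rightarrow> real. continuous_on S h \<longrightarrow>
     ((\<lambda>n. LINT z:S|M n. h z) \<longlongrightarrow> (LINT z:S|N. h z)) F)"

text \<open>\<open>kernel S T \<kappa>\<close>: a measurable family of probability measures on \<open>T\<close>, indexed by \<open>S\<close>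
  (the values off \<open>S\<close> are irrelevant).\<close>

definition kernel ::
  "'a::topological_space set \<Rightarrow> 'b::topological_space set \<Rightarrow> ('a \<Rightarrow> 'b measure) \<Rightarrow> bool" where
  "kernel S T \<kappa> \<longleftrightarrow>
     \<kappa> \<in> measurable (restrict_space borel S) (prob_algebra borel) \<and> (\<forall>s\<in>S. \<kappa> s \<in> prob_on T)"

definition semidirect ::
  "'a::topological_space measure \<Rightarrow> ('a \<Rightarrow> 'b::topological_space measure) \<Rightarrow> ('a \<times> 'b) measure" where
  "semidirect \<alpha> \<kappa> = measure_of UNIV (sets borel) (\<lambda>A. \<integral>\<^sup>+ s. emeasure (\<kappa> s) (Pair s -` A) \<partial>\<alpha>)"

definition disintegration ::
  "'a::topological_space set \<Rightarrow> 'b::topological_space set \<Rightarrow> 'a measure \<Rightarrow> ('a \<times> 'b) measure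
    \<Rightarrow> ('a \<Rightarrow> 'b measure) \<Rightarrow> bool" where
  "disintegration S T \<alpha> \<pi> \<kappa> \<longleftrightarrow> kernel S T \<kappa> \<and> sets \<pi> = sets borel \<and>
     (\<forall>A\<in>sets borel. emeasure \<pi> A = (\<integral>\<^sup>+ s. emeasure (\<kappa> s) (Pair s -` A) \<partial>\<alpha>))"

lemma disintegration_semidirect:
  fixes \<alpha> :: "'a::second_countable_topology measure"
    and \<kappa> :: "'a \<Rightarrow> 'b::second_countable_topology measure"
  assumes \<alpha>: "sets \<alpha> = sets borel" "emeasure \<alpha> (- S) = 0" and S: "S \<in> sets borel"
    and \<kappa>: "kernel S T \<kappa>"
  shows "disintegration S T \<alpha> (semidirect \<alpha> \<kappa>) \<kappa>"
proof -
  define F where "F = (\<lambda>A s. indicator S s * emeasure (\<kappa> s) (Pair s -` A))"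
  have AE_S: "AE s in \<alpha>. s \<in> S"
    using \<alpha> S by (intro AE_I[of _ _ "- S"]) auto
  have F_eq: "(\<integral>\<^sup>+ s. emeasure (\<kappa> s) (Pair s -` A) \<partial>\<alpha>) = (\<integral>\<^sup>+ s. F A s \<partial>\<alpha>)" for A
    using AE_S by (intro nn_integral_cong_AE) (auto simp: F_def)
  have F_meas: "F A \<in> borel_measurable \<alpha>" if A: "A \<in> sets borel" for A
  proof -
    have \<kappa>': "\<kappa> \<in> measurable (restrict_space borel S) (subprob_algebra borel)"
      using \<kappa> unfolding kernel_def by (auto intro: measurable_prob_algebraD)
    have A': "A \<in> sets (borel \<Otimes>\<^sub>M borel)" using A by (metis borel_prod)
    have "Sigma (space (restrict_space borel S)) (\<lambda>s. Pair s -` A) =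
        A \<inter> (space (restrict_space borel S) \<times> space borel)"
      by auto
    also have "\<dots> \<in> sets (restrict_space borel S \<Otimes>\<^sub>M borel)"
    proof -
      have "(\<lambda>z. z) \<in> measurable (restrict_space borel S \<Otimes>\<^sub>M borel) ((borel :: 'a measure) \<Otimes>\<^sub>M (borel :: 'b measure))"
        by (rule measurable_pair) (auto simp: comp_def intro!: measurable_restrict_space1
            measurable_compose[OF measurable_fst])
      from measurable_sets[OF this A'] show ?thesis
        by (simp add: space_pair_measure Int_commute)
    qed
    finally have "(\<lambda>s. emeasure (\<kappa> s) (Pair s -` A)) \<in> borel_measurable (restrict_space borel S)"
      using \<kappa>' by (rule emeasure_measurable_subprob_algebra2)
    then have "(\<lambda>s. emeasure (\<kappa> s) (Pair s -` A) * indicator S s) \<in> borel_measurable borel"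
      using S by (subst (asm) borel_measurable_restrict_space_iff_ennreal) auto
    then show ?thesis
      unfolding F_def measurable_cong_sets[OF \<alpha>(1) refl] by (simp add: mult.commute)
  qed
  have sets: "sets (semidirect \<alpha> \<kappa>) = sets borel"
    unfolding semidirect_def by (metis sets.sets_measure_of_eq space_borel)
  have "emeasure (semidirect \<alpha> \<kappa>) A = (\<integral>\<^sup>+ s. emeasure (\<kappa> s) (Pair s -` A) \<partial>\<alpha>)"
    if A: "A \<in> sets borel" for A
    unfolding semidirect_def F_eq
  proof (rule emeasure_measure_of_sigma)
    show "sigma_algebra UNIV (sets (borel :: ('a \<times> 'b) measure))"
      using sets.sigma_algebra_axioms[of "borel :: ('a \<times> 'b) measure"] by simp
    show "positive (sets borel) (\<lambda>A. \<integral>\<^sup>+ s. F A s \<partial>\<alpha>)" by (simp add: positive_def F_def)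
    show "countably_additive (sets borel) (\<lambda>A. \<integral>\<^sup>+ s. F A s \<partial>\<alpha>)"
    proof (rule countably_additiveI)
      fix B :: "nat \<Rightarrow> ('a \<times> 'b) set"
      assume B: "range B \<subseteq> sets borel" "disjoint_family B"
      have "(\<Sum>j. \<integral>\<^sup>+ s. F (B j) s \<partial>\<alpha>) = (\<integral>\<^sup>+ s. (\<Sum>j. F (B j) s) \<partial>\<alpha>)"
        using B F_meas by (intro nn_integral_suminf[symmetric]) auto
      also have "\<dots> = (\<integral>\<^sup>+ s. F (\<Union>j. B j) s \<partial>\<alpha>)"
      proof (rule nn_integral_cong)
        fix s
        show "(\<Sum>j. F (B j) s) = F (\<Union>j. B j) s"
        proof (cases "s \<in> S")
          case True
          then have sets_\<kappa>: "sets (\<kappa> s) = sets borel"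
            using \<kappa> by (auto simp: kernel_def prob_on_def)
          have "Pair s -` B j \<in> sets (\<kappa> s)" for j
          proof -
            have "B j \<in> sets ((borel :: 'a measure) \<Otimes>\<^sub>M (borel :: 'b measure))"
              using B(1) by (metis borel_prod range_subsetD)
            from sets_Pair1[OF this] show ?thesis by (simp add: sets_\<kappa>)
          qed
          moreover have "disjoint_family (\<lambda>j. Pair s -` B j)"
            using B(2) by (auto simp: disjoint_family_on_def)
          ultimately have "(\<Sum>j. emeasure (\<kappa> s) (Pair s -` B j)) = emeasure (\<kappa> s) (\<Union>j. Pair s -` B j)"
            by (intro suminf_emeasure) auto
          then show ?thesis using True by (simp add: F_def vimage_UN)
        qed (simp add: F_def)
      qed
      finally show "(\<Sum>j. \<integral>\<^sup>+ s. F (B j) s \<partial>\<alpha>) = (\<integral>\<^sup>+ s. F (\<Union>j. B j) s \<partial>\<alpha>)" .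
    qed
  qed (rule A)
  then show ?thesis using \<kappa> sets by (simp add: disintegration_def)
qed

section \<open>Entropy, Wasserstein distance, vertical transport metric\<close>

definition entropy_fun :: "real \<Rightarrow> real" where
  "entropy_fun s = (if s = 0 then 1 else s * ln s - s + 1)"

definition KL :: "'a measure \<Rightarrow> 'a measure \<Rightarrow> ennreal" where
  "KL \<alpha> \<beta> = (if absolutely_continuous \<beta> \<alpha>
     then \<integral>\<^sup>+ z. ennreal (entropy_fun (enn2real (RN_deriv \<beta> \<alpha> z))) \<partial>\<beta> else \<infinity>)"

definition W1 :: "'a::metric_space measure \<Rightarrow> 'a measure \<Rightarrow> ennreal" where
  "W1 \<alpha> \<beta> = (INF \<gamma>\<in>couplings \<alpha> \<beta>. \<integral>\<^sup>+ z. ennreal (dist (fst z) (snd z)) \<partial>\<gamma>)"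

text \<open>The disintegration is unique up to a \<open>\<mu>\<close>-null set, so the choice made here does not affect
  the integral.\<close>

definition vertical_W ::
  "'a::topological_space set \<Rightarrow> 'b::metric_space set \<Rightarrow> 'a measure
    \<Rightarrow> ('a \<times> 'b) measure \<Rightarrow> ('a \<times> 'b) measure \<Rightarrow> ennreal" where
  "vertical_W X Y \<mu> \<pi> \<pi>' = (\<integral>\<^sup>+ x. W1 ((SOME \<kappa>. disintegration X Y \<mu> \<pi> \<kappa>) x)
     ((SOME \<kappa>. disintegration X Y \<mu> \<pi>' \<kappa>) x) \<partial>\<mu>)"

section \<open>Regularity of functions\<close>

definition C1_with_deriv ::
  "'a::real_normed_vector set \<Rightarrow> ('a \<Rightarrow> 'b::real_normed_vector) \<Rightarrow> ('a \<Rightarrow> 'a \<Rightarrow>\<^sub>L 'b) \<Rightarrow> bool" where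
  "C1_with_deriv U f f' \<longleftrightarrow>
     (\<forall>z\<in>U. (f has_derivative blinfun_apply (f' z)) (at z)) \<and> continuous_on U f'"

text \<open>\<open>C\<^sup>1\<close> on a closed set: there is a \<open>C\<^sup>1\<close> extension to an open neighbourhood.\<close>

definition C1_on :: "'a::real_normed_vector set \<Rightarrow> ('a \<Rightarrow> 'b::real_normed_vector) \<Rightarrow> bool" where
  "C1_on S f \<longleftrightarrow> (\<exists>U g g'. open U \<and> S \<subseteq> U \<and> (\<forall>z\<in>S. g z = f z) \<and> C1_with_deriv U g g')"

text \<open>The distributional total variation on an open set; \<open>\<phi>\<close> runs over the \<open>C\<^sup>1\<close> vector fields
  with compact support in \<open>\<Omega>\<close> and norm at most one, and \<open>\<phi>'\<close> is the derivative of \<open>\<phi>\<close>.\<close>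

definition total_variation :: "(real^'n::finite) set \<Rightarrow> (real^'n \<Rightarrow> real) \<Rightarrow> ereal" where
  "total_variation \<Omega> g =
     (SUP (\<phi>, \<phi>') \<in> {(\<phi> :: real^'n \<Rightarrow> real^'n, \<phi>'). C1_with_deriv UNIV \<phi> \<phi>' \<and>
           compact (closure {x. \<phi> x \<noteq> 0}) \<and> closure {x. \<phi> x \<noteq> 0} \<subseteq> \<Omega> \<and> (\<forall>x. norm (\<phi> x) \<le> 1)}.
        ereal (LINT x:\<Omega>|lborel. g x * (\<Sum>l\<in>UNIV. blinfun_apply (\<phi>' x) (axis l 1) $ l)))"

definition bounded_variation :: "(real^'n::finite) set \<Rightarrow> (real^'n \<Rightarrow> real) \<Rightarrow> bool" where
  "bounded_variation \<Omega> g \<longleftrightarrow> set_integrable lborel \<Omega> g \<and> total_variation \<Omega> g < \<infinity>"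

section \<open>Basic and composite cells\<close>

definition unit_cube :: "(real^'n::finite) set" where
  "unit_cube = cbox (\<chi> l. 0) (\<chi> l. 1)"

definition pos_even :: "nat set" where
  "pos_even = {n. even n \<and> 0 < n}"

definition even_sequentially :: "nat filter" where
  "even_sequentially = inf sequentially (principal pos_even)"

definition idx :: "nat \<Rightarrow> (nat^'n::finite) set" where
  "idx n = {i. \<forall>l. i $ l < n}"

definition cell :: "nat \<Rightarrow> nat^'n::finite \<Rightarrow> (real^'n) set" where
  "cell n i = cbox (\<chi> l. real (i $ l) / real n) (\<chi> l. (real (i $ l) + 1) / real n)"

definition composites_A :: "nat \<Rightarrow> (nat^'n::finite) set set" where
  "composites_A n =
     idx n // {(i, j). i \<in> idx n \<and> j \<in> idx n \<and> (\<forall>l. (i $ l) div 2 = (j $ l) div 2)}"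

definition composites_B :: "nat \<Rightarrow> (nat^'n::finite) set set" where
  "composites_B n =
     idx n // {(i, j). i \<in> idx n \<and> j \<in> idx n \<and> (\<forall>l. (i $ l + 1) div 2 = (j $ l + 1) div 2)}"

definition composites :: "nat \<Rightarrow> nat \<Rightarrow> (nat^'n::finite) set set" where
  "composites n k = (if odd k then composites_A n else composites_B n)"

definition comp_cell :: "nat \<Rightarrow> (nat^'n::finite) set \<Rightarrow> (real^'n) set" where
  "comp_cell n J = (\<Union>i\<in>J. cell n i)"

section \<open>Domain decomposition\<close>

text \<open>In \<open>ereal\<close> one has \<open>0 * \<infinity> = 0\<close>, as required for vanishing \<open>\<epsilon>\<close>.\<close>

definition cell_energy ::
  "(real^'n::finite) set \<Rightarrow> ((real^'n) \<times> (real^'n) \<Rightarrow> real) \<Rightarrow> real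
    \<Rightarrow> (real^'n) measure \<Rightarrow> (real^'n) measure \<Rightarrow> (real^'n) set
    \<Rightarrow> ((real^'n) \<times> (real^'n)) measure \<Rightarrow> ereal" where
  "cell_energy Y c \<epsilon> \<mu> \<nu> A \<pi> =
     ereal (LINT z:A \<times> Y|\<pi>. c z) + ereal \<epsilon> * enn2ereal (KL \<pi> (mrestrict \<mu> A \<Otimes>\<^sub>M \<nu>))"

definition Y_marginal_on ::
  "(real^'n::finite) set \<Rightarrow> (real^'n) set \<Rightarrow> ((real^'n) \<times> (real^'n)) measure \<Rightarrow> (real^'n) measure" where
  "Y_marginal_on Y A \<pi> = distr (mrestrict \<pi> (A \<times> Y)) borel snd"

definition is_cell_minimizer ::
  "(real^'n::finite) set \<Rightarrow> ((real^'n) \<times> (real^'n) \<Rightarrow> real) \<Rightarrow> real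
    \<Rightarrow> (real^'n) measure \<Rightarrow> (real^'n) measure \<Rightarrow> (real^'n) set
    \<Rightarrow> ((real^'n) \<times> (real^'n)) measure \<Rightarrow> ((real^'n) \<times> (real^'n)) measure \<Rightarrow> bool" where
  "is_cell_minimizer Y c \<epsilon> \<mu> \<nu> A \<pi>_prev \<pi> \<longleftrightarrow>
     \<pi> \<in> couplings (mrestrict \<mu> A) (Y_marginal_on Y A \<pi>_prev) \<and>
     (\<forall>\<pi>'\<in>couplings (mrestrict \<mu> A) (Y_marginal_on Y A \<pi>_prev).
        cell_energy Y c \<epsilon> \<mu> \<nu> A \<pi> \<le> cell_energy Y c \<epsilon> \<mu> \<nu> A \<pi>')"

definition rho_cell ::
  "(real^'n::finite) set \<Rightarrow> (real^'n) measure \<Rightarrow> nat \<Rightarrow> ((real^'n) \<times> (real^'n)) measure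
    \<Rightarrow> nat^'n \<Rightarrow> (real^'n) measure" where
  "rho_cell Y \<mu> n \<pi> i = scale_measure (1 / emeasure \<mu> (cell n i)) (Y_marginal_on Y (cell n i) \<pi>)"

definition rho_comp ::
  "(real^'n::finite) set \<Rightarrow> (real^'n) measure \<Rightarrow> nat \<Rightarrow> ((real^'n) \<times> (real^'n)) measure
    \<Rightarrow> (nat^'n) set \<Rightarrow> (real^'n) measure" where
  "rho_comp Y \<mu> n \<pi> J = scale_measure (1 / (\<Sum>i\<in>J. emeasure \<mu> (cell n i)))
     (sum_measure (\<lambda>i. Y_marginal_on Y (cell n i) \<pi>) J)"

text \<open>For \<open>x\<close> on the boundary between composite cells (a \<open>\<mu>\<close>-null set) one of the cells
  containing \<open>x\<close> is selected.\<close>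

definition disc_kernel ::
  "(real^'n::finite) set \<Rightarrow> (real^'n) measure \<Rightarrow> (nat \<Rightarrow> nat \<Rightarrow> ((real^'n) \<times> (real^'n)) measure)
    \<Rightarrow> nat \<Rightarrow> real \<Rightarrow> real^'n \<Rightarrow> (real^'n) measure" where
  "disc_kernel Y \<mu> \<pi> n t x = (let k = nat \<lfloor>real n * t\<rfloor> in
     rho_comp Y \<mu> n (\<pi> n k) (SOME J. J \<in> composites n k \<and> x \<in> comp_cell n J))"

definition disc_trajectory ::
  "(real^'n::finite) set \<Rightarrow> (real^'n) measure \<Rightarrow> (nat \<Rightarrow> nat \<Rightarrow> ((real^'n) \<times> (real^'n)) measure)
    \<Rightarrow> nat \<Rightarrow> real \<Rightarrow> ((real^'n) \<times> (real^'n)) measure" where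
  "disc_trajectory Y \<mu> \<pi> n t = semidirect \<mu> (disc_kernel Y \<mu> \<pi> n t)"

definition WTVB ::
  "(real^'n::finite) set \<Rightarrow> (real^'n) measure \<Rightarrow> nat \<Rightarrow> ((real^'n) \<times> (real^'n)) measure \<Rightarrow> ennreal" where
  "WTVB Y \<mu> n \<pi> = ennreal (1 / real n ^ (CARD('n) - 1)) *
     (\<Sum>(i, i')\<in>{(i, i'). i \<in> idx n \<and> i' \<in> idx n \<and> (\<exists>l. i = i' + axis l 2)}.
        W1 (rho_cell Y \<mu> n \<pi> i) (rho_cell Y \<mu> n \<pi> i'))"

end

theory Submission
  imports Defs
begin

text \<open>Why the theorem holds. Testing against a Lipschitz partition of unity of small mesh controls the
  Wasserstein distance on \<open>Y\<close> from above and from below, so the vertical distance between two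
  measures is governed by the \<open>L\<^sup>1(\<mu>)\<close> distances of finitely many real functions, the fibre
  integrals of the tests (\<open>W1_le_test_differences\<close>, \<open>vertical_W_le_test_differences\<close>). It remains to
  prove compactness for these functions of time and space, for a fixed Lipschitz test.

  On a basic cell, the discrete trajectory integrated against the test is the average of the test
  over a composite cell. A step of the iteration conserves the mass of its composite cells, and
  therefore the values at two consecutive times are averages of the same iterate, over the two
  partitions into composite cells. Two composite cells that overlap differ by cells that are two
  steps apart. Hence the change in one step is bounded by the variation at step two of the cell
  averages, which the basic cell Wasserstein variation controls, and by the variation of the cell
  masses, which is controlled because the density is of bounded variation
  (\<open>cell_integral_variation\<close>). Since the sum over all cells of these changes is of order
  \<open>n ^ (CARD('n) - 1)\<close> and a cell has mass of order \<open>1 / n ^ CARD('n)\<close>, a step of duration \<open>1 / n\<close>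
  moves the trajectory by \<open>O(1 / n)\<close> in \<open>L\<^sup>1\<close>, so that it is Lipschitz in time up to an error \<open>O(1 / n)\<close>
  (\<open>trajectory_time\<close>). The same variation bounds show that it is close to functions that are constant on
  a coarse grid, with an error of the order of the coarse mesh plus \<open>1 / n\<close> (\<open>trajectory_space\<close>).

  These two estimates give total boundedness, uniformly for times in a bounded interval. It is
  expressed as a colouring of the resolutions \<open>2 ^ (p + 1)\<close> with finitely many colours, such that equal
  colours imply closeness (\<open>finite_colouring\<close>), and a diagonal argument yields one subsequence that is
  Cauchy for all tests. The limits of the test integrals are integrals against probability kernels,
  because the probability measures on the compact set \<open>Y\<close> are weakly compact (\<open>limit_kernel\<close>). The
  kernels obtained in this way define the limit trajectory. Its second marginal and its
  measurability in time are again read off from tests.\<close>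

section \<open>Wasserstein distance and Lipschitz test functions\<close>

text \<open>Functions with values between 0 and 1 suffice as tests, and their integrals can be read both as
  Bochner integrals and as integrals of nonnegative extended functions.\<close>

definition lip01 :: "real \<Rightarrow> ('a::metric_space \<Rightarrow> real) set" where
  "lip01 L = {\<phi>. L-lipschitz_on UNIV \<phi> \<and> range \<phi> \<subseteq> {0..1}}"

lemma lip01D:
  assumes "\<phi> \<in> lip01 L"
  shows "\<bar>\<phi> x - \<phi> y\<bar> \<le> L * dist x y" "0 \<le> \<phi> x" "\<phi> x \<le> 1" "0 \<le> L"
    "continuous_on S \<phi>" "\<phi> \<in> borel_measurable borel"
proof -
  have L: "L-lipschitz_on UNIV \<phi>" and r: "range \<phi> \<subseteq> {0..1}"
    using assms by (auto simp: lip01_def)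
  show "\<bar>\<phi> x - \<phi> y\<bar> \<le> L * dist x y" "0 \<le> L"
    using lipschitz_onD[OF L, of x y] lipschitz_on_nonneg[OF L] by (auto simp: dist_real_def)
  have "\<phi> x \<in> {0..1}" using r by blast
  then show "0 \<le> \<phi> x" "\<phi> x \<le> 1" by auto
  have c: "continuous_on UNIV \<phi>" using L by (rule lipschitz_on_continuous_on)
  then show "\<phi> \<in> borel_measurable borel" by (rule borel_measurable_continuous_onI)
  show "continuous_on S \<phi>" using c continuous_on_subset by blast
qed

lemma lip01I:
  assumes "\<And>x y. \<bar>\<phi> x - \<phi> y\<bar> \<le> L * dist x y" "\<And>x. 0 \<le> \<phi> x" "\<And>x. \<phi> x \<le> 1" "0 \<le> L"
  shows "\<phi> \<in> lip01 L"
  using assms by (auto simp: lip01_def lipschitz_on_def dist_real_def)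

lemma prob_onD:
  assumes "M \<in> prob_on S"
  shows "sets M = sets borel" "space M = UNIV" "prob_space M" "emeasure M (- S) = 0"
  using assms sets_eq_imp_space_eq[of M borel] by (auto simp: prob_on_def)

lemma prob_on_AE:
  assumes "M \<in> prob_on S" "closed S"
  shows "AE y in M. y \<in> S"
  using assms by (intro AE_I[of _ _ "- S"]) (auto simp: prob_onD)

lemma integrable_lip01:
  assumes "\<phi> \<in> lip01 L" "finite_measure M" "sets M = sets borel"
  shows "integrable M \<phi>"
  using assms(1) lip01D[OF assms(1)] assms(3)
  by (intro finite_measure.integrable_const_bound[OF assms(2), of _ 1])
     (auto simp: measurable_cong_sets[OF assms(3) refl])

lemma nn_integral_lip01:
  assumes "\<phi> \<in> lip01 L" "finite_measure M" "sets M = sets borel"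
  shows "(\<integral>\<^sup>+ y. ennreal (\<phi> y) \<partial>M) = ennreal (LINT y|M. \<phi> y)"
  using lip01D(2)[OF assms(1)]
  by (intro nn_integral_eq_integral integrable_lip01[OF assms(1)] assms) auto

lemma integral_lip01_bounds:
  assumes "\<phi> \<in> lip01 L" "prob_space M" "sets M = sets borel"
  shows "0 \<le> (LINT y|M. \<phi> y)" "(LINT y|M. \<phi> y) \<le> 1"
proof -
  interpret prob_space M by fact
  show "0 \<le> (LINT y|M. \<phi> y)" using lip01D(2)[OF assms(1)] by (simp add: integral_nonneg_AE)
  have "(LINT y|M. \<phi> y) \<le> (LINT y|M. 1)"
    using lip01D(2,3)[OF assms(1)]
    by (intro integral_mono integrable_lip01[OF assms(1)] assms) (auto simp: finite_measure_axioms)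
  then show "(LINT y|M. \<phi> y) \<le> 1" by (simp add: prob_space)
qed

text \<open>The easy half of Kantorovich duality: a coupling moves the mass by the distance that it
  charges, and along a distance \<open>r\<close> the test function changes by at most \<open>L * r\<close>.\<close>

lemma test_difference_le_W1:
  fixes \<alpha> \<beta> :: "'a::{metric_space,second_countable_topology} measure"
  assumes \<alpha>: "prob_space \<alpha>" and \<phi>: "\<phi> \<in> lip01 L" and L: "0 < L"
  shows "ennreal \<bar>(LINT y|\<alpha>. \<phi> y) - (LINT y|\<beta>. \<phi> y)\<bar> \<le> ennreal L * W1 \<alpha> \<beta>"
proof -
  let ?x = "\<bar>(LINT y|\<alpha>. \<phi> y) - (LINT y|\<beta>. \<phi> y)\<bar>"
  note [measurable] = lip01D(6)[OF \<phi>]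
  have key: "ennreal (?x / L) \<le> (\<integral>\<^sup>+ z. ennreal (dist (fst z) (snd z)) \<partial>\<gamma>)"
    if \<gamma>: "\<gamma> \<in> couplings \<alpha> \<beta>" for \<gamma>
  proof -
    have s: "sets \<gamma> = sets borel" and a: "\<alpha> = distr \<gamma> borel fst" and b: "\<beta> = distr \<gamma> borel snd"
      using \<gamma> by (auto simp: couplings_def)
    have mf: "fst \<in> measurable \<gamma> borel" "snd \<in> measurable \<gamma> borel"
      unfolding measurable_cong_sets[OF s refl]
      by (auto intro!: borel_measurable_continuous_onI continuous_intros)
    note [measurable] = mf
    interpret prob_space \<gamma> using \<alpha> mf(1) unfolding a by (rule prob_space_distrD[rotated])
    have i: "integrable \<gamma> (\<lambda>z. \<phi> (fst z))" "integrable \<gamma> (\<lambda>z. \<phi> (snd z))"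
      using lip01D[OF \<phi>] by (auto intro!: integrable_const_bound[of _ 1])
    have "?x = \<bar>LINT z|\<gamma>. \<phi> (fst z) - \<phi> (snd z)\<bar>"
      unfolding a b using i by (simp add: integral_distr)
    also have "\<dots> \<le> (LINT z|\<gamma>. \<bar>\<phi> (fst z) - \<phi> (snd z)\<bar>)"
      by (rule integral_abs_bound)
    finally have "ennreal (?x / L) \<le> ennreal ((LINT z|\<gamma>. \<bar>\<phi> (fst z) - \<phi> (snd z)\<bar>) / L)"
      using L by (intro ennreal_leI divide_right_mono) auto
    also have "\<dots> = ennreal (LINT z|\<gamma>. \<bar>\<phi> (fst z) - \<phi> (snd z)\<bar> / L)" by simp
    also have "\<dots> = (\<integral>\<^sup>+ z. ennreal (\<bar>\<phi> (fst z) - \<phi> (snd z)\<bar> / L) \<partial>\<gamma>)"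
      using i L by (intro nn_integral_eq_integral[symmetric]) auto
    also have "\<dots> \<le> (\<integral>\<^sup>+ z. ennreal (dist (fst z) (snd z)) \<partial>\<gamma>)"
      using lip01D(1)[OF \<phi>] L
      by (intro nn_integral_mono ennreal_leI) (auto simp: field_simps)
    finally show ?thesis .
  qed
  have "ennreal ?x = ennreal L * ennreal (?x / L)"
    using L by (simp flip: ennreal_mult)
  also have "\<dots> \<le> ennreal L * W1 \<alpha> \<beta>"
    unfolding W1_def by (intro mult_left_mono INF_greatest key) auto
  finally show ?thesis .
qed

text \<open>The density of a coupling with respect to the product measure. If \<open>a q\<close> and \<open>b q\<close> are the
  integrals of the member \<open>\<psi> q\<close> of a partition of unity, the common mass \<open>min (a q) (b q)\<close> stays in
  the small set where \<open>\<psi> q\<close> is positive, and the two remainders are coupled independently.\<close>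

definition overlap_density ::
  "nat \<Rightarrow> (nat \<Rightarrow> 'a \<Rightarrow> real) \<Rightarrow> (nat \<Rightarrow> real) \<Rightarrow> (nat \<Rightarrow> real) \<Rightarrow> 'a \<Rightarrow> 'a \<Rightarrow> real" where
  "overlap_density N \<psi> a b y y' =
     (\<Sum>q<N. min (a q) (b q) / (a q * b q) * \<psi> q y * \<psi> q y') +
     (1 - (\<Sum>q<N. min (a q) (b q) / a q * \<psi> q y)) *
       (1 - (\<Sum>q<N. min (a q) (b q) / b q * \<psi> q y')) / (1 - (\<Sum>q<N. min (a q) (b q)))"

lemma overlap_density_swap: "overlap_density N \<psi> a b y y' = overlap_density N \<psi> b a y' y"
  by (simp add: overlap_density_def min.commute mult.commute mult.left_commute)

context
  fixes \<alpha> \<beta> :: "'a::{metric_space,second_countable_topology} measure"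
    and Y :: "'a set" and N :: nat and \<psi> :: "nat \<Rightarrow> 'a \<Rightarrow> real" and L :: real
  assumes \<alpha>: "\<alpha> \<in> prob_on Y" and \<beta>: "\<beta> \<in> prob_on Y" and Y: "closed Y"
    and \<psi>: "\<And>q. q < N \<Longrightarrow> \<psi> q \<in> lip01 L" and sum1: "\<And>y. y \<in> Y \<Longrightarrow> (\<Sum>q<N. \<psi> q y) = 1"
begin

lemma integral_tests_sum:
  "(\<Sum>q<N. LINT y|\<alpha>. \<psi> q y) = 1" "(\<Sum>q<N. LINT y|\<beta>. \<psi> q y) = 1"
proof -
  have "(\<Sum>q<N. LINT y|M. \<psi> q y) = 1" if M: "M \<in> prob_on Y" for M
  proof -
    interpret prob_space M using M by (rule prob_onD)
    have "(\<Sum>q<N. LINT y|M. \<psi> q y) = (LINT y|M. (\<Sum>q<N. \<psi> q y))"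
      using prob_onD(1)[OF M] finite_measure_axioms
      by (intro Bochner_Integration.integral_sum[symmetric] integrable_lip01[OF \<psi>]) auto
    also have "\<dots> = (LINT y|M. 1)"
    proof (rule integral_cong_AE)
      show "AE y in M. (\<Sum>q<N. \<psi> q y) = 1" using prob_on_AE[OF M Y] sum1 by auto
      show "(\<lambda>y. \<Sum>q<N. \<psi> q y) \<in> borel_measurable M"
        unfolding measurable_cong_sets[OF prob_onD(1)[OF M] refl]
        by (intro borel_measurable_sum lip01D(6)[OF \<psi>]) auto
    qed simp
    finally show ?thesis by (simp add: prob_space)
  qed
  then show "(\<Sum>q<N. LINT y|\<alpha>. \<psi> q y) = 1" "(\<Sum>q<N. LINT y|\<beta>. \<psi> q y) = 1"
    using \<alpha> \<beta> by auto
qed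

text \<open>Integrating out the second variable gives \<open>A y + (1 - A y) (1 - s) / (1 - s)\<close> with
  \<open>A y = (\<Sum>q. min (a q) (b q) / a q * \<psi> q y)\<close> and \<open>s\<close> the total overlap. If \<open>s = 1\<close> the
  quotient vanishes by convention, but then \<open>A\<close> has integral one and \<open>A \<le> 1\<close>, so
  \<open>A = 1\<close> almost everywhere.\<close>

lemma overlap_density_marginal:
  defines "a \<equiv> \<lambda>q. LINT y|\<alpha>. \<psi> q y" and "b \<equiv> \<lambda>q. LINT y|\<beta>. \<psi> q y"
  shows "y \<in> Y \<Longrightarrow> y' \<in> Y \<Longrightarrow> 0 \<le> overlap_density N \<psi> a b y y'"
    and "AE y in \<alpha>. (\<integral>\<^sup>+ y'. ennreal (overlap_density N \<psi> a b y y') \<partial>\<beta>) = 1"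
    and "0 \<le> D \<Longrightarrow> 0 \<le> \<delta> \<Longrightarrow>
      (\<And>y y'. y \<in> Y \<Longrightarrow> y' \<in> Y \<Longrightarrow> dist y y' \<le> D) \<Longrightarrow>
      (\<And>q y y'. q < N \<Longrightarrow> \<psi> q y \<noteq> 0 \<Longrightarrow> \<psi> q y' \<noteq> 0 \<Longrightarrow> dist y y' \<le> \<delta>) \<Longrightarrow>
      (\<integral>\<^sup>+ y. \<integral>\<^sup>+ y'. ennreal (overlap_density N \<psi> a b y y') * ennreal (dist y y') \<partial>\<beta> \<partial>\<alpha>)
        \<le> ennreal (\<delta> + D * (\<Sum>q<N. \<bar>a q - b q\<bar>))"
proof -
  interpret \<alpha>: prob_space \<alpha> using \<alpha> by (rule prob_onD)
  interpret \<beta>: prob_space \<beta> using \<beta> by (rule prob_onD)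
  define A where "A y = (\<Sum>q<N. min (a q) (b q) / a q * \<psi> q y)" for y
  define B where "B y = (\<Sum>q<N. min (a q) (b q) / b q * \<psi> q y)" for y
  define s where "s = (\<Sum>q<N. min (a q) (b q))"
  define K where "K y y' = (\<Sum>q<N. min (a q) (b q) / (a q * b q) * \<psi> q y * \<psi> q y')" for y y'
  have od: "overlap_density N \<psi> a b y y' = K y y' + (1 - A y) * (1 - B y') / (1 - s)" for y y'
    by (simp add: overlap_density_def A_def B_def s_def K_def)
  have \<psi>0: "0 \<le> \<psi> q y" if "q < N" for q y using lip01D[OF \<psi>[OF that]] by auto
  have ab0: "0 \<le> a q" "0 \<le> b q" if "q < N" for q
    unfolding a_def b_def using \<psi>0[OF that] by (auto intro: integral_nonneg_AE)
  have i\<alpha>: "integrable \<alpha> (\<psi> q)" and i\<beta>: "integrable \<beta> (\<psi> q)" if "q < N" for q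
    using integrable_lip01[OF \<psi>[OF that]] \<alpha> \<beta> \<alpha>.finite_measure_axioms \<beta>.finite_measure_axioms
    by (auto simp: prob_onD)
  have AE\<alpha>: "AE y in \<alpha>. y \<in> Y" and AE\<beta>: "AE y in \<beta>. y \<in> Y"
    using prob_on_AE \<alpha> \<beta> Y by auto
  have quot: "min (a q) (b q) / a q \<le> 1" "min (a q) (b q) / b q \<le> 1" if "q < N" for q
    using ab0[OF that] by (auto simp: divide_le_eq_1)
  have A1: "A y \<le> 1" and B1: "B y \<le> 1" if "y \<in> Y" for y
  proof -
    have "A y \<le> (\<Sum>q<N. \<psi> q y)" "B y \<le> (\<Sum>q<N. \<psi> q y)"
      unfolding A_def B_def using quot \<psi>0 ab0
      by (auto intro!: sum_mono mult_left_le_one_le simp del: times_divide_eq_left)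
    then show "A y \<le> 1" "B y \<le> 1" using sum1[OF that] by auto
  qed
  have K0: "0 \<le> K y y'" for y y'
    unfolding K_def using \<psi>0 ab0 by (auto intro!: sum_nonneg mult_nonneg_nonneg divide_nonneg_nonneg)
  have s1: "s \<le> 1"
    unfolding s_def using integral_tests_sum(1) sum_mono[of "{..<N}" "\<lambda>q. min (a q) (b q)" a]
    by (auto simp: a_def)
  have s0: "0 \<le> s" unfolding s_def using ab0 by (auto intro!: sum_nonneg)
  have R0: "0 \<le> (1 - A y) * (1 - B y') / (1 - s)" if "y \<in> Y" "y' \<in> Y" for y y'
    using A1[OF that(1)] B1[OF that(2)] s1 by auto
  show nonneg: "y \<in> Y \<Longrightarrow> y' \<in> Y \<Longrightarrow> 0 \<le> overlap_density N \<psi> a b y y'" for y y'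
    unfolding od using K0 R0 by (auto intro: add_nonneg_nonneg)
  have iA: "integrable \<alpha> A" unfolding A_def using i\<alpha> by auto
  have iB: "integrable \<beta> B" unfolding B_def using i\<beta> by auto
  have iK: "integrable \<beta> (K y)" for y unfolding K_def using i\<beta> by auto
  have intA: "(LINT y|\<alpha>. A y) = s"
  proof -
    have "(LINT y|\<alpha>. A y) = (\<Sum>q<N. min (a q) (b q) / a q * a q)"
      unfolding A_def a_def using i\<alpha> by (subst Bochner_Integration.integral_sum) auto
    also have "\<dots> = s" unfolding s_def using ab0 by (intro sum.cong) auto
    finally show ?thesis .
  qed
  have intB: "(LINT y|\<beta>. B y) = s"
  proof -
    have "(LINT y|\<beta>. B y) = (\<Sum>q<N. min (a q) (b q) / b q * b q)"
      unfolding B_def b_def using i\<beta> by (subst Bochner_Integration.integral_sum) auto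
    also have "\<dots> = s" unfolding s_def using ab0 by (intro sum.cong) auto
    finally show ?thesis .
  qed
  have intK: "(LINT y'|\<beta>. K y y') = A y" for y
  proof -
    have "(LINT y'|\<beta>. K y y') = (\<Sum>q<N. min (a q) (b q) / (a q * b q) * \<psi> q y * b q)"
      unfolding K_def b_def using i\<beta> by (subst Bochner_Integration.integral_sum) auto
    also have "\<dots> = A y" unfolding A_def
    proof (rule sum.cong)
      fix q assume "q \<in> {..<N}"
      then have "0 \<le> a q" "0 \<le> b q" using ab0 by auto
      then show "min (a q) (b q) / (a q * b q) * \<psi> q y * b q = min (a q) (b q) / a q * \<psi> q y"
        by (cases "b q = 0") (auto simp: min_def)
    qed simp
    finally show ?thesis .
  qed
  have inner: "(\<integral>\<^sup>+ y'. ennreal (u * K y y' + v * ((1 - A y) * (1 - B y') / (1 - s))) \<partial>\<beta>)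
      = ennreal (u * A y + v * ((1 - A y) * (1 - s) / (1 - s)))"
    if y: "y \<in> Y" and "0 \<le> u" "0 \<le> v" for y u v
  proof -
    have "(\<integral>\<^sup>+ y'. ennreal (u * K y y' + v * ((1 - A y) * (1 - B y') / (1 - s))) \<partial>\<beta>)
        = ennreal (LINT y'|\<beta>. u * K y y' + v * ((1 - A y) * (1 - B y') / (1 - s)))"
      using AE\<beta> K0 R0[OF y] that iK iB
      by (intro nn_integral_eq_integral)
         (auto intro!: add_nonneg_nonneg mult_nonneg_nonneg elim!: AE_mp
            simp del: times_divide_eq_right times_divide_eq_left)
    also have "\<dots> = ennreal (u * A y + v * ((1 - A y) * (1 - s) / (1 - s)))"
      using iK iB by (simp add: intK intB \<beta>.prob_space)
    finally show ?thesis .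
  qed
  show "AE y in \<alpha>. (\<integral>\<^sup>+ y'. ennreal (overlap_density N \<psi> a b y y') \<partial>\<beta>) = 1"
  proof (cases "s = 1")
    case False
    then show ?thesis using AE\<alpha> inner[of _ 1 1] by (auto simp: od elim!: AE_mp)
  next
    case True
    have "AE y in \<alpha>. 1 - A y = 0"
    proof (rule integral_nonneg_eq_0_iff_AE[THEN iffD1])
      show "AE y in \<alpha>. 0 \<le> 1 - A y" using AE\<alpha> A1 by (auto elim!: AE_mp)
      show "(LINT y|\<alpha>. 1 - A y) = 0" using iA by (simp add: intA \<alpha>.prob_space True)
    qed (use iA in auto)
    with AE\<alpha> show ?thesis
    proof eventually_elim
      case (elim y)
      then show ?case using inner[of y 1 1] True by (simp add: od)
    qed
  qed
  assume D: "0 \<le> D" "\<And>y y'. y \<in> Y \<Longrightarrow> y' \<in> Y \<Longrightarrow> dist y y' \<le> D" and \<delta>0: "0 \<le> \<delta>"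
    and \<delta>: "\<And>q y y'. q < N \<Longrightarrow> \<psi> q y \<noteq> 0 \<Longrightarrow> \<psi> q y' \<noteq> 0 \<Longrightarrow> dist y y' \<le> \<delta>"
  have Kd: "K y y' * dist y y' \<le> \<delta> * K y y'" for y y'
  proof -
    have "min (a q) (b q) / (a q * b q) * \<psi> q y * \<psi> q y' * dist y y'
        \<le> min (a q) (b q) / (a q * b q) * \<psi> q y * \<psi> q y' * \<delta>" if q: "q < N" for q
    proof (cases "\<psi> q y \<noteq> 0 \<and> \<psi> q y' \<noteq> 0")
      case True
      then show ?thesis using \<delta>[OF q] ab0[OF q] \<psi>0[OF q]
        by (intro mult_left_mono mult_nonneg_nonneg divide_nonneg_nonneg) auto
    qed auto
    then show ?thesis
      by (auto simp: K_def sum_distrib_right sum_distrib_left mult.commute[of \<delta>] intro!: sum_mono)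
  qed
  have "(\<integral>\<^sup>+ y. \<integral>\<^sup>+ y'. ennreal (overlap_density N \<psi> a b y y') * ennreal (dist y y') \<partial>\<beta> \<partial>\<alpha>)
      \<le> (\<integral>\<^sup>+ y. \<integral>\<^sup>+ y'. ennreal (\<delta> * K y y' + D * ((1 - A y) * (1 - B y') / (1 - s))) \<partial>\<beta> \<partial>\<alpha>)"
  proof (rule nn_integral_mono_AE)
    show "AE y in \<alpha>. (\<integral>\<^sup>+ y'. ennreal (overlap_density N \<psi> a b y y') * ennreal (dist y y') \<partial>\<beta>)
      \<le> (\<integral>\<^sup>+ y'. ennreal (\<delta> * K y y' + D * ((1 - A y) * (1 - B y') / (1 - s))) \<partial>\<beta>)"
      using AE\<alpha>
    proof eventually_elim
      case (elim y)
      show ?case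
      proof (rule nn_integral_mono_AE, use AE\<beta> in eventually_elim)
        case (elim y')
        have "overlap_density N \<psi> a b y y' * dist y y'
            \<le> \<delta> * K y y' + D * ((1 - A y) * (1 - B y') / (1 - s))"
          unfolding od distrib_right using Kd[of y y'] D(2)[OF \<open>y \<in> Y\<close> elim] R0[OF \<open>y \<in> Y\<close> elim]
          by (intro add_mono) (auto simp: mult.commute[of D] intro: mult_left_mono
                simp del: times_divide_eq_right times_divide_eq_left)
        then show ?case
          using nonneg[OF \<open>y \<in> Y\<close> elim] by (simp add: ennreal_leI flip: ennreal_mult)
      qed
    qed
  qed
  also have "\<dots> = (\<integral>\<^sup>+ y. ennreal (\<delta> * A y + D * ((1 - A y) * (1 - s) / (1 - s))) \<partial>\<alpha>)"
    using AE\<alpha> inner[OF _ \<delta>0 D(1)] by (intro nn_integral_cong_AE) (auto elim!: AE_mp)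
  also have "\<dots> = ennreal (LINT y|\<alpha>. \<delta> * A y + D * ((1 - A y) * (1 - s) / (1 - s)))"
  proof (rule nn_integral_eq_integral)
    have A0: "0 \<le> A y" for y unfolding A_def using ab0 \<psi>0 by (auto intro!: sum_nonneg)
    show "AE y in \<alpha>. 0 \<le> \<delta> * A y + D * ((1 - A y) * (1 - s) / (1 - s))"
      using AE\<alpha> by eventually_elim (use A0 A1 s1 \<delta>0 D in \<open>auto intro!: add_nonneg_nonneg\<close>)
  qed (cases "s = 1"; use iA in auto)
  also have "\<dots> \<le> ennreal (\<delta> + D * (\<Sum>q<N. \<bar>a q - b q\<bar>))"
  proof (rule ennreal_leI)
    have "(LINT y|\<alpha>. \<delta> * A y + D * ((1 - A y) * (1 - s) / (1 - s))) = \<delta> * s + D * (1 - s)"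
      using iA by (cases "s = 1") (auto simp: intA \<alpha>.prob_space)
    moreover have "1 - s \<le> (\<Sum>q<N. \<bar>a q - b q\<bar>)"
    proof -
      have "1 - s = (\<Sum>q<N. a q - min (a q) (b q))"
        using integral_tests_sum(1) by (simp add: s_def a_def sum_subtractf)
      also have "\<dots> \<le> (\<Sum>q<N. \<bar>a q - b q\<bar>)" by (intro sum_mono) auto
      finally show ?thesis .
    qed
    ultimately show "(LINT y|\<alpha>. \<delta> * A y + D * ((1 - A y) * (1 - s) / (1 - s)))
        \<le> \<delta> + D * (\<Sum>q<N. \<bar>a q - b q\<bar>)"
      using s1 \<delta>0 D(1) by (auto intro!: add_mono mult_left_le mult_left_mono)
  qed
  finally show "(\<integral>\<^sup>+ y. \<integral>\<^sup>+ y'. ennreal (overlap_density N \<psi> a b y y') * ennreal (dist y y') \<partial>\<beta> \<partial>\<alpha>)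
        \<le> ennreal (\<delta> + D * (\<Sum>q<N. \<bar>a q - b q\<bar>))" .
qed

end

text \<open>The converse of the easy half of the duality, without Hahn-Banach: split both measures by a
  partition of unity with supports of diameter at most \<open>\<delta>\<close>, couple the common mass of each piece
  within the piece (cost at most \<open>\<delta>\<close>) and the remaining mass, which is at most the sum of the
  differences of the test integrals, arbitrarily (cost at most \<open>D\<close>).\<close>

lemma W1_le_test_differences:
  fixes N :: nat and \<alpha> \<beta> :: "'a::{metric_space,second_countable_topology} measure"
  assumes \<alpha>: "\<alpha> \<in> prob_on Y" and \<beta>: "\<beta> \<in> prob_on Y" and Y: "closed Y"
    and \<psi>: "\<And>q. q < N \<Longrightarrow> \<psi> q \<in> lip01 L" and sum1: "\<And>y. y \<in> Y \<Longrightarrow> (\<Sum>q<N. \<psi> q y) = 1"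
    and D: "0 \<le> D" "\<And>y y'. y \<in> Y \<Longrightarrow> y' \<in> Y \<Longrightarrow> dist y y' \<le> D" and \<delta>0: "0 \<le> \<delta>"
    and \<delta>: "\<And>q y y'. q < N \<Longrightarrow> \<psi> q y \<noteq> 0 \<Longrightarrow> \<psi> q y' \<noteq> 0 \<Longrightarrow> dist y y' \<le> \<delta>"
  shows "W1 \<alpha> \<beta> \<le> ennreal (\<delta> + D * (\<Sum>q<N. \<bar>(LINT y|\<alpha>. \<psi> q y) - (LINT y|\<beta>. \<psi> q y)\<bar>))"
proof -
  interpret \<alpha>: prob_space \<alpha> using \<alpha> by (rule prob_onD)
  interpret \<beta>: prob_space \<beta> using \<beta> by (rule prob_onD)
  interpret pair_sigma_finite \<alpha> \<beta> ..
  define a where "a = (\<lambda>q. LINT y|\<alpha>. \<psi> q y)"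
  define b where "b = (\<lambda>q. LINT y|\<beta>. \<psi> q y)"
  define k where "k z = ennreal (overlap_density N \<psi> a b (fst z) (snd z))" for z
  define \<gamma> where "\<gamma> = density (\<alpha> \<Otimes>\<^sub>M \<beta>) k"
  have s\<alpha>[measurable_cong]: "sets \<alpha> = sets borel" and s\<beta>[measurable_cong]: "sets \<beta> = sets borel"
    using \<alpha> \<beta> by (auto simp: prob_onD)
  have [measurable]: "\<psi> q \<in> borel_measurable borel" if "q < N" for q
    using lip01D[OF \<psi>[OF that]] by auto
  have k[measurable]: "k \<in> borel_measurable (\<alpha> \<Otimes>\<^sub>M \<beta>)"
    unfolding k_def overlap_density_def by measurable
  have s\<gamma>: "sets \<gamma> = sets borel"
    unfolding \<gamma>_def using sets_pair_measure_cong[OF s\<alpha> s\<beta>] by (simp only: borel_prod sets_density)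
  have m1: "AE y in \<alpha>. (\<integral>\<^sup>+ y'. k (y, y') \<partial>\<beta>) = 1"
    using overlap_density_marginal(2)[OF \<alpha> \<beta> Y \<psi> sum1] by (simp add: k_def a_def b_def)
  have m2: "AE y' in \<beta>. (\<integral>\<^sup>+ y. k (y, y') \<partial>\<alpha>) = 1"
    using overlap_density_marginal(2)[OF \<beta> \<alpha> Y \<psi> sum1]
    by (simp add: k_def a_def b_def overlap_density_swap[of N \<psi> "\<lambda>q. LINT y|\<alpha>. \<psi> q y"])
  have "distr \<gamma> borel fst = \<alpha>"
  proof (rule measure_eqI)
    fix S assume "S \<in> sets (distr \<gamma> borel fst)"
    then have S[measurable]: "S \<in> sets borel" by simp
    have "emeasure (distr \<gamma> borel fst) S = emeasure \<gamma> (S \<times> UNIV)"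
      using \<open>S \<in> sets borel\<close> sets_eq_imp_space_eq[OF s\<gamma>]
      by (subst emeasure_distr)
         (auto simp: measurable_cong_sets[OF s\<gamma> refl] intro!: arg_cong2[where f=emeasure]
           borel_measurable_continuous_onI continuous_intros)
    also have "\<dots> = (\<integral>\<^sup>+ z. k z * indicator (S \<times> UNIV) z \<partial>(\<alpha> \<Otimes>\<^sub>M \<beta>))"
      unfolding \<gamma>_def using S by (intro emeasure_density) auto
    also have "\<dots> = (\<integral>\<^sup>+ y. \<integral>\<^sup>+ y'. k (y, y') * indicator S y \<partial>\<beta> \<partial>\<alpha>)"
      by (subst \<beta>.nn_integral_fst[symmetric]) (auto simp: indicator_times)
    also have "\<dots> = (\<integral>\<^sup>+ y. (\<integral>\<^sup>+ y'. k (y, y') \<partial>\<beta>) * indicator S y \<partial>\<alpha>)"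
      by (intro nn_integral_cong nn_integral_multc) (measurable; auto)
    also have "\<dots> = (\<integral>\<^sup>+ y. indicator S y \<partial>\<alpha>)"
      using m1 by (intro nn_integral_cong_AE) (auto elim!: AE_mp)
    also have "\<dots> = emeasure \<alpha> S" using S by simp
    finally show "emeasure (distr \<gamma> borel fst) S = emeasure \<alpha> S" .
  qed (simp add: s\<alpha>)
  moreover have "distr \<gamma> borel snd = \<beta>"
  proof (rule measure_eqI)
    fix S assume "S \<in> sets (distr \<gamma> borel snd)"
    then have S[measurable]: "S \<in> sets borel" by simp
    have "emeasure (distr \<gamma> borel snd) S = emeasure \<gamma> (UNIV \<times> S)"
      using \<open>S \<in> sets borel\<close> sets_eq_imp_space_eq[OF s\<gamma>]
      by (subst emeasure_distr)
         (auto simp: measurable_cong_sets[OF s\<gamma> refl] intro!: arg_cong2[where f=emeasure]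
           borel_measurable_continuous_onI continuous_intros)
    also have "\<dots> = (\<integral>\<^sup>+ z. k z * indicator (UNIV \<times> S) z \<partial>(\<alpha> \<Otimes>\<^sub>M \<beta>))"
      unfolding \<gamma>_def using S by (intro emeasure_density) auto
    also have "\<dots> = (\<integral>\<^sup>+ y'. \<integral>\<^sup>+ y. k (y, y') * indicator S y' \<partial>\<alpha> \<partial>\<beta>)"
      by (subst nn_integral_snd[symmetric]) (auto simp: indicator_times)
    also have "\<dots> = (\<integral>\<^sup>+ y'. (\<integral>\<^sup>+ y. k (y, y') \<partial>\<alpha>) * indicator S y' \<partial>\<beta>)"
      by (intro nn_integral_cong nn_integral_multc) (measurable; auto)
    also have "\<dots> = (\<integral>\<^sup>+ y'. indicator S y' \<partial>\<beta>)"
      using m2 by (intro nn_integral_cong_AE) (auto elim!: AE_mp)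
    also have "\<dots> = emeasure \<beta> S" using S by simp
    finally show "emeasure (distr \<gamma> borel snd) S = emeasure \<beta> S" .
  qed (simp add: s\<beta>)
  ultimately have "\<gamma> \<in> couplings \<alpha> \<beta>" by (simp add: couplings_def s\<gamma>)
  then have "W1 \<alpha> \<beta> \<le> (\<integral>\<^sup>+ z. ennreal (dist (fst z) (snd z)) \<partial>\<gamma>)"
    unfolding W1_def by (rule INF_lower)
  also have "\<dots> = (\<integral>\<^sup>+ z. k z * ennreal (dist (fst z) (snd z)) \<partial>(\<alpha> \<Otimes>\<^sub>M \<beta>))"
    unfolding \<gamma>_def by (intro nn_integral_density) measurable
  also have "\<dots> = (\<integral>\<^sup>+ y. \<integral>\<^sup>+ y'. k (y, y') * ennreal (dist y y') \<partial>\<beta> \<partial>\<alpha>)"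
  proof (subst \<beta>.nn_integral_fst[symmetric])
    show "(\<lambda>z. k z * ennreal (dist (fst z) (snd z))) \<in> borel_measurable (\<alpha> \<Otimes>\<^sub>M \<beta>)"
      by measurable
  qed simp
  also have "\<dots> \<le> ennreal (\<delta> + D * (\<Sum>q<N. \<bar>a q - b q\<bar>))"
    using overlap_density_marginal(3)[OF \<alpha> \<beta> Y \<psi> sum1 D(1) \<delta>0 D(2) \<delta>]
    by (simp add: k_def a_def b_def)
  finally show ?thesis by (simp add: a_def b_def)
qed

text \<open>The partition of unity consists of the increments of the truncated partial sums
  \<open>min 1 (\<Sum>i<q. h i)\<close>, where \<open>h i\<close> is a cone over the \<open>i\<close>-th point of a net. Truncation keeps
  the increments Lipschitz, and an increment vanishes where its cone vanishes.\<close>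

lemma lipschitz_partition_of_unity:
  fixes Y :: "'a::metric_space set"
  assumes Y: "compact Y" and \<delta>: "0 < \<delta>"
  obtains N and \<psi> :: "nat \<Rightarrow> 'a \<Rightarrow> real" and L where "0 < L" "\<And>q. \<psi> q \<in> lip01 L"
    "\<And>y. y \<in> Y \<Longrightarrow> (\<Sum>q<N. \<psi> q y) = 1"
    "\<And>q y y'. \<psi> q y \<noteq> 0 \<Longrightarrow> \<psi> q y' \<noteq> 0 \<Longrightarrow> dist y y' \<le> \<delta>"
proof -
  have "Y \<subseteq> (\<Union>c\<in>Y. ball c (\<delta> / 4))" using \<delta> by auto
  then obtain C where C: "C \<subseteq> Y" "finite C" "Y \<subseteq> (\<Union>c\<in>C. ball c (\<delta> / 4))"
    using compactE_image[OF Y, of Y "\<lambda>c. ball c (\<delta> / 4)"] by auto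
  obtain cs where cs: "set cs = C" using finite_list[OF C(2)] by auto
  define N where "N = length cs"
  define h where "h i y = max 0 (2 - (4 / \<delta>) * dist (cs ! i) y)" for i y
  define S where "S q y = min 1 (\<Sum>i<q. h (min i (N - 1)) y)" for q y
  define \<psi> where "\<psi> q y = (if q < N then S (Suc q) y - S q y else 0)" for q y
  define L where "L = 2 * (real N + 1) * (4 / \<delta>)"
  have L0: "0 < L" using \<delta> by (simp add: L_def)
  have h0: "0 \<le> h i y" for i y by (simp add: h_def)
  have hL: "\<bar>h i x - h i y\<bar> \<le> (4 / \<delta>) * dist x y" for i x y
  proof -
    have "\<bar>dist (cs ! i) x - dist (cs ! i) y\<bar> \<le> dist x y" by metric
    then have "(4 / \<delta>) * \<bar>dist (cs ! i) x - dist (cs ! i) y\<bar> \<le> (4 / \<delta>) * dist x y"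
      using \<delta> by (intro mult_left_mono) auto
    moreover have "(4 / \<delta>) * \<bar>dist (cs ! i) x - dist (cs ! i) y\<bar>
      = \<bar>(4 / \<delta>) * dist (cs ! i) x - (4 / \<delta>) * dist (cs ! i) y\<bar>"
      using \<delta> by (simp only: abs_mult flip: right_diff_distrib) simp
    ultimately show ?thesis unfolding h_def by linarith
  qed
  have SL: "\<bar>S q x - S q y\<bar> \<le> real q * (4 / \<delta>) * dist x y" for q x y
  proof -
    have "\<bar>S q x - S q y\<bar> \<le> \<bar>(\<Sum>i<q. h (min i (N - 1)) x) - (\<Sum>i<q. h (min i (N - 1)) y)\<bar>"
      unfolding S_def by linarith
    also have "\<dots> \<le> (\<Sum>i<q. \<bar>h (min i (N - 1)) x - h (min i (N - 1)) y\<bar>)"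
      by (simp flip: sum_subtractf)
    also have "\<dots> \<le> (\<Sum>i<q. (4 / \<delta>) * dist x y)" by (intro sum_mono hL)
    finally show ?thesis by simp
  qed
  have mono: "S q y \<le> S (Suc q) y" for q y using h0[of "min q (N - 1)" y] by (simp add: S_def min_def)
  have S01: "0 \<le> S q y" "S q y \<le> 1" for q y using h0 by (auto simp: S_def sum_nonneg)
  show ?thesis
  proof (rule that[OF L0])
    fix q
    show "\<psi> q \<in> lip01 L"
    proof (rule lip01I)
      fix x y
      show "\<bar>\<psi> q x - \<psi> q y\<bar> \<le> L * dist x y"
      proof (cases "q < N")
        case True
        have "\<bar>\<psi> q x - \<psi> q y\<bar> \<le> \<bar>S (Suc q) x - S (Suc q) y\<bar> + \<bar>S q x - S q y\<bar>"
          using True by (simp add: \<psi>_def)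
        also have "\<dots> \<le> real (Suc q) * (4 / \<delta>) * dist x y + real q * (4 / \<delta>) * dist x y"
          by (intro add_mono SL)
        also have "\<dots> = (real (Suc q) + real q) * ((4 / \<delta>) * dist x y)"
          by (simp only: algebra_simps)
        also have "\<dots> \<le> (2 * (real N + 1)) * ((4 / \<delta>) * dist x y)"
          using True \<delta> by (intro mult_right_mono) auto
        finally show ?thesis unfolding L_def by (simp only: mult.assoc)
      qed (use L0 in \<open>simp add: \<psi>_def\<close>)
    next
      fix y
      show "0 \<le> \<psi> q y" using mono by (simp add: \<psi>_def)
      show "\<psi> q y \<le> 1" using S01[of "Suc q" y] S01[of q y] by (simp add: \<psi>_def)
    qed (use L0 in simp)
  next
    fix y assume "y \<in> Y"
    have "(\<Sum>q<N. \<psi> q y) = (\<Sum>q<N. S (Suc q) y - S q y)" by (auto simp: \<psi>_def)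
    also have "\<dots> = S N y - S 0 y" by (rule sum_lessThan_telescope)
    also have "\<dots> = S N y" by (simp add: S_def)
    also have "\<dots> = 1"
    proof -
      obtain j where j: "j < N" "dist (cs ! j) y < \<delta> / 4"
        using C(3) \<open>y \<in> Y\<close> unfolding cs[symmetric] N_def by (auto simp: set_conv_nth)
      have "1 \<le> h j y" using j(2) \<delta> by (simp add: h_def field_simps max_def)
      also have "h j y = h (min j (N - 1)) y" using j(1) by (auto simp: min_def intro: arg_cong2)
      also have "\<dots> \<le> (\<Sum>i<N. h (min i (N - 1)) y)" using j(1) h0 by (intro member_le_sum) auto
      finally show ?thesis by (simp add: S_def)
    qed
    finally show "(\<Sum>q<N. \<psi> q y) = 1" .
  next
    fix q y y'
    assume *: "\<psi> q y \<noteq> 0" "\<psi> q y' \<noteq> 0"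
    then have q: "q < N" by (auto simp: \<psi>_def split: if_splits)
    have "dist (cs ! q) z \<le> \<delta> / 2" if "\<psi> q z \<noteq> 0" for z
    proof (rule ccontr)
      assume "\<not> ?thesis"
      then have "h q z = 0" using \<delta> by (auto simp: h_def field_simps)
      then have "S (Suc q) z = S q z" using q by (simp add: S_def min_absorb1)
      then show False using that by (simp add: \<psi>_def split: if_splits)
    qed
    from this[OF *(1)] this[OF *(2)] show "dist y y' \<le> \<delta>" by metric
  qed
qed

section \<open>Weak compactness of the probability measures on a compact set\<close>

text \<open>The digits of the encoding in base three record membership in the balls of finer and finer
  finite covers. Points with close codes agree on many digits, hence are close: the encoding itself
  is only Borel, but its inverse is uniformly continuous.\<close>

lemma borel_encoding_with_uniformly_continuous_inverse:
  fixes Y :: "'a::metric_space set"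
  assumes Y: "compact Y" "Y \<noteq> {}"
  obtains g :: "'a \<Rightarrow> real" where "g \<in> borel_measurable borel" "\<And>y. 0 \<le> g y" "\<And>y. g y \<le> 1"
    "\<And>\<epsilon>. 0 < \<epsilon> \<Longrightarrow> \<exists>\<delta>>0. \<forall>y\<in>Y. \<forall>y'\<in>Y. \<bar>g y - g y'\<bar> < \<delta> \<longrightarrow> dist y y' < \<epsilon>"
proof -
  have "\<exists>C. finite C \<and> C \<subseteq> Y \<and> Y \<subseteq> (\<Union>c\<in>C. ball c (1 / real (Suc m)))" for m
  proof -
    have "Y \<subseteq> (\<Union>c\<in>Y. ball c (1 / real (Suc m)))" by auto
    then show ?thesis
      using compactE_image[OF Y(1), of Y "\<lambda>c. ball c (1 / real (Suc m))"] by (metis open_ball)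
  qed
  then obtain C where C: "\<And>m. finite (C m)" "\<And>m. C m \<subseteq> Y"
    "\<And>m. Y \<subseteq> (\<Union>c\<in>C m. ball c (1 / real (Suc m)))" by metis
  define BB where "BB = (\<Union>m. (\<lambda>c. ball c (1 / real (Suc m))) ` C m)"
  have cnt: "countable BB" unfolding BB_def using C(1) by (auto intro: countable_finite)
  have ne: "BB \<noteq> {}" using C(3)[of 0] Y(2) by (auto simp: BB_def)
  define B where "B = from_nat_into BB"
  have B_open: "open (B j)" for j
    using from_nat_into[OF ne, of j] by (auto simp: B_def BB_def)
  define w :: "nat \<Rightarrow> real" where "w j = 2 * (1 / 3) ^ Suc j" for j
  have w_tail: "(\<lambda>i. w (i + k)) sums (1 / 3) ^ k" for k
  proof -
    have "(\<lambda>i. (2 / 3) * (1 / 3) ^ k * (1 / 3 :: real) ^ i) sums ((2 / 3) * (1 / 3) ^ k * (1 / (1 - 1 / 3)))"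
      by (intro sums_mult geometric_sums) auto
    then show ?thesis by (simp add: w_def power_add mult_ac)
  qed
  have w0: "0 \<le> w j" for j by (simp add: w_def)
  have w_summable: "summable w" using w_tail[of 0] by (simp add: sums_iff)
  define g where "g y = (\<Sum>j. w j * indicator (B j) y)" for y
  have sg: "summable (\<lambda>j. w j * indicator (B j) y)" for y
    by (rule summable_comparison_test'[OF w_summable, of 0]) (auto simp: w0 indicator_def)
  show ?thesis
  proof (rule that)
    show "g \<in> borel_measurable borel"
      unfolding g_def using B_open by (intro borel_measurable_suminf) auto
    fix y
    show "0 \<le> g y" unfolding g_def using sg w0 by (intro suminf_nonneg) auto
    have "g y \<le> (\<Sum>j. w j)"
      unfolding g_def using sg w_summable w0 by (intro suminf_le) (auto simp: indicator_def)
    also have "\<dots> = 1" using w_tail[of 0] by (simp add: sums_iff)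
    finally show "g y \<le> 1" .
  next
    have digits: "(y \<in> B j) = (y' \<in> B j)" if "\<bar>g y - g y'\<bar> < (1 / 3) ^ K" "j < K" for y y' j K
    proof (rule ccontr)
      assume "(y \<in> B j) \<noteq> (y' \<in> B j)"
      define i where "i = (LEAST i. (y \<in> B i) \<noteq> (y' \<in> B i))"
      have i: "(y \<in> B i) \<noteq> (y' \<in> B i)" "i \<le> j"
        unfolding i_def using \<open>(y \<in> B j) \<noteq> (y' \<in> B j)\<close>
        by (rule LeastI[of "\<lambda>i. (y \<in> B i) \<noteq> (y' \<in> B i)"], rule Least_le)
      have before: "(y \<in> B l) = (y' \<in> B l)" if "l < i" for l
        using not_less_Least[OF that[unfolded i_def]] by auto
      define e where "e l = w l * indicator (B l) y - w l * indicator (B l) y'" for l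
      have se: "summable e" unfolding e_def using sg by (intro summable_diff)
      have el: "\<bar>e l\<bar> \<le> w l" for l using w0[of l] by (auto simp: e_def indicator_def)
      have "g y - g y' = (\<Sum>l. e l)" unfolding g_def e_def using sg by (intro suminf_diff)
      also have "\<dots> = (\<Sum>l. e (l + Suc i)) + (\<Sum>l<Suc i. e l)"
        using se by (rule suminf_split_initial_segment)
      also have "(\<Sum>l<Suc i. e l) = e i"
        using before by (auto simp: e_def indicator_def intro!: sum.neutral)
      finally have split: "g y - g y' = (\<Sum>l. e (l + Suc i)) + e i" .
      have s': "summable (\<lambda>l. \<bar>e (l + Suc i)\<bar>)"
        by (rule summable_comparison_test'[OF sums_summable[OF w_tail[of "Suc i"]], of 0])
           (auto simp: el)
      have "\<bar>\<Sum>l. e (l + Suc i)\<bar> \<le> (\<Sum>l. \<bar>e (l + Suc i)\<bar>)" using s' by (rule summable_rabs)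
      also have "\<dots> \<le> (\<Sum>l. w (l + Suc i))"
        using s' w_tail[of "Suc i"] el by (intro suminf_le) (auto simp: sums_iff)
      also have "\<dots> = (1 / 3) ^ Suc i" using w_tail[of "Suc i"] by (simp only: sums_iff)
      finally have "\<bar>\<Sum>l. e (l + Suc i)\<bar> \<le> (1 / 3) ^ Suc i" .
      moreover have "\<bar>e i\<bar> = 2 * (1 / 3) ^ Suc i" using i(1) by (auto simp: e_def w_def)
      ultimately have "(1 / 3) ^ Suc i \<le> \<bar>g y - g y'\<bar>" unfolding split by linarith
      moreover have "(1 / 3 :: real) ^ K \<le> (1 / 3) ^ Suc i"
        using i(2) that(2) by (intro power_decreasing) auto
      ultimately show False using that(1) by linarith
    qed
    fix \<epsilon> :: real assume \<epsilon>: "0 < \<epsilon>"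
    obtain m where m: "1 / real (Suc m) < \<epsilon> / 2" using nat_approx_posE[of "\<epsilon> / 2"] \<epsilon> by auto
    have "\<exists>j. B j = ball c (1 / real (Suc m))" if "c \<in> C m" for c
      unfolding B_def using that cnt by (intro from_nat_into_surj) (auto simp: BB_def)
    then obtain J where J: "\<And>c. c \<in> C m \<Longrightarrow> B (J c) = ball c (1 / real (Suc m))" by metis
    define K where "K = Suc (Max (J ` C m))"
    show "\<exists>\<delta>>0. \<forall>y\<in>Y. \<forall>y'\<in>Y. \<bar>g y - g y'\<bar> < \<delta> \<longrightarrow> dist y y' < \<epsilon>"
    proof (intro exI[of _ "(1 / 3) ^ K"] conjI ballI impI)
      fix y y' assume y: "y \<in> Y" "y' \<in> Y" and d: "\<bar>g y - g y'\<bar> < (1 / 3) ^ K"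
      obtain c where c: "c \<in> C m" "y \<in> ball c (1 / real (Suc m))" using C(3)[of m] y(1) by auto
      have "J c < K" unfolding K_def using C(1) c(1) by (auto simp: less_Suc_eq_le)
      then have "y' \<in> ball c (1 / real (Suc m))" using digits[OF d] c J by metis
      then have "dist c y < \<epsilon> / 2" "dist c y' < \<epsilon> / 2" using c m by auto
      then show "dist y y' < \<epsilon>" by metric
    qed simp
  qed
qed

text \<open>The encoding turns the measures into measures on \<open>{0..1}\<close>, where Helly's theorem selects a
  weakly convergent subsequence. The decoding extends to a continuous map on the line, and pushing
  forward by a continuous map preserves weak convergence.\<close>

lemma prob_on_weakly_sequentially_compact:
  fixes Y :: "'a::euclidean_space set" and \<alpha> :: "nat \<Rightarrow> 'a measure"
  assumes Y: "compact Y" and \<alpha>: "\<And>n. \<alpha> n \<in> prob_on Y"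
  shows "\<exists>r \<beta>. strict_mono r \<and> \<beta> \<in> prob_on Y \<and>
    (\<forall>L. \<forall>\<phi>\<in>lip01 L. (\<lambda>n. LINT y|\<alpha> (r n). \<phi> y) \<longlonglongrightarrow> (LINT y|\<beta>. \<phi> y))"
proof -
  have closed_Y: "closed Y" using Y by (rule compact_imp_closed)
  have Yne: "Y \<noteq> {}"
  proof
    assume "Y = {}"
    then have "emeasure (\<alpha> 0) (space (\<alpha> 0)) = 0" using prob_onD[OF \<alpha>[of 0]] by simp
    then show False using prob_space.emeasure_space_1[OF prob_onD(3)[OF \<alpha>[of 0]]] by simp
  qed
  obtain g :: "'a \<Rightarrow> real" where g[measurable]: "g \<in> borel_measurable borel"
    and g01: "\<And>y. 0 \<le> g y" "\<And>y. g y \<le> 1"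
    and g_inv: "\<And>\<epsilon>. 0 < \<epsilon> \<Longrightarrow> \<exists>\<delta>>0. \<forall>y\<in>Y. \<forall>y'\<in>Y. \<bar>g y - g y'\<bar> < \<delta> \<longrightarrow> dist y y' < \<epsilon>"
    using borel_encoding_with_uniformly_continuous_inverse[OF Y Yne] by blast
  have inj: "inj_on g Y"
  proof (rule inj_onI)
    fix y y' assume *: "y \<in> Y" "y' \<in> Y" "g y = g y'"
    have "dist y y' < \<epsilon>" if "0 < \<epsilon>" for \<epsilon> using g_inv[OF that] * by force
    then show "y = y'" by (metis dist_pos_lt less_irrefl)
  qed
  have uc: "uniformly_continuous_on (g ` Y) (inv_into Y g)"
    unfolding uniformly_continuous_on_def
  proof (intro allI impI)
    fix \<epsilon> :: real assume "0 < \<epsilon>"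
    then obtain \<delta> where "\<delta> > 0" "\<And>y y'. y \<in> Y \<Longrightarrow> y' \<in> Y \<Longrightarrow> \<bar>g y - g y'\<bar> < \<delta> \<Longrightarrow> dist y y' < \<epsilon>"
      using g_inv by blast
    then show "\<exists>d>0. \<forall>x\<in>g ` Y. \<forall>x'\<in>g ` Y. dist x' x < d \<longrightarrow> dist (inv_into Y g x') (inv_into Y g x) < \<epsilon>"
      by (intro exI[of _ \<delta>]) (auto simp: inv_into_f_f[OF inj] dist_real_def)
  qed
  obtain h where h: "uniformly_continuous_on (closure (g ` Y)) h"
    "\<And>x. x \<in> g ` Y \<Longrightarrow> inv_into Y g x = h x"
    using uniformly_continuous_on_extension_on_closure[OF uc] by metis
  obtain F :: "real \<Rightarrow> 'a" where F: "continuous_on UNIV F"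
    and Fh: "\<And>x. x \<in> closure (g ` Y) \<Longrightarrow> F x = h x"
    using Tietze_unbounded[OF uniformly_continuous_imp_continuous[OF h(1)], of UNIV] by auto
  have Fg: "F (g y) = y" if "y \<in> Y" for y
    using that Fh[of "g y"] h(2)[of "g y"] closure_subset[of "g ` Y"] inv_into_f_f[OF inj that]
    by (metis image_eqI subsetD)
  have F_meas[measurable]: "F \<in> borel_measurable borel"
    using F by (rule borel_measurable_continuous_onI)
  define b where "b n = distr (\<alpha> n) borel g" for n
  have g\<alpha>: "g \<in> borel_measurable (\<alpha> n)" for n
    unfolding measurable_cong_sets[OF prob_onD(1)[OF \<alpha>] refl] by (rule g)
  have rd: "real_distribution (b n)" for n
    unfolding b_def real_distribution_def real_distribution_axioms_def
    using prob_space.prob_space_distr[OF prob_onD(3)[OF \<alpha>] g\<alpha>] by auto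
  have "tight b"
    unfolding tight_def
  proof (intro conjI allI impI)
    fix \<epsilon> :: real assume "0 < \<epsilon>"
    have "measure (b n) {- 1<..1} = 1" for n
    proof -
      have "g -` {- 1<..1} \<inter> space (\<alpha> n) = space (\<alpha> n)"
        using g01(2) less_le_trans[OF _ g01(1), of "- 1"] by auto
      then show ?thesis
        unfolding b_def using g\<alpha> prob_space.prob_space[OF prob_onD(3)[OF \<alpha>]]
        by (subst measure_distr) auto
    qed
    then show "\<exists>a c. a < c \<and> (\<forall>n. 1 - \<epsilon> < measure (b n) {a<..c})"
      using \<open>0 < \<epsilon>\<close> by (intro exI[of _ "- 1"] exI[of _ 1]) auto
  qed (rule rd)
  then obtain r M where r: "strict_mono (r :: nat \<Rightarrow> nat)" and M: "real_distribution M"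
    and wc: "weak_conv_m (b \<circ> id \<circ> r) M"
    using tight_imp_convergent_subsubsequence[of b id] strict_mono_id by blast
  interpret M: real_distribution M by (rule M)
  define \<beta> where "\<beta> = distr M borel F"
  have FM: "F \<in> borel_measurable M" by measurable
  have conv: "(\<lambda>n. LINT y|\<alpha> (r n). \<phi> y) \<longlonglongrightarrow> (LINT y|\<beta>. \<phi> y)" if \<phi>: "\<phi> \<in> lip01 L" for \<phi> L
  proof -
    have [measurable]: "\<phi> \<in> borel_measurable borel" using lip01D[OF \<phi>] by simp
    have c: "continuous_on UNIV (\<lambda>x. \<phi> (F x))"
      using F lip01D(5)[OF \<phi>, of UNIV] by (metis continuous_on_compose2 subset_UNIV)
    interpret b: real_distribution "(b \<circ> id \<circ> r) n" for n using rd by simp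
    have "(\<lambda>n. LINT x|(b \<circ> id \<circ> r) n. \<phi> (F x)) \<longlonglongrightarrow> (LINT x|M. \<phi> (F x))"
    proof (rule weak_conv_imp_bdd_ae_continuous_conv[where B = 1])
      have "{x. \<not> isCont (\<lambda>x. \<phi> (F x)) x} = {}" using c by (simp add: continuous_on_eq_continuous_at)
      then show "emeasure M {x. \<not> isCont (\<lambda>x. \<phi> (F x)) x} = 0" by simp
      show "norm (\<phi> (F x)) \<le> 1" for x using lip01D(2,3)[OF \<phi>] by simp
      show "weak_conv_m (\<lambda>n. (b \<circ> id \<circ> r) n) M" using wc by (simp only: o_def)
    qed (use rd M in auto)
    moreover have "(LINT x|(b \<circ> id \<circ> r) n. \<phi> (F x)) = (LINT y|\<alpha> (r n). \<phi> y)" for n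
    proof -
      have "(LINT x|(b \<circ> id \<circ> r) n. \<phi> (F x)) = (LINT y|\<alpha> (r n). \<phi> (F (g y)))"
        by (simp add: b_def integral_distr[OF g\<alpha>])
      also have "\<dots> = (LINT y|\<alpha> (r n). \<phi> y)"
        using prob_on_AE[OF \<alpha>[of "r n"] closed_Y]
        by (intro integral_cong_AE)
           (auto simp: measurable_cong_sets[OF prob_onD(1)[OF \<alpha>] refl] Fg elim!: AE_mp)
      finally show ?thesis .
    qed
    ultimately show ?thesis by (simp add: \<beta>_def integral_distr[OF FM])
  qed
  have sb: "sets \<beta> = sets borel" and pb: "prob_space \<beta>"
    unfolding \<beta>_def using M.prob_space_distr[OF FM] by auto
  interpret \<beta>: prob_space \<beta> by fact
  have "emeasure \<beta> (- Y) = 0"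
  proof -
    define \<phi> where "\<phi> y = min 1 (infdist y Y)" for y
    have \<phi>: "\<phi> \<in> lip01 1"
    proof (rule lip01I)
      fix x y
      have "\<bar>infdist x Y - infdist y Y\<bar> \<le> dist x y"
        by (rule infdist_triangle_abs)
      then show "\<bar>\<phi> x - \<phi> y\<bar> \<le> 1 * dist x y" unfolding \<phi>_def by linarith
    qed (auto simp: \<phi>_def infdist_nonneg)
    have "(LINT y|\<alpha> n. \<phi> y) = 0" for n
      using prob_on_AE[OF \<alpha>[of n] closed_Y] by (intro integral_eq_zero_AE) (auto simp: \<phi>_def elim!: AE_mp)
    then have "(LINT y|\<beta>. \<phi> y) = 0" using LIMSEQ_unique[OF conv[OF \<phi>]] by simp
    then have "AE y in \<beta>. \<phi> y = 0"
      using integral_nonneg_eq_0_iff_AE[OF integrable_lip01[OF \<phi> \<beta>.finite_measure_axioms sb]]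
        lip01D(2)[OF \<phi>] by auto
    then have "AE y in \<beta>. y \<in> Y"
      using in_closed_iff_infdist_zero[OF closed_Y Yne] by (auto simp: \<phi>_def min_def elim!: AE_mp split: if_splits)
    then show ?thesis using AE_iff_measurable[of "- Y" \<beta> "\<lambda>y. y \<in> Y"] closed_Y sb sets_eq_imp_space_eq[OF sb]
      by auto
  qed
  then have "\<beta> \<in> prob_on Y" using sb pb by (simp add: prob_on_def)
  with r conv show ?thesis by blast
qed

section \<open>Kernels and disintegrations seen through test functions\<close>

text \<open>Lipschitz functions that decrease to the indicator of the closed set \<open>F\<close>.\<close>

definition cone_over :: "'a::metric_space set \<Rightarrow> nat \<Rightarrow> 'a \<Rightarrow> real" where
  "cone_over F m y = max 0 (1 - real m * infdist y F)"

lemma cone_over_lip01: "cone_over F m \<in> lip01 (real m)"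
proof (rule lip01I)
  fix x y
  have "\<bar>infdist x F - infdist y F\<bar> \<le> dist x y" by (rule infdist_triangle_abs)
  then have "real m * \<bar>infdist x F - infdist y F\<bar> \<le> real m * dist x y" by (intro mult_left_mono) auto
  moreover have "real m * \<bar>infdist x F - infdist y F\<bar> = \<bar>real m * infdist x F - real m * infdist y F\<bar>"
    by (simp add: abs_mult flip: right_diff_distrib)
  ultimately show "\<bar>cone_over F m x - cone_over F m y\<bar> \<le> real m * dist x y"
    unfolding cone_over_def by linarith
qed (auto simp: cone_over_def infdist_nonneg)

lemma integral_cone_over_tendsto:
  assumes "prob_space M" "sets M = sets borel" "closed F" "F \<noteq> {}"
  shows "(\<lambda>m. LINT y|M. cone_over F m y) \<longlonglongrightarrow> measure M F"
proof -
  interpret prob_space M by fact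
  have F: "F \<in> sets M" using assms by simp
  have "(\<lambda>m. LINT y|M. cone_over F m y) \<longlonglongrightarrow> (LINT y|M. indicator F y)"
  proof (rule integral_dominated_convergence[where w = "\<lambda>_. 1"])
    show "AE y in M. (\<lambda>m. cone_over F m y) \<longlonglongrightarrow> indicator F y"
    proof (rule AE_I2)
      fix y
      show "(\<lambda>m. cone_over F m y) \<longlonglongrightarrow> indicator F y"
      proof (cases "y \<in> F")
        case True
        then show ?thesis by (simp add: cone_over_def)
      next
        case False
        then have "infdist y F \<noteq> 0" using in_closed_iff_infdist_zero assms by blast
        then have pos: "0 < infdist y F" using infdist_nonneg[of y F] by linarith
        then obtain k where k: "1 < real k * infdist y F" using ex_less_of_nat_mult by blast
        have "cone_over F m y = 0" if "k \<le> m" for m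
        proof -
          have "real k * infdist y F \<le> real m * infdist y F" using that pos by (intro mult_right_mono) auto
          then show ?thesis using k by (simp add: cone_over_def)
        qed
        then have "eventually (\<lambda>m. cone_over F m y = indicator F y) sequentially"
          using False by (auto simp: eventually_sequentially intro!: exI[of _ k])
        then show ?thesis by (rule tendsto_eventually)
      qed
    qed
    show "cone_over F m \<in> borel_measurable M" for m
      unfolding measurable_cong_sets[OF assms(2) refl] using lip01D(6)[OF cone_over_lip01] .
    show "AE y in M. norm (cone_over F m y) \<le> 1" for m
      using lip01D(2,3)[OF cone_over_lip01, of F m] by (intro AE_I2) simp
  qed (use F in auto)
  then show ?thesis using F by simp
qed

text \<open>The tests determine the measure of closed sets, which form an intersection-stable generator.\<close>

lemma prob_measures_eq_if_tests_eq:
  fixes \<alpha> \<beta> :: "'a::metric_space measure"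
  assumes \<alpha>: "prob_space \<alpha>" "sets \<alpha> = sets borel" and \<beta>: "prob_space \<beta>" "sets \<beta> = sets borel"
    and eq: "\<And>L \<phi>. \<phi> \<in> lip01 L \<Longrightarrow> (LINT y|\<alpha>. \<phi> y) = (LINT y|\<beta>. \<phi> y)"
  shows "\<alpha> = \<beta>"
proof (rule measure_eqI_generator_eq[where \<Omega> = UNIV and E = "Collect closed" and A = "\<lambda>_. UNIV"])
  interpret \<alpha>: prob_space \<alpha> by fact
  interpret \<beta>: prob_space \<beta> by fact
  show "Int_stable (Collect closed :: 'a set set)" by (auto simp: Int_stable_def)
  show "sets \<alpha> = sigma_sets UNIV (Collect closed)" "sets \<beta> = sigma_sets UNIV (Collect closed)"
    using \<alpha> \<beta> by (simp_all add: borel_eq_closed sets_measure_of)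
  show "emeasure \<alpha> F = emeasure \<beta> F" if "F \<in> Collect closed" for F
  proof (cases "F = {}")
    case False
    have "measure \<alpha> F = measure \<beta> F"
      using integral_cone_over_tendsto[OF \<alpha> _ False] integral_cone_over_tendsto[OF \<beta> _ False] that
      by (simp add: eq[OF cone_over_lip01]) (rule LIMSEQ_unique)
    then show ?thesis by (simp add: \<alpha>.emeasure_eq_measure \<beta>.emeasure_eq_measure)
  qed simp
  show "emeasure \<alpha> UNIV \<noteq> \<infinity>" using \<alpha>.emeasure_finite[of UNIV] by (simp add: infinity_ennreal_def)
qed auto

lemma measurable_prob_algebra_if_tests_measurable:
  fixes \<kappa> :: "'s \<Rightarrow> 'a::metric_space measure"
  assumes \<kappa>: "\<And>s. s \<in> space M \<Longrightarrow> prob_space (\<kappa> s)" "\<And>s. s \<in> space M \<Longrightarrow> sets (\<kappa> s) = sets borel"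
    and tests: "\<And>L \<phi>. \<phi> \<in> lip01 L \<Longrightarrow> (\<lambda>s. LINT y|\<kappa> s. \<phi> y) \<in> borel_measurable M"
  shows "\<kappa> \<in> measurable M (prob_algebra borel)"
proof (rule measurable_prob_algebra_generated[where \<Omega> = UNIV and G = "Collect closed"])
  show "sets (borel :: 'a measure) = sigma_sets UNIV (Collect closed)"
    by (simp add: borel_eq_closed sets_measure_of)
  show "Int_stable (Collect closed :: 'a set set)" by (auto simp: Int_stable_def)
  show "(\<lambda>s. emeasure (\<kappa> s) F) \<in> borel_measurable M" if F: "F \<in> Collect closed" for F
  proof (cases "F = {}")
    case False
    have "(\<lambda>s. measure (\<kappa> s) F) \<in> borel_measurable M"
    proof (rule borel_measurable_LIMSEQ_real)
      show "(\<lambda>m. LINT y|\<kappa> s. cone_over F m y) \<longlonglongrightarrow> measure (\<kappa> s) F" if "s \<in> space M" for s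
        using integral_cone_over_tendsto[OF \<kappa>(1,2)[OF that] _ False] F by simp
    qed (rule tests[OF cone_over_lip01])
    then have "(\<lambda>s. ennreal (measure (\<kappa> s) F)) \<in> borel_measurable M" by measurable
    then show ?thesis
      by (rule measurable_cong[THEN iffD1, rotated])
         (use \<kappa> in \<open>simp add: finite_measure.emeasure_eq_measure prob_space.finite_measure\<close>)
  qed simp
qed (use \<kappa> in auto)

lemma nn_integral_kernel_measurable:
  fixes \<kappa> :: "'a::second_countable_topology \<Rightarrow> 'b::second_countable_topology measure"
  assumes \<kappa>: "kernel S T \<kappa>" and h: "h \<in> borel_measurable borel"
  shows "(\<lambda>x. \<integral>\<^sup>+ y. h (x, y) \<partial>\<kappa> x) \<in> borel_measurable (restrict_space borel S)"
proof (rule nn_integral_measurable_subprob_algebra2[where N = borel])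
  show "\<kappa> \<in> measurable (restrict_space borel S) (subprob_algebra borel)"
    using \<kappa> unfolding kernel_def by (auto intro: measurable_prob_algebraD)
  have "(\<lambda>z. (fst z, snd z)) \<in> measurable (restrict_space borel S \<Otimes>\<^sub>M (borel :: 'b measure))
      ((borel :: 'a measure) \<Otimes>\<^sub>M (borel :: 'b measure))"
    by (intro measurable_Pair measurable_compose[OF measurable_fst] measurable_snd
        measurable_restrict_space1 measurable_ident_sets refl)
  then have "(\<lambda>z. (fst z, snd z)) \<in> measurable (restrict_space borel S \<Otimes>\<^sub>M (borel :: 'b measure)) borel"
    by (simp only: borel_prod)
  from measurable_compose[OF this h]
  show "case_prod (\<lambda>x y. h (x, y)) \<in> borel_measurable (restrict_space borel S \<Otimes>\<^sub>M borel)"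
    by (simp add: case_prod_beta')
qed

context
  fixes S :: "'a::second_countable_topology set" and \<alpha> :: "'a measure"
  assumes S: "S \<in> sets borel" and \<alpha>: "sets \<alpha> = sets borel" "emeasure \<alpha> (- S) = 0"
begin

lemma AE_carrier: "AE x in \<alpha>. x \<in> S"
  using \<alpha> S by (intro AE_I[of _ _ "- S"]) auto

lemma nn_integral_extend_zero:
  fixes f :: "'a \<Rightarrow> ennreal"
  assumes f: "f \<in> borel_measurable (restrict_space borel S)"
  shows "(\<lambda>x. f x * indicator S x) \<in> borel_measurable \<alpha>"
    and "(\<integral>\<^sup>+ x. f x \<partial>\<alpha>) = (\<integral>\<^sup>+ x. f x * indicator S x \<partial>\<alpha>)"
proof -
  show "(\<lambda>x. f x * indicator S x) \<in> borel_measurable \<alpha>"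
    unfolding measurable_cong_sets[OF \<alpha>(1) refl]
    using S f by (subst (asm) borel_measurable_restrict_space_iff_ennreal) auto
  show "(\<integral>\<^sup>+ x. f x \<partial>\<alpha>) = (\<integral>\<^sup>+ x. f x * indicator S x \<partial>\<alpha>)"
    using AE_carrier by (intro nn_integral_cong_AE) (auto elim!: AE_mp)
qed

lemma nn_integral_disintegration:
  fixes \<pi> :: "('a \<times> 'b::second_countable_topology) measure"
  assumes d: "disintegration S T \<alpha> \<pi> \<kappa>" and h: "h \<in> borel_measurable borel"
  shows "(\<integral>\<^sup>+ z. h z \<partial>\<pi>) = (\<integral>\<^sup>+ x. \<integral>\<^sup>+ y. h (x, y) \<partial>\<kappa> x \<partial>\<alpha>)"
proof -
  have \<kappa>: "kernel S T \<kappa>" and s\<pi>: "sets \<pi> = sets borel"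
    and em: "\<And>A. A \<in> sets borel \<Longrightarrow> emeasure \<pi> A = (\<integral>\<^sup>+ s. emeasure (\<kappa> s) (Pair s -` A) \<partial>\<alpha>)"
    using d by (auto simp: disintegration_def)
  have s\<kappa>: "sets (\<kappa> x) = sets borel" if "x \<in> S" for x
    using \<kappa> that by (auto simp: kernel_def prob_on_def)
  have Pm[measurable]: "Pair x \<in> measurable borel (borel :: ('a \<times> 'b) measure)" for x
    by (simp add: borel_measurable_continuous_onI continuous_on_Pair continuous_on_const continuous_on_id)
  have inner: "(\<lambda>y. k (x, y)) \<in> borel_measurable (\<kappa> x)"
    if "x \<in> S" "k \<in> borel_measurable borel" for x and k :: "'a \<times> 'b \<Rightarrow> ennreal"
    unfolding measurable_cong_sets[OF s\<kappa>[OF that(1)] refl]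
    using measurable_compose[OF Pm that(2)] by simp
  note outer = nn_integral_kernel_measurable[OF \<kappa>]
  from h show ?thesis
  proof (induction rule: borel_measurable_induct)
    case (cong f g)
    then show ?case by simp
  next
    case (set A)
    have "(\<integral>\<^sup>+ z. indicator A z \<partial>\<pi>) = emeasure \<pi> A" using set s\<pi> by simp
    also have "\<dots> = (\<integral>\<^sup>+ s. emeasure (\<kappa> s) (Pair s -` A) \<partial>\<alpha>)" using em set by simp
    also have "\<dots> = (\<integral>\<^sup>+ x. \<integral>\<^sup>+ y. indicator A (x, y) \<partial>\<kappa> x \<partial>\<alpha>)"
    proof (rule nn_integral_cong_AE, use AE_carrier in eventually_elim)
      fix x assume x: "x \<in> S"
      have "Pair x -` A \<in> sets (\<kappa> x)" using measurable_sets[OF Pm set] s\<kappa>[OF x] by simp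
      moreover have "(\<lambda>y. indicator A (x, y) :: ennreal) = indicator (Pair x -` A)"
        by (auto simp: indicator_def)
      ultimately show "emeasure (\<kappa> x) (Pair x -` A) = (\<integral>\<^sup>+ y. indicator A (x, y) \<partial>\<kappa> x)"
        by simp
    qed
    finally show ?case .
  next
    case (mult u c)
    have "(\<integral>\<^sup>+ z. c * u z \<partial>\<pi>) = c * (\<integral>\<^sup>+ x. (\<integral>\<^sup>+ y. u (x, y) \<partial>\<kappa> x) * indicator S x \<partial>\<alpha>)"
      using mult s\<pi> nn_integral_extend_zero(2)[OF outer[OF mult(2)]]
      by (subst nn_integral_cmult) (auto simp: measurable_cong_sets[OF s\<pi> refl])
    also have "\<dots> = (\<integral>\<^sup>+ x. c * ((\<integral>\<^sup>+ y. u (x, y) \<partial>\<kappa> x) * indicator S x) \<partial>\<alpha>)"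
      using nn_integral_extend_zero(1)[OF outer[OF mult(2)]] by (rule nn_integral_cmult[symmetric])
    also have "\<dots> = (\<integral>\<^sup>+ x. \<integral>\<^sup>+ y. c * u (x, y) \<partial>\<kappa> x \<partial>\<alpha>)"
      by (rule nn_integral_cong_AE, use AE_carrier in eventually_elim)
         (simp add: nn_integral_cmult[OF inner[OF _ mult(2)]])
    finally show ?case .
  next
    case (add u v)
    have "(\<integral>\<^sup>+ z. v z + u z \<partial>\<pi>)
        = (\<integral>\<^sup>+ x. (\<integral>\<^sup>+ y. v (x, y) \<partial>\<kappa> x) * indicator S x \<partial>\<alpha>) + (\<integral>\<^sup>+ x. (\<integral>\<^sup>+ y. u (x, y) \<partial>\<kappa> x) * indicator S x \<partial>\<alpha>)"
      using add s\<pi> nn_integral_extend_zero(2)[OF outer[OF add(1)]] nn_integral_extend_zero(2)[OF outer[OF add(3)]]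
      by (subst nn_integral_add) (auto simp: measurable_cong_sets[OF s\<pi> refl])
    also have "\<dots> = (\<integral>\<^sup>+ x. (\<integral>\<^sup>+ y. v (x, y) \<partial>\<kappa> x) * indicator S x + (\<integral>\<^sup>+ y. u (x, y) \<partial>\<kappa> x) * indicator S x \<partial>\<alpha>)"
      using nn_integral_extend_zero(1)[OF outer[OF add(1)]] nn_integral_extend_zero(1)[OF outer[OF add(3)]]
      by (intro nn_integral_add[symmetric])
    also have "\<dots> = (\<integral>\<^sup>+ x. \<integral>\<^sup>+ y. v (x, y) + u (x, y) \<partial>\<kappa> x \<partial>\<alpha>)"
      by (rule nn_integral_cong_AE, use AE_carrier in eventually_elim)
         (simp add: nn_integral_add[OF inner[OF _ add(3)] inner[OF _ add(1)]])
    finally show ?case .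
  next
    case (seq U)
    have mU: "U i \<in> borel_measurable borel" for i using seq by auto
    have "(\<integral>\<^sup>+ z. (\<Squnion> (range U)) z \<partial>\<pi>) = (\<integral>\<^sup>+ z. (SUP i. U i z) \<partial>\<pi>)" by (simp add: image_comp)
    also have "\<dots> = (SUP i. \<integral>\<^sup>+ z. U i z \<partial>\<pi>)"
      using seq mU by (intro nn_integral_monotone_convergence_SUP) (auto simp: measurable_cong_sets[OF s\<pi> refl])
    also have "\<dots> = (SUP i. \<integral>\<^sup>+ x. (\<integral>\<^sup>+ y. U i (x, y) \<partial>\<kappa> x) * indicator S x \<partial>\<alpha>)"
      using seq nn_integral_extend_zero(2)[OF outer[OF mU]] by simp
    also have "\<dots> = (\<integral>\<^sup>+ x. (SUP i. (\<integral>\<^sup>+ y. U i (x, y) \<partial>\<kappa> x) * indicator S x) \<partial>\<alpha>)"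
      using seq(3) nn_integral_extend_zero(1)[OF outer[OF mU]]
      by (intro nn_integral_monotone_convergence_SUP[symmetric])
         (auto simp: incseq_def le_fun_def intro!: mult_right_mono nn_integral_mono)
    also have "\<dots> = (\<integral>\<^sup>+ x. \<integral>\<^sup>+ y. (\<Squnion> (range U)) (x, y) \<partial>\<kappa> x \<partial>\<alpha>)"
    proof (rule nn_integral_cong_AE, use AE_carrier in eventually_elim)
      fix x assume x: "x \<in> S"
      have "(\<integral>\<^sup>+ y. (SUP i. U i (x, y)) \<partial>\<kappa> x) = (SUP i. \<integral>\<^sup>+ y. U i (x, y) \<partial>\<kappa> x)"
        using seq(3) inner[OF x mU]
        by (intro nn_integral_monotone_convergence_SUP) (auto simp: incseq_def le_fun_def)
      then show "(SUP i. (\<integral>\<^sup>+ y. U i (x, y) \<partial>\<kappa> x) * indicator S x) = (\<integral>\<^sup>+ y. (\<Squnion> (range U)) (x, y) \<partial>\<kappa> x)"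
        using x by (simp add: SUP_apply image_comp)
    qed
    finally show ?case .
  qed
qed

lemma test_kernel_measurable:
  fixes \<kappa> :: "'a \<Rightarrow> 'b::{metric_space,second_countable_topology} measure"
  assumes \<kappa>: "kernel S T \<kappa>" and \<phi>: "\<phi> \<in> lip01 L"
  shows "(\<lambda>x. LINT y|\<kappa> x. \<phi> y) \<in> borel_measurable (restrict_space borel S)"
proof -
  have p: "prob_space (\<kappa> x)" "sets (\<kappa> x) = sets borel" if "x \<in> S" for x
    using \<kappa> that by (auto simp: kernel_def prob_on_def)
  have "snd \<in> measurable (borel :: ('a \<times> 'b) measure) borel"
    by (intro borel_measurable_continuous_onI continuous_intros)
  from measurable_compose[OF measurable_compose[OF this lip01D(6)[OF \<phi>]] measurable_ennreal]
  have "(\<lambda>z. ennreal (\<phi> (snd z))) \<in> borel_measurable (borel :: ('a \<times> 'b) measure)" .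
  from nn_integral_kernel_measurable[OF \<kappa> this]
  have "(\<lambda>x. enn2real (\<integral>\<^sup>+ y. ennreal (\<phi> y) \<partial>\<kappa> x)) \<in> borel_measurable (restrict_space borel S)"
    by simp
  moreover have "enn2real (\<integral>\<^sup>+ y. ennreal (\<phi> y) \<partial>\<kappa> x) = (LINT y|\<kappa> x. \<phi> y)" if "x \<in> S" for x
    using nn_integral_lip01[OF \<phi> prob_space.finite_measure p(2)] integral_lip01_bounds[OF \<phi>] p that by simp
  ultimately show ?thesis
    by (subst measurable_cong[where g = "\<lambda>x. enn2real (\<integral>\<^sup>+ y. ennreal (\<phi> y) \<partial>\<kappa> x)"])
       (auto simp: space_restrict_space)
qed

text \<open>Both sides have the same integral over every Borel set of first coordinates.\<close>

lemma disintegration_unique_on_tests: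
  fixes \<pi> :: "('a \<times> 'b::{metric_space,second_countable_topology}) measure"
  assumes d: "disintegration S T \<alpha> \<pi> \<kappa>" and d': "disintegration S T' \<alpha> \<pi> \<kappa>'" and \<phi>: "\<phi> \<in> lip01 L"
    and fin: "finite_measure \<alpha>"
  shows "AE x in \<alpha>. (LINT y|\<kappa> x. \<phi> y) = (LINT y|\<kappa>' x. \<phi> y)"
proof -
  have k: "kernel S T \<kappa>" "kernel S T' \<kappa>'" using d d' by (auto simp: disintegration_def)
  have p: "prob_space (\<kappa> x)" "sets (\<kappa> x) = sets borel" "prob_space (\<kappa>' x)" "sets (\<kappa>' x) = sets borel" if "x \<in> S" for x
    using k that by (auto simp: kernel_def prob_on_def)
  define f where "f x = ennreal (LINT y|\<kappa> x. \<phi> y) * indicator S x" for x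
  define f' where "f' x = ennreal (LINT y|\<kappa>' x. \<phi> y) * indicator S x" for x
  have mf: "f \<in> borel_measurable \<alpha>" "f' \<in> borel_measurable \<alpha>"
    unfolding f_def f'_def using test_kernel_measurable[OF k(1) \<phi>] test_kernel_measurable[OF k(2) \<phi>]
    by (auto intro!: nn_integral_extend_zero(1))
  have "density \<alpha> f = density \<alpha> f'"
  proof (rule measure_eqI)
    fix A assume "A \<in> sets (density \<alpha> f)"
    then have A: "A \<in> sets borel" using \<alpha> by simp
    have "(\<lambda>z. ennreal (\<phi> (snd z)) * indicator A (fst z)) \<in> borel_measurable (borel \<Otimes>\<^sub>M borel)"
      using lip01D(6)[OF \<phi>] A by measurable
    then have h: "(\<lambda>z. ennreal (\<phi> (snd z)) * indicator A (fst z)) \<in> borel_measurable (borel :: ('a \<times> 'b) measure)"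
      by (simp add: borel_prod)
    have "emeasure (density \<alpha> g) A = (\<integral>\<^sup>+ z. ennreal (\<phi> (snd z)) * indicator A (fst z) \<partial>\<pi>)"
      if g: "g = (\<lambda>x. ennreal (LINT y|\<eta> x. \<phi> y) * indicator S x)" "g \<in> borel_measurable \<alpha>"
        and \<eta>: "disintegration S U \<alpha> \<pi> \<eta>" for g \<eta> U
    proof -
      have p: "prob_space (\<eta> x)" "sets (\<eta> x) = sets borel" if "x \<in> S" for x
        using \<eta> that by (auto simp: kernel_def prob_on_def disintegration_def)
      have "emeasure (density \<alpha> g) A = (\<integral>\<^sup>+ x. g x * indicator A x \<partial>\<alpha>)"
        using g A \<alpha> by (intro emeasure_density) auto
      also have "\<dots> = (\<integral>\<^sup>+ x. \<integral>\<^sup>+ y. ennreal (\<phi> y) * indicator A x \<partial>\<eta> x \<partial>\<alpha>)"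
      proof (rule nn_integral_cong_AE, use AE_carrier in eventually_elim)
        fix x assume x: "x \<in> S"
        show "g x * indicator A x = (\<integral>\<^sup>+ y. ennreal (\<phi> y) * indicator A x \<partial>\<eta> x)"
          using x lip01D(6)[OF \<phi>] nn_integral_lip01[OF \<phi> prob_space.finite_measure[OF p(1)[OF x]] p(2)[OF x]]
          by (subst nn_integral_multc) (auto simp: g measurable_cong_sets[OF p(2)[OF x] refl])
      qed
      also have "\<dots> = (\<integral>\<^sup>+ z. ennreal (\<phi> (snd z)) * indicator A (fst z) \<partial>\<pi>)"
        by (subst nn_integral_disintegration[OF \<eta> h]) simp
      finally show ?thesis .
    qed
    from this[of f \<kappa> T] this[of f' \<kappa>' T'] show "emeasure (density \<alpha> f) A = emeasure (density \<alpha> f') A"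
      using mf d d' by (simp add: f_def[abs_def] f'_def[abs_def])
  qed simp
  then have "AE x in \<alpha>. f x = f' x"
    using mf fin by (intro sigma_finite_measure.density_unique) (auto simp: finite_measure_def)
  then show ?thesis
    using AE_carrier
  proof eventually_elim
    case (elim x)
    then show ?case
      using integral_lip01_bounds(1)[OF \<phi> p(1,2)[OF elim(2)]] integral_lip01_bounds(1)[OF \<phi> p(3,4)[OF elim(2)]]
      by (simp add: f_def f'_def)
  qed
qed

text \<open>The disintegrations selected in the definition of the vertical distance agree with the given ones
  on every test, almost everywhere. Integrating the bound on the Wasserstein distance of the fibres
  therefore bounds the vertical distance by \<open>L\<^sup>1\<close> distances of finitely many real functions.\<close>

lemma vertical_W_le_test_differences:
  fixes N :: nat and \<pi> \<pi>' :: "('a \<times> 'b::{metric_space,second_countable_topology}) measure"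
  assumes \<alpha>1: "prob_space \<alpha>"
    and d: "disintegration S Y \<alpha> \<pi> \<kappa>" and d': "disintegration S Y \<alpha> \<pi>' \<kappa>'" and Y: "closed Y"
    and \<psi>: "\<And>q. q < N \<Longrightarrow> \<psi> q \<in> lip01 L" and sum1: "\<And>y. y \<in> Y \<Longrightarrow> (\<Sum>q<N. \<psi> q y) = 1"
    and D: "0 \<le> D" "\<And>y y'. y \<in> Y \<Longrightarrow> y' \<in> Y \<Longrightarrow> dist y y' \<le> D" and \<delta>0: "0 \<le> \<delta>"
    and \<delta>: "\<And>q y y'. q < N \<Longrightarrow> \<psi> q y \<noteq> 0 \<Longrightarrow> \<psi> q y' \<noteq> 0 \<Longrightarrow> dist y y' \<le> \<delta>"
  shows "vertical_W S Y \<alpha> \<pi> \<pi>' \<le> ennreal \<delta> + ennreal D *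
    (\<Sum>q<N. \<integral>\<^sup>+ x. ennreal \<bar>(LINT y|\<kappa> x. \<psi> q y) - (LINT y|\<kappa>' x. \<psi> q y)\<bar> \<partial>\<alpha>)"
proof -
  interpret prob_space \<alpha> by fact
  define \<eta> where "\<eta> = (SOME \<kappa>. disintegration S Y \<alpha> \<pi> \<kappa>)"
  define \<eta>' where "\<eta>' = (SOME \<kappa>. disintegration S Y \<alpha> \<pi>' \<kappa>)"
  have \<eta>: "disintegration S Y \<alpha> \<pi> \<eta>" "disintegration S Y \<alpha> \<pi>' \<eta>'"
    unfolding \<eta>_def \<eta>'_def
    using someI[of "disintegration S Y \<alpha> \<pi>", OF d] someI[of "disintegration S Y \<alpha> \<pi>'", OF d'] by auto
  have k: "kernel S Y \<kappa>" "kernel S Y \<kappa>'" using d d' by (auto simp: disintegration_def)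
  have po: "\<eta> x \<in> prob_on Y" "\<eta>' x \<in> prob_on Y" if "x \<in> S" for x
    using \<eta> that by (auto simp: disintegration_def kernel_def)
  let ?g = "\<lambda>q x. \<bar>(LINT y|\<kappa> x. \<psi> q y) - (LINT y|\<kappa>' x. \<psi> q y)\<bar>"
  have AEq: "AE x in \<alpha>. \<forall>q\<in>{..<N}. (LINT y|\<eta> x. \<psi> q y) = (LINT y|\<kappa> x. \<psi> q y) \<and>
      (LINT y|\<eta>' x. \<psi> q y) = (LINT y|\<kappa>' x. \<psi> q y)"
    using disintegration_unique_on_tests[OF \<eta>(1) d \<psi> finite_measure_axioms]
      disintegration_unique_on_tests[OF \<eta>(2) d' \<psi> finite_measure_axioms]
    by (intro AE_finite_allI) auto
  have "vertical_W S Y \<alpha> \<pi> \<pi>' = (\<integral>\<^sup>+ x. W1 (\<eta> x) (\<eta>' x) \<partial>\<alpha>)"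
    by (simp add: vertical_W_def \<eta>_def \<eta>'_def)
  also have "\<dots> \<le> (\<integral>\<^sup>+ x. ennreal \<delta> + ennreal D * (\<Sum>q<N. ennreal (?g q x)) \<partial>\<alpha>)"
  proof (rule nn_integral_mono_AE, use AE_carrier AEq in eventually_elim)
    fix x assume x: "x \<in> S" and eq: "\<forall>q\<in>{..<N}. (LINT y|\<eta> x. \<psi> q y) = (LINT y|\<kappa> x. \<psi> q y) \<and>
      (LINT y|\<eta>' x. \<psi> q y) = (LINT y|\<kappa>' x. \<psi> q y)"
    have "W1 (\<eta> x) (\<eta>' x) \<le> ennreal (\<delta> + D * (\<Sum>q<N. \<bar>(LINT y|\<eta> x. \<psi> q y) - (LINT y|\<eta>' x. \<psi> q y)\<bar>))"
      by (rule W1_le_test_differences[OF po[OF x] Y \<psi> sum1 D \<delta>0 \<delta>])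
    also have "\<dots> = ennreal (\<delta> + D * (\<Sum>q<N. ?g q x))" using eq by simp
    also have "\<dots> = ennreal \<delta> + ennreal D * (\<Sum>q<N. ennreal (?g q x))"
      using D(1) \<delta>0 by (simp add: ennreal_plus ennreal_mult sum_nonneg)
    finally show "W1 (\<eta> x) (\<eta>' x) \<le> ennreal \<delta> + ennreal D * (\<Sum>q<N. ennreal (?g q x))" .
  qed
  also have "\<dots> = (\<integral>\<^sup>+ x. (ennreal \<delta> + ennreal D * (\<Sum>q<N. ennreal (?g q x) * indicator S x)) \<partial>\<alpha>)"
    by (rule nn_integral_cong_AE, use AE_carrier in eventually_elim) simp
  also have "\<dots> = ennreal \<delta> + ennreal D * (\<Sum>q<N. \<integral>\<^sup>+ x. ennreal (?g q x) \<partial>\<alpha>)"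
  proof -
    have r: "(\<lambda>x. ennreal (?g q x)) \<in> borel_measurable (restrict_space borel S)" if "q < N" for q
      using test_kernel_measurable[OF k(1) \<psi>[OF that]] test_kernel_measurable[OF k(2) \<psi>[OF that]]
      by measurable
    define G where "G q x = ennreal (?g q x) * indicator S x" for q x
    have m: "G q \<in> borel_measurable \<alpha>" if "q < N" for q
      using nn_integral_extend_zero(1)[OF r[OF that]] by (simp add: G_def[abs_def])
    have s: "(\<lambda>x. \<Sum>q<N. G q x) \<in> borel_measurable \<alpha>"
      using m by (intro borel_measurable_sum) auto
    have "(\<integral>\<^sup>+ x. ennreal \<delta> + ennreal D * (\<Sum>q<N. G q x) \<partial>\<alpha>)
        = ennreal \<delta> + ennreal D * (\<Sum>q<N. \<integral>\<^sup>+ x. G q x \<partial>\<alpha>)"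
      using s nn_integral_sum[of "{..<N}" G \<alpha>] m
      by (simp add: nn_integral_add nn_integral_cmult emeasure_space_1)
    also have "(\<Sum>q<N. \<integral>\<^sup>+ x. G q x \<partial>\<alpha>) = (\<Sum>q<N. \<integral>\<^sup>+ x. ennreal (?g q x) \<partial>\<alpha>)"
      using nn_integral_extend_zero(2)[OF r] by (intro sum.cong) (auto simp: G_def)
    finally show ?thesis by (simp only: G_def)
  qed
  finally show ?thesis .
qed

end

section \<open>Discrete variation on grids\<close>

definition vset :: "'a^'n::finite \<Rightarrow> 'n \<Rightarrow> 'a \<Rightarrow> 'a^'n" where
  "vset a l s = (\<chi> m. if m = l then s else a $ m)"

lemma vset_nth [simp]: "vset a l s $ m = (if m = l then s else a $ m)"
  by (simp add: vset_def)

lemma vset_vset [simp]: "vset (vset a l s) l t = vset a l t"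
  by (simp add: vec_eq_iff)

lemma vset_same [simp]: "vset a l (a $ l) = a"
  by (simp add: vec_eq_iff)

lemma axis_nth_if: "axis l x $ m = (if m = l then x else 0)"
  by (simp add: axis_def)

lemma card_vec_box:
  fixes G :: "'n::finite \<Rightarrow> nat set"
  assumes "\<And>m. finite (G m)"
  shows "finite {i :: nat^'n. \<forall>m. i $ m \<in> G m}" "card {i :: nat^'n. \<forall>m. i $ m \<in> G m} = (\<Prod>m\<in>UNIV. card (G m))"
proof -
  have b: "bij_betw (\<lambda>i :: nat^'n. ($) i) {i. \<forall>m. i $ m \<in> G m} (Pi\<^sub>E UNIV G)"
  proof (rule bij_betw_byWitness[where f' = vec_lambda])
    show "\<forall>i\<in>{i :: nat^'n. \<forall>m. i $ m \<in> G m}. vec_lambda (($) i) = i" by (simp add: vec_lambda_eta)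
  qed auto
  have "finite (Pi\<^sub>E UNIV G)" using assms by (intro finite_PiE) auto
  then show "finite {i :: nat^'n. \<forall>m. i $ m \<in> G m}" using bij_betw_finite[OF b] by simp
  show "card {i :: nat^'n. \<forall>m. i $ m \<in> G m} = (\<Prod>m\<in>UNIV. card (G m))"
    using bij_betw_same_card[OF b] by (simp add: card_PiE)
qed

lemma idx_box: "idx n = {i. \<forall>m. i $ m \<in> {..<n}}" by (auto simp: idx_def)

lemma finite_idx [simp]: "finite (idx n)"
  unfolding idx_box by (rule card_vec_box) simp

lemma card_idx: "card (idx n :: (nat^'n::finite) set) = n ^ CARD('n)"
  unfolding idx_box by (subst card_vec_box) simp_all

lemma vset_idx: "a \<in> idx n \<Longrightarrow> s < n \<Longrightarrow> vset a l s \<in> idx n"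
  by (auto simp: idx_def)

text \<open>A sum over the grid is the average, over all grid points, of the sums along the lines through
  them. This reduces estimates on the grid to estimates on an interval of integers.\<close>

lemma sum_over_lines:
  fixes F :: "nat^'n::finite \<Rightarrow> real"
  shows "(\<Sum>a\<in>idx n. \<Sum>s<n. F (vset a l s)) = real n * (\<Sum>a\<in>idx n. F a)"
proof -
  have "(\<Sum>a\<in>idx n. \<Sum>s<n. F (vset a l s)) = (\<Sum>(a, s)\<in>idx n \<times> {..<n}. F (vset a l s))"
    by (simp add: sum.cartesian_product)
  also have "\<dots> = (\<Sum>(a, s)\<in>idx n \<times> {..<n}. F a)"
    by (rule sum.reindex_bij_witness[where i = "\<lambda>(a, s). (vset a l s, a $ l)" and j = "\<lambda>(a, s). (vset a l s, a $ l)"])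
       (auto simp: idx_def)
  also have "\<dots> = real n * (\<Sum>a\<in>idx n. F a)"
    by (simp add: sum_distrib_left flip: sum.cartesian_product)
  finally show ?thesis .
qed

lemma sum_le_if_line_sums_le:
  fixes F G :: "nat^'n::finite \<Rightarrow> real"
  assumes "0 < n" "\<And>a. a \<in> idx n \<Longrightarrow> (\<Sum>s<n. F (vset a l s)) \<le> (\<Sum>s<n. G (vset a l s))"
  shows "(\<Sum>a\<in>idx n. F a) \<le> (\<Sum>a\<in>idx n. G a)"
proof -
  have "real n * (\<Sum>a\<in>idx n. F a) \<le> real n * (\<Sum>a\<in>idx n. G a)"
    unfolding sum_over_lines[symmetric, of n _ l] by (intro sum_mono assms)
  then show ?thesis using assms(1) by simp
qed

text \<open>The discrete counterpart, in direction \<open>l\<close>, of the total variation. Step two compares cells in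
  equal position within neighbouring composite cells; step one is used on the coarser grid of
  composite cells.\<close>

definition step_variation :: "nat \<Rightarrow> nat \<Rightarrow> 'n \<Rightarrow> (nat^'n::finite \<Rightarrow> real) \<Rightarrow> real" where
  "step_variation n j l h = (\<Sum>i\<in>idx n. if i $ l + j < n then \<bar>h (i + axis l j) - h i\<bar> else 0)"

lemma add_axis_eq_vset: "a + axis l j = vset a l (a $ l + j)" for a :: "nat^'n::finite"
  by (simp add: vec_eq_iff axis_nth_if)

lemma add_axis_idx: "i \<in> idx n \<Longrightarrow> i $ l + j < n \<Longrightarrow> i + axis l j \<in> idx n"
  by (auto simp: idx_def axis_nth_if)

lemma step_variation_mult:
  fixes h r :: "nat^'n::finite \<Rightarrow> real"
  assumes h: "\<And>i. i \<in> idx n \<Longrightarrow> 0 \<le> h i \<and> h i \<le> M" and r: "\<And>i. i \<in> idx n \<Longrightarrow> \<bar>r i\<bar> \<le> 1"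
  shows "step_variation n j l (\<lambda>i. h i * r i) \<le> M * step_variation n j l r + step_variation n j l h"
  unfolding step_variation_def sum_distrib_left sum.distrib[symmetric]
proof (rule sum_mono)
  fix i :: "nat^'n" assume i: "i \<in> idx n"
  show "(if i $ l + j < n then \<bar>h (i + axis l j) * r (i + axis l j) - h i * r i\<bar> else 0)
    \<le> M * (if i $ l + j < n then \<bar>r (i + axis l j) - r i\<bar> else 0) +
      (if i $ l + j < n then \<bar>h (i + axis l j) - h i\<bar> else 0)"
  proof (cases "i $ l + j < n")
    case True
    let ?i = "i + axis l j"
    have i': "?i \<in> idx n" using add_axis_idx[OF i True] .
    have "h ?i * r ?i - h i * r i = h i * (r ?i - r i) + (h ?i - h i) * r ?i" by (simp add: algebra_simps)
    then have "\<bar>h ?i * r ?i - h i * r i\<bar> \<le> \<bar>h i\<bar> * \<bar>r ?i - r i\<bar> + \<bar>h ?i - h i\<bar> * \<bar>r ?i\<bar>"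
      by (simp add: abs_mult[symmetric])
    also have "\<dots> \<le> M * \<bar>r ?i - r i\<bar> + \<bar>h ?i - h i\<bar> * 1"
      using h[OF i] r[OF i'] by (intro add_mono mult_right_mono mult_left_mono) auto
    finally show ?thesis using True by simp
  qed simp
qed

subsection \<open>Two shifted groupings\<close>

text \<open>The grouping of the index pairs of one coordinate, unshifted or shifted by one. The group of an
  index uses the shifted pairs exactly in the coordinates in \<open>L\<close>, so that \<open>L = {}\<close> and
  \<open>L = UNIV\<close> give the two kinds of composite cells.\<close>

definition pair_label :: "bool \<Rightarrow> nat \<Rightarrow> nat" where
  "pair_label b s = (if b then (s + 1) div 2 else s div 2)"

definition group :: "nat \<Rightarrow> 'n set \<Rightarrow> nat^'n::finite \<Rightarrow> (nat^'n) set" where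
  "group n L i = {j \<in> idx n. \<forall>m. pair_label (m \<in> L) (j $ m) = pair_label (m \<in> L) (i $ m)}"

lemma finite_group [simp]: "finite (group n L i)"
  by (rule finite_subset[of _ "idx n"]) (auto simp: group_def)

lemma group_self: "i \<in> idx n \<Longrightarrow> i \<in> group n L i"
  by (simp add: group_def)

lemma pair_label_fiber: "finite {s. pair_label b s = c}" "card {s. pair_label b s = c} \<le> 2"
proof -
  have sub: "{s. pair_label b s = c} \<subseteq> (if b then {2 * c - 1, 2 * c} else {2 * c, 2 * c + 1})"
    by (auto simp: pair_label_def)
  then show "finite {s. pair_label b s = c}" by (rule finite_subset) auto
  have "card {s. pair_label b s = c} \<le> card (if b then {2 * c - 1, 2 * c} else {2 * c, 2 * c + 1})"
    using sub by (intro card_mono) auto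
  also have "\<dots> \<le> 2" by (auto simp: card_insert_if)
  finally show "card {s. pair_label b s = c} \<le> 2" .
qed

lemma card_group_le: "card (group n L i) \<le> 2 ^ CARD('n)" for i :: "nat^'n::finite"
proof -
  let ?G = "\<lambda>m. {s. pair_label (m \<in> L) s = pair_label (m \<in> L) (i $ m)}"
  have fin: "\<And>m. finite (?G m)" using pair_label_fiber(1) by blast
  have "card (group n L i) \<le> card {j. \<forall>m. j $ m \<in> ?G m}"
    using card_vec_box(1)[of ?G] fin by (intro card_mono) (auto simp: group_def)
  also have "\<dots> = (\<Prod>m\<in>UNIV. card (?G m))" using card_vec_box(2)[of ?G] fin by blast
  also have "\<dots> \<le> (\<Prod>m\<in>(UNIV :: 'n set). 2)" using pair_label_fiber(2) by (intro prod_mono) auto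
  finally show ?thesis by simp
qed

text \<open>An index lies in the groups of at most \<open>2 ^ CARD('n)\<close> indices.\<close>

lemma sum_over_groups_le:
  fixes E :: "nat^'n::finite \<Rightarrow> real"
  assumes E: "\<And>j. j \<in> idx n \<Longrightarrow> 0 \<le> E j" and K: "\<And>i. i \<in> idx n \<Longrightarrow> K i \<subseteq> group n L i"
  shows "(\<Sum>i\<in>idx n. \<Sum>j\<in>K i. E j) \<le> 2 ^ CARD('n) * (\<Sum>j\<in>idx n. E j)"
proof -
  have "(\<Sum>i\<in>idx n. \<Sum>j\<in>K i. E j) \<le> (\<Sum>i\<in>idx n. \<Sum>j\<in>group n L i. E j)"
    using E K by (intro sum_mono sum_mono2) (auto simp: group_def)
  also have "\<dots> = (\<Sum>i\<in>idx n. \<Sum>j\<in>{j \<in> idx n. j \<in> group n L i}. E j)"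
    by (intro sum.cong) (auto simp: group_def)
  also have "\<dots> = (\<Sum>j\<in>idx n. \<Sum>i\<in>{i \<in> idx n. j \<in> group n L i}. E j)"
    by (rule sum.swap_restrict) auto
  also have "\<dots> = (\<Sum>j\<in>idx n. real (card (group n L j)) * E j)"
  proof (intro sum.cong refl)
    fix j :: "nat^'n" assume "j \<in> idx n"
    then have "{i \<in> idx n. j \<in> group n L i} = group n L j" by (auto simp: group_def)
    then show "(\<Sum>i\<in>{i \<in> idx n. j \<in> group n L i}. E j) = real (card (group n L j)) * E j" by simp
  qed
  also have "\<dots> \<le> (\<Sum>j\<in>idx n. 2 ^ CARD('n) * E j)"
  proof (intro sum_mono mult_right_mono E)
    fix j :: "nat^'n"
    have "real (card (group n L j)) \<le> real (2 ^ CARD('n))" using card_group_le by (simp only: of_nat_le_iff)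
    then show "real (card (group n L j)) \<le> 2 ^ CARD('n)" by simp
  qed
  finally show ?thesis by (simp add: sum_distrib_left)
qed

text \<open>The unshifted and the shifted pair of an inner index have this index in common, and their other
  members are two steps apart. At the two ends of the interval the shifted pairs are singletons,
  which costs \<open>B\<close> each.\<close>

lemma pair_sum_difference_le:
  fixes x :: "nat \<Rightarrow> real"
  assumes n: "even n" "0 < n" and x: "\<And>s. s < n \<Longrightarrow> \<bar>x s\<bar> \<le> B"
  shows "(\<Sum>s<n. \<bar>(\<Sum>t\<in>{t. t < n \<and> pair_label False t = pair_label False s}. x t) -
      (\<Sum>t\<in>{t. t < n \<and> pair_label True t = pair_label True s}. x t)\<bar>)
    \<le> (\<Sum>s<n. if s + 2 < n then \<bar>x (s + 2) - x s\<bar> else 0) + 2 * B"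
proof -
  have n2: "2 \<le> n" using n by presburger
  let ?E = "\<lambda>s. \<bar>(\<Sum>t\<in>{t. t < n \<and> pair_label False t = pair_label False s}. x t) -
      (\<Sum>t\<in>{t. t < n \<and> pair_label True t = pair_label True s}. x t)\<bar>"
  have inner: "?E (Suc s) = \<bar>x (s + 2) - x s\<bar>" if s: "s + 2 < n" for s
  proof (cases "even s")
    case True
    then have "{t. t < n \<and> pair_label False t = pair_label False (Suc s)} = {s, Suc s}"
      "{t. t < n \<and> pair_label True t = pair_label True (Suc s)} = {Suc s, s + 2}"
      using s by ((auto simp: pair_label_def; presburger), (auto simp: pair_label_def; presburger))
    then show ?thesis by simp
  next
    case F: False
    then have "{t. t < n \<and> pair_label False t = pair_label False (Suc s)} = {Suc s, s + 2}"
      "{t. t < n \<and> pair_label True t = pair_label True (Suc s)} = {s, Suc s}"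
      using s by ((auto simp: pair_label_def; presburger), (auto simp: pair_label_def; presburger))
    then show ?thesis by simp
  qed
  have first: "?E 0 \<le> B"
  proof -
    have "{t. t < n \<and> pair_label False t = pair_label False 0} = {0, 1}"
      "{t. t < n \<and> pair_label True t = pair_label True 0} = {0}"
      using n2 by ((auto simp: pair_label_def; presburger), (auto simp: pair_label_def; presburger))
    then show ?thesis using x[of 1] n2 by simp
  qed
  have last: "?E (n - 1) \<le> B"
  proof -
    have "{t. t < n \<and> pair_label False t = pair_label False (n - 1)} = {n - 2, n - 1}"
      "{t. t < n \<and> pair_label True t = pair_label True (n - 1)} = {n - 1}"
      using n2 n by ((auto simp: pair_label_def; presburger), (auto simp: pair_label_def; presburger))
    then show ?thesis using x[of "n - 2"] n2 by simp
  qed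
  define R where "R = Suc ` {s. s + 2 < n}"
  have finR: "finite R"
    unfolding R_def by (intro finite_imageI finite_subset[of "{s. s + 2 < n}" "{..<n}"]) auto
  have notin: "n - 1 \<notin> R" "0 \<notin> insert (n - 1) R" using n2 by (auto simp: R_def)
  have "{..<n} = insert 0 (insert (n - 1) R)"
  proof (intro set_eqI iffI)
    fix s assume s: "s \<in> {..<n}"
    show "s \<in> insert 0 (insert (n - 1) R)"
    proof (cases "s = 0 \<or> s = n - 1")
      case False
      then have "s = Suc (s - 1)" "s - 1 + 2 < n" using s by auto
      then show ?thesis unfolding R_def by blast
    qed auto
  qed (use n2 in \<open>auto simp: R_def\<close>)
  then have "(\<Sum>s<n. ?E s) = (\<Sum>s\<in>insert 0 (insert (n - 1) R). ?E s)" by (rule arg_cong)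
  also have "\<dots> = ?E 0 + (\<Sum>s\<in>insert (n - 1) R. ?E s)"
    using finR notin(2) by (intro sum.insert) auto
  also have "(\<Sum>s\<in>insert (n - 1) R. ?E s) = ?E (n - 1) + (\<Sum>s\<in>R. ?E s)"
    using finR notin(1) by (intro sum.insert)
  also have "(\<Sum>s\<in>R. ?E s) = (\<Sum>s\<in>{s. s + 2 < n}. ?E (Suc s))"
    unfolding R_def by (subst sum.reindex) (auto simp: o_def)
  also have "\<dots> = (\<Sum>s\<in>{s \<in> {..<n}. s + 2 < n}. \<bar>x (s + 2) - x s\<bar>)"
    using inner by (intro sum.cong) auto
  also have "\<dots> = (\<Sum>s<n. if s + 2 < n then \<bar>x (s + 2) - x s\<bar> else 0)"
    by (rule sum.inter_filter) simp
  finally show ?thesis using first last by linarith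
qed

definition group_sum :: "nat \<Rightarrow> 'n set \<Rightarrow> (nat^'n::finite \<Rightarrow> real) \<Rightarrow> nat^'n \<Rightarrow> real" where
  "group_sum n L h i = (\<Sum>j\<in>group n L i. h j)"

text \<open>Switching a single coordinate from unshifted to shifted pairs replaces, in each pair, the
  partner of an index on one side by the partner on the other side. These differ by two steps,
  which is why variation at step two controls the difference.\<close>

lemma group_sum_switch_coordinate:
  fixes h :: "nat^'n::finite \<Rightarrow> real"
  assumes n: "even n" "0 < n" and h: "\<And>i. i \<in> idx n \<Longrightarrow> \<bar>h i\<bar> \<le> B" and l: "l \<notin> L"
  shows "(\<Sum>i\<in>idx n. \<bar>group_sum n L h i - group_sum n (insert l L) h i\<bar>)
    \<le> 2 ^ CARD('n) * (step_variation n 2 l h + 2 * B * real n ^ (CARD('n) - 1))"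
proof -
  define K where "K i = {j \<in> group n L i. j $ l = i $ l}" for i :: "nat^'n"
  define P where "P b s = {t. t < n \<and> pair_label b t = pair_label b s}" for b s
  define E where "E j = \<bar>(\<Sum>t\<in>P False (j $ l). h (vset j l t)) - (\<Sum>t\<in>P True (j $ l). h (vset j l t))\<bar>" for j
  have finP: "finite (P b s)" for b s by (rule finite_subset[of _ "{..<n}"]) (auto simp: P_def)
  have finK: "finite (K i)" for i unfolding K_def by simp
  have split: "group_sum n L' h i = (\<Sum>j\<in>K i. \<Sum>t\<in>P (l \<in> L') (i $ l). h (vset j l t))"
    if i: "i \<in> idx n" and L': "L' = L \<or> L' = insert l L" for i L'
  proof -
    have same: "m \<noteq> l \<Longrightarrow> (m \<in> L') = (m \<in> L)" for m using L' by auto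
    have "(\<Sum>j\<in>K i. \<Sum>t\<in>P (l \<in> L') (i $ l). h (vset j l t)) = (\<Sum>(j, t)\<in>K i \<times> P (l \<in> L') (i $ l). h (vset j l t))"
      using finK finP by (simp add: sum.cartesian_product)
    also have "\<dots> = (\<Sum>j\<in>group n L' i. h j)"
    proof (rule sum.reindex_bij_witness[where i = "\<lambda>j. (vset j l (i $ l), j $ l)" and j = "\<lambda>(j, t). vset j l t"])
      fix p assume "p \<in> K i \<times> P (l \<in> L') (i $ l)"
      then obtain j t where p: "p = (j, t)" "j \<in> K i" "t \<in> P (l \<in> L') (i $ l)" by auto
      show "(\<lambda>j. (vset j l (i $ l), j $ l)) ((\<lambda>(j, t). vset j l t) p) = p"
        using p by (auto simp: K_def vec_eq_iff)
      show "(\<lambda>(j, t). vset j l t) p \<in> group n L' i"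
        using p same by (auto simp: K_def P_def group_def vset_idx)
    next
      fix j assume j: "j \<in> group n L' i"
      show "(\<lambda>(j, t). vset j l t) (vset j l (i $ l), j $ l) = j" by simp
      show "(vset j l (i $ l), j $ l) \<in> K i \<times> P (l \<in> L') (i $ l)"
      proof -
        have "pair_label (m \<in> L) (j $ m) = pair_label (m \<in> L) (i $ m)" if "m \<noteq> l" for m
        proof -
          have "pair_label (m \<in> L') (j $ m) = pair_label (m \<in> L') (i $ m)"
            using j unfolding group_def by blast
          then show ?thesis unfolding same[OF that] .
        qed
        then show ?thesis using j i by (auto simp: K_def P_def group_def idx_def)
      qed
    qed auto
    finally show ?thesis by (simp add: group_sum_def)
  qed
  have "(\<Sum>i\<in>idx n. \<bar>group_sum n L h i - group_sum n (insert l L) h i\<bar>) \<le> (\<Sum>i\<in>idx n. \<Sum>j\<in>K i. E j)"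
  proof (rule sum_mono)
    fix i :: "nat^'n" assume i: "i \<in> idx n"
    have "\<bar>group_sum n L h i - group_sum n (insert l L) h i\<bar>
      = \<bar>\<Sum>j\<in>K i. (\<Sum>t\<in>P False (i $ l). h (vset j l t)) - (\<Sum>t\<in>P True (i $ l). h (vset j l t))\<bar>"
      using l by (simp add: split[OF i] sum_subtractf)
    also have "\<dots> \<le> (\<Sum>j\<in>K i. E j)"
      unfolding E_def by (rule order.trans[OF sum_abs]) (auto intro!: sum_mono simp: K_def)
    finally show "\<bar>group_sum n L h i - group_sum n (insert l L) h i\<bar> \<le> (\<Sum>j\<in>K i. E j)" .
  qed
  also have "\<dots> \<le> 2 ^ CARD('n) * (\<Sum>j\<in>idx n. E j)"
    by (rule sum_over_groups_le) (auto simp: E_def K_def)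
  also have "(\<Sum>j\<in>idx n. E j)
    \<le> (\<Sum>j\<in>idx n. (if j $ l + 2 < n then \<bar>h (j + axis l 2) - h j\<bar> else 0) + 2 * B / real n)"
  proof (rule sum_le_if_line_sums_le[OF n(2), where l = l])
    fix a :: "nat^'n" assume a: "a \<in> idx n"
    have "(\<Sum>s<n. E (vset a l s)) = (\<Sum>s<n. \<bar>(\<Sum>t\<in>P False s. h (vset a l t)) - (\<Sum>t\<in>P True s. h (vset a l t))\<bar>)"
      by (simp add: E_def)
    also have "\<dots> \<le> (\<Sum>s<n. if s + 2 < n then \<bar>h (vset a l (s + 2)) - h (vset a l s)\<bar> else 0) + 2 * B"
      unfolding P_def using a h by (intro pair_sum_difference_le n) (auto simp: vset_idx)
    also have "\<dots> = (\<Sum>s<n. (if s + 2 < n then \<bar>h (vset a l (s + 2)) - h (vset a l s)\<bar> else 0) + 2 * B / real n)"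
      using n(2) by (simp add: sum.distrib)
    finally show "(\<Sum>s<n. E (vset a l s)) \<le> (\<Sum>s<n. (if vset a l s $ l + 2 < n then
        \<bar>h (vset a l s + axis l 2) - h (vset a l s)\<bar> else 0) + 2 * B / real n)"
      by (simp add: add_axis_eq_vset cong: if_cong)
  qed
  also have "\<dots> = step_variation n 2 l h + 2 * B * real n ^ (CARD('n) - 1)"
  proof -
    have "real n ^ CARD('n) = real n ^ (CARD('n) - 1) * real n"
      by (metis One_nat_def Suc_pred mult.commute power_Suc zero_less_card_finite)
    then show ?thesis using n(2) by (simp add: sum.distrib step_variation_def card_idx)
  qed
  finally show ?thesis by simp
qed

text \<open>The coordinates are shifted one after the other.\<close>

lemma group_sum_shift_difference:
  fixes h :: "nat^'n::finite \<Rightarrow> real"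
  assumes n: "even n" "0 < n" and h: "\<And>i. i \<in> idx n \<Longrightarrow> \<bar>h i\<bar> \<le> B"
  shows "(\<Sum>i\<in>idx n. \<bar>group_sum n {} h i - group_sum n UNIV h i\<bar>)
    \<le> 2 ^ CARD('n) * (\<Sum>l\<in>UNIV. step_variation n 2 l h + 2 * B * real n ^ (CARD('n) - 1))"
proof -
  have "(\<Sum>i\<in>idx n. \<bar>group_sum n {} h i - group_sum n L h i\<bar>)
    \<le> 2 ^ CARD('n) * (\<Sum>l\<in>L. step_variation n 2 l h + 2 * B * real n ^ (CARD('n) - 1))" for L :: "'n set"
  proof (induction L rule: finite_induct[OF finite])
    case 1
    then show ?case by simp
  next
    case (2 l L)
    have "(\<Sum>i\<in>idx n. \<bar>group_sum n {} h i - group_sum n (insert l L) h i\<bar>)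
      \<le> (\<Sum>i\<in>idx n. \<bar>group_sum n {} h i - group_sum n L h i\<bar> + \<bar>group_sum n L h i - group_sum n (insert l L) h i\<bar>)"
      by (intro sum_mono) linarith
    also have "\<dots> = (\<Sum>i\<in>idx n. \<bar>group_sum n {} h i - group_sum n L h i\<bar>) +
        (\<Sum>i\<in>idx n. \<bar>group_sum n L h i - group_sum n (insert l L) h i\<bar>)" by (rule sum.distrib)
    also have "\<dots> \<le> 2 ^ CARD('n) * (\<Sum>l\<in>L. step_variation n 2 l h + 2 * B * real n ^ (CARD('n) - 1)) +
        2 ^ CARD('n) * (step_variation n 2 l h + 2 * B * real n ^ (CARD('n) - 1))"
      using 2(2) by (intro add_mono 2(3) group_sum_switch_coordinate n h)
    finally show ?case unfolding sum.insert[OF 2(1,2)] by (simp only: distrib_left add.commute)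
  qed
  then show ?thesis .
qed

text \<open>A translation by two steps maps unshifted groups to unshifted groups.\<close>

lemma step_variation_group_sum:
  fixes h :: "nat^'n::finite \<Rightarrow> real"
  assumes n: "even n"
  shows "step_variation n 2 l (group_sum n {} h) \<le> 2 ^ CARD('n) * step_variation n 2 l h"
proof -
  define E where "E j = (if j $ l + 2 < n then \<bar>h (j + axis l 2) - h j\<bar> else 0)" for j
  have "step_variation n 2 l (group_sum n {} h) \<le> (\<Sum>i\<in>idx n. \<Sum>j\<in>group n {} i. E j)"
    unfolding step_variation_def
  proof (rule sum_mono)
    fix i :: "nat^'n" assume i: "i \<in> idx n"
    show "(if i $ l + 2 < n then \<bar>group_sum n {} h (i + axis l 2) - group_sum n {} h i\<bar> else 0) \<le> (\<Sum>j\<in>group n {} i. E j)"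
    proof (cases "i $ l + 2 < n")
      case True
      have room: "j $ l + 2 < n" if "j \<in> group n {} i" for j
      proof -
        have "j $ l div 2 = i $ l div 2" using that by (simp add: group_def pair_label_def)
        moreover obtain k where k: "n = 2 * k" using n by (rule evenE)
        moreover have "i $ l div 2 + 1 < k" using True k by linarith
        ultimately show ?thesis by linarith
      qed
      have "group_sum n {} h (i + axis l 2) = (\<Sum>j\<in>group n {} i. h (j + axis l 2))"
        unfolding group_sum_def
      proof (rule sum.reindex_bij_witness[where i = "\<lambda>j. j + axis l 2" and j = "\<lambda>j. vset j l (j $ l - 2)"])
        fix j assume j: "j \<in> group n {} (i + axis l 2)"
        then have *: "j $ m div 2 = (i + axis l 2) $ m div 2" "j $ m < n" for m
          by (auto simp: group_def pair_label_def idx_def)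
        have ge: "2 \<le> j $ l" using *(1)[of l] by (auto simp: axis_nth_if)
        then show restore: "vset j l (j $ l - 2) + axis l 2 = j" by (simp add: vec_eq_iff axis_nth_if)
        have "vset j l (j $ l - 2) $ m div 2 = i $ m div 2 \<and> vset j l (j $ l - 2) $ m < n" for m
        proof (cases "m = l")
          case True
          have "(j $ l - 2 + 2) div 2 = (i $ l + 2) div 2" using *(1)[of l] ge by (simp add: axis_nth_if)
          then have "(j $ l - 2) div 2 = i $ l div 2" by simp
          then show ?thesis using True *(2)[of l] by simp
        qed (use *[of m] in \<open>simp add: axis_nth_if\<close>)
        then show "vset j l (j $ l - 2) \<in> group n {} i" by (simp add: group_def pair_label_def idx_def)
        show "h (vset j l (j $ l - 2) + axis l 2) = h j" by (simp only: restore)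
      next
        fix j assume j: "j \<in> group n {} i"
        show "vset (j + axis l 2) l ((j + axis l 2) $ l - 2) = j" by (simp add: vec_eq_iff axis_nth_if)
        show "j + axis l 2 \<in> group n {} (i + axis l 2)"
          using j room[OF j] by (auto simp: group_def pair_label_def axis_nth_if add_axis_idx)
      qed
      then have "\<bar>group_sum n {} h (i + axis l 2) - group_sum n {} h i\<bar> = \<bar>\<Sum>j\<in>group n {} i. h (j + axis l 2) - h j\<bar>"
        by (simp add: group_sum_def sum_subtractf)
      also have "\<dots> \<le> (\<Sum>j\<in>group n {} i. E j)"
        using room by (intro order.trans[OF sum_abs] sum_mono) (auto simp: E_def)
      finally show ?thesis using True by simp
    qed (auto intro!: sum_nonneg simp: E_def)
  qed
  also have "\<dots> \<le> 2 ^ CARD('n) * step_variation n 2 l h"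
    unfolding step_variation_def E_def by (rule sum_over_groups_le[where L = "{}"]) auto
  finally show ?thesis .
qed

subsection \<open>Weighted averages over groups\<close>

definition group_average :: "nat \<Rightarrow> 'n set \<Rightarrow> (nat^'n::finite \<Rightarrow> real) \<Rightarrow> (nat^'n \<Rightarrow> real) \<Rightarrow> nat^'n \<Rightarrow> real" where
  "group_average n L h r i = group_sum n L (\<lambda>j. h j * r j) i / group_sum n L h i"

text \<open>This follows from \<open>a / b - a' / b' = ((a - a') + a / b * (b' - b)) / b'\<close> and \<open>a / b \<le> 1\<close>.\<close>

lemma quotient_difference_le:
  fixes a b a' b' :: real
  assumes "0 \<le> a" "a \<le> b" "0 < b" "0 < M" "M \<le> b'"
  shows "\<bar>a / b - a' / b'\<bar> \<le> (\<bar>a - a'\<bar> + \<bar>b - b'\<bar>) / M"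
proof -
  have b': "0 < b'" using assms by linarith
  have "a / b - a' / b' = (a - a') / b' + (a / b) * (b' - b) / b'"
    using assms b' by (simp add: field_simps)
  also have "\<bar>\<dots>\<bar> \<le> \<bar>a - a'\<bar> / b' + (a / b) * \<bar>b' - b\<bar> / b'"
    using assms b' by (intro order.trans[OF abs_triangle_ineq]) (simp add: abs_mult abs_divide)
  also have "\<dots> \<le> \<bar>a - a'\<bar> / b' + 1 * \<bar>b' - b\<bar> / b'"
    using assms b' by (intro add_left_mono divide_right_mono mult_right_mono) auto
  also have "\<dots> = (\<bar>a - a'\<bar> + \<bar>b - b'\<bar>) / b'" by (simp add: add_divide_distrib abs_minus_commute)
  also have "\<dots> \<le> (\<bar>a - a'\<bar> + \<bar>b - b'\<bar>) / M" using assms by (intro divide_left_mono) auto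
  finally show ?thesis .
qed

context
  fixes n :: nat and h r :: "nat^'n::finite \<Rightarrow> real" and Ml Mu :: real
  assumes n: "even n" "0 < n" and Ml: "0 < Ml"
    and h: "\<And>i. i \<in> idx n \<Longrightarrow> Ml \<le> h i" "\<And>i. i \<in> idx n \<Longrightarrow> h i \<le> Mu"
    and r: "\<And>i. i \<in> idx n \<Longrightarrow> 0 \<le> r i" "\<And>i. i \<in> idx n \<Longrightarrow> r i \<le> 1"
begin

lemma group_sum_weight_ge: "i \<in> idx n \<Longrightarrow> Ml \<le> group_sum n L h i"
  unfolding group_sum_def using h(1) Ml
  by (intro order.trans[OF h(1) member_le_sum[of i]]) (auto simp: group_self, auto simp: group_def intro: order.trans[of 0 Ml])

lemma group_sum_product_bounds:
  "0 \<le> group_sum n L (\<lambda>j. h j * r j) i" "group_sum n L (\<lambda>j. h j * r j) i \<le> group_sum n L h i"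
proof -
  have "0 \<le> h j * r j \<and> h j * r j \<le> h j" if "j \<in> group n L i" for j
  proof -
    have "j \<in> idx n" using that by (simp add: group_def)
    then show ?thesis using h(1)[of j] r[of j] Ml by (auto intro!: mult_nonneg_nonneg mult_left_le)
  qed
  then show "0 \<le> group_sum n L (\<lambda>j. h j * r j) i" "group_sum n L (\<lambda>j. h j * r j) i \<le> group_sum n L h i"
    unfolding group_sum_def by (auto intro!: sum_nonneg sum_mono)
qed

lemma group_average_bounds:
  assumes "i \<in> idx n"
  shows "0 \<le> group_average n L h r i" "group_average n L h r i \<le> 1"
  using group_sum_product_bounds[of L i] group_sum_weight_ge[OF assms, of L] Ml
  by (auto simp: group_average_def)

lemma group_average_difference_le:
  assumes "i \<in> idx n" "i' \<in> idx n"
  shows "\<bar>group_average n L h r i - group_average n L' h r i'\<bar>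
    \<le> (\<bar>group_sum n L (\<lambda>j. h j * r j) i - group_sum n L' (\<lambda>j. h j * r j) i'\<bar> +
        \<bar>group_sum n L h i - group_sum n L' h i'\<bar>) / Ml"
  unfolding group_average_def
  using group_sum_product_bounds[of L i] group_sum_weight_ge assms Ml
  by (intro quotient_difference_le) (auto intro: less_le_trans)

lemma weighted_bound: "i \<in> idx n \<Longrightarrow> \<bar>h i * r i\<bar> \<le> Mu" "i \<in> idx n \<Longrightarrow> \<bar>h i\<bar> \<le> Mu"
proof -
  assume i: "i \<in> idx n"
  have "0 \<le> h i" "h i \<le> Mu" "0 \<le> r i" "r i \<le> 1" using i h r Ml by (auto intro: order.trans[of 0 Ml])
  then show "\<bar>h i * r i\<bar> \<le> Mu" "\<bar>h i\<bar> \<le> Mu"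
    using mult_left_le[of "r i" "h i"] by (auto simp: abs_mult)
qed

lemma weighted_step_variation:
  "step_variation n j l (\<lambda>i. h i * r i) \<le> Mu * step_variation n j l r + step_variation n j l h"
  using h r Ml by (intro step_variation_mult) (auto intro: order.trans[of 0 Ml])

lemma group_average_shift_difference:
  "(\<Sum>i\<in>idx n. \<bar>group_average n {} h r i - group_average n UNIV h r i\<bar>)
    \<le> 2 ^ CARD('n) / Ml * (\<Sum>l\<in>UNIV. Mu * step_variation n 2 l r + 2 * step_variation n 2 l h +
        4 * Mu * real n ^ (CARD('n) - 1))"
proof -
  let ?hr = "\<lambda>j. h j * r j"
  let ?N = "real n ^ (CARD('n) - 1)"
  have "(\<Sum>i\<in>idx n. \<bar>group_average n {} h r i - group_average n UNIV h r i\<bar>)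
    \<le> (\<Sum>i\<in>idx n. (\<bar>group_sum n {} ?hr i - group_sum n UNIV ?hr i\<bar> + \<bar>group_sum n {} h i - group_sum n UNIV h i\<bar>) / Ml)"
    by (intro sum_mono group_average_difference_le)
  also have "\<dots> = ((\<Sum>i\<in>idx n. \<bar>group_sum n {} ?hr i - group_sum n UNIV ?hr i\<bar>) +
      (\<Sum>i\<in>idx n. \<bar>group_sum n {} h i - group_sum n UNIV h i\<bar>)) / Ml"
    by (simp only: sum.distrib flip: sum_divide_distrib)
  also have "\<dots> \<le> (2 ^ CARD('n) * (\<Sum>l\<in>UNIV. step_variation n 2 l ?hr + 2 * Mu * ?N) +
      2 ^ CARD('n) * (\<Sum>l\<in>UNIV. step_variation n 2 l h + 2 * Mu * ?N)) / Ml"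
    using Ml weighted_bound by (intro divide_right_mono add_mono group_sum_shift_difference n) auto
  also have "\<dots> = 2 ^ CARD('n) / Ml * (\<Sum>l\<in>UNIV. step_variation n 2 l ?hr + step_variation n 2 l h + 4 * Mu * ?N)"
    by (simp add: sum.distrib field_simps)
  also have "\<dots> \<le> 2 ^ CARD('n) / Ml * (\<Sum>l\<in>UNIV. Mu * step_variation n 2 l r + 2 * step_variation n 2 l h + 4 * Mu * ?N)"
    using Ml weighted_step_variation[of 2] by (intro mult_left_mono sum_mono) (auto simp: algebra_simps)
  finally show ?thesis .
qed

lemma step_variation_group_average:
  "step_variation n 2 l (group_average n {} h r)
    \<le> 2 ^ CARD('n) / Ml * (Mu * step_variation n 2 l r + 2 * step_variation n 2 l h)"
proof -
  let ?hr = "\<lambda>j. h j * r j"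
  have "step_variation n 2 l (group_average n {} h r)
    \<le> (\<Sum>i\<in>idx n. ((if i $ l + 2 < n then \<bar>group_sum n {} ?hr (i + axis l 2) - group_sum n {} ?hr i\<bar> else 0) +
        (if i $ l + 2 < n then \<bar>group_sum n {} h (i + axis l 2) - group_sum n {} h i\<bar> else 0)) / Ml)"
    unfolding step_variation_def
    by (intro sum_mono) (auto intro!: group_average_difference_le add_axis_idx)
  also have "\<dots> = (step_variation n 2 l (group_sum n {} ?hr) + step_variation n 2 l (group_sum n {} h)) / Ml"
    by (simp only: step_variation_def sum.distrib flip: sum_divide_distrib)
  also have "\<dots> \<le> (2 ^ CARD('n) * step_variation n 2 l ?hr + 2 ^ CARD('n) * step_variation n 2 l h) / Ml"
    using Ml by (intro divide_right_mono add_mono step_variation_group_sum n) auto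
  also have "\<dots> = 2 ^ CARD('n) / Ml * (step_variation n 2 l ?hr + step_variation n 2 l h)"
    by (simp add: field_simps)
  also have "\<dots> \<le> 2 ^ CARD('n) / Ml * (Mu * step_variation n 2 l r + 2 * step_variation n 2 l h)"
    using Ml weighted_step_variation[of 2 l] by (intro mult_left_mono) auto
  finally show ?thesis .
qed

end

subsection \<open>Approximation by functions that are constant on blocks\<close>

lemma sum_lessThan_add: "(\<Sum>s<k + b. x s) = (\<Sum>s<k. x s) + (\<Sum>t<b. x (k + t))"
  for x :: "nat \<Rightarrow> real"
  by (induction b) simp_all

lemma sum_blocks:
  fixes x :: "nat \<Rightarrow> real"
  shows "(\<Sum>s<M * b. x s) = (\<Sum>\<beta><M. \<Sum>t<b. x (b * \<beta> + t))"
proof (induction M)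
  case (Suc M)
  have "(\<Sum>s<Suc M * b. x s) = (\<Sum>s<M * b + b. x s)" by (simp add: add.commute)
  also have "\<dots> = (\<Sum>s<M * b. x s) + (\<Sum>t<b. x (M * b + t))"
    by (rule sum_lessThan_add)
  finally show ?case using Suc by (simp add: mult.commute)
qed simp

text \<open>Any two values in a block differ by at most the variation within the block.\<close>

lemma block_average_approximation:
  fixes x :: "nat \<Rightarrow> real"
  assumes b: "0 < b"
  shows "(\<Sum>s<M * b. \<bar>x s - (\<Sum>t<b. x (b * (s div b) + t)) / real b\<bar>)
    \<le> real b * (\<Sum>s<M * b. if s + 1 < M * b then \<bar>x (s + 1) - x s\<bar> else 0)"
proof -
  define V where "V \<beta> = (\<Sum>u<b. if u + 1 < b then \<bar>x (b * \<beta> + u + 1) - x (b * \<beta> + u)\<bar> else 0)" for \<beta>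
  have path: "\<bar>x (b * \<beta> + u) - x (b * \<beta> + t)\<bar> \<le> V \<beta>" if "u < b" "t \<le> u" for u t \<beta>
    using that(2,1)
  proof (induction u rule: dec_induct)
    case base
    then show ?case by (auto simp: V_def intro!: sum_nonneg)
  next
    case (step u)
    have "\<bar>x (b * \<beta> + u') - x (b * \<beta> + t)\<bar> \<le> (\<Sum>v\<in>{t..<u'}. \<bar>x (b * \<beta> + v + 1) - x (b * \<beta> + v)\<bar>)"
      if "t \<le> u'" for u'
      using that by (induction u' rule: dec_induct) (auto simp: atLeastLessThanSuc)
    from this[of "Suc u"] have "\<bar>x (b * \<beta> + Suc u) - x (b * \<beta> + t)\<bar>
        \<le> (\<Sum>v\<in>{t..<Suc u}. \<bar>x (b * \<beta> + v + 1) - x (b * \<beta> + v)\<bar>)" using step by simp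
    also have "\<dots> = (\<Sum>v\<in>{t..<Suc u}. if v + 1 < b then \<bar>x (b * \<beta> + v + 1) - x (b * \<beta> + v)\<bar> else 0)"
      using step by (intro sum.cong) auto
    also have "\<dots> \<le> V \<beta>" unfolding V_def using step by (intro sum_mono2) auto
    finally show ?case .
  qed
  have osc: "\<bar>x (b * \<beta> + u) - x (b * \<beta> + t)\<bar> \<le> V \<beta>" if "u < b" "t < b" for u t \<beta>
    using path[of u t \<beta>] path[of t u \<beta>] that by (cases "t \<le> u") (auto simp: abs_minus_commute)
  have dev: "\<bar>x (b * \<beta> + u) - (\<Sum>t<b. x (b * \<beta> + t)) / real b\<bar> \<le> V \<beta>" if "u < b" for u \<beta>
  proof -
    have "x (b * \<beta> + u) - (\<Sum>t<b. x (b * \<beta> + t)) / real b = (\<Sum>t<b. x (b * \<beta> + u) - x (b * \<beta> + t)) / real b"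
      using b by (simp add: sum_subtractf field_simps)
    also have "\<bar>\<dots>\<bar> \<le> (\<Sum>t<b. V \<beta>) / real b"
      unfolding abs_divide using osc[OF that]
      by (simp only: abs_of_nat, intro divide_right_mono order.trans[OF sum_abs] sum_mono) auto
    finally show ?thesis using b by simp
  qed
  have "(\<Sum>s<M * b. \<bar>x s - (\<Sum>t<b. x (b * (s div b) + t)) / real b\<bar>)
    = (\<Sum>\<beta><M. \<Sum>u<b. \<bar>x (b * \<beta> + u) - (\<Sum>t<b. x (b * ((b * \<beta> + u) div b) + t)) / real b\<bar>)"
    by (rule sum_blocks)
  also have "\<dots> \<le> (\<Sum>\<beta><M. \<Sum>u<b. V \<beta>)"
    using dev b by (intro sum_mono) auto
  also have "\<dots> = real b * (\<Sum>\<beta><M. V \<beta>)" by (simp add: sum_distrib_left)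
  also have "(\<Sum>\<beta><M. V \<beta>) \<le> (\<Sum>\<beta><M. \<Sum>u<b. if b * \<beta> + u + 1 < M * b then \<bar>x (b * \<beta> + u + 1) - x (b * \<beta> + u)\<bar> else 0)"
  proof (unfold V_def, intro sum_mono)
    fix \<beta> u assume "\<beta> \<in> {..<M}" "u \<in> {..<b}"
    then have "\<beta> < M" by simp
    then have "b * \<beta> + b \<le> M * b" by (metis Suc_leI mult.commute mult_Suc_right add.commute mult_le_mono2)
    then show "(if u + 1 < b then \<bar>x (b * \<beta> + u + 1) - x (b * \<beta> + u)\<bar> else 0)
      \<le> (if b * \<beta> + u + 1 < M * b then \<bar>x (b * \<beta> + u + 1) - x (b * \<beta> + u)\<bar> else 0)" by auto
  qed
  also have "\<dots> = (\<Sum>s<M * b. if s + 1 < M * b then \<bar>x (s + 1) - x s\<bar> else 0)"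
    by (rule sum_blocks[symmetric])
  finally show ?thesis by (simp add: mult_left_mono)
qed

lemma block_average_sum:
  fixes x :: "nat \<Rightarrow> real"
  assumes b: "0 < b"
  shows "(\<Sum>s<M * b. (\<Sum>t<b. x (b * (s div b) + t)) / real b) = (\<Sum>s<M * b. x s)"
  unfolding sum_blocks using b by simp

text \<open>Averaging over blocks in one coordinate after the other: each average costs at most the block
  length times the variation in its own direction and does not increase the variation in the
  directions that are still to be treated.\<close>

lemma block_approximation:
  fixes v :: "nat^'n::finite \<Rightarrow> real"
  assumes b: "0 < b" and M: "0 < M" and v: "\<And>a. a \<in> idx (M * b) \<Longrightarrow> 0 \<le> v a \<and> v a \<le> 1"
  obtains w where "\<And>a. a \<in> idx (M * b) \<Longrightarrow> 0 \<le> w a \<and> w a \<le> 1"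
    "\<And>a a'. a \<in> idx (M * b) \<Longrightarrow> a' \<in> idx (M * b) \<Longrightarrow> (\<And>m. a $ m div b = a' $ m div b) \<Longrightarrow> w a = w a'"
    "(\<Sum>a\<in>idx (M * b). \<bar>v a - w a\<bar>) \<le> real b * (\<Sum>l\<in>UNIV. step_variation (M * b) 1 l v)"
proof -
  define N where "N = M * b"
  have N: "0 < N" using b M by (simp add: N_def)
  define good where "good L w \<longleftrightarrow> (\<forall>a\<in>idx N. 0 \<le> w a \<and> w a \<le> 1) \<and>
      (\<forall>a\<in>idx N. \<forall>a'\<in>idx N. (\<forall>m\<in>L. a $ m div b = a' $ m div b) \<longrightarrow> (\<forall>m. m \<notin> L \<longrightarrow> a $ m = a' $ m) \<longrightarrow> w a = w a') \<and>
      (\<Sum>a\<in>idx N. \<bar>v a - w a\<bar>) \<le> real b * (\<Sum>l\<in>L. step_variation N 1 l v) \<and>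
      (\<forall>m. m \<notin> L \<longrightarrow> step_variation N 1 m w \<le> step_variation N 1 m v)" for L :: "'n set" and w
  have "\<exists>w. good L w" for L
  proof (induction L rule: finite_induct[OF finite])
    case 1
    have "v a = v a'" if "\<forall>m. a $ m = a' $ m" for a a'
    proof -
      have "a = a'" using that by (simp add: vec_eq_iff)
      then show ?thesis by simp
    qed
    then have "good {} v" using v by (simp add: good_def N_def)
    then show ?case by blast
  next
    case (2 l L)
    obtain w where w: "good L w" using 2(3) by (rule exE)
    note c = w[unfolded good_def]
    have w01: "0 \<le> w a \<and> w a \<le> 1" if "a \<in> idx N" for a
      using conjunct1[OF c] that by (rule bspec)
    note c2 = conjunct1[OF conjunct2[OF c], rule_format]
    have wL: "w a = w a'" if "a \<in> idx N" "a' \<in> idx N" "\<And>m. m \<in> L \<Longrightarrow> a $ m div b = a' $ m div b"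
      "\<And>m. m \<notin> L \<Longrightarrow> a $ m = a' $ m" for a a'
      using that by (rule c2)
    note vw = conjunct1[OF conjunct2[OF conjunct2[OF c]]]
    note wV = conjunct2[OF conjunct2[OF conjunct2[OF c]], rule_format]
    define w' where "w' a = (\<Sum>t<b. w (vset a l (b * (a $ l div b) + t))) / real b" for a
    have in_N: "b * (s div b) + t < N" if "s < N" "t < b" for s t
    proof -
      have "s div b < M" using that(1) b by (simp add: N_def less_mult_imp_div_less)
      then have "b * (s div b) + b \<le> N"
        unfolding N_def by (metis Suc_leI mult.commute mult_Suc_right add.commute mult_le_mono2)
      then show ?thesis using that(2) by linarith
    qed
    have in_idx: "vset a l (b * (a $ l div b) + t) \<in> idx N" if "a \<in> idx N" "t < b" for a t
      using that in_N by (intro vset_idx) (auto simp: idx_def)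
    have "0 \<le> w' a \<and> w' a \<le> 1" if a: "a \<in> idx N" for a
    proof -
      have "(\<Sum>t<b. w (vset a l (b * (a $ l div b) + t))) \<le> (\<Sum>t<b. 1)"
        using w01 in_idx[OF a] by (intro sum_mono) auto
      then show ?thesis unfolding w'_def using w01 in_idx[OF a] b by (auto intro!: divide_nonneg_pos sum_nonneg)
    qed
    moreover have "w' a = w' a'"
      if a: "a \<in> idx N" "a' \<in> idx N" and m: "\<And>m. m \<in> insert l L \<Longrightarrow> a $ m div b = a' $ m div b"
        "\<And>m. m \<notin> insert l L \<Longrightarrow> a $ m = a' $ m" for a a'
    proof -
      have "w (vset a l (b * (a $ l div b) + t)) = w (vset a' l (b * (a' $ l div b) + t))" if t: "t < b" for t
        using m(1)[of l] m in_idx[OF a(1) t] in_idx[OF a(2) t] by (intro wL) auto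
      then show ?thesis by (simp add: w'_def)
    qed
    moreover have "(\<Sum>a\<in>idx N. \<bar>v a - w' a\<bar>) \<le> real b * (\<Sum>l\<in>insert l L. step_variation N 1 l v)"
    proof -
      have "(\<Sum>a\<in>idx N. \<bar>w a - w' a\<bar>)
        \<le> (\<Sum>a\<in>idx N. real b * (if a $ l + 1 < N then \<bar>w (a + axis l 1) - w a\<bar> else 0))"
      proof (rule sum_le_if_line_sums_le[OF N, where l = l])
        fix a :: "nat^'n"
        have "(\<Sum>s<N. \<bar>w (vset a l s) - w' (vset a l s)\<bar>)
            \<le> real b * (\<Sum>s<N. if s + 1 < N then \<bar>w (vset a l (s + 1)) - w (vset a l s)\<bar> else 0)"
          unfolding N_def w'_def using block_average_approximation[OF b, where x = "\<lambda>s. w (vset a l s)"] by simp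
        also have "\<dots> = (\<Sum>s<N. real b * (if s + 1 < N then \<bar>w (vset a l (s + 1)) - w (vset a l s)\<bar> else 0))"
          by (simp only: sum_distrib_left)
        finally show "(\<Sum>s<N. \<bar>w (vset a l s) - w' (vset a l s)\<bar>)
          \<le> (\<Sum>s<N. real b * (if vset a l s $ l + 1 < N then \<bar>w (vset a l s + axis l 1) - w (vset a l s)\<bar> else 0))"
          by (simp add: add_axis_eq_vset cong: if_cong)
      qed
      also have "\<dots> = real b * step_variation N 1 l w" by (simp only: step_variation_def sum_distrib_left)
      also have "\<dots> \<le> real b * step_variation N 1 l v" using wV[OF 2(2)] by (intro mult_left_mono) auto
      finally have ww': "(\<Sum>a\<in>idx N. \<bar>w a - w' a\<bar>) \<le> real b * step_variation N 1 l v" .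
      have "(\<Sum>a\<in>idx N. \<bar>v a - w' a\<bar>) \<le> (\<Sum>a\<in>idx N. \<bar>v a - w a\<bar> + \<bar>w a - w' a\<bar>)"
        by (intro sum_mono) linarith
      then show ?thesis using vw ww' 2(1,2) by (simp add: sum.distrib distrib_left)
    qed
    moreover have "step_variation N 1 m w' \<le> step_variation N 1 m v" if m: "m \<notin> insert l L" for m
    proof -
      define F where "F a = (if a $ m + 1 < N then \<bar>w (a + axis m 1) - w a\<bar> else 0)" for a
      have "step_variation N 1 m w' \<le> (\<Sum>a\<in>idx N. (\<Sum>t<b. F (vset a l (b * (a $ l div b) + t))) / real b)"
        unfolding step_variation_def
      proof (rule sum_mono)
        fix a :: "nat^'n"
        have comm: "vset (a + axis m 1) l s = vset a l s + axis m 1" for s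
          using m by (auto simp: vec_eq_iff axis_nth_if)
        have "\<bar>w' (a + axis m 1) - w' a\<bar>
          = \<bar>\<Sum>t<b. w (vset a l (b * (a $ l div b) + t) + axis m 1) - w (vset a l (b * (a $ l div b) + t))\<bar> / real b"
          using m not_sym[of m l] b unfolding w'_def comm by (simp add: axis_nth_if sum_subtractf abs_divide flip: diff_divide_distrib)
        also have "\<dots> \<le> (\<Sum>t<b. \<bar>w (vset a l (b * (a $ l div b) + t) + axis m 1) - w (vset a l (b * (a $ l div b) + t))\<bar>) / real b"
          by (intro divide_right_mono sum_abs) auto
        finally show "(if a $ m + 1 < N then \<bar>w' (a + axis m 1) - w' a\<bar> else 0)
          \<le> (\<Sum>t<b. F (vset a l (b * (a $ l div b) + t))) / real b"
          using m by (auto simp: F_def)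
      qed
      also have "\<dots> \<le> (\<Sum>a\<in>idx N. F a)"
      proof (rule sum_le_if_line_sums_le[OF N, where l = l])
        fix a :: "nat^'n"
        show "(\<Sum>s<N. (\<Sum>t<b. F (vset (vset a l s) l (b * (vset a l s $ l div b) + t))) / real b) \<le> (\<Sum>s<N. F (vset a l s))"
          unfolding N_def using block_average_sum[OF b, where x = "\<lambda>s. F (vset a l s)" and M = M] by simp
      qed
      also have "\<dots> = step_variation N 1 m w" by (simp only: F_def step_variation_def)
      also have "\<dots> \<le> step_variation N 1 m v" using wV m by simp
      finally show ?thesis .
    qed
    ultimately have "good (insert l L) w'" unfolding good_def by blast
    then show ?case by blast
  qed
  then obtain w where "good UNIV w" by blast
  note c = this[unfolded good_def N_def]
  show ?thesis
  proof (rule that[of w])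
    show "0 \<le> w a \<and> w a \<le> 1" if "a \<in> idx (M * b)" for a
      using conjunct1[OF c] that by (rule bspec)
    show "w a = w a'" if "a \<in> idx (M * b)" "a' \<in> idx (M * b)" "\<And>m. a $ m div b = a' $ m div b" for a a'
      using that by (intro conjunct1[OF conjunct2[OF c], rule_format]) auto
    show "(\<Sum>a\<in>idx (M * b). \<bar>v a - w a\<bar>) \<le> real b * (\<Sum>l\<in>UNIV. step_variation (M * b) 1 l v)"
      by (rule conjunct1[OF conjunct2[OF conjunct2[OF c]]])
  qed
qed

section \<open>Densities of bounded variation on cells\<close>

text \<open>A continuously differentiable substitute for the positive part, from which the bumps are built.\<close>

definition pos_square :: "real \<Rightarrow> real" where
  "pos_square x = (max 0 x)\<^sup>2"

lemma pos_square_deriv: "(pos_square has_real_derivative 2 * max 0 x) (at x)"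
proof -
  consider "0 < x" | "x < 0" | "x = 0" by linarith
  then show ?thesis
  proof cases
    case 1
    have "((\<lambda>x. x\<^sup>2) has_real_derivative 2 * max 0 x) (at x)"
      using 1 by (auto intro!: derivative_eq_intros)
    then show ?thesis
      by (rule has_field_derivative_transform_within_open[where S = "{0<..}"])
         (use 1 in \<open>auto simp: pos_square_def\<close>)
  next
    case 2
    have "((\<lambda>x. 0) has_real_derivative 2 * max 0 x) (at x)" using 2 by simp
    then show ?thesis
      by (rule has_field_derivative_transform_within_open[where S = "{..<0}"])
         (use 2 in \<open>auto simp: pos_square_def\<close>)
  next
    case 3
    have "((\<lambda>h. pos_square h / h) \<longlongrightarrow> 0) (at 0)"
    proof (rule Lim_null_comparison[where g = "\<lambda>h. \<bar>h\<bar>"])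
      show "((\<lambda>h. \<bar>h\<bar>) \<longlongrightarrow> (0::real)) (at 0)" using tendsto_rabs[OF tendsto_ident_at, of 0 UNIV] by simp
      have "norm (pos_square h / h) \<le> \<bar>h\<bar>" for h
        by (cases "h > 0") (auto simp: pos_square_def power2_eq_square)
      then show "\<forall>\<^sub>F h in at 0. norm (pos_square h / h) \<le> \<bar>h\<bar>" by simp
    qed
    then show ?thesis using 3 by (simp add: DERIV_def) (simp add: pos_square_def)
  qed
qed

text \<open>Continuously differentiable bumps with compact support in \<open>{0<..<w}\<close> that increase to the
  indicator of this interval as \<open>k\<close> grows.\<close>

definition bump :: "real \<Rightarrow> nat \<Rightarrow> real \<Rightarrow> real" where
  "bump w k u = 1 - pos_square (1 - real k * pos_square ((u - w / (k + 3)) * (w - w / (k + 3) - u)))"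

lemma bump_C1: "\<exists>f'. (\<forall>u. (bump w k has_real_derivative f' u) (at u)) \<and> continuous_on UNIV f'"
proof -
  let ?v = "\<lambda>u. (u - w / (k + 3)) * (w - w / (k + 3) - u)"
  let ?f' = "\<lambda>u. 2 * max 0 (1 - real k * pos_square (?v u)) * (real k * (2 * max 0 (?v u) * (w - 2 * u)))"
  have v: "(?v has_real_derivative (w - 2 * u)) (at u)" for u
    by (auto intro!: derivative_eq_intros simp: algebra_simps)
  have "(bump w k has_real_derivative ?f' u) (at u)" for u
  proof -
    have 1: "((\<lambda>u. pos_square (?v u)) has_real_derivative 2 * max 0 (?v u) * (w - 2 * u)) (at u)"
      by (rule DERIV_chain2[OF pos_square_deriv v])
    have 2: "((\<lambda>u. 1 - real k * pos_square (?v u)) has_real_derivative - (real k * (2 * max 0 (?v u) * (w - 2 * u)))) (at u)"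
      using DERIV_diff[OF DERIV_const[of 1] DERIV_cmult[OF 1, of "real k"]] by simp
    have "((\<lambda>u. 1 - pos_square (1 - real k * pos_square (?v u))) has_real_derivative
        0 - 2 * max 0 (1 - real k * pos_square (?v u)) * - (real k * (2 * max 0 (?v u) * (w - 2 * u)))) (at u)"
      by (rule DERIV_diff[OF DERIV_const DERIV_chain2[OF pos_square_deriv 2]])
    then show ?thesis by (simp add: bump_def[abs_def])
  qed
  moreover have "continuous_on UNIV pos_square"
    using pos_square_deriv by (meson DERIV_isCont continuous_at_imp_continuous_on)
  then have "continuous_on UNIV (\<lambda>u. pos_square (?v u))"
    by (rule continuous_on_compose2) (auto intro!: continuous_intros)
  then have "continuous_on UNIV ?f'" by (intro continuous_intros) auto
  ultimately show ?thesis by (intro exI[of _ ?f'] conjI allI)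
qed

lemma bump_isCont: "isCont (bump w k) u"
  using bump_C1[of w k] DERIV_isCont by blast

lemma bump_bounds: "0 \<le> bump w k u" "bump w k u \<le> 1"
proof -
  have "0 \<le> pos_square x" for x by (simp add: pos_square_def)
  then have "max 0 (1 - real k * pos_square x) \<le> 1" for x by simp
  then have "pos_square (1 - real k * pos_square x) \<le> 1" for x
    unfolding pos_square_def[of "1 - _"] by (intro power_le_one) auto
  then show "0 \<le> bump w k u" by (simp add: bump_def)
  show "bump w k u \<le> 1" by (simp add: bump_def pos_square_def)
qed

lemma bump_support:
  assumes "0 < w" "bump w k u \<noteq> 0"
  shows "w / (k + 3) < u" "u < w - w / (k + 3)"
proof -
  have "\<not> (u - w / (k + 3)) * (w - w / (k + 3) - u) \<le> 0"
  proof
    assume "(u - w / (k + 3)) * (w - w / (k + 3) - u) \<le> 0"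
    then have "bump w k u = 0" by (simp add: bump_def pos_square_def)
    then show False using assms by simp
  qed
  moreover have "w / (k + 3) \<le> w / 3" using assms(1) by (intro divide_left_mono) auto
  then have "w / (k + 3) < w - w / (k + 3)" using assms(1) by linarith
  ultimately show "w / (k + 3) < u" "u < w - w / (k + 3)"
    by (auto simp: not_le zero_less_mult_iff)
qed

lemma bump_support':
  assumes "0 < w" "bump w k u \<noteq> 0"
  shows "0 < u \<and> u < w"
proof -
  have "0 < w / (k + 3)" using assms by (simp add: add_nonneg_pos)
  then show ?thesis using bump_support[OF assms] by (intro conjI; linarith)
qed

lemma bump_tendsto:
  assumes w: "0 < w"
  shows "(\<lambda>k. bump w k u) \<longlonglongrightarrow> (if 0 < u \<and> u < w then 1 else 0)"
proof (cases "0 < u \<and> u < w")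
  case True
  have k3: "filterlim (\<lambda>k. real k + 3) at_top sequentially"
    by (rule filterlim_tendsto_add_at_top[OF tendsto_const filterlim_real_sequentially, of 3, simplified add.commute])
  have d: "(\<lambda>k. w / (real k + 3)) \<longlonglongrightarrow> 0"
    by (rule real_tendsto_divide_at_top[OF tendsto_const k3])
  have "(\<lambda>k. (u - w / (real k + 3)) * (w - w / (real k + 3) - u)) \<longlonglongrightarrow> (u - 0) * (w - 0 - u)"
    by (intro tendsto_intros d)
  moreover have "u * (w - u) / 2 < (u - 0) * (w - 0 - u)" using True by (simp add: field_simps)
  ultimately have "\<forall>\<^sub>F k in sequentially. u * (w - u) / 2 < (u - w / (real k + 3)) * (w - w / (real k + 3) - u)"
    by (rule order_tendstoD(1))
  moreover have "\<forall>\<^sub>F k in sequentially. 1 / (u * (w - u) / 2)\<^sup>2 \<le> real k"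
    using filterlim_real_sequentially by (simp add: filterlim_at_top)
  ultimately have "\<forall>\<^sub>F k in sequentially. bump w k u = 1"
  proof eventually_elim
    case (elim k)
    have p: "0 < u * (w - u) / 2" using True by simp
    have "(u * (w - u) / 2)\<^sup>2 \<le> pos_square ((u - w / (real k + 3)) * (w - w / (real k + 3) - u))"
      unfolding pos_square_def using elim(1) p by (intro power_mono; linarith)
    then have "real k * (u * (w - u) / 2)\<^sup>2 \<le> real k * pos_square ((u - w / (real k + 3)) * (w - w / (real k + 3) - u))"
      by (intro mult_left_mono) auto
    moreover have "1 \<le> real k * (u * (w - u) / 2)\<^sup>2" using elim(2) p
      by (subst (asm) pos_divide_le_eq) (simp_all only: zero_less_power)
    ultimately have "1 - real k * pos_square ((u - w / (real k + 3)) * (w - w / (real k + 3) - u)) \<le> 0" by linarith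
    then show ?case by (simp add: bump_def pos_square_def[of "1 - _"])
  qed
  then show ?thesis using True by (simp add: tendsto_eventually)
next
  case False
  then have "bump w k u = 0" for k using bump_support'[OF w] by blast
  moreover have e: "(if 0 < u \<and> u < w then 1 else 0) = (0::real)" using False by simp
  ultimately show ?thesis unfolding e by simp
qed

text \<open>The moving average of a bump: its derivative is the difference of two bumps at distance
  \<open>2 * w\<close>, which is what makes the variation at step two appear.\<close>

lemma bump_moving_average:
  assumes w: "0 < w"
  obtains B where "\<And>u. (B has_real_derivative (bump w k u - bump w k (u - 2 * w))) (at u)"
    "\<And>u. \<bar>B u\<bar> \<le> 2 * w" "\<And>u. B u \<noteq> 0 \<Longrightarrow> w / (k + 3) < u \<and> u < 3 * w - w / (k + 3)"
proof -
  obtain F where F: "\<And>u. (F has_real_derivative bump w k u) (at u)"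
    using einterval_antiderivative[of "-\<infinity>" \<infinity> "bump w k"] bump_isCont
    by (auto simp: has_real_derivative_iff_has_vector_derivative)
  define B where "B u = F u - F (u - 2 * w)" for u
  have mvt: "\<exists>\<xi>. u - 2 * w < \<xi> \<and> \<xi> < u \<and> B u = 2 * w * bump w k \<xi>" for u
  proof -
    have "\<exists>\<xi>. \<xi> > u - 2 * w \<and> \<xi> < u \<and> F u - F (u - 2 * w) = (u - (u - 2 * w)) * bump w k \<xi>"
      using w F by (intro MVT2) auto
    then show ?thesis by (auto simp: B_def)
  qed
  show ?thesis
  proof (rule that)
    fix u
    have "((\<lambda>u. F (u - 2 * w)) has_real_derivative bump w k (u - 2 * w) * 1) (at u)"
      by (rule DERIV_chain2[OF F]) (auto intro!: derivative_eq_intros)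
    then show "(B has_real_derivative (bump w k u - bump w k (u - 2 * w))) (at u)"
      unfolding B_def[abs_def] using DERIV_diff[OF F] by fastforce
    obtain \<xi> where \<xi>: "u - 2 * w < \<xi>" "\<xi> < u" "B u = 2 * w * bump w k \<xi>" using mvt by blast
    then show "\<bar>B u\<bar> \<le> 2 * w" using bump_bounds[of w k \<xi>] w by (simp add: abs_mult mult_left_le)
    show "w / (k + 3) < u \<and> u < 3 * w - w / (k + 3)" if "B u \<noteq> 0"
      using bump_support[OF w, of k \<xi>] \<xi> that by auto
  qed
qed

lemma C1_with_deriv_scaleR_sum:
  assumes "\<And>i. i \<in> I \<Longrightarrow> C1_with_deriv U (f i) (f' i)"
  shows "C1_with_deriv U (\<lambda>x. \<Sum>i\<in>I. s i *\<^sub>R f i x) (\<lambda>x. \<Sum>i\<in>I. s i *\<^sub>R f' i x)"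
  unfolding C1_with_deriv_def
proof (intro conjI ballI)
  fix z assume z: "z \<in> U"
  have "blinfun_apply (\<Sum>i\<in>I. s i *\<^sub>R f' i z) = (\<lambda>v. \<Sum>i\<in>I. s i *\<^sub>R blinfun_apply (f' i z) v)"
    by (rule ext) (simp add: blinfun.sum_left blinfun.scaleR_left)
  then show "((\<lambda>x. \<Sum>i\<in>I. s i *\<^sub>R f i x) has_derivative blinfun_apply (\<Sum>i\<in>I. s i *\<^sub>R f' i z)) (at z)"
    using assms z
    by (simp only:) (intro has_derivative_sum has_derivative_scaleR_right, auto simp: C1_with_deriv_def)
qed (use assms in \<open>auto simp: C1_with_deriv_def intro!: continuous_intros\<close>)

text \<open>The divergence of a field that points in one coordinate direction only involves the derivative of
  the factor belonging to this direction.\<close>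

lemma C1_product_field:
  fixes \<psi> \<psi>' :: "'n::finite \<Rightarrow> real \<Rightarrow> real"
  assumes d: "\<And>m s. (\<psi> m has_real_derivative \<psi>' m s) (at s)" and c: "\<And>m. continuous_on UNIV (\<psi>' m)"
  shows "\<exists>\<phi>'. C1_with_deriv UNIV (\<lambda>x :: real^'n. (\<Prod>m\<in>UNIV. \<psi> m (x $ m)) *\<^sub>R axis l (1::real)) \<phi>' \<and>
    (\<forall>x. (\<Sum>l'\<in>UNIV. blinfun_apply (\<phi>' x) (axis l' 1) $ l') = \<psi>' l (x $ l) * (\<Prod>m\<in>UNIV - {l}. \<psi> m (x $ m)))"
proof -
  define E :: "'n \<Rightarrow> (real^'n) \<Rightarrow>\<^sub>L (real^'n)" where "E m = Blinfun (\<lambda>v. (v $ m) *\<^sub>R axis l (1::real))" for m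
  have E: "blinfun_apply (E m) v = (v $ m) *\<^sub>R axis l (1::real)" for m v
    unfolding E_def
    by (subst bounded_linear_Blinfun_apply) (auto intro!: bounded_linear_scaleR_const bounded_linear_vec_nth)
  define q where "q m x = \<psi>' m (x $ m) * (\<Prod>j\<in>UNIV - {m}. \<psi> j (x $ j))" for m and x :: "real^'n"
  define \<phi>' where "\<phi>' x = (\<Sum>m\<in>UNIV. q m x *\<^sub>R E m)" for x
  have cont_nth: "continuous_on UNIV (\<lambda>x :: real^'n. f (x $ m))" if "continuous_on UNIV f" for f :: "real \<Rightarrow> real" and m
    using that by (rule continuous_on_compose2) (auto intro!: continuous_intros)
  have c\<psi>: "continuous_on UNIV (\<psi> m)" for m
    using d by (meson DERIV_isCont continuous_at_imp_continuous_on)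
  show ?thesis
  proof (intro exI[of _ \<phi>'] conjI allI)
    have "((\<lambda>x :: real^'n. (\<Prod>m\<in>UNIV. \<psi> m (x $ m)) *\<^sub>R axis l (1::real)) has_derivative blinfun_apply (\<phi>' x)) (at x)" for x
    proof -
      have 1: "((\<lambda>x :: real^'n. \<psi> m (x $ m)) has_derivative (\<lambda>v. \<psi>' m (x $ m) * (v $ m))) (at x)" for m
        using has_derivative_compose[OF bounded_linear_imp_has_derivative[OF bounded_linear_vec_nth]
            d[of m "x $ m", unfolded has_field_derivative_def]] by simp
      have "((\<lambda>x :: real^'n. \<Prod>m\<in>UNIV. \<psi> m (x $ m)) has_derivative
          (\<lambda>v. \<Sum>m\<in>UNIV. \<psi>' m (x $ m) * (v $ m) * (\<Prod>j\<in>UNIV - {m}. \<psi> j (x $ j)))) (at x)"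
        by (rule has_derivative_prod[OF 1])
      from has_derivative_scaleR_left[OF this, of "axis l 1"]
      have "((\<lambda>x :: real^'n. (\<Prod>m\<in>UNIV. \<psi> m (x $ m)) *\<^sub>R axis l (1::real)) has_derivative
          (\<lambda>v. (\<Sum>m\<in>UNIV. \<psi>' m (x $ m) * (v $ m) * (\<Prod>j\<in>UNIV - {m}. \<psi> j (x $ j))) *\<^sub>R axis l 1)) (at x)" .
      also have "(\<lambda>v. (\<Sum>m\<in>UNIV. \<psi>' m (x $ m) * (v $ m) * (\<Prod>j\<in>UNIV - {m}. \<psi> j (x $ j))) *\<^sub>R axis l 1)
          = blinfun_apply (\<phi>' x)"
        by (rule ext) (simp add: \<phi>'_def q_def E blinfun.sum_left blinfun.scaleR_left scaleR_sum_left mult_ac)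
      finally show ?thesis .
    qed
    moreover have "continuous_on UNIV \<phi>'"
      unfolding \<phi>'_def q_def
      by (intro continuous_on_sum continuous_on_scaleR continuous_on_mult continuous_on_prod continuous_on_const cont_nth c c\<psi>)
    ultimately show "C1_with_deriv UNIV (\<lambda>x :: real^'n. (\<Prod>m\<in>UNIV. \<psi> m (x $ m)) *\<^sub>R axis l (1::real)) \<phi>'"
      by (simp add: C1_with_deriv_def)
    fix x :: "real^'n"
    have "(\<Sum>l'\<in>UNIV. blinfun_apply (\<phi>' x) (axis l' 1) $ l')
      = (\<Sum>l'\<in>UNIV. \<Sum>m\<in>UNIV. q m x * ((axis l' 1 :: real^'n) $ m * (axis l 1 :: real^'n) $ l'))"
      by (simp add: \<phi>'_def E blinfun.sum_left blinfun.scaleR_left mult.assoc)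
    also have "\<dots> = (\<Sum>l'\<in>UNIV. \<Sum>m\<in>UNIV. if m = l' then (if l' = l then q l x else 0) else 0)"
      by (intro sum.cong) (auto simp: axis_nth_if)
    also have "\<dots> = q l x" by simp
    finally show "(\<Sum>l'\<in>UNIV. blinfun_apply (\<phi>' x) (axis l' 1) $ l') = \<psi>' l (x $ l) * (\<Prod>m\<in>UNIV - {l}. \<psi> m (x $ m))"
      by (simp add: q_def)
  qed
qed

text \<open>The moving averages of the bumps live on intervals of three cell widths, so at most three of them
  overlap in each direction.\<close>

lemma card_nats_in_interval_le_3:
  "finite {s :: nat. a < real s \<and> real s < a + 3}" "card {s :: nat. a < real s \<and> real s < a + 3} \<le> 3"
proof -
  let ?k = "nat (\<lfloor>a\<rfloor> + 1)"
  have sub: "{s :: nat. a < real s \<and> real s < a + 3} \<subseteq> {?k..?k + 2}"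
  proof
    fix s :: nat assume "s \<in> {s. a < real s \<and> real s < a + 3}"
    then have "\<lfloor>a\<rfloor> < int s" "int s < \<lfloor>a\<rfloor> + 4" by (auto, linarith+)
    then show "s \<in> {?k..?k + 2}" by auto
  qed
  then show "finite {s :: nat. a < real s \<and> real s < a + 3}" by (rule finite_subset) simp
  show "card {s :: nat. a < real s \<and> real s < a + 3} \<le> 3" using card_mono[OF _ sub] by simp
qed

definition cell_bump :: "nat \<Rightarrow> nat \<Rightarrow> nat^'n::finite \<Rightarrow> real^'n \<Rightarrow> real" where
  "cell_bump n k i x = (\<Prod>m\<in>UNIV. bump (1 / real n) k (x $ m - real (i $ m) / real n))"

lemma interior_unit_cube: "interior (unit_cube :: (real^'n::finite) set) = {x. \<forall>m. 0 < x $ m \<and> x $ m < 1}"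
  by (auto simp: unit_cube_def interior_cbox mem_box_cart)

text \<open>The test field behind the estimate for one direction and one choice of signs. In direction
  \<open>l\<close> its factors are moving averages, in the other directions bumps. At each point at most
  \<open>3 ^ CARD('n)\<close> of the summands are nonzero, and each is at most \<open>2 / n\<close>.\<close>

lemma signed_bump_differences_le_total_variation:
  fixes g :: "real^'n::finite \<Rightarrow> real" and \<sigma> :: "nat^'n \<Rightarrow> real" and l :: 'n
  assumes n: "0 < n" and \<sigma>: "\<And>i. \<bar>\<sigma> i\<bar> \<le> 1"
    and V: "total_variation (interior unit_cube) g \<le> ereal V"
  defines "I \<equiv> {i \<in> idx n. i $ l + 2 < n}"
  shows "(LINT x:interior unit_cube|lborel. g x *
      (\<Sum>i\<in>I. \<sigma> i * (cell_bump n k i x - cell_bump n k (i + axis l 2) x))) \<le> 2 * 3 ^ CARD('n) * V / real n"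
proof -
  define w where "w = 1 / real n"
  have w: "0 < w" using n by (simp add: w_def)
  obtain B where B: "\<And>u. (B has_real_derivative (bump w k u - bump w k (u - 2 * w))) (at u)"
    "\<And>u. \<bar>B u\<bar> \<le> 2 * w" "\<And>u. B u \<noteq> 0 \<Longrightarrow> w / (k + 3) < u \<and> u < 3 * w - w / (k + 3)"
    using bump_moving_average[OF w] by blast
  obtain b' where b': "\<And>u. (bump w k has_real_derivative b' u) (at u)" "continuous_on UNIV b'"
    using bump_C1 by blast
  define \<psi> where "\<psi> i m s = (if m = l then B (s - i $ m * w) else bump w k (s - i $ m * w))" for i :: "nat^'n" and m s
  define \<psi>' where "\<psi>' i m s = (if m = l then bump w k (s - i $ m * w) - bump w k (s - i $ m * w - 2 * w) else b' (s - i $ m * w))"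
    for i :: "nat^'n" and m s
  have "\<exists>\<phi>'. C1_with_deriv UNIV (\<lambda>x :: real^'n. (\<Prod>m\<in>UNIV. \<psi> i m (x $ m)) *\<^sub>R axis l (1::real)) \<phi>' \<and>
    (\<forall>x. (\<Sum>l'\<in>UNIV. blinfun_apply (\<phi>' x) (axis l' 1) $ l') = \<psi>' i l (x $ l) * (\<Prod>m\<in>UNIV - {l}. \<psi> i m (x $ m)))" for i
  proof -
    have sh: "((\<lambda>s. s - i $ m * w) has_real_derivative 1) (at s)" for m s
      by (auto intro!: derivative_eq_intros)
    have der: "(\<psi> i m has_real_derivative \<psi>' i m s) (at s)" for m s
      using DERIV_chain2[OF B(1) sh] DERIV_chain2[OF b'(1) sh]
      by (cases "m = l") (simp_all add: \<psi>_def[abs_def] \<psi>'_def)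
    have cb: "continuous_on UNIV (bump w k)" using bump_isCont by (simp add: continuous_at_imp_continuous_on)
    have "continuous_on UNIV (\<psi>' i m)" for m
      unfolding \<psi>'_def[abs_def]
      by (cases "m = l") (auto intro!: continuous_intros continuous_on_compose2[OF cb] continuous_on_compose2[OF b'(2)])
    with der show ?thesis by (rule C1_product_field)
  qed
  then have "\<exists>\<Phi>. \<forall>i. C1_with_deriv UNIV (\<lambda>x :: real^'n. (\<Prod>m\<in>UNIV. \<psi> i m (x $ m)) *\<^sub>R axis l (1::real)) (\<Phi> i) \<and>
    (\<forall>x. (\<Sum>l'\<in>UNIV. blinfun_apply (\<Phi> i x) (axis l' 1) $ l') = \<psi>' i l (x $ l) * (\<Prod>m\<in>UNIV - {l}. \<psi> i m (x $ m)))"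
    by (intro choice allI)
  then obtain \<Phi> where "\<forall>i. C1_with_deriv UNIV (\<lambda>x :: real^'n. (\<Prod>m\<in>UNIV. \<psi> i m (x $ m)) *\<^sub>R axis l (1::real)) (\<Phi> i) \<and>
    (\<forall>x. (\<Sum>l'\<in>UNIV. blinfun_apply (\<Phi> i x) (axis l' 1) $ l') = \<psi>' i l (x $ l) * (\<Prod>m\<in>UNIV - {l}. \<psi> i m (x $ m)))"
    by (rule exE)
  then have \<Phi>: "C1_with_deriv UNIV (\<lambda>x :: real^'n. (\<Prod>m\<in>UNIV. \<psi> i m (x $ m)) *\<^sub>R axis l (1::real)) (\<Phi> i)"
    "(\<Sum>l'\<in>UNIV. blinfun_apply (\<Phi> i x) (axis l' 1) $ l') = \<psi>' i l (x $ l) * (\<Prod>m\<in>UNIV - {l}. \<psi> i m (x $ m))" for i x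
    by simp_all
  have div: "(\<Sum>l'\<in>UNIV. blinfun_apply (\<Phi> i x) (axis l' 1) $ l') = cell_bump n k i x - cell_bump n k (i + axis l 2) x" for i x
  proof -
    have P: "(\<Prod>m\<in>UNIV. f m) = f l * (\<Prod>m\<in>UNIV - {l}. f m)" for f :: "'n \<Rightarrow> real"
      by (simp add: prod.remove[of UNIV l])
    have a: "x $ l - real ((i + axis l 2) $ l) * w = x $ l - i $ l * w - 2 * w"
      by (simp add: axis_nth_if algebra_simps)
    have b: "(\<Prod>m\<in>UNIV - {l}. \<psi> i m (x $ m)) = (\<Prod>m\<in>UNIV - {l}. bump w k (x $ m - i $ m * w))"
      by (intro prod.cong) (auto simp: \<psi>_def)
    have cb: "cell_bump n k j x = bump w k (x $ l - j $ l * w) * (\<Prod>m\<in>UNIV - {l}. bump w k (x $ m - j $ m * w))" for j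
      unfolding cell_bump_def P by (simp add: w_def)
    have "(\<Prod>m\<in>UNIV - {l}. bump w k (x $ m - (i + axis l 2) $ m * w)) = (\<Prod>m\<in>UNIV - {l}. bump w k (x $ m - i $ m * w))"
      by (intro prod.cong) (auto simp: axis_nth_if)
    then show ?thesis unfolding \<Phi>(2) cb a b by (simp add: \<psi>'_def algebra_simps)
  qed
  define c where "c = 1 / (2 * 3 ^ CARD('n) * w)"
  have c: "0 < c" using w by (simp add: c_def)
  define \<phi> where "\<phi> x = (\<Sum>i\<in>I. (c * \<sigma> i) *\<^sub>R ((\<Prod>m\<in>UNIV. \<psi> i m (x $ m)) *\<^sub>R axis l (1::real)))" for x :: "real^'n"
  define \<phi>' where "\<phi>' x = (\<Sum>i\<in>I. (c * \<sigma> i) *\<^sub>R \<Phi> i x)" for x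
  have finI: "finite I" unfolding I_def by simp
  have C1: "C1_with_deriv UNIV \<phi> \<phi>'"
    unfolding \<phi>_def[abs_def] \<phi>'_def[abs_def] by (rule C1_with_deriv_scaleR_sum[OF \<Phi>(1)])
  have supp_\<psi>: "w / (k + 3) < s - i $ m * w \<and> s - i $ m * w < (if m = l then 3 * w else w) - w / (k + 3)"
    if "\<psi> i m s \<noteq> 0" for i m s
    using that B(3)[of "s - i $ m * w"] bump_support[OF w, of k "s - i $ m * w"] by (auto simp: \<psi>_def split: if_splits)
  have wk: "0 < w / (k + 3)" using w by (simp add: add_nonneg_pos)
  have norm1: "norm (\<phi> x) \<le> 1" for x
  proof -
    define G where "G m = {s :: nat. x $ m / w - 3 < real s \<and> real s < x $ m / w - 3 + 3}" for m
    define T where "T i = (\<Prod>m\<in>UNIV. \<psi> i m (x $ m))" for i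
    have G: "finite (G m)" "card (G m) \<le> 3" for m
      unfolding G_def using card_nats_in_interval_le_3 by blast+
    have Tsupp: "i \<in> {i. \<forall>m. i $ m \<in> G m}" if "T i \<noteq> 0" for i
    proof -
      have "i $ m \<in> G m" for m
      proof -
        have "\<psi> i m (x $ m) \<noteq> 0" using that by (simp add: T_def)
        moreover have "(if m = l then 3 * w else w) \<le> 3 * w" using w by simp
        ultimately have "0 < x $ m - i $ m * w" "x $ m - i $ m * w < 3 * w"
          using wk supp_\<psi>[of i m "x $ m"] by linarith+
        then show ?thesis using w by (auto simp: G_def field_simps)
      qed
      then show ?thesis by simp
    qed
    have Tb: "\<bar>T i\<bar> \<le> 2 * w" for i
    proof -
      have "\<bar>T i\<bar> = \<bar>\<psi> i l (x $ l)\<bar> * (\<Prod>m\<in>UNIV - {l}. \<bar>\<psi> i m (x $ m)\<bar>)"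
        by (simp add: T_def prod.remove[of UNIV l] abs_mult abs_prod)
      also have "\<dots> \<le> 2 * w * 1"
        using B(2) bump_bounds[of w k] w
        by (intro mult_mono prod_le_1 prod_nonneg) (auto simp: \<psi>_def)
      finally show ?thesis by simp
    qed
    have "\<bar>\<Sum>i\<in>I. \<sigma> i * T i\<bar> \<le> (\<Sum>i\<in>I. \<bar>T i\<bar>)"
      using \<sigma> by (intro order.trans[OF sum_abs] sum_mono) (auto simp: abs_mult mult_left_le_one_le)
    also have "\<dots> = (\<Sum>i\<in>I \<inter> {i. \<forall>m. i $ m \<in> G m}. \<bar>T i\<bar>)"
    proof (rule sum.mono_neutral_right[OF finI Int_lower1], rule ballI)
      fix i assume "i \<in> I - I \<inter> {i. \<forall>m. i $ m \<in> G m}"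
      then have "T i = 0" using Tsupp[of i] by blast
      then show "\<bar>T i\<bar> = 0" by simp
    qed
    also have "\<dots> \<le> (\<Sum>i\<in>I \<inter> {i. \<forall>m. i $ m \<in> G m}. 2 * w)" by (intro sum_mono Tb)
    also have "\<dots> \<le> 3 ^ CARD('n) * (2 * w)"
    proof -
      have "card (I \<inter> {i. \<forall>m. i $ m \<in> G m}) \<le> card {i :: nat^'n. \<forall>m. i $ m \<in> G m}"
        using card_vec_box(1)[of G] G by (intro card_mono) auto
      also have "\<dots> \<le> (\<Prod>m\<in>(UNIV :: 'n set). 3)"
        unfolding card_vec_box(2)[of G, OF G(1)] using G(2) by (intro prod_mono) auto
      finally have "card (I \<inter> {i. \<forall>m. i $ m \<in> G m}) \<le> 3 ^ CARD('n)" by simp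
      then have "real (card (I \<inter> {i. \<forall>m. i $ m \<in> G m})) \<le> real (3 ^ CARD('n))"
        by (simp only: of_nat_le_iff)
      then have "real (card (I \<inter> {i. \<forall>m. i $ m \<in> G m})) * (2 * w) \<le> real (3 ^ CARD('n)) * (2 * w)"
        using w by (intro mult_right_mono) auto
      then show ?thesis by simp
    qed
    finally have "\<bar>\<Sum>i\<in>I. \<sigma> i * T i\<bar> \<le> 2 * 3 ^ CARD('n) * w" by simp
    then have "c * \<bar>\<Sum>i\<in>I. \<sigma> i * T i\<bar> \<le> c * (2 * 3 ^ CARD('n) * w)" using c by (intro mult_left_mono) auto
    also have "\<dots> = 1" using w by (simp add: c_def)
    finally have "c * \<bar>\<Sum>i\<in>I. \<sigma> i * T i\<bar> \<le> 1" .
    moreover have "\<phi> x = (c * (\<Sum>i\<in>I. \<sigma> i * T i)) *\<^sub>R axis l 1"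
      by (simp add: \<phi>_def T_def scaleR_sum_left sum_distrib_left mult_ac)
    ultimately show ?thesis using c by (simp add: abs_mult norm_axis_1)
  qed
  define K :: "(real^'n) set" where "K = cbox (\<chi> m. w / (k + 3)) (\<chi> m. 1 - w / (k + 3))"
  have "{x. \<phi> x \<noteq> 0} \<subseteq> K"
  proof
    fix x assume "x \<in> {x. \<phi> x \<noteq> 0}"
    then obtain i where i: "i \<in> I" "(c * \<sigma> i) *\<^sub>R ((\<Prod>m\<in>UNIV. \<psi> i m (x $ m)) *\<^sub>R axis l (1::real)) \<noteq> 0"
      unfolding \<phi>_def mem_Collect_eq by (rule sum.not_neutral_contains_not_neutral)
    have "w / (k + 3) \<le> x $ m \<and> x $ m \<le> 1 - w / (k + 3)" for m
    proof -
      have *: "w / (k + 3) < x $ m - i $ m * w" "x $ m - i $ m * w < (if m = l then 3 * w else w) - w / (k + 3)"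
        using supp_\<psi>[of i m "x $ m"] i(2) by auto
      have "i $ m + (if m = l then 3 else 1) \<le> n" using i(1) by (auto simp: I_def idx_def Suc_le_eq)
      then have "real (i $ m + (if m = l then 3 else 1)) * w \<le> real n * w" using w by (intro mult_right_mono) auto
      then have "i $ m * w + (if m = l then 3 * w else w) \<le> 1" using n by (auto simp: w_def algebra_simps split: if_splits)
      moreover have "0 \<le> i $ m * w" using w by simp
      ultimately show ?thesis using * by linarith
    qed
    then show "x \<in> K" by (simp add: K_def mem_box_cart)
  qed
  moreover have "compact K" "closed K" unfolding K_def by (simp_all add: closed_cbox)
  ultimately have clK: "closure {x. \<phi> x \<noteq> 0} \<subseteq> K" by (simp add: closure_minimal)
  moreover have "K \<subseteq> interior unit_cube"
  proof
    fix x assume "x \<in> K"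
    then have in_K: "w / (k + 3) \<le> x $ m \<and> x $ m \<le> 1 - w / (k + 3)" for m by (simp add: K_def mem_box_cart)
    have "0 < x $ m \<and> x $ m < 1" for m using in_K[of m] wk by (intro conjI; linarith)
    then show "x \<in> interior unit_cube" by (simp add: interior_unit_cube)
  qed
  moreover have "compact (closure {x. \<phi> x \<noteq> 0})"
    using bounded_subset[OF compact_imp_bounded[OF \<open>compact K\<close>] clK] by (simp add: compact_eq_bounded_closed)
  ultimately have mem: "(\<phi>, \<phi>') \<in> {(\<phi>, \<phi>'). C1_with_deriv UNIV \<phi> \<phi>' \<and>
      compact (closure {x. \<phi> x \<noteq> 0}) \<and> closure {x. \<phi> x \<noteq> 0} \<subseteq> interior unit_cube \<and> (\<forall>x. norm (\<phi> x) \<le> 1)}"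
    using C1 norm1 by auto
  have "ereal (LINT x:interior unit_cube|lborel. g x * (\<Sum>l\<in>UNIV. blinfun_apply (\<phi>' x) (axis l 1) $ l)) \<le> ereal V"
    by (rule order.trans[OF SUP_upper[OF mem, of "\<lambda>(\<phi>, \<phi>'). ereal (LINT x:interior unit_cube|lborel.
        g x * (\<Sum>l\<in>UNIV. blinfun_apply (\<phi>' x) (axis l 1) $ l))", unfolded prod.case] V[unfolded total_variation_def]])
  then have "(LINT x:interior unit_cube|lborel. g x * (\<Sum>l\<in>UNIV. blinfun_apply (\<phi>' x) (axis l 1) $ l)) \<le> V" by simp
  moreover have "(\<Sum>l'\<in>UNIV. blinfun_apply (\<phi>' x) (axis l' 1) $ l')
      = c * (\<Sum>i\<in>I. \<sigma> i * (cell_bump n k i x - cell_bump n k (i + axis l 2) x))" for x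
  proof -
    have "(\<Sum>l'\<in>UNIV. blinfun_apply (\<phi>' x) (axis l' 1) $ l')
      = (\<Sum>i\<in>I. (c * \<sigma> i) * (\<Sum>l'\<in>UNIV. blinfun_apply (\<Phi> i x) (axis l' 1) $ l'))"
      unfolding \<phi>'_def blinfun.sum_left blinfun.scaleR_left sum_component vector_scaleR_component sum_distrib_left real_scaleR_def
      by (rule sum.swap)
    then show ?thesis by (simp add: div sum_distrib_left mult_ac)
  qed
  ultimately have "c * (LINT x:interior unit_cube|lborel. g x *
      (\<Sum>i\<in>I. \<sigma> i * (cell_bump n k i x - cell_bump n k (i + axis l 2) x))) \<le> V"
    by (simp add: mult.left_commute[of _ c])
  then show ?thesis using c n by (simp add: c_def w_def field_simps)
qed

lemma frontier_cell_null: "frontier (cell n i) \<in> null_sets lborel"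
proof -
  let ?a = "\<chi> l. real (i $ l) / real n" and ?b = "\<chi> l. (real (i $ l) + 1) / real n"
  have "emeasure lborel (cbox ?a ?b - box ?a ?b) = emeasure lborel (cbox ?a ?b) - emeasure lborel (box ?a ?b)"
    by (intro emeasure_Diff box_subset_cbox) (auto simp: emeasure_lborel_box_eq)
  also have "\<dots> = 0" by (simp add: emeasure_lborel_box_eq emeasure_lborel_cbox_eq)
  finally show ?thesis by (simp add: cell_def frontier_cbox null_sets_def)
qed

lemma interior_cell: "interior (cell n i) = {x. \<forall>m. real (i $ m) / n < x $ m \<and> x $ m < (real (i $ m) + 1) / n}"
  by (auto simp: cell_def interior_cbox mem_box_cart)

lemma mem_cell: "x \<in> cell n i \<longleftrightarrow> (\<forall>m. real (i $ m) / n \<le> x $ m \<and> x $ m \<le> (real (i $ m) + 1) / n)"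
  by (auto simp: cell_def mem_box_cart)

lemma closed_cell: "closed (cell n i)"
  unfolding cell_def by (rule closed_cbox)

lemma borel_cell: "cell n i \<in> sets borel"
  using closed_cell by (rule borel_closed)

lemma mem_unit_cube: "x \<in> unit_cube \<longleftrightarrow> (\<forall>m. 0 \<le> x $ m \<and> x $ m \<le> 1)"
  by (auto simp: unit_cube_def mem_box_cart)

lemma index_scale_bounds:
  assumes "i \<in> idx n"
  shows "0 \<le> real (i $ m) / n" "(real (i $ m) + 1) / n \<le> 1"
proof -
  have "i $ m < n" using assms by (simp add: idx_def)
  then show "0 \<le> real (i $ m) / n" "(real (i $ m) + 1) / n \<le> 1" by (auto simp: divide_le_eq)
qed

lemma cell_subset_unit_cube:
  assumes "i \<in> idx n"
  shows "cell n i \<subseteq> unit_cube"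
  unfolding subset_iff mem_cell mem_unit_cube
  using index_scale_bounds[OF assms] by (meson order.trans)

lemma interior_cell_subset: "i \<in> idx n \<Longrightarrow> interior (cell n i) \<subseteq> interior unit_cube"
  by (intro interior_mono cell_subset_unit_cube)

lemma cell_bump_tendsto:
  assumes n: "0 < n"
  shows "(\<lambda>k. cell_bump n k i x) \<longlonglongrightarrow> indicator (interior (cell n i)) x"
proof -
  have "(\<lambda>k. cell_bump n k i x) \<longlonglongrightarrow> (\<Prod>m\<in>UNIV. if 0 < x $ m - real (i $ m) / n \<and> x $ m - real (i $ m) / n < 1 / n then 1 else 0)"
    unfolding cell_bump_def using n by (intro tendsto_prod bump_tendsto) auto
  also have "(\<Prod>m\<in>UNIV. if 0 < x $ m - real (i $ m) / n \<and> x $ m - real (i $ m) / n < 1 / n then 1 else 0)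
      = (indicator (interior (cell n i)) x :: real)"
  proof -
    have "(0 < x $ m - real (i $ m) / n \<and> x $ m - real (i $ m) / n < 1 / n) =
      (real (i $ m) / n < x $ m \<and> x $ m < (real (i $ m) + 1) / n)" for m
      by (auto simp: add_divide_distrib)
    then show ?thesis by (auto simp: interior_cell indicator_def)
  qed
  finally show ?thesis .
qed

lemma cell_bump_bounds: "0 \<le> cell_bump n k i x" "cell_bump n k i x \<le> 1"
  unfolding cell_bump_def using bump_bounds by (auto intro!: prod_nonneg prod_le_1)

lemma cell_bump_measurable [measurable]:
  fixes i :: "nat^'n::finite"
  shows "cell_bump n k i \<in> borel_measurable borel"
proof -
  have "continuous_on UNIV (bump w k)" for w using bump_isCont by (simp add: continuous_at_imp_continuous_on)
  then have "continuous_on UNIV (\<lambda>x :: real^'n. bump w k (x $ m - a))" for w m a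
    by (rule continuous_on_compose2) (auto intro!: continuous_intros)
  then have "continuous_on UNIV (cell_bump n k i)"
    unfolding cell_bump_def by (intro continuous_on_prod)
  then show ?thesis by (rule borel_measurable_continuous_onI)
qed

text \<open>Choosing the signs of the differences of cell integrals turns the step variation into the integral
  of the density against a signed sum of differences of indicators. These indicators are limits of
  bumps, for which the estimate by the total variation is available.\<close>

lemma cell_integral_variation:
  fixes g :: "real^'n::finite \<Rightarrow> real"
  assumes n: "0 < n" and g[measurable]: "g \<in> borel_measurable borel"
    and gb: "\<And>x. x \<in> unit_cube \<Longrightarrow> \<bar>g x\<bar> \<le> M"
    and V: "total_variation (interior unit_cube) g \<le> ereal V"
  shows "step_variation n 2 l (\<lambda>i. LINT x:cell n i|lborel. g x) \<le> 2 * 3 ^ CARD('n) * V / real n"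
proof -
  define c where "c i = (LINT x:cell n i|lborel. g x)" for i
  define I where "I = {i \<in> idx n. i $ l + 2 < n}"
  define \<sigma> where "\<sigma> i = sgn (c i - c (i + axis l 2))" for i
  define f where "f i x = indicator (interior (cell n i)) x * g x" for i x
  let ?\<Omega> = "interior (unit_cube :: (real^'n) set)"
  have finI: "finite I" by (simp add: I_def)
  have I: "i \<in> idx n" "i + axis l 2 \<in> idx n" if "i \<in> I" for i
    using that add_axis_idx[of i n l 2] by (auto simp: I_def)
  have ind: "indicator ?\<Omega> x * indicator (interior (cell n i)) x = (indicator (interior (cell n i)) x :: real)"
    if "i \<in> idx n" for i x
    using interior_cell_subset[OF that] by (auto simp: indicator_def)
  have fin: "emeasure lborel (interior (cell n i)) < \<infinity>" for i :: "nat^'n"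
    by (simp add: cell_def interior_cbox emeasure_lborel_box_eq)
  have fin\<Omega>: "emeasure lborel ?\<Omega> < \<infinity>" by (simp add: unit_cube_def interior_cbox emeasure_lborel_box_eq)
  have int_f: "integrable lborel (f i)" if "i \<in> idx n" for i
  proof (rule Bochner_Integration.integrable_bound[of _ "\<lambda>x. indicator (interior (cell n i)) x * M"])
    show "integrable lborel (\<lambda>x. indicator (interior (cell n i)) x * M)"
      using fin by (intro integrable_mult_left integrable_real_indicator) auto
    show "AE x in lborel. norm (f i x) \<le> norm (indicator (interior (cell n i)) x * M)"
    proof (rule AE_I2)
      fix x
      show "norm (f i x) \<le> norm (indicator (interior (cell n i)) x * M)"
      proof (cases "x \<in> interior (cell n i)")
        case True
        then have "x \<in> unit_cube" using interior_subset cell_subset_unit_cube[OF that] by blast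
        then show ?thesis using gb[of x] True by (simp add: f_def)
      qed (simp add: f_def)
    qed
  qed (unfold f_def, measurable)
  have int_c: "(LINT x|lborel. f i x) = c i" if "i \<in> idx n" for i
    unfolding c_def set_lebesgue_integral_def f_def
  proof (rule integral_cong_AE)
    have "AE x in lborel. x \<notin> frontier (cell n i)" by (rule AE_not_in[OF frontier_cell_null])
    then show "AE x in lborel. indicator (interior (cell n i)) x * g x = indicator (cell n i) x *\<^sub>R g x"
      by eventually_elim (use interior_subset[of "cell n i"] closed_cell[of n i] in
          \<open>auto simp: indicator_def frontier_def subset_iff\<close>)
  qed (use borel_cell in measurable)
  have "(\<lambda>k. LINT x|lborel. indicator ?\<Omega> x *\<^sub>R (g x * (\<Sum>i\<in>I. \<sigma> i * (cell_bump n k i x - cell_bump n k (i + axis l 2) x))))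
    \<longlonglongrightarrow> (LINT x|lborel. (\<Sum>i\<in>I. \<sigma> i * (f i x - f (i + axis l 2) x)))"
  proof (rule integral_dominated_convergence[where w = "\<lambda>x. indicator ?\<Omega> x * (M * real (card I))"])
    show "integrable lborel (\<lambda>x. indicator ?\<Omega> x * (M * real (card I)))"
      using fin\<Omega> by (intro integrable_mult_left integrable_real_indicator) auto
    show "AE x in lborel. (\<lambda>k. indicator ?\<Omega> x *\<^sub>R (g x * (\<Sum>i\<in>I. \<sigma> i * (cell_bump n k i x - cell_bump n k (i + axis l 2) x))))
      \<longlonglongrightarrow> (\<Sum>i\<in>I. \<sigma> i * (f i x - f (i + axis l 2) x))"
    proof (rule AE_I2)
      fix x
      have "(\<lambda>k. indicator ?\<Omega> x *\<^sub>R (g x * (\<Sum>i\<in>I. \<sigma> i * (cell_bump n k i x - cell_bump n k (i + axis l 2) x))))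
        \<longlonglongrightarrow> indicator ?\<Omega> x *\<^sub>R (g x * (\<Sum>i\<in>I. \<sigma> i * (indicator (interior (cell n i)) x - indicator (interior (cell n (i + axis l 2))) x)))"
        using n by (intro tendsto_intros cell_bump_tendsto)
      also have "indicator ?\<Omega> x *\<^sub>R (g x * (\<Sum>i\<in>I. \<sigma> i * (indicator (interior (cell n i)) x - indicator (interior (cell n (i + axis l 2))) x)))
        = (\<Sum>i\<in>I. \<sigma> i * (indicator ?\<Omega> x * indicator (interior (cell n i)) x * g x
            - indicator ?\<Omega> x * indicator (interior (cell n (i + axis l 2))) x * g x))"
        by (simp add: sum_distrib_left algebra_simps)
      also have "\<dots> = (\<Sum>i\<in>I. \<sigma> i * (f i x - f (i + axis l 2) x))"
        by (intro sum.cong refl) (simp only: f_def ind I)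
      finally show "(\<lambda>k. indicator ?\<Omega> x *\<^sub>R (g x * (\<Sum>i\<in>I. \<sigma> i * (cell_bump n k i x - cell_bump n k (i + axis l 2) x))))
      \<longlonglongrightarrow> (\<Sum>i\<in>I. \<sigma> i * (f i x - f (i + axis l 2) x))" .
    qed
    show "AE x in lborel. norm (indicator ?\<Omega> x *\<^sub>R (g x * (\<Sum>i\<in>I. \<sigma> i * (cell_bump n k i x - cell_bump n k (i + axis l 2) x))))
      \<le> indicator ?\<Omega> x * (M * real (card I))" for k
    proof (rule AE_I2)
      fix x
      have "\<bar>\<Sum>i\<in>I. \<sigma> i * (cell_bump n k i x - cell_bump n k (i + axis l 2) x)\<bar> \<le> (\<Sum>i\<in>I. 1)"
      proof (intro order.trans[OF sum_abs] sum_mono)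
        fix i
        have "\<bar>cell_bump n k i x - cell_bump n k (i + axis l 2) x\<bar> \<le> 1"
          using cell_bump_bounds[of n k i x] cell_bump_bounds[of n k "i + axis l 2" x] by linarith
        moreover have "\<bar>\<sigma> i\<bar> \<le> 1" by (simp add: \<sigma>_def sgn_if)
        ultimately show "\<bar>\<sigma> i * (cell_bump n k i x - cell_bump n k (i + axis l 2) x)\<bar> \<le> 1"
          unfolding abs_mult by (rule mult_le_one[OF _ abs_ge_zero, rotated])
      qed
      then show "norm (indicator ?\<Omega> x *\<^sub>R (g x * (\<Sum>i\<in>I. \<sigma> i * (cell_bump n k i x - cell_bump n k (i + axis l 2) x))))
        \<le> indicator ?\<Omega> x * (M * real (card I))"
        using gb[of x] interior_subset[of "unit_cube :: (real^'n) set"]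
        by (auto simp: indicator_def abs_mult intro!: mult_mono)
    qed
    show "(\<lambda>x. \<Sum>i\<in>I. \<sigma> i * (f i x - f (i + axis l 2) x)) \<in> borel_measurable lborel"
      unfolding f_def by measurable
  qed measurable
  moreover have "(LINT x|lborel. (\<Sum>i\<in>I. \<sigma> i * (f i x - f (i + axis l 2) x))) = (\<Sum>i\<in>I. \<sigma> i * (c i - c (i + axis l 2)))"
    using I int_f by (subst Bochner_Integration.integral_sum) (auto simp: int_c intro!: sum.cong)
  moreover have "(LINT x|lborel. indicator ?\<Omega> x *\<^sub>R (g x * (\<Sum>i\<in>I. \<sigma> i * (cell_bump n k i x - cell_bump n k (i + axis l 2) x))))
    \<le> 2 * 3 ^ CARD('n) * V / real n" for k
    using signed_bump_differences_le_total_variation[OF n _ V, where \<sigma> = \<sigma> and l = l and k = k]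
    unfolding I_def set_lebesgue_integral_def by (simp add: \<sigma>_def sgn_if)
  ultimately have "(\<Sum>i\<in>I. \<sigma> i * (c i - c (i + axis l 2))) \<le> 2 * 3 ^ CARD('n) * V / real n"
    by (metis (no_types, lifting) LIMSEQ_le_const2)
  moreover have "\<sigma> i * (c i - c (i + axis l 2)) = \<bar>c (i + axis l 2) - c i\<bar>" for i
    by (simp add: \<sigma>_def sgn_if)
  moreover have "(\<Sum>i\<in>I. \<bar>c (i + axis l 2) - c i\<bar>) = step_variation n 2 l c"
    unfolding step_variation_def I_def by (rule sum.inter_filter) simp
  ultimately show ?thesis by (simp add: c_def[abs_def])
qed

section \<open>Cells and the domain decomposition iterates\<close>

definition cell_index :: "nat \<Rightarrow> real^'n::finite \<Rightarrow> nat^'n" where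
  "cell_index n x = (\<chi> m. nat \<lfloor>real n * x $ m\<rfloor>)"

definition generic :: "nat \<Rightarrow> (real^'n::finite) set" where
  "generic n = unit_cube - (\<Union>i\<in>idx n. frontier (cell n i))"

lemma generic_borel [measurable]: "generic n \<in> sets borel"
  unfolding generic_def unit_cube_def by (intro sets.Diff sets.finite_UN) (auto intro: borel_closed)

lemma unit_cube_covered:
  fixes x :: "real^'n::finite"
  assumes n: "0 < n" and x: "x \<in> unit_cube"
  shows "\<exists>i\<in>idx n. x \<in> cell n i"
proof -
  define i0 where "i0 = (\<chi> m. min (n - 1) (nat \<lfloor>real n * x $ m\<rfloor>))"
  have i0: "i0 \<in> idx n" using n by (auto simp: i0_def idx_def min_def)
  have "x \<in> cell n i0"
    unfolding mem_cell
  proof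
    fix m
    have x01: "0 \<le> x $ m" "x $ m \<le> 1" using x by (auto simp: mem_unit_cube)
    have fl: "real (nat \<lfloor>real n * x $ m\<rfloor>) \<le> real n * x $ m" "real n * x $ m < real (nat \<lfloor>real n * x $ m\<rfloor>) + 1"
      using x01 by (auto simp: of_nat_nat)
    have "real (i0 $ m) \<le> real n * x $ m" using fl(1) by (simp add: i0_def min_def)
    moreover have "real n * x $ m \<le> real (i0 $ m) + 1"
      using fl(2) n x01(2) mult_left_le[of "x $ m" "real n"] by (auto simp: i0_def min_def of_nat_diff)
    ultimately show "real (i0 $ m) / n \<le> x $ m \<and> x $ m \<le> (real (i0 $ m) + 1) / n"
      using n by (auto simp: field_simps)
  qed
  with i0 show ?thesis by blast
qed

lemma cell_index_measurable:
  "cell_index n \<in> measurable (borel :: (real^'n::finite) measure) (count_space UNIV)"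
proof (rule measurable_count_space_eq_countable[THEN iffD2])
  have "cell_index n -` {i} = (\<Inter>m\<in>UNIV. {x. nat \<lfloor>real n * x $ m\<rfloor> = i $ m})" for i :: "nat^'n"
    by (auto simp: cell_index_def vec_eq_iff)
  moreover have "{x :: real^'n. nat \<lfloor>real n * x $ m\<rfloor> = a} \<in> sets borel" for m a by measurable
  ultimately show "cell_index n \<in> space borel \<rightarrow> UNIV \<and>
    (\<forall>i\<in>UNIV. cell_index n -` {i} \<inter> space (borel :: (real^'n) measure) \<in> sets borel)"
    by (auto intro!: sets.finite_INT)
  show "countable (UNIV :: (nat^'n) set)"
  proof (rule countable_subset)
    show "(UNIV :: (nat^'n) set) \<subseteq> vec_lambda ` (Pi\<^sub>E UNIV (\<lambda>_. UNIV))"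
      by (auto simp: image_iff PiE_UNIV_domain) (metis vec_lambda_eta)
    show "countable (vec_lambda ` (Pi\<^sub>E (UNIV :: 'n set) (\<lambda>_. UNIV :: nat set)))"
      by (intro countable_image countable_PiE) auto
  qed
qed

text \<open>Off the null set of cell boundaries, membership in cells is described by the measurable map
  \<open>cell_index\<close>, which turns unions of cells into sets of indices.\<close>

lemma generic_cell_index:
  fixes x :: "real^'n::finite"
  assumes n: "0 < n" and x: "x \<in> generic n"
  shows "cell_index n x \<in> idx n" "x \<in> interior (cell n (cell_index n x))"
    "i \<in> idx n \<Longrightarrow> x \<in> cell n i \<longleftrightarrow> cell_index n x = i"
proof -
  have int: "x \<in> interior (cell n i)" if "i \<in> idx n" "x \<in> cell n i" for i
    using x that closed_cell[of n i] by (auto simp: generic_def frontier_def)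
  have eq: "cell_index n x = i" if "x \<in> interior (cell n i)" for i
  proof -
    have "nat \<lfloor>real n * x $ m\<rfloor> = i $ m" for m
    proof -
      have "real (i $ m) / n < x $ m" "x $ m < (real (i $ m) + 1) / n" using that by (auto simp: interior_cell)
      then have "real (i $ m) < real n * x $ m" "real n * x $ m < real (i $ m) + 1"
        using n by (auto simp: field_simps)
      then have "\<lfloor>real n * x $ m\<rfloor> = int (i $ m)" by (intro floor_unique) auto
      then show ?thesis by simp
    qed
    then show ?thesis by (simp add: cell_index_def vec_eq_iff)
  qed
  obtain i0 where i0: "i0 \<in> idx n" "x \<in> cell n i0"
    using unit_cube_covered[OF n] x unfolding generic_def by blast
  then have i0x: "x \<in> interior (cell n i0)" by (rule int)
  then have e: "cell_index n x = i0" by (rule eq)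
  show "cell_index n x \<in> idx n" "x \<in> interior (cell n (cell_index n x))" using e i0 i0x by auto
  show "x \<in> cell n i \<longleftrightarrow> cell_index n x = i" if "i \<in> idx n"
    using int[OF that] eq \<open>x \<in> interior (cell n (cell_index n x))\<close> interior_subset by blast
qed

lemma generic_comp_cell:
  assumes "0 < n" "x \<in> generic n" "J \<subseteq> idx n"
  shows "x \<in> comp_cell n J \<longleftrightarrow> cell_index n x \<in> J"
  using generic_cell_index(3)[OF assms(1,2)] assms(3) by (auto simp: comp_cell_def)

lemma AE_generic:
  fixes M :: "(real^'n::finite) measure"
  assumes M: "M \<in> prob_on unit_cube" and fr: "\<And>i. i \<in> idx n \<Longrightarrow> emeasure M (frontier (cell n i)) = 0"
  shows "AE x in M. x \<in> generic n"
proof -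
  have s: "sets M = sets borel" using M by (rule prob_onD)
  have "frontier (cell n i) \<in> sets M" for i unfolding s by (intro borel_closed frontier_closed)
  then have "AE x in M. \<forall>i\<in>idx n. x \<notin> frontier (cell n i)"
    using fr by (intro AE_finite_allI finite_idx AE_not_in) (auto simp: null_sets_def)
  moreover have "closed (unit_cube :: (real^'n) set)" unfolding unit_cube_def by (rule closed_cbox)
  then have "AE x in M. x \<in> unit_cube" using prob_on_AE[OF M] by blast
  ultimately show ?thesis by eventually_elim (auto simp: generic_def)
qed

text \<open>Odd steps use the unshifted partition and even steps the shifted one.\<close>

definition shifted_coords :: "nat \<Rightarrow> 'n set" where
  "shifted_coords k = (if odd k then {} else UNIV)"

lemma composites_eq_groups: "composites n k = group n (shifted_coords k) ` idx n"
proof -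
  have q: "A // {(i, j). i \<in> A \<and> j \<in> A \<and> P i j} = (\<lambda>i. {j \<in> A. P i j}) ` A" for A :: "'b set" and P
    by (auto simp: quotient_def)
  have g: "group n {} = (\<lambda>i. {j \<in> idx n. \<forall>l. (i $ l) div 2 = (j $ l) div 2})"
    "group n UNIV = (\<lambda>i. {j \<in> idx n. \<forall>l. (i $ l + 1) div 2 = (j $ l + 1) div 2})"
    by (auto simp: fun_eq_iff group_def pair_label_def)
  show ?thesis
    by (simp only: composites_def shifted_coords_def composites_A_def composites_B_def q g if_distrib) simp
qed

lemma group_eqI: "j \<in> group n L i \<Longrightarrow> group n L j = group n L i"
  by (auto simp: group_def)

lemma composites_partition:
  assumes "J \<in> composites n k"
  shows "J \<subseteq> idx n" "finite J" "i \<in> J \<Longrightarrow> J = group n (shifted_coords k) i"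
    "\<exists>i\<in>idx n. J = group n (shifted_coords k) i"
  using assms group_eqI unfolding composites_eq_groups by (auto simp: group_def)

lemma finite_composites: "finite (composites n k)"
  by (simp add: composites_eq_groups)

lemma sum_composites:
  fixes f :: "nat^'n::finite \<Rightarrow> 'b::comm_monoid_add"
  shows "(\<Sum>J\<in>composites n k. \<Sum>i\<in>J. f i) = (\<Sum>i\<in>idx n. f i)"
proof -
  have U: "\<Union>(composites n k) = (idx n :: (nat^'n) set)"
    using group_self by (fastforce simp: composites_eq_groups group_def)
  have "sum f (\<Union>(composites n k)) = sum (sum f) (composites n k)"
  proof (intro sum.Union_disjoint[unfolded comp_def] ballI impI)
    show "finite J" if "J \<in> composites n k" for J :: "(nat^'n) set" using composites_partition(2)[OF that] .
    fix J J' :: "(nat^'n) set" assume *: "J \<in> composites n k" "J' \<in> composites n k" "J \<noteq> J'"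
    show "J \<inter> J' = {}"
    proof (rule ccontr)
      assume "J \<inter> J' \<noteq> {}"
      then obtain i where "i \<in> J" "i \<in> J'" by blast
      then show False using composites_partition(3)[OF *(1)] composites_partition(3)[OF *(2)] *(3) by metis
    qed
  qed
  then show ?thesis by (simp only: U)
qed

lemma nn_integral_sum_measure:
  fixes F :: "'i \<Rightarrow> 'a::topological_space measure"
  assumes s: "\<And>i. i \<in> I \<Longrightarrow> sets (F i) = sets borel" and f: "f \<in> borel_measurable borel"
  shows "(\<integral>\<^sup>+ z. f z \<partial>sum_measure F I) = (\<Sum>i\<in>I. \<integral>\<^sup>+ z. f z \<partial>F i)"
  using f
proof (induction rule: borel_measurable_induct)
  case (cong f g)
  then show ?case by simp
next
  case (set A)
  then show ?case using emeasure_sum_measure[OF s] s by simp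
next
  case (mult u c)
  have m: "u \<in> borel_measurable M" if "sets M = sets borel" for M
    using mult(2) unfolding measurable_cong_sets[OF that refl] .
  show ?case using m s by (simp add: nn_integral_cmult mult.IH sum_distrib_left cong: sum.cong)
next
  case (add u v)
  have m: "u \<in> borel_measurable M" "v \<in> borel_measurable M" if "sets M = sets borel" for M
    using add unfolding measurable_cong_sets[OF that refl] by auto
  show ?case using add m s by (simp add: nn_integral_add sum.distrib cong: sum.cong)
next
  case (seq U)
  have m: "U i \<in> borel_measurable M" if "sets M = sets borel" for M i
    using seq(1) unfolding measurable_cong_sets[OF that refl] .
  have sup: "(\<integral>\<^sup>+ z. (\<Squnion> (range U)) z \<partial>M) = (SUP i. \<integral>\<^sup>+ z. U i z \<partial>M)" if "sets M = sets borel" for M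
    using nn_integral_monotone_convergence_SUP[OF seq(3) m[OF that]] by (simp add: image_comp)
  have "(\<integral>\<^sup>+ z. (\<Squnion> (range U)) z \<partial>sum_measure F I) = (SUP i. \<Sum>j\<in>I. \<integral>\<^sup>+ z. U i z \<partial>F j)"
    unfolding sup[OF sets_sum_measure] using seq.IH by simp
  also have "\<dots> = (\<Sum>j\<in>I. SUP i. \<integral>\<^sup>+ z. U i z \<partial>F j)"
    using seq(3) by (intro incseq_sumI2 ennreal_SUP_sum) (auto simp: incseq_def le_fun_def intro!: nn_integral_mono)
  also have "\<dots> = (\<Sum>j\<in>I. \<integral>\<^sup>+ z. (\<Squnion> (range U)) z \<partial>F j)"
    by (intro sum.cong refl sup[OF s, symmetric])
  finally show ?case .
qed

lemma nn_integral_mrestrict: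
  assumes "sets M = sets borel" "A \<in> sets borel" "f \<in> borel_measurable borel"
  shows "(\<integral>\<^sup>+ z. f z \<partial>mrestrict M A) = (\<integral>\<^sup>+ z. f z * indicator A z \<partial>M)"
  unfolding mrestrict_def using assms
  by (subst nn_integral_density) (auto simp: measurable_cong_sets[OF assms(1) refl] mult.commute)

lemma sets_mrestrict [simp]: "sets (mrestrict M A) = sets M"
  by (simp add: mrestrict_def)

lemma fst_snd_borel:
  "fst \<in> measurable (borel :: ('a::topological_space \<times> 'b::topological_space) measure) borel"
  "snd \<in> measurable (borel :: ('a::topological_space \<times> 'b::topological_space) measure) borel"
  by (intro borel_measurable_continuous_onI continuous_intros)+

lemma nn_integral_Y_marginal_on:
  fixes \<pi> :: "((real^'n::finite) \<times> (real^'n)) measure"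
  assumes s: "sets \<pi> = sets borel" and A: "A \<in> sets borel" "Y \<in> sets borel" and f: "f \<in> borel_measurable borel"
  shows "(\<integral>\<^sup>+ y. f y \<partial>Y_marginal_on Y A \<pi>) = (\<integral>\<^sup>+ z. f (snd z) * indicator A (fst z) * indicator Y (snd z) \<partial>\<pi>)"
proof -
  have AY: "A \<times> Y \<in> sets borel" using A by (metis pair_measureI borel_prod)
  have m: "(\<lambda>z. f (snd z)) \<in> borel_measurable (borel :: ((real^'n) \<times> (real^'n)) measure)"
    by (rule measurable_compose[OF fst_snd_borel(2) f])
  have snd: "snd \<in> measurable (mrestrict \<pi> (A \<times> Y)) borel"
    using fst_snd_borel(2) s by (subst measurable_cong_sets[of _ borel]) auto
  have "(\<integral>\<^sup>+ y. f y \<partial>Y_marginal_on Y A \<pi>) = (\<integral>\<^sup>+ z. f (snd z) \<partial>mrestrict \<pi> (A \<times> Y))"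
    unfolding Y_marginal_on_def using f by (intro nn_integral_distr snd) simp
  also have "\<dots> = (\<integral>\<^sup>+ z. f (snd z) * indicator (A \<times> Y) z \<partial>\<pi>)"
    by (rule nn_integral_mrestrict[OF s AY m])
  finally show ?thesis by (simp add: indicator_times mult.assoc)
qed

lemma sets_Y_marginal_on [simp]: "sets (Y_marginal_on Y A \<pi>) = sets borel"
  by (simp add: Y_marginal_on_def)

lemma AE_couplings_iff:
  assumes "\<pi> \<in> couplings \<alpha> \<beta>" "{x. P x} \<in> sets borel"
  shows "(AE z in \<pi>. P (fst z)) \<longleftrightarrow> (AE x in \<alpha>. P x)"
proof -
  have s: "sets \<pi> = sets borel" and a: "\<alpha> = distr \<pi> borel fst" using assms(1) by (auto simp: couplings_def)
  have "fst \<in> measurable \<pi> borel" using fst_snd_borel(1) by (subst measurable_cong_sets[OF s refl])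
  then show ?thesis unfolding a using assms(2) by (subst AE_distr_iff) auto
qed

lemma nn_integral_couplings:
  assumes \<pi>: "\<pi> \<in> couplings \<alpha> \<beta>" and f: "f \<in> borel_measurable borel"
  shows "(\<integral>\<^sup>+ z. f (fst z) \<partial>\<pi>) = (\<integral>\<^sup>+ x. f x \<partial>\<alpha>)"
    and "g \<in> borel_measurable borel \<Longrightarrow> (\<integral>\<^sup>+ z. g (snd z) \<partial>\<pi>) = (\<integral>\<^sup>+ y. g y \<partial>\<beta>)"
proof -
  have s: "sets \<pi> = sets borel" and a: "\<alpha> = distr \<pi> borel fst" "\<beta> = distr \<pi> borel snd"
    using \<pi> by (auto simp: couplings_def)
  have m: "fst \<in> measurable \<pi> borel" "snd \<in> measurable \<pi> borel"
    using fst_snd_borel by (subst measurable_cong_sets[OF s refl], blast)+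
  show "(\<integral>\<^sup>+ z. f (fst z) \<partial>\<pi>) = (\<integral>\<^sup>+ x. f x \<partial>\<alpha>)" unfolding a using m f by (subst nn_integral_distr) auto
  show "(\<integral>\<^sup>+ z. g (snd z) \<partial>\<pi>) = (\<integral>\<^sup>+ y. g y \<partial>\<beta>)" if "g \<in> borel_measurable borel"
    unfolding a using m that by (subst nn_integral_distr) auto
qed

text \<open>The structure of the iterates for one fixed \<open>n\<close>: each step rearranges the mass within its composite
  cells, keeping both marginals there.\<close>

locale dd_iterates =
  fixes Y :: "(real^'n::finite) set" and \<mu> \<mu>n \<nu>n :: "(real^'n) measure" and n :: nat
    and \<pi> :: "nat \<Rightarrow> ((real^'n) \<times> (real^'n)) measure"
    and \<pi>J :: "nat \<Rightarrow> (nat^'n) set \<Rightarrow> ((real^'n) \<times> (real^'n)) measure"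
  assumes Y: "closed Y" and n: "0 < n"
    and \<mu>: "\<mu> \<in> prob_on unit_cube"
    and m_pos: "\<And>i. i \<in> idx n \<Longrightarrow> 0 < emeasure \<mu> (cell n i)"
    and \<mu>n: "\<mu>n \<in> prob_on unit_cube"
      "\<And>i. i \<in> idx n \<Longrightarrow> emeasure \<mu>n (cell n i) = emeasure \<mu> (cell n i)"
      "\<And>i. i \<in> idx n \<Longrightarrow> emeasure \<mu>n (frontier (cell n i)) = 0"
    and \<nu>n: "\<nu>n \<in> prob_on Y"
    and init: "\<pi> 0 \<in> couplings \<mu>n \<nu>n"
    and cell_coupling: "\<And>k J. 1 \<le> k \<Longrightarrow> J \<in> composites n k \<Longrightarrow>
      \<pi>J k J \<in> couplings (mrestrict \<mu>n (comp_cell n J)) (Y_marginal_on Y (comp_cell n J) (\<pi> (k - 1)))"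
    and iter_sum: "\<And>k. 1 \<le> k \<Longrightarrow> \<pi> k = sum_measure (\<pi>J k) (composites n k)"
begin

lemma Y_borel [measurable]: "Y \<in> sets borel" using Y by (rule borel_closed)

lemma comp_cell_borel: "J \<in> composites n k \<Longrightarrow> comp_cell n J \<in> sets borel"
  unfolding comp_cell_def using composites_partition(2) borel_cell by (intro sets.finite_UN) auto

lemma iterate_sets: "sets (\<pi> k) = sets borel"
  using init iter_sum[of k] by (cases k) (auto simp: couplings_def)

lemma AE_mun_generic: "AE x in \<mu>n. x \<in> generic n"
  using AE_generic \<mu>n by blast

text \<open>Cell boundaries carry no mass of the first marginal, so that cells can be replaced by indices.\<close>

lemma AE_cell_measure:
  assumes "1 \<le> k" "J \<in> composites n k"
  shows "AE z in \<pi>J k J. fst z \<in> generic n \<and> cell_index n (fst z) \<in> J"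
proof -
  have J: "comp_cell n J \<in> sets borel" using comp_cell_borel assms by blast
  have s: "sets \<mu>n = sets borel" using \<mu>n(1) by (rule prob_onD)
  have "AE x in mrestrict \<mu>n (comp_cell n J). x \<in> generic n \<inter> comp_cell n J"
    unfolding mrestrict_def using AE_mun_generic J
    by (subst AE_density) (auto simp: measurable_cong_sets[OF s refl] indicator_def elim!: AE_mp)
  moreover have "{x. x \<in> generic n \<inter> comp_cell n J} \<in> sets borel" using J by simp
  note AE_couplings_iff[OF cell_coupling[OF assms] this]
  ultimately have "AE z in \<pi>J k J. fst z \<in> generic n \<inter> comp_cell n J" by (simp only:)
  then show ?thesis
    by eventually_elim (use generic_comp_cell[OF n _ composites_partition(1)[OF assms(2)]] in auto)
qed

text \<open>Replacing cell masses by sums over indices, the first marginal of the sum of the cell measures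
  is again that of the previous iterate, and its second marginal stays on \<open>Y\<close>.\<close>

lemma iterate_invariant:
  "(\<forall>f \<in> borel_measurable borel. (\<integral>\<^sup>+ z. f (fst z) \<partial>\<pi> k) = (\<integral>\<^sup>+ x. f x \<partial>\<mu>n)) \<and> (AE z in \<pi> k. snd z \<in> Y)"
proof (cases k)
  case 0
  have "AE y in \<nu>n. y \<in> Y" using prob_on_AE[OF \<nu>n Y] .
  moreover have "distr (\<pi> 0) borel snd = \<nu>n" using init by (simp add: couplings_def)
  ultimately have "AE y in distr (\<pi> 0) borel snd. y \<in> Y" by (simp only:)
  moreover have "snd \<in> measurable (\<pi> 0) borel"
    using fst_snd_borel(2) by (subst measurable_cong_sets[OF iterate_sets refl])
  ultimately have "AE z in \<pi> 0. snd z \<in> Y" by (rule AE_distrD[rotated])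
  then show ?thesis using nn_integral_couplings(1)[OF init] 0 by auto
next
  case (Suc k')
  then have k: "1 \<le> k" by simp
  have sJ: "sets (\<pi>J k J) = sets borel" if "J \<in> composites n k" for J
    using cell_coupling[OF k that] by (simp add: couplings_def)
  have s: "sets \<mu>n = sets borel" using \<mu>n(1) by (rule prob_onD)
  show ?thesis
  proof (intro conjI ballI)
    fix f :: "real^'n \<Rightarrow> ennreal" assume f: "f \<in> borel_measurable borel"
    have m: "f \<in> borel_measurable \<mu>n" using f by (subst measurable_cong_sets[OF s refl])
    have "(\<integral>\<^sup>+ z. f (fst z) \<partial>\<pi> k) = (\<Sum>J\<in>composites n k. \<integral>\<^sup>+ z. f (fst z) \<partial>\<pi>J k J)"
      unfolding iter_sum[OF k] using sJ measurable_compose[OF fst_snd_borel(1) f] by (intro nn_integral_sum_measure)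
    also have "\<dots> = (\<Sum>J\<in>composites n k. \<integral>\<^sup>+ x. f x * indicator (comp_cell n J) x \<partial>\<mu>n)"
      using nn_integral_couplings(1)[OF cell_coupling[OF k] f] nn_integral_mrestrict[OF s comp_cell_borel f]
      by (intro sum.cong) auto
    also have "\<dots> = (\<integral>\<^sup>+ x. (\<Sum>J\<in>composites n k. f x * indicator (comp_cell n J) x) \<partial>\<mu>n)"
      by (intro nn_integral_sum[symmetric] borel_measurable_times_ennreal m borel_measurable_indicator)
         (simp add: s comp_cell_borel)
    also have "\<dots> = (\<integral>\<^sup>+ x. f x \<partial>\<mu>n)"
    proof (rule nn_integral_cong_AE, use AE_mun_generic in eventually_elim)
      fix x :: "real^'n" assume x: "x \<in> generic n"
      have "(\<Sum>J\<in>composites n k. indicator (comp_cell n J) x) = (\<Sum>J\<in>composites n k. \<Sum>i\<in>J. if cell_index n x = i then 1 else 0 :: ennreal)"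
      proof (intro sum.cong refl)
        fix J :: "(nat^'n) set" assume J: "J \<in> composites n k"
        show "indicator (comp_cell n J) x = (\<Sum>i\<in>J. if cell_index n x = i then 1 else 0 :: ennreal)"
          using generic_comp_cell[OF n x composites_partition(1)[OF J]] composites_partition(2)[OF J]
          by (simp add: indicator_def)
      qed
      also have "\<dots> = 1" unfolding sum_composites using generic_cell_index(1)[OF n x] by simp
      finally show "(\<Sum>J\<in>composites n k. f x * indicator (comp_cell n J) x) = f x"
        by (simp flip: sum_distrib_left)
    qed
    finally show "(\<integral>\<^sup>+ z. f (fst z) \<partial>\<pi> k) = (\<integral>\<^sup>+ x. f x \<partial>\<mu>n)" .
  next
    have mY: "indicator (- Y) \<in> borel_measurable borel" by measurable
    have "(\<integral>\<^sup>+ z. indicator (- Y) (snd z) \<partial>\<pi> k) = (\<Sum>J\<in>composites n k. \<integral>\<^sup>+ z. indicator (- Y) (snd z) \<partial>\<pi>J k J)"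
      unfolding iter_sum[OF k] using sJ measurable_compose[OF fst_snd_borel(2) mY] by (intro nn_integral_sum_measure)
    also have "\<dots> = (\<Sum>J\<in>composites n k. \<integral>\<^sup>+ y. indicator (- Y) y \<partial>Y_marginal_on Y (comp_cell n J) (\<pi> (k - 1)))"
      by (intro sum.cong refl nn_integral_couplings(2)[OF cell_coupling[OF k] mY mY])
    also have "\<dots> = 0"
      using nn_integral_Y_marginal_on[OF iterate_sets comp_cell_borel Y_borel mY]
      by (intro sum.neutral) (auto simp: indicator_def intro!: nn_integral_zero')
    finally have "AE z in \<pi> k. indicator (- Y) (snd z) = (0 :: ennreal)"
      using measurable_compose[OF fst_snd_borel(2) mY]
      by (subst (asm) nn_integral_0_iff_AE) (auto simp: measurable_cong_sets[OF iterate_sets refl])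
    then show "AE z in \<pi> k. snd z \<in> Y" by eventually_elim (auto simp: indicator_def split: if_splits)
  qed
qed

lemma AE_iterate: "AE z in \<pi> k. fst z \<in> generic n \<and> snd z \<in> Y"
proof -
  have m: "indicator (- generic n) \<in> borel_measurable (borel :: (real^'n) measure)" by measurable
  have "(\<integral>\<^sup>+ z. indicator (- generic n) (fst z) \<partial>\<pi> k) = (\<integral>\<^sup>+ x. indicator (- generic n) x \<partial>\<mu>n)"
    using iterate_invariant m by blast
  also have "\<dots> = 0"
    using AE_mun_generic by (intro nn_integral_0_iff_AE[THEN iffD2])
      (auto simp: measurable_cong_sets[OF prob_onD(1)[OF \<mu>n(1)] refl] elim!: AE_mp)
  finally have "AE z in \<pi> k. indicator (- generic n) (fst z) = (0 :: ennreal)"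
    using measurable_compose[OF fst_snd_borel(1) m]
    by (subst (asm) nn_integral_0_iff_AE) (auto simp: measurable_cong_sets[OF iterate_sets refl])
  with iterate_invariant[THEN conjunct2] show ?thesis
    by eventually_elim (auto simp: indicator_def split: if_splits)
qed

text \<open>The integral of \<open>f\<close> against the second marginal of the part of the iterate above the cells with
  index in \<open>J\<close>. Selecting this part by indices makes the overlap of closed cells harmless and the
  dependence on \<open>J\<close> additive.\<close>

definition index_integral :: "nat \<Rightarrow> (real^'n \<Rightarrow> ennreal) \<Rightarrow> (nat^'n) set \<Rightarrow> ennreal" where
  "index_integral k f J = (\<integral>\<^sup>+ z. f (snd z) * indicator J (cell_index n (fst z)) \<partial>\<pi> k)"

lemma index_integrand_measurable:
  fixes f :: "real^'n \<Rightarrow> ennreal"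
  assumes f: "f \<in> borel_measurable borel"
  shows "(\<lambda>z. f (snd z) * indicator J (cell_index n (fst z))) \<in> borel_measurable (borel :: ((real^'n) \<times> (real^'n)) measure)"
proof -
  have i: "(\<lambda>x. indicator J (cell_index n x) :: ennreal) \<in> borel_measurable borel"
    by (rule measurable_compose[OF cell_index_measurable]) simp
  show ?thesis
    by (intro borel_measurable_times_ennreal measurable_compose[OF fst_snd_borel(2) f]
        measurable_compose[OF fst_snd_borel(1) i])
qed

lemma index_integral_eq:
  assumes "J \<subseteq> idx n" and f: "f \<in> borel_measurable borel" and J: "comp_cell n J \<in> sets borel"
  shows "(\<integral>\<^sup>+ y. f y \<partial>Y_marginal_on Y (comp_cell n J) (\<pi> k)) = index_integral k f J"
  unfolding nn_integral_Y_marginal_on[OF iterate_sets J Y_borel f] index_integral_def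
  by (rule nn_integral_cong_AE, use AE_iterate in eventually_elim)
     (use generic_comp_cell[OF n _ assms(1)] in \<open>auto simp: indicator_def\<close>)

lemma cell_integral_eq:
  assumes "i \<in> idx n" "f \<in> borel_measurable borel"
  shows "(\<integral>\<^sup>+ y. f y \<partial>Y_marginal_on Y (cell n i) (\<pi> k)) = index_integral k f {i}"
  using index_integral_eq[of "{i}" f k] assms borel_cell[of n i] by (simp add: comp_cell_def)

lemma index_integral_sum:
  assumes f: "f \<in> borel_measurable borel" and "finite J"
  shows "(\<Sum>i\<in>J. index_integral k f {i}) = index_integral k f J"
proof -
  have "(\<Sum>i\<in>J. index_integral k f {i}) = (\<integral>\<^sup>+ z. (\<Sum>i\<in>J. f (snd z) * indicator {i} (cell_index n (fst z))) \<partial>\<pi> k)"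
    unfolding index_integral_def using index_integrand_measurable[OF f]
    by (intro nn_integral_sum[symmetric]) (simp add: measurable_cong_sets[OF iterate_sets refl])
  also have "\<dots> = index_integral k f J"
    unfolding index_integral_def using assms(2)
    by (intro nn_integral_cong) (auto simp: indicator_def simp flip: sum_distrib_left)
  finally show ?thesis .
qed

text \<open>Each step only redistributes mass within the composite cells of its own partition.\<close>

lemma composite_mass_conserved:
  assumes k: "1 \<le> k" and J: "J \<in> composites n k" and f: "f \<in> borel_measurable borel"
  shows "index_integral k f J = index_integral (k - 1) f J"
proof -
  let ?F = "\<lambda>z. f (snd z) * indicator J (cell_index n (fst z))"
  have sJ: "sets (\<pi>J k J') = sets borel" if "J' \<in> composites n k" for J'
    using cell_coupling[OF k that] by (simp add: couplings_def)
  have "index_integral k f J = (\<Sum>J'\<in>composites n k. \<integral>\<^sup>+ z. ?F z \<partial>\<pi>J k J')"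
    unfolding index_integral_def iter_sum[OF k] using sJ index_integrand_measurable[OF f]
    by (intro nn_integral_sum_measure)
  also have "\<dots> = (\<Sum>J'\<in>composites n k. if J' = J then \<integral>\<^sup>+ z. f (snd z) \<partial>\<pi>J k J else 0)"
  proof (intro sum.cong refl)
    fix J' :: "(nat^'n) set" assume J': "J' \<in> composites n k"
    show "(\<integral>\<^sup>+ z. ?F z \<partial>\<pi>J k J') = (if J' = J then \<integral>\<^sup>+ z. f (snd z) \<partial>\<pi>J k J else 0)"
    proof (cases "J' = J")
      case True
      have "(\<integral>\<^sup>+ z. ?F z \<partial>\<pi>J k J') = (\<integral>\<^sup>+ z. f (snd z) \<partial>\<pi>J k J')"
        by (rule nn_integral_cong_AE, use AE_cell_measure[OF k J'] in eventually_elim) (use True in auto)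
      then show ?thesis using True by simp
    next
      case False
      then have "i \<notin> J" if "i \<in> J'" for i
        using composites_partition(3)[OF J, of i] composites_partition(3)[OF J', of i] that by metis
      then have "(\<integral>\<^sup>+ z. ?F z \<partial>\<pi>J k J') = (\<integral>\<^sup>+ z. 0 \<partial>\<pi>J k J')"
        by (intro nn_integral_cong_AE) (use AE_cell_measure[OF k J'] in eventually_elim, auto)
      then show ?thesis using False by simp
    qed
  qed
  also have "\<dots> = (\<integral>\<^sup>+ z. f (snd z) \<partial>\<pi>J k J)" by (simp add: finite_composites J)
  also have "\<dots> = (\<integral>\<^sup>+ y. f y \<partial>Y_marginal_on Y (comp_cell n J) (\<pi> (k - 1)))"
    using nn_integral_couplings(2)[OF cell_coupling[OF k J] f f] .
  also have "\<dots> = index_integral (k - 1) f J"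
    using index_integral_eq composites_partition(1)[OF J] f comp_cell_borel[OF J] by blast
  finally show ?thesis .
qed

lemma total_integral:
  assumes f: "f \<in> borel_measurable borel"
  shows "(\<Sum>i\<in>idx n. index_integral k f {i}) = (\<integral>\<^sup>+ y. f y \<partial>\<nu>n)"
proof (induction k)
  case 0
  have "(\<Sum>i\<in>idx n. index_integral 0 f {i}) = (\<integral>\<^sup>+ z. f (snd z) * indicator (idx n) (cell_index n (fst z)) \<partial>\<pi> 0)"
    using index_integral_sum[OF f finite_idx] by (simp add: index_integral_def)
  also have "\<dots> = (\<integral>\<^sup>+ z. f (snd z) \<partial>\<pi> 0)"
    by (rule nn_integral_cong_AE, use AE_iterate in eventually_elim) (simp add: generic_cell_index(1)[OF n])
  also have "\<dots> = (\<integral>\<^sup>+ y. f y \<partial>\<nu>n)" by (rule nn_integral_couplings(2)[OF init f f])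
  finally show ?case .
next
  case (Suc k)
  have "(\<Sum>i\<in>idx n. index_integral (Suc k) f {i}) = (\<Sum>J\<in>composites n (Suc k). \<Sum>i\<in>J. index_integral (Suc k) f {i})"
    by (rule sum_composites[symmetric])
  also have "\<dots> = (\<Sum>J\<in>composites n (Suc k). \<Sum>i\<in>J. index_integral k f {i})"
  proof (rule sum.cong[OF refl])
    fix J :: "(nat^'n) set" assume J: "J \<in> composites n (Suc k)"
    show "(\<Sum>i\<in>J. index_integral (Suc k) f {i}) = (\<Sum>i\<in>J. index_integral k f {i})"
      unfolding index_integral_sum[OF f composites_partition(2)[OF J]]
      using composite_mass_conserved[OF _ J f] by simp
  qed
  also have "\<dots> = (\<Sum>i\<in>idx n. index_integral k f {i})" by (rule sum_composites)
  finally show ?case using Suc by simp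
qed

lemma index_mass: "i \<in> idx n \<Longrightarrow> index_integral k (\<lambda>_. 1) {i} = emeasure \<mu> (cell n i)"
proof -
  assume i: "i \<in> idx n"
  have "index_integral k (\<lambda>_. 1) {i} = (\<integral>\<^sup>+ z. indicator (cell n i) (fst z) \<partial>\<pi> k)"
    unfolding index_integral_def
    by (rule nn_integral_cong_AE, use AE_iterate in eventually_elim)
       (use generic_cell_index(3)[OF n _ i] in \<open>auto simp: indicator_def\<close>)
  also have "\<dots> = (\<integral>\<^sup>+ x. indicator (cell n i) x \<partial>\<mu>n)"
    using borel_cell[of n i]
    by (intro iterate_invariant[THEN conjunct1, rule_format]) simp
  also have "\<dots> = emeasure \<mu> (cell n i)" using \<mu>n(2)[OF i] prob_onD(1)[OF \<mu>n(1)] borel_cell[of n i] by simp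
  finally show ?thesis .
qed

definition mass :: "nat^'n \<Rightarrow> real" where
  "mass i = measure \<mu> (cell n i)"

lemma emeasure_mass: "emeasure \<mu> (cell n i) = ennreal (mass i)"
  using finite_measure.emeasure_eq_measure[OF prob_space.finite_measure[OF prob_onD(3)[OF \<mu>]]] by (simp add: mass_def)

lemma mass_pos: "i \<in> idx n \<Longrightarrow> 0 < mass i"
  using m_pos[of i] by (simp add: emeasure_mass)

lemma rho_comp_nn_integral:
  assumes J: "J \<subseteq> idx n" "J \<noteq> {}" and f: "f \<in> borel_measurable borel"
  shows "(\<integral>\<^sup>+ y. f y \<partial>rho_comp Y \<mu> n (\<pi> k) J) = (\<Sum>i\<in>J. index_integral k f {i}) / ennreal (\<Sum>i\<in>J. mass i)"
proof -
  have "(\<integral>\<^sup>+ y. f y \<partial>rho_comp Y \<mu> n (\<pi> k) J) = 1 / (\<Sum>i\<in>J. emeasure \<mu> (cell n i)) *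
      (\<integral>\<^sup>+ y. f y \<partial>sum_measure (\<lambda>i. Y_marginal_on Y (cell n i) (\<pi> k)) J)"
    unfolding rho_comp_def using f
    by (intro nn_integral_scale_measure) (simp add: measurable_cong_sets[OF sets_sum_measure refl])
  also have "(\<integral>\<^sup>+ y. f y \<partial>sum_measure (\<lambda>i. Y_marginal_on Y (cell n i) (\<pi> k)) J) = (\<Sum>i\<in>J. index_integral k f {i})"
    using J f by (subst nn_integral_sum_measure) (auto intro!: sum.cong cell_integral_eq)
  also have "(\<Sum>i\<in>J. emeasure \<mu> (cell n i)) = ennreal (\<Sum>i\<in>J. mass i)"
    unfolding emeasure_mass using J(1) mass_pos by (intro sum_ennreal less_imp_le[OF mass_pos]) (rule subsetD)
  finally show ?thesis by (simp add: divide_ennreal_def mult.commute)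
qed

lemma rho_cell_nn_integral:
  assumes i: "i \<in> idx n" and f: "f \<in> borel_measurable borel"
  shows "(\<integral>\<^sup>+ y. f y \<partial>rho_cell Y \<mu> n (\<pi> k) i) = index_integral k f {i} / ennreal (mass i)"
proof -
  have "(\<integral>\<^sup>+ y. f y \<partial>rho_cell Y \<mu> n (\<pi> k) i) = 1 / emeasure \<mu> (cell n i) * (\<integral>\<^sup>+ y. f y \<partial>Y_marginal_on Y (cell n i) (\<pi> k))"
    unfolding rho_cell_def using f
    by (intro nn_integral_scale_measure) (simp add: measurable_cong_sets[OF sets_Y_marginal_on refl])
  then show ?thesis using cell_integral_eq[OF i f] by (simp add: emeasure_mass divide_ennreal_def mult.commute)
qed

lemma index_integral_off_Y: "index_integral k (indicator (- Y)) J = 0"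
proof -
  have "index_integral k (indicator (- Y)) J = (\<integral>\<^sup>+ z. 0 \<partial>\<pi> k)"
    unfolding index_integral_def by (rule nn_integral_cong_AE, use AE_iterate in eventually_elim) simp
  then show ?thesis by simp
qed

lemma sets_rho [simp]: "sets (rho_comp Y \<mu> n p J) = sets borel" "sets (rho_cell Y \<mu> n p i) = sets borel"
  by (simp_all add: rho_comp_def rho_cell_def)

lemma rho_comp_prob_on:
  assumes J: "J \<subseteq> idx n" "J \<noteq> {}"
  shows "rho_comp Y \<mu> n (\<pi> k) J \<in> prob_on Y"
proof -
  let ?R = "rho_comp Y \<mu> n (\<pi> k) J"
  have sp: "space ?R = UNIV" using sets_eq_imp_space_eq[OF sets_rho(1)] by simp
  have fin: "finite J" using J finite_subset[OF _ finite_idx] by blast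
  have pos: "0 < (\<Sum>i\<in>J. mass i)" using J fin mass_pos by (intro sum_pos) auto
  have "emeasure ?R (space ?R) = (\<integral>\<^sup>+ y. 1 \<partial>?R)" by simp
  also have "\<dots> = (\<Sum>i\<in>J. ennreal (mass i)) / ennreal (\<Sum>i\<in>J. mass i)"
    using J by (subst rho_comp_nn_integral[OF J]) (auto simp: index_mass emeasure_mass intro!: arg_cong2[where f = "(/)"] sum.cong)
  also have "\<dots> = 1"
  proof -
    have "(\<Sum>i\<in>J. ennreal (mass i)) = ennreal (\<Sum>i\<in>J. mass i)"
      using J(1) by (intro sum_ennreal less_imp_le[OF mass_pos]) (rule subsetD)
    then show ?thesis using pos by (simp add: ennreal_divide_self)
  qed
  finally have "prob_space ?R" by (rule prob_spaceI)
  moreover have "emeasure ?R (- Y) = 0"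
  proof -
    have "emeasure ?R (- Y) = (\<integral>\<^sup>+ y. indicator (- Y) y \<partial>?R)" by simp
    also have "\<dots> = 0"
      by (subst rho_comp_nn_integral[OF J]) (auto simp: index_integral_off_Y)
    finally show ?thesis .
  qed
  ultimately show ?thesis by (simp add: prob_on_def)
qed

lemma rho_cell_prob_space:
  assumes i: "i \<in> idx n"
  shows "prob_space (rho_cell Y \<mu> n (\<pi> k) i)"
proof (rule prob_spaceI)
  have m1: "(\<lambda>_. 1 :: ennreal) \<in> borel_measurable (borel :: (real^'n) measure)" by (rule measurable_const) simp
  have "emeasure (rho_cell Y \<mu> n (\<pi> k) i) (space (rho_cell Y \<mu> n (\<pi> k) i)) = (\<integral>\<^sup>+ y. 1 \<partial>rho_cell Y \<mu> n (\<pi> k) i)"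
    by (simp only: nn_integral_const mult_1)
  also have "\<dots> = ennreal (mass i) / ennreal (mass i)"
    unfolding rho_cell_nn_integral[OF i m1] index_mass[OF i] emeasure_mass ..
  also have "\<dots> = 1" using mass_pos[OF i] by (intro ennreal_divide_self) auto
  finally show "emeasure (rho_cell Y \<mu> n (\<pi> k) i) (space (rho_cell Y \<mu> n (\<pi> k) i)) = 1" .
qed

definition cell_test :: "(real^'n \<Rightarrow> real) \<Rightarrow> nat \<Rightarrow> nat^'n \<Rightarrow> real" where
  "cell_test \<phi> k i = (LINT y|rho_cell Y \<mu> n (\<pi> k) i. \<phi> y)"

context
  fixes \<phi> :: "real^'n \<Rightarrow> real" and L :: real
  assumes \<phi>: "\<phi> \<in> lip01 L"
begin

lemma cell_test_bounds: "i \<in> idx n \<Longrightarrow> 0 \<le> cell_test \<phi> k i" "i \<in> idx n \<Longrightarrow> cell_test \<phi> k i \<le> 1"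
  unfolding cell_test_def
  by (rule integral_lip01_bounds[OF \<phi> rho_cell_prob_space sets_rho(2)], assumption)+

lemma mass_test_nonneg: "i \<in> idx n \<Longrightarrow> 0 \<le> mass i * cell_test \<phi> k i"
  by (intro mult_nonneg_nonneg less_imp_le[OF mass_pos] cell_test_bounds(1))

lemma index_integral_test:
  assumes i: "i \<in> idx n"
  shows "index_integral k (\<lambda>y. ennreal (\<phi> y)) {i} = ennreal (mass i * cell_test \<phi> k i)"
proof -
  have f: "(\<lambda>y. ennreal (\<phi> y)) \<in> borel_measurable borel" using lip01D(6)[OF \<phi>] by simp
  have "ennreal (cell_test \<phi> k i) = index_integral k (\<lambda>y. ennreal (\<phi> y)) {i} / ennreal (mass i)"
    unfolding cell_test_def rho_cell_nn_integral[OF i f, symmetric]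
    by (rule nn_integral_lip01[OF \<phi> prob_space.finite_measure[OF rho_cell_prob_space[OF i]] sets_rho(2), symmetric])
  then have "ennreal (mass i) * ennreal (cell_test \<phi> k i)
      = index_integral k (\<lambda>y. ennreal (\<phi> y)) {i} * ennreal (mass i) / ennreal (mass i)"
    by (simp only: ennreal_times_divide mult.commute)
  also have "\<dots> = index_integral k (\<lambda>y. ennreal (\<phi> y)) {i}"
    using mass_pos[OF i] by (intro ennreal_mult_divide_eq) auto
  finally show ?thesis using mass_pos[OF i] cell_test_bounds(1)[OF i] by (simp add: ennreal_mult)
qed

lemma rho_comp_test:
  assumes J: "J \<subseteq> idx n" "J \<noteq> {}"
  shows "(LINT y|rho_comp Y \<mu> n (\<pi> k) J. \<phi> y) = (\<Sum>i\<in>J. mass i * cell_test \<phi> k i) / (\<Sum>i\<in>J. mass i)"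
proof -
  have f: "(\<lambda>y. ennreal (\<phi> y)) \<in> borel_measurable borel" using lip01D(6)[OF \<phi>] by simp
  note p = rho_comp_prob_on[OF J, of k]
  have fin: "finite J" using J finite_subset[OF _ finite_idx] by blast
  have pos: "0 < (\<Sum>i\<in>J. mass i)" using J fin mass_pos by (intro sum_pos) auto
  have nonneg: "0 \<le> mass i * cell_test \<phi> k i" if "i \<in> J" for i
    using that J(1) by (intro mass_test_nonneg) (rule subsetD)
  have "ennreal (LINT y|rho_comp Y \<mu> n (\<pi> k) J. \<phi> y) = (\<Sum>i\<in>J. index_integral k (\<lambda>y. ennreal (\<phi> y)) {i}) / ennreal (\<Sum>i\<in>J. mass i)"
    unfolding rho_comp_nn_integral[OF J f, symmetric]
    by (rule nn_integral_lip01[OF \<phi> prob_space.finite_measure[OF prob_onD(3)[OF p]] sets_rho(1), symmetric])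
  also have "\<dots> = ennreal ((\<Sum>i\<in>J. mass i * cell_test \<phi> k i) / (\<Sum>i\<in>J. mass i))"
    using J pos nonneg by (simp add: index_integral_test subset_iff sum_ennreal divide_ennreal sum_nonneg)
  finally show ?thesis
    using integral_lip01_bounds(1)[OF \<phi> prob_onD(3)[OF p] sets_rho(1)] pos nonneg by (simp add: sum_nonneg)
qed

text \<open>The groups of this step are the composite cells in which it rearranges mass, so the averages over
  them do not change. The factor \<open>a\<close> allows for rescaled masses.\<close>

lemma group_average_conserved:
  assumes i: "i \<in> idx n" and k: "1 \<le> k" and a: "0 < a"
  shows "group_average n (shifted_coords k) (\<lambda>i. a * mass i) (cell_test \<phi> k) i
    = group_average n (shifted_coords k) (\<lambda>i. a * mass i) (cell_test \<phi> (k - 1)) i"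
proof -
  define J where "J = group n (shifted_coords k) i"
  have J: "J \<in> composites n k" unfolding J_def composites_eq_groups using i by (rule imageI)
  have f: "(\<lambda>y. ennreal (\<phi> y)) \<in> borel_measurable borel" using lip01D(6)[OF \<phi>] by simp
  have nonneg: "0 \<le> mass i * cell_test \<phi> k' i" if "i \<in> J" for i k'
    using that composites_partition(1)[OF J] by (intro mass_test_nonneg) (rule subsetD)
  have e: "index_integral k' (\<lambda>y. ennreal (\<phi> y)) J = ennreal (\<Sum>i\<in>J. mass i * cell_test \<phi> k' i)" for k'
  proof -
    have "index_integral k' (\<lambda>y. ennreal (\<phi> y)) J = (\<Sum>i\<in>J. ennreal (mass i * cell_test \<phi> k' i))"
      unfolding index_integral_sum[OF f composites_partition(2)[OF J], symmetric]
      using composites_partition(1)[OF J] by (intro sum.cong refl index_integral_test) (rule subsetD)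
    also have "\<dots> = ennreal (\<Sum>i\<in>J. mass i * cell_test \<phi> k' i)" by (rule sum_ennreal) (rule nonneg)
    finally show ?thesis .
  qed
  have "ennreal (\<Sum>i\<in>J. mass i * cell_test \<phi> k i) = ennreal (\<Sum>i\<in>J. mass i * cell_test \<phi> (k - 1) i)"
    using composite_mass_conserved[OF k J f] unfolding e .
  moreover have nn: "0 \<le> (\<Sum>i\<in>J. mass i * cell_test \<phi> k' i)" for k' by (intro sum_nonneg nonneg)
  ultimately have "(\<Sum>i\<in>J. mass i * cell_test \<phi> k i) = (\<Sum>i\<in>J. mass i * cell_test \<phi> (k - 1) i)"
    unfolding ennreal_inj[OF nn nn] by blast
  then have "(\<Sum>i\<in>J. a * mass i * cell_test \<phi> k i) = (\<Sum>i\<in>J. a * mass i * cell_test \<phi> (k - 1) i)"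
    unfolding mult.assoc sum_distrib_left[symmetric] by (rule arg_cong)
  then show ?thesis unfolding group_average_def group_sum_def J_def by (rule arg_cong)
qed

lemma total_test: "(\<Sum>i\<in>idx n. mass i * cell_test \<phi> k i) = (LINT y|\<nu>n. \<phi> y)"
proof -
  have f: "(\<lambda>y. ennreal (\<phi> y)) \<in> borel_measurable borel" using lip01D(6)[OF \<phi>] by simp
  note nonneg = mass_test_nonneg
  have "ennreal (\<Sum>i\<in>idx n. mass i * cell_test \<phi> k i) = (\<Sum>i\<in>idx n. index_integral k (\<lambda>y. ennreal (\<phi> y)) {i})"
  proof -
    have "(\<Sum>i\<in>idx n. index_integral k (\<lambda>y. ennreal (\<phi> y)) {i}) = (\<Sum>i\<in>idx n. ennreal (mass i * cell_test \<phi> k i))"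
      by (intro sum.cong refl index_integral_test)
    also have "\<dots> = ennreal (\<Sum>i\<in>idx n. mass i * cell_test \<phi> k i)" by (rule sum_ennreal) (rule nonneg)
    finally show ?thesis by (rule sym)
  qed
  also have "\<dots> = ennreal (LINT y|\<nu>n. \<phi> y)"
    unfolding total_integral[OF f]
    by (rule nn_integral_lip01[OF \<phi> prob_space.finite_measure[OF prob_onD(3)[OF \<nu>n]] prob_onD(1)[OF \<nu>n]])
  finally have eq: "ennreal (\<Sum>i\<in>idx n. mass i * cell_test \<phi> k i) = ennreal (LINT y|\<nu>n. \<phi> y)" .
  have nn: "0 \<le> (\<Sum>i\<in>idx n. mass i * cell_test \<phi> k i)" by (intro sum_nonneg nonneg)
  show ?thesis
    using eq unfolding ennreal_inj[OF nn integral_lip01_bounds(1)[OF \<phi> prob_onD(3)[OF \<nu>n] prob_onD(1)[OF \<nu>n]]] .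
qed

end

text \<open>The kernel depends on \<open>x\<close> only through the set of composite cells that contain \<open>x\<close>, and there are
  only finitely many such sets, each of them attained on a Borel set. The family \<open>p\<close> collects the
  iterates at all resolutions, and \<open>\<pi>\<close> is its member at resolution \<open>n\<close>.\<close>

lemma kernel_disc:
  assumes ps: "p n = \<pi>"
  shows "kernel unit_cube Y (disc_kernel Y \<mu> p n t)"
proof -
  define k where "k = nat \<lfloor>real n * t\<rfloor>"
  define S where "S x = {J \<in> composites n k. x \<in> comp_cell n J}" for x :: "real^'n"
  define H where "H T = rho_comp Y \<mu> n (\<pi> k) (SOME J. J \<in> T)" for T
  let ?A = "Pow (composites n k) - {{} :: (nat^'n) set set}"
  let ?M = "restrict_space borel (unit_cube :: (real^'n) set)"
  have dk: "disc_kernel Y \<mu> p n t x = H (S x)" for x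
    unfolding disc_kernel_def Let_def k_def[symmetric] ps H_def S_def mem_Collect_eq by (rule refl)
  have SA: "S x \<in> ?A" if x: "x \<in> unit_cube" for x
  proof -
    obtain i where i: "i \<in> idx n" "x \<in> cell n i" using unit_cube_covered[OF n x] by blast
    have "group n (shifted_coords k) i \<in> composites n k" unfolding composites_eq_groups using i(1) by (rule imageI)
    moreover have "x \<in> comp_cell n (group n (shifted_coords k) i)"
      unfolding comp_cell_def using group_self[OF i(1)] i(2) by blast
    ultimately show ?thesis unfolding S_def by blast
  qed
  have HA: "H T \<in> prob_on Y" if T: "T \<in> ?A" for T
  proof -
    have "(SOME J. J \<in> T) \<in> T" using T by (intro some_in_eq[THEN iffD2]) blast
    then have J: "(SOME J. J \<in> T) \<in> composites n k" using T by blast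
    then have "(SOME J. J \<in> T) \<noteq> {}" using composites_partition(4)[OF J] group_self by fastforce
    then show ?thesis unfolding H_def by (rule rho_comp_prob_on[OF composites_partition(1)[OF J]])
  qed
  have "S \<in> measurable ?M (count_space ?A)"
  proof (subst measurable_count_space_eq2)
    show "finite ?A" using finite_composites by simp
    have "S -` {T} \<inter> space ?M \<in> sets ?M" if T: "T \<in> ?A" for T
    proof -
      have "S -` {T} = (\<Inter>J\<in>composites n k. if J \<in> T then comp_cell n J else - comp_cell n J)"
      proof (intro set_eqI)
        fix x
        show "x \<in> S -` {T} \<longleftrightarrow> x \<in> (\<Inter>J\<in>composites n k. if J \<in> T then comp_cell n J else - comp_cell n J)"
          using T by (auto simp: S_def split: if_splits)
      qed
      moreover have "composites n k \<noteq> ({} :: (nat^'n) set set)" using T by auto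
      moreover have "(if J \<in> T then comp_cell n J else - comp_cell n J) \<in> sets borel" if "J \<in> composites n k" for J
        using comp_cell_borel[OF that] by auto
      ultimately have "S -` {T} \<in> sets borel" by (simp only:) (intro sets.finite_INT finite_composites)
      then show ?thesis by (auto simp: sets_restrict_space space_restrict_space)
    qed
    then show "S \<in> space ?M \<rightarrow> ?A \<and> (\<forall>a\<in>?A. S -` {a} \<inter> space ?M \<in> sets ?M)"
      using SA by (auto simp: space_restrict_space)
  qed
  moreover have "H \<in> measurable (count_space ?A) (prob_algebra borel)"
    using prob_onD(1,3)[OF HA] unfolding measurable_count_space_eq1 Pi_iff space_prob_algebra by blast
  ultimately have "(\<lambda>x. H (S x)) \<in> measurable ?M (prob_algebra borel)" by (rule measurable_compose)
  then show ?thesis using SA HA by (simp add: kernel_def dk[abs_def])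
qed

end

section \<open>Uniform estimates for the discrete trajectories\<close>

lemma cell_index_coarsen:
  assumes x: "x \<in> unit_cube" and n: "n = M * b" and b: "0 < b"
  shows "cell_index M x = (\<chi> m. cell_index n x $ m div b)"
proof -
  have "nat \<lfloor>real M * x $ m\<rfloor> = nat \<lfloor>real n * x $ m\<rfloor> div b" for m
  proof -
    have "\<lfloor>real M * x $ m\<rfloor> = \<lfloor>(real n * x $ m) / real_of_int (int b)\<rfloor>" using b by (simp add: n)
    also have "\<dots> = \<lfloor>real n * x $ m\<rfloor> div int b" by (rule floor_divide_real_eq_div) simp
    finally show ?thesis using b x by (simp add: mem_unit_cube nat_div_distrib)
  qed
  then show ?thesis by (simp add: cell_index_def vec_eq_iff)
qed

text \<open>Bounds that are uniform in \<open>n\<close>: the rescaled masses are comparable to one, and the variations on the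
  grid are of order \<open>n ^ (CARD('n) - 1)\<close>, the number of lines in a coordinate direction.\<close>

locale dd_regular = dd_iterates Y \<mu> \<mu>n \<nu>n n \<pi> \<pi>J
  for Y :: "(real^'n::finite) set" and \<mu> \<mu>n \<nu>n n \<pi> \<pi>J +
  fixes Ml Mu G W :: real
  assumes even: "even n" and Ml: "0 < Ml" and \<mu>_generic: "AE x in \<mu>. x \<in> generic n"
    and mass_bounds: "\<And>i. i \<in> idx n \<Longrightarrow> Ml \<le> real n ^ CARD('n) * mass i"
      "\<And>i. i \<in> idx n \<Longrightarrow> real n ^ CARD('n) * mass i \<le> Mu"
    and mass_variation: "\<And>l. step_variation n 2 l (\<lambda>i. real n ^ CARD('n) * mass i) \<le> G * real n ^ (CARD('n) - 1)"
    and W: "0 \<le> W" "\<And>k. WTVB Y \<mu> n (\<pi> k) \<le> ennreal W"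
begin

definition weight :: "nat^'n \<Rightarrow> real" where
  "weight i = real n ^ CARD('n) * mass i"

lemma weight_bounds: "i \<in> idx n \<Longrightarrow> Ml \<le> weight i" "i \<in> idx n \<Longrightarrow> weight i \<le> Mu"
  using mass_bounds by (simp_all add: weight_def)

lemma weight_variation: "step_variation n 2 l weight \<le> G * real n ^ (CARD('n) - 1)"
  using mass_variation by (simp add: weight_def[abs_def])

text \<open>A test changes by at most its Lipschitz constant times the Wasserstein distance, so the basic cell
  variation bounds the variation of the cell averages of every test.\<close>

lemma cell_test_variation:
  assumes \<phi>: "\<phi> \<in> lip01 L" and L: "0 < L"
  shows "step_variation n 2 l (cell_test \<phi> k) \<le> L * W * real n ^ (CARD('n) - 1)"
proof -
  define I where "I = {i \<in> idx n. i $ l + 2 < n}"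
  define P where "P = {(i, i'). i \<in> (idx n :: (nat^'n) set) \<and> i' \<in> idx n \<and> (\<exists>l. i = i' + axis l 2)}"
  define V where "V = (\<lambda>(i, i'). W1 (rho_cell Y \<mu> n (\<pi> k) i) (rho_cell Y \<mu> n (\<pi> k) i'))"
  have finP: "finite P" by (rule finite_subset[of _ "idx n \<times> idx n"]) (auto simp: P_def)
  have np: "0 < real n ^ (CARD('n) - 1)" using n by simp
  have "ennreal (step_variation n 2 l (cell_test \<phi> k)) = (\<Sum>i\<in>I. ennreal \<bar>cell_test \<phi> k (i + axis l 2) - cell_test \<phi> k i\<bar>)"
    unfolding step_variation_def I_def by (subst sum.inter_filter[symmetric]) (simp_all add: sum_ennreal)
  also have "\<dots> \<le> (\<Sum>i\<in>I. ennreal L * V (i + axis l 2, i))"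
  proof (rule sum_mono)
    fix i assume "i \<in> I"
    then have "i + axis l 2 \<in> idx n" using add_axis_idx[of i n l 2] by (simp add: I_def)
    from test_difference_le_W1[OF rho_cell_prob_space[OF this] \<phi> L]
    show "ennreal \<bar>cell_test \<phi> k (i + axis l 2) - cell_test \<phi> k i\<bar> \<le> ennreal L * V (i + axis l 2, i)"
      by (simp add: cell_test_def V_def)
  qed
  also have "\<dots> = ennreal L * (\<Sum>p\<in>(\<lambda>i. (i + axis l 2, i)) ` I. V p)"
    by (subst sum.reindex) (auto simp: inj_on_def sum_distrib_left)
  also have "\<dots> \<le> ennreal L * (\<Sum>p\<in>P. V p)"
    using finP add_axis_idx[of _ n l 2] by (intro mult_left_mono sum_mono2) (auto simp: I_def P_def)
  also have "(\<Sum>p\<in>P. V p) = ennreal (real n ^ (CARD('n) - 1)) * WTVB Y \<mu> n (\<pi> k)"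
  proof -
    have "ennreal x * ennreal (1 / x) = 1" if "0 < x" for x using that by (simp flip: ennreal_mult)
    from this[OF np] show ?thesis unfolding WTVB_def P_def V_def by (simp add: mult.assoc[symmetric])
  qed
  also have "ennreal L * (ennreal (real n ^ (CARD('n) - 1)) * WTVB Y \<mu> n (\<pi> k))
      \<le> ennreal L * (ennreal (real n ^ (CARD('n) - 1)) * ennreal W)"
    using W(2) by (intro mult_left_mono) auto
  also have "\<dots> = ennreal (L * W * real n ^ (CARD('n) - 1))"
    using L W(1) np by (simp add: ennreal_mult mult_ac)
  finally show ?thesis using L W(1) np by (subst (asm) ennreal_le_iff) auto
qed

text \<open>The average of the test over the composite cell of \<open>i\<close> in the partition belonging to the iterate
  \<open>k\<close>: the value of the discrete trajectory, integrated against the test, on the basic cell \<open>i\<close>.\<close>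

definition comp_average :: "(real^'n \<Rightarrow> real) \<Rightarrow> nat \<Rightarrow> nat^'n \<Rightarrow> real" where
  "comp_average \<phi> k i = group_average n (shifted_coords k) weight (cell_test \<phi> k) i"

text \<open>A Lipschitz constant for the time dependence, up to the bound on the density: one step of duration
  \<open>1 / n\<close> changes the composite averages by at most this amount times \<open>n ^ (CARD('n) - 1)\<close> in total,
  while a cell has mass of order \<open>1 / n ^ CARD('n)\<close>.\<close>

definition speed :: "real \<Rightarrow> real" where
  "speed L = 2 ^ CARD('n) / Ml * (real CARD('n) * (Mu * (L * W) + 2 * G + 4 * Mu))"

lemma comp_average_eq_test:
  assumes \<phi>: "\<phi> \<in> lip01 L" and i: "i \<in> idx n"
  shows "(LINT y|rho_comp Y \<mu> n (\<pi> k) (group n (shifted_coords k) i). \<phi> y) = comp_average \<phi> k i"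
proof -
  have ne: "group n (shifted_coords k) i \<noteq> {}" using group_self[OF i] by blast
  have sub: "group n (shifted_coords k) i \<subseteq> idx n" by (auto simp: group_def)
  have "comp_average \<phi> k i = (real n ^ CARD('n) * (\<Sum>j\<in>group n (shifted_coords k) i. mass j * cell_test \<phi> k j))
      / (real n ^ CARD('n) * (\<Sum>j\<in>group n (shifted_coords k) i. mass j))"
    unfolding comp_average_def group_average_def group_sum_def weight_def sum_distrib_left mult.assoc ..
  also have "\<dots> = (LINT y|rho_comp Y \<mu> n (\<pi> k) (group n (shifted_coords k) i). \<phi> y)"
    unfolding rho_comp_test[OF \<phi> sub ne] using n by (intro mult_divide_mult_cancel_left) simp
  finally show ?thesis by (rule sym)
qed

lemma kernel_test:
  assumes \<phi>: "\<phi> \<in> lip01 L" and x: "x \<in> generic n" and ps: "p n = \<pi>"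
  shows "(LINT y|disc_kernel Y \<mu> p n t x. \<phi> y) = comp_average \<phi> (nat \<lfloor>real n * t\<rfloor>) (cell_index n x)"
proof -
  define k where "k = nat \<lfloor>real n * t\<rfloor>"
  let ?J = "SOME J. J \<in> composites n k \<and> x \<in> comp_cell n J"
  note ix = generic_cell_index(1)[OF n x]
  let ?Jx = "group n (shifted_coords k) (cell_index n x)"
  have J0: "?Jx \<in> composites n k" unfolding composites_eq_groups using ix by (rule imageI)
  have "x \<in> comp_cell n ?Jx"
    unfolding generic_comp_cell[OF n x composites_partition(1)[OF J0]] using group_self[OF ix] .
  with J0 have "?Jx \<in> composites n k \<and> x \<in> comp_cell n ?Jx" by (rule conjI)
  then have *: "?J \<in> composites n k \<and> x \<in> comp_cell n ?J" by (rule someI)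
  note J = conjunct1[OF *] conjunct2[OF *]
  from J(2) have "cell_index n x \<in> ?J" unfolding generic_comp_cell[OF n x composites_partition(1)[OF J(1)]] .
  from composites_partition(3)[OF J(1) this] have e: "?J = ?Jx" .
  have "disc_kernel Y \<mu> p n t x = rho_comp Y \<mu> n (p n k) ?J"
    unfolding disc_kernel_def Let_def k_def[symmetric] by (rule refl)
  also have "\<dots> = rho_comp Y \<mu> n (\<pi> k) ?Jx" by (simp only: ps e)
  finally show ?thesis unfolding k_def[symmetric] using comp_average_eq_test[OF \<phi> ix, of k] by (simp only:)
qed

lemma Mu_nonneg: "0 \<le> Mu"
proof -
  have z: "(\<chi> m. 0) \<in> idx n" using n by (simp add: idx_def)
  show ?thesis using weight_bounds[OF z] Ml by linarith
qed

context
  fixes \<phi> :: "real^'n \<Rightarrow> real" and L :: real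
  assumes \<phi>: "\<phi> \<in> lip01 L" and L: "0 < L"
begin

text \<open>Passing from one partition to the other moves the averages by the variation of the cell averages and
  of the masses.\<close>

lemma shift_difference:
  "(\<Sum>i\<in>idx n. \<bar>group_average n {} weight (cell_test \<phi> k) i - group_average n UNIV weight (cell_test \<phi> k) i\<bar>)
    \<le> speed L * real n ^ (CARD('n) - 1)"
proof -
  let ?N = "real n ^ (CARD('n) - 1)"
  have "(\<Sum>i\<in>idx n. \<bar>group_average n {} weight (cell_test \<phi> k) i - group_average n UNIV weight (cell_test \<phi> k) i\<bar>)
    \<le> 2 ^ CARD('n) / Ml * (\<Sum>l\<in>UNIV. Mu * step_variation n 2 l (cell_test \<phi> k) + 2 * step_variation n 2 l weight + 4 * Mu * ?N)"
    by (rule group_average_shift_difference[OF even n Ml weight_bounds cell_test_bounds[OF \<phi>]])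
  also have "\<dots> \<le> 2 ^ CARD('n) / Ml * (\<Sum>l\<in>(UNIV :: 'n set). Mu * (L * W * ?N) + 2 * (G * ?N) + 4 * Mu * ?N)"
    using Ml Mu_nonneg
    by (intro mult_left_mono sum_mono add_mono cell_test_variation[OF \<phi> L] weight_variation order.refl) auto
  also have "\<dots> = speed L * ?N" by (simp add: speed_def algebra_simps)
  finally show ?thesis .
qed

text \<open>The current composite averages of two consecutive iterates are averages of the same iterate
  over the two kinds of composite cells, because a step conserves the mass of its composite
  cells.\<close>

lemma comp_average_step: "(\<Sum>i\<in>idx n. \<bar>comp_average \<phi> k i - comp_average \<phi> (Suc k) i\<bar>) \<le> speed L * real n ^ (CARD('n) - 1)"
proof -
  have "(\<Sum>i\<in>idx n. \<bar>comp_average \<phi> k i - comp_average \<phi> (Suc k) i\<bar>)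
    = (\<Sum>i\<in>idx n. \<bar>group_average n {} weight (cell_test \<phi> k) i - group_average n UNIV weight (cell_test \<phi> k) i\<bar>)"
  proof (rule sum.cong[OF refl])
    fix i :: "nat^'n" assume i: "i \<in> idx n"
    have np: "0 < real n ^ CARD('n)" using n by simp
    have "comp_average \<phi> (Suc k) i = group_average n (shifted_coords (Suc k)) weight (cell_test \<phi> k) i"
      using group_average_conserved[OF \<phi> i, of "Suc k", OF _ np] by (simp add: comp_average_def weight_def[abs_def])
    then show "\<bar>comp_average \<phi> k i - comp_average \<phi> (Suc k) i\<bar>
      = \<bar>group_average n {} weight (cell_test \<phi> k) i - group_average n UNIV weight (cell_test \<phi> k) i\<bar>"
      by (cases "odd k") (simp_all add: comp_average_def shifted_coords_def abs_minus_commute)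
  qed
  then show ?thesis using shift_difference by simp
qed

text \<open>The steps between \<open>k\<close> and \<open>k'\<close> add up.\<close>

lemma comp_average_lipschitz:
  "(\<Sum>i\<in>idx n. \<bar>comp_average \<phi> k i - comp_average \<phi> k' i\<bar>) \<le> \<bar>real k - real k'\<bar> * (speed L * real n ^ (CARD('n) - 1))"
proof -
  have "(\<Sum>i\<in>idx n. \<bar>comp_average \<phi> k i - comp_average \<phi> (k + j) i\<bar>) \<le> real j * (speed L * real n ^ (CARD('n) - 1))" for k j
  proof (induction j)
    case (Suc j)
    have "(\<Sum>i\<in>idx n. \<bar>comp_average \<phi> k i - comp_average \<phi> (k + Suc j) i\<bar>)
      \<le> (\<Sum>i\<in>idx n. \<bar>comp_average \<phi> k i - comp_average \<phi> (k + j) i\<bar> + \<bar>comp_average \<phi> (k + j) i - comp_average \<phi> (Suc (k + j)) i\<bar>)"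
      by (intro sum_mono) simp
    also have "\<dots> = (\<Sum>i\<in>idx n. \<bar>comp_average \<phi> k i - comp_average \<phi> (k + j) i\<bar>) + (\<Sum>i\<in>idx n. \<bar>comp_average \<phi> (k + j) i - comp_average \<phi> (Suc (k + j)) i\<bar>)"
      by (rule sum.distrib)
    also have "\<dots> \<le> real j * (speed L * real n ^ (CARD('n) - 1)) + speed L * real n ^ (CARD('n) - 1)"
      by (intro add_mono Suc comp_average_step)
    finally show ?case by (simp add: algebra_simps)
  qed simp
  from this[of k "k' - k"] this[of k' "k - k'"] show ?thesis
    by (cases "k \<le> k'") (simp_all add: abs_minus_commute of_nat_diff)
qed

text \<open>The averages over the shifted partition are first replaced by those over the unshifted one. The
  latter are constant on composite cells, and their variation on the grid of composite cells is
  controlled by variation at step two on the fine grid, so block averaging applies.\<close>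

lemma comp_average_coarse_approximation:
  assumes nMb: "n = 2 * (M * b)" and M: "0 < M" and b: "0 < b"
  obtains w where "\<And>\<alpha>. \<alpha> \<in> idx M \<Longrightarrow> 0 \<le> w \<alpha> \<and> w \<alpha> \<le> 1"
    "(\<Sum>i\<in>idx n. \<bar>comp_average \<phi> k i - w (\<chi> m. i $ m div (2 * b))\<bar>)
      \<le> (1 + 2 ^ CARD('n) * real b) * speed L * real n ^ (CARD('n) - 1)"
proof -
  let ?N = "real n ^ (CARD('n) - 1)"
  define A where "A = group_average n {} weight (cell_test \<phi> k)"
  define dbl :: "nat^'n \<Rightarrow> nat^'n" where "dbl a = (\<chi> m. 2 * a $ m)" for a
  define hlf :: "nat^'n \<Rightarrow> nat^'n" where "hlf i = (\<chi> m. i $ m div 2)" for i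
  define v where "v a = A (dbl a)" for a
  have A01: "0 \<le> A i \<and> A i \<le> 1" if "i \<in> idx n" for i
    unfolding A_def using that
    by (intro conjI group_average_bounds[OF even n Ml weight_bounds cell_test_bounds[OF \<phi>]])
  have dbl_idx: "dbl a \<in> idx n" if "a \<in> idx (M * b)" for a
    using that by (auto simp: dbl_def idx_def nMb)
  have hlf_idx: "hlf i \<in> idx (M * b)" if "i \<in> idx n" for i
    using that by (auto simp: hlf_def idx_def nMb less_mult_imp_div_less mult.commute)
  have A_hlf: "A i = v (hlf i)" for i
  proof -
    have "group n {} (dbl (hlf i)) = group n {} i" by (simp add: group_def pair_label_def dbl_def hlf_def)
    then show ?thesis by (simp add: A_def v_def group_average_def group_sum_def)
  qed
  have varA: "step_variation n 2 l A \<le> 2 ^ CARD('n) / Ml * (Mu * (L * W * ?N) + 2 * (G * ?N))" for l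
  proof -
    have "step_variation n 2 l A \<le> 2 ^ CARD('n) / Ml * (Mu * step_variation n 2 l (cell_test \<phi> k) + 2 * step_variation n 2 l weight)"
      unfolding A_def by (rule step_variation_group_average[OF even n Ml weight_bounds cell_test_bounds[OF \<phi>]])
    also have "\<dots> \<le> 2 ^ CARD('n) / Ml * (Mu * (L * W * ?N) + 2 * (G * ?N))"
      using Ml Mu_nonneg by (intro mult_left_mono add_mono cell_test_variation[OF \<phi> L] weight_variation) auto
    finally show ?thesis .
  qed
  have varv: "step_variation (M * b) 1 l v \<le> step_variation n 2 l A" for l
  proof -
    have "step_variation (M * b) 1 l v
        = (\<Sum>a\<in>idx (M * b). (\<lambda>i. if i $ l + 2 < n then \<bar>A (i + axis l 2) - A i\<bar> else 0) (dbl a))"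
      unfolding step_variation_def
    proof (rule sum.cong[OF refl])
      fix a :: "nat^'n"
      have "dbl (a + axis l 1) = dbl a + axis l 2" by (simp add: dbl_def vec_eq_iff axis_nth_if)
      moreover have "(dbl a $ l + 2 < n) = (a $ l + 1 < M * b)" by (auto simp: dbl_def nMb)
      ultimately show "(if a $ l + 1 < M * b then \<bar>v (a + axis l 1) - v a\<bar> else 0)
        = (\<lambda>i. if i $ l + 2 < n then \<bar>A (i + axis l 2) - A i\<bar> else 0) (dbl a)" by (simp only: v_def)
    qed
    also have "\<dots> = (\<Sum>i\<in>dbl ` idx (M * b). if i $ l + 2 < n then \<bar>A (i + axis l 2) - A i\<bar> else 0)"
      by (subst sum.reindex) (auto simp: inj_on_def dbl_def vec_eq_iff)
    also have "\<dots> \<le> step_variation n 2 l A"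
      unfolding step_variation_def using dbl_idx by (intro sum_mono2) auto
    finally show ?thesis .
  qed
  obtain w0 where w0: "\<And>a. a \<in> idx (M * b) \<Longrightarrow> 0 \<le> w0 a \<and> w0 a \<le> 1"
    "\<And>a a'. a \<in> idx (M * b) \<Longrightarrow> a' \<in> idx (M * b) \<Longrightarrow> (\<And>m. a $ m div b = a' $ m div b) \<Longrightarrow> w0 a = w0 a'"
    "(\<Sum>a\<in>idx (M * b). \<bar>v a - w0 a\<bar>) \<le> real b * (\<Sum>l\<in>UNIV. step_variation (M * b) 1 l v)"
  proof (rule block_approximation[OF b M, of v])
    show "0 \<le> v a \<and> v a \<le> 1" if "a \<in> idx (M * b)" for a
      unfolding v_def by (rule A01[OF dbl_idx[OF that]])
  next
    fix w assume a: "\<And>a. a \<in> idx (M * b) \<Longrightarrow> 0 \<le> w a \<and> w a \<le> 1"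
      and b: "\<And>a a'. a \<in> idx (M * b) \<Longrightarrow> a' \<in> idx (M * b) \<Longrightarrow> (\<And>m. a $ m div b = a' $ m div b) \<Longrightarrow> w a = w a'"
      and c: "(\<Sum>a\<in>idx (M * b). \<bar>v a - w a\<bar>) \<le> real b * (\<Sum>l\<in>UNIV. step_variation (M * b) 1 l v)"
    show thesis by (rule that[OF a b c])
  qed
  define w where "w \<alpha> = w0 (\<chi> m. b * \<alpha> $ m)" for \<alpha>
  have sc: "(\<chi> m. b * \<alpha> $ m) \<in> idx (M * b)" if "\<alpha> \<in> idx M" for \<alpha> :: "nat^'n"
    using that b by (auto simp: idx_def)
  have w_eq: "w0 (hlf i) = w (\<chi> m. i $ m div (2 * b))" if i: "i \<in> idx n" for i
  proof -
    have "(\<chi> m. i $ m div (2 * b)) \<in> idx M"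
      using i b by (auto simp: idx_def nMb less_mult_imp_div_less mult_ac)
    from sc[OF this] show ?thesis unfolding w_def
      using hlf_idx[OF i] b by (intro w0(2)) (simp_all add: hlf_def div_mult2_eq)
  qed
  have AB: "(\<Sum>i\<in>idx n. \<bar>comp_average \<phi> k i - A i\<bar>) \<le> speed L * ?N"
  proof (cases "odd k")
    case True
    have "0 \<le> (\<Sum>i\<in>idx n. \<bar>group_average n {} weight (cell_test \<phi> k) i - group_average n UNIV weight (cell_test \<phi> k) i\<bar>)"
      by (intro sum_nonneg) simp
    from this shift_difference[of k] have "0 \<le> speed L * ?N" by (rule order.trans)
    then show ?thesis using True by (simp add: comp_average_def A_def shifted_coords_def)
  next
    case False
    then show ?thesis
      using shift_difference[of k] by (simp add: comp_average_def A_def shifted_coords_def abs_minus_commute)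
  qed
  have fold: "(\<Sum>i\<in>idx n. F (hlf i)) \<le> 2 ^ CARD('n) * (\<Sum>a\<in>idx (M * b). F a)"
    if F: "\<And>a. 0 \<le> F a" for F :: "nat^'n \<Rightarrow> real"
  proof -
    define E where "E j = (if j \<in> dbl ` idx (M * b) then F (hlf j) else 0)" for j
    have hd: "hlf (dbl a) = a" for a by (simp add: hlf_def dbl_def)
    have "(\<Sum>i\<in>idx n. F (hlf i)) = (\<Sum>i\<in>idx n. \<Sum>j\<in>{dbl (hlf i)}. E j)"
      using hlf_idx by (intro sum.cong refl) (simp add: E_def hd)
    also have "\<dots> \<le> 2 ^ CARD('n) * (\<Sum>j\<in>idx n. E j)"
    proof (rule sum_over_groups_le[where L = "{}"])
      show "{dbl (hlf i)} \<subseteq> group n {} i" if "i \<in> idx n" for i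
        using dbl_idx[OF hlf_idx[OF that]] by (simp add: group_def pair_label_def dbl_def hlf_def)
    qed (simp add: E_def F)
    also have "(\<Sum>j\<in>idx n. E j) = (\<Sum>j\<in>dbl ` idx (M * b). F (hlf j))"
      unfolding E_def using dbl_idx by (subst sum.inter_restrict[symmetric]) (auto intro!: sum.cong)
    also have "\<dots> = (\<Sum>a\<in>idx (M * b). F a)"
      by (subst sum.reindex) (auto simp: hd intro!: inj_on_inverseI[of _ hlf])
    finally show ?thesis .
  qed
  have "(\<Sum>i\<in>idx n. \<bar>comp_average \<phi> k i - w (\<chi> m. i $ m div (2 * b))\<bar>)
    \<le> (\<Sum>i\<in>idx n. \<bar>comp_average \<phi> k i - A i\<bar> + \<bar>v (hlf i) - w0 (hlf i)\<bar>)"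
    using w_eq A_hlf by (intro sum_mono) (simp add: abs_triangle_ineq4[THEN order.trans])
  also have "\<dots> = (\<Sum>i\<in>idx n. \<bar>comp_average \<phi> k i - A i\<bar>) + (\<Sum>i\<in>idx n. \<bar>v (hlf i) - w0 (hlf i)\<bar>)"
    by (rule sum.distrib)
  also have "\<dots> \<le> speed L * ?N + 2 ^ CARD('n) * (real b * (speed L * ?N))"
  proof (intro add_mono AB)
    have "(\<Sum>i\<in>idx n. \<bar>v (hlf i) - w0 (hlf i)\<bar>) \<le> 2 ^ CARD('n) * (\<Sum>a\<in>idx (M * b). \<bar>v a - w0 a\<bar>)"
      by (rule fold) simp
    also have "\<dots> \<le> 2 ^ CARD('n) * (real b * (\<Sum>l\<in>UNIV. step_variation (M * b) 1 l v))"
      by (intro mult_left_mono w0(3)) simp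
    also have "\<dots> \<le> 2 ^ CARD('n) * (real b * (\<Sum>l\<in>(UNIV :: 'n set). 2 ^ CARD('n) / Ml * (Mu * (L * W * ?N) + 2 * (G * ?N))))"
      by (intro mult_left_mono sum_mono order.trans[OF varv varA]) simp_all
    also have "\<dots> \<le> 2 ^ CARD('n) * (real b * (speed L * ?N))"
    proof (intro mult_left_mono)
      have "(\<Sum>l\<in>(UNIV :: 'n set). 2 ^ CARD('n) / Ml * (Mu * (L * W * ?N) + 2 * (G * ?N)))
        = 2 ^ CARD('n) / Ml * (real CARD('n) * (Mu * (L * W) + 2 * G)) * ?N" by (simp add: algebra_simps)
      also have "\<dots> \<le> speed L * ?N"
        unfolding speed_def using Ml Mu_nonneg by (intro mult_right_mono mult_left_mono) auto
      finally show "(\<Sum>l\<in>(UNIV :: 'n set). 2 ^ CARD('n) / Ml * (Mu * (L * W * ?N) + 2 * (G * ?N))) \<le> speed L * ?N" .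
    qed simp_all
    finally show "(\<Sum>i\<in>idx n. \<bar>v (hlf i) - w0 (hlf i)\<bar>) \<le> 2 ^ CARD('n) * (real b * (speed L * ?N))" .
  qed
  also have "\<dots> = (1 + 2 ^ CARD('n) * real b) * speed L * ?N" by (simp add: algebra_simps)
  finally have est: "(\<Sum>i\<in>idx n. \<bar>comp_average \<phi> k i - w (\<chi> m. i $ m div (2 * b))\<bar>)
    \<le> (1 + 2 ^ CARD('n) * real b) * speed L * ?N" .
  show ?thesis
  proof (rule that[of w])
    show "0 \<le> w \<alpha> \<and> w \<alpha> \<le> 1" if "\<alpha> \<in> idx M" for \<alpha> using w0(1)[OF sc[OF that]] by (simp add: w_def)
  qed (rule est)
qed

end

lemma nn_integral_cell_function:
  fixes F :: "nat^'n \<Rightarrow> real"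
  assumes F: "\<And>i. i \<in> idx n \<Longrightarrow> 0 \<le> F i"
  shows "(\<integral>\<^sup>+ x. ennreal (F (cell_index n x)) \<partial>\<mu>) = ennreal (\<Sum>i\<in>idx n. mass i * F i)"
proof -
  have s: "sets \<mu> = sets borel" using \<mu> by (rule prob_onD)
  have "(\<integral>\<^sup>+ x. ennreal (F (cell_index n x)) \<partial>\<mu>) = (\<integral>\<^sup>+ x. (\<Sum>i\<in>idx n. ennreal (F i) * indicator (cell n i) x) \<partial>\<mu>)"
  proof (rule nn_integral_cong_AE, use \<mu>_generic in eventually_elim)
    fix x :: "real^'n" assume x: "x \<in> generic n"
    have "(\<Sum>i\<in>idx n. ennreal (F i) * indicator (cell n i) x) = (\<Sum>i\<in>idx n. if cell_index n x = i then ennreal (F i) else 0)"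
      using generic_cell_index(3)[OF n x] by (intro sum.cong refl) (simp add: indicator_def)
    then show "ennreal (F (cell_index n x)) = (\<Sum>i\<in>idx n. ennreal (F i) * indicator (cell n i) x)"
      using generic_cell_index(1)[OF n x] by simp
  qed
  also have "\<dots> = (\<Sum>i\<in>idx n. \<integral>\<^sup>+ x. ennreal (F i) * indicator (cell n i) x \<partial>\<mu>)"
    by (intro nn_integral_sum borel_measurable_times_ennreal borel_measurable_indicator borel_measurable_const)
       (simp add: s borel_cell)
  also have "\<dots> = (\<Sum>i\<in>idx n. ennreal (mass i * F i))"
  proof (rule sum.cong[OF refl])
    fix i :: "nat^'n" assume i: "i \<in> idx n"
    have "(\<integral>\<^sup>+ x. ennreal (F i) * indicator (cell n i) x \<partial>\<mu>) = ennreal (F i) * ennreal (mass i)"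
      using borel_cell[of n i] by (subst nn_integral_cmult_indicator) (simp_all add: s emeasure_mass)
    then show "(\<integral>\<^sup>+ x. ennreal (F i) * indicator (cell n i) x \<partial>\<mu>) = ennreal (mass i * F i)"
      using F[OF i] mass_pos[OF i] by (simp add: ennreal_mult mult.commute)
  qed
  also have "\<dots> = ennreal (\<Sum>i\<in>idx n. mass i * F i)"
    by (intro sum_ennreal mult_nonneg_nonneg F less_imp_le[OF mass_pos])
  finally show ?thesis .
qed

text \<open>Each cell has mass at most \<open>Mu / n ^ CARD('n)\<close>.\<close>

lemma nn_integral_cell_function_le:
  assumes F: "\<And>i. i \<in> idx n \<Longrightarrow> 0 \<le> F i" and S: "(\<Sum>i\<in>idx n. F i) \<le> C * real n ^ (CARD('n) - 1)"
  shows "(\<integral>\<^sup>+ x. ennreal (F (cell_index n x)) \<partial>\<mu>) \<le> ennreal (Mu * C / real n)"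
proof -
  have np: "real n ^ CARD('n) = real n ^ (CARD('n) - 1) * real n"
    by (metis One_nat_def Suc_pred mult.commute power_Suc zero_less_card_finite)
  have "(\<Sum>i\<in>idx n. mass i * F i) \<le> (\<Sum>i\<in>idx n. Mu / real n ^ CARD('n) * F i)"
  proof (intro sum_mono mult_right_mono F)
    fix i :: "nat^'n" assume "i \<in> idx n"
    then show "mass i \<le> Mu / real n ^ CARD('n)" using mass_bounds(2)[of i] n by (simp add: pos_le_divide_eq mult.commute)
  qed
  also have "\<dots> = Mu / real n ^ CARD('n) * (\<Sum>i\<in>idx n. F i)" by (rule sum_distrib_left[symmetric])
  also have "\<dots> \<le> Mu / real n ^ CARD('n) * (C * real n ^ (CARD('n) - 1))"
    using Mu_nonneg by (intro mult_left_mono S) simp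
  also have "\<dots> = Mu * C / real n" unfolding np using n by simp
  finally have "ennreal (\<Sum>i\<in>idx n. mass i * F i) \<le> ennreal (Mu * C / real n)" by (rule ennreal_leI)
  moreover have "(\<integral>\<^sup>+ x. ennreal (F (cell_index n x)) \<partial>\<mu>) = ennreal (\<Sum>i\<in>idx n. mass i * F i)"
    by (rule nn_integral_cell_function) (rule F)
  ultimately show ?thesis by (simp only:)
qed

lemma speed_nonneg:
  fixes \<phi> :: "real^'n \<Rightarrow> real"
  assumes L: "0 < L" and \<phi>: "\<phi> \<in> lip01 L"
  shows "0 \<le> speed L"
proof -
  have "0 \<le> (\<Sum>i\<in>idx n. \<bar>comp_average \<phi> 0 i - comp_average \<phi> (Suc 0) i\<bar>)" by (intro sum_nonneg) simp
  also have "\<dots> \<le> speed L * real n ^ (CARD('n) - 1)" by (rule comp_average_step[OF \<phi> L])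
  finally have "0 \<le> speed L * real n ^ (CARD('n) - 1)" .
  moreover have "0 < real n ^ (CARD('n) - 1)" using n by (intro zero_less_power) simp
  ultimately show ?thesis by (simp only: zero_le_mult_iff) linarith
qed

text \<open>The summand \<open>1 / n\<close> accounts for the trajectory being constant on time intervals of this length.\<close>

lemma trajectory_time:
  assumes \<phi>: "\<phi> \<in> lip01 L" and L: "0 < L" and ps: "p n = \<pi>" and st: "0 \<le> s" "0 \<le> t"
  shows "(\<integral>\<^sup>+ x. ennreal \<bar>(LINT y|disc_kernel Y \<mu> p n s x. \<phi> y) - (LINT y|disc_kernel Y \<mu> p n t x. \<phi> y)\<bar> \<partial>\<mu>)
    \<le> ennreal (Mu * speed L * (\<bar>s - t\<bar> + 1 / real n))"
proof -
  let ?k = "\<lambda>s. nat \<lfloor>real n * s\<rfloor>"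
  have fl: "real (?k s) \<le> real n * s" "real n * s < real (?k s) + 1" if "0 \<le> s" for s
    using that by (auto simp: of_nat_nat)
  have kk: "\<bar>real (?k s) - real (?k t)\<bar> \<le> real n * \<bar>s - t\<bar> + 1"
  proof -
    have "\<bar>real (?k s) - real (?k t)\<bar> \<le> \<bar>real n * s - real n * t\<bar> + 1" using fl[OF st(1)] fl[OF st(2)] by linarith
    also have "\<bar>real n * s - real n * t\<bar> = real n * \<bar>s - t\<bar>" by (simp add: abs_mult flip: right_diff_distrib)
    finally show ?thesis .
  qed
  have "(\<integral>\<^sup>+ x. ennreal \<bar>(LINT y|disc_kernel Y \<mu> p n s x. \<phi> y) - (LINT y|disc_kernel Y \<mu> p n t x. \<phi> y)\<bar> \<partial>\<mu>)
    = (\<integral>\<^sup>+ x. ennreal \<bar>comp_average \<phi> (?k s) (cell_index n x) - comp_average \<phi> (?k t) (cell_index n x)\<bar> \<partial>\<mu>)"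
    by (rule nn_integral_cong_AE, use \<mu>_generic in eventually_elim) (simp add: kernel_test[where p = p, OF \<phi> _ ps])
  also have "\<dots> \<le> ennreal (Mu * (\<bar>real (?k s) - real (?k t)\<bar> * speed L) / real n)"
    using comp_average_lipschitz[OF \<phi> L, of "?k s" "?k t"]
    by (intro nn_integral_cell_function_le[where F = "\<lambda>i. \<bar>comp_average \<phi> (?k s) i - comp_average \<phi> (?k t) i\<bar>"]) (simp_all add: mult.assoc)
  also have "\<dots> \<le> ennreal (Mu * ((real n * \<bar>s - t\<bar> + 1) * speed L) / real n)"
    using kk Mu_nonneg speed_nonneg[OF L \<phi>]
    by (intro ennreal_leI divide_right_mono mult_left_mono mult_right_mono) simp_all
  also have "Mu * ((real n * \<bar>s - t\<bar> + 1) * speed L) / real n = Mu * speed L * (\<bar>s - t\<bar> + 1 / real n)"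
    using n by (simp add: field_simps)
  finally show ?thesis .
qed

text \<open>At every time the trajectory is close to a function that is constant on cells of side \<open>1 / M\<close>. The
  number of values of such a function does not depend on \<open>n\<close>, which is the source of compactness.\<close>

lemma trajectory_space:
  assumes \<phi>: "\<phi> \<in> lip01 L" and L: "0 < L" and ps: "p n = \<pi>" and nMb: "n = 2 * (M * b)" and M: "0 < M" and b: "0 < b"
  shows "\<exists>w. (\<forall>\<alpha>\<in>idx M. 0 \<le> w \<alpha> \<and> w \<alpha> \<le> 1) \<and>
    (\<integral>\<^sup>+ x. ennreal \<bar>(LINT y|disc_kernel Y \<mu> p n t x. \<phi> y) - w (cell_index M x)\<bar> \<partial>\<mu>)
      \<le> ennreal (Mu * speed L * 2 ^ CARD('n) * (1 / real M + 1 / real n))"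
proof -
  let ?k = "nat \<lfloor>real n * t\<rfloor>"
  obtain w where w: "\<And>\<alpha>. \<alpha> \<in> idx M \<Longrightarrow> 0 \<le> w \<alpha> \<and> w \<alpha> \<le> 1"
    "(\<Sum>i\<in>idx n. \<bar>comp_average \<phi> ?k i - w (\<chi> m. i $ m div (2 * b))\<bar>)
      \<le> (1 + 2 ^ CARD('n) * real b) * speed L * real n ^ (CARD('n) - 1)"
    using comp_average_coarse_approximation[OF \<phi> L nMb M b] by blast
  have nM: "n = M * (2 * b)" "0 < 2 * b" using nMb b by simp_all
  have "(\<integral>\<^sup>+ x. ennreal \<bar>(LINT y|disc_kernel Y \<mu> p n t x. \<phi> y) - w (cell_index M x)\<bar> \<partial>\<mu>)
    = (\<integral>\<^sup>+ x. ennreal \<bar>comp_average \<phi> ?k (cell_index n x) - w (\<chi> m. cell_index n x $ m div (2 * b))\<bar> \<partial>\<mu>)"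
  proof (rule nn_integral_cong_AE, use \<mu>_generic in eventually_elim)
    fix x :: "real^'n" assume x: "x \<in> generic n"
    then have "x \<in> unit_cube" by (simp add: generic_def)
    from cell_index_coarsen[OF this nM] kernel_test[where p = p and t = t, OF \<phi> x ps]
    show "ennreal \<bar>(LINT y|disc_kernel Y \<mu> p n t x. \<phi> y) - w (cell_index M x)\<bar>
      = ennreal \<bar>comp_average \<phi> ?k (cell_index n x) - w (\<chi> m. cell_index n x $ m div (2 * b))\<bar>" by simp
  qed
  also have "\<dots> \<le> ennreal (Mu * ((1 + 2 ^ CARD('n) * real b) * speed L) / real n)"
    using w(2) by (intro nn_integral_cell_function_le[where F = "\<lambda>i. \<bar>comp_average \<phi> ?k i - w (\<chi> m. i $ m div (2 * b))\<bar>"]) simp_all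
  also have "\<dots> \<le> ennreal (Mu * speed L * 2 ^ CARD('n) * (1 / real M + 1 / real n))"
  proof (rule ennreal_leI)
    have "(1 + 2 ^ CARD('n) * real b) / real n \<le> 2 ^ CARD('n) * (1 / real M + 1 / real n)"
    proof -
      have "1 * (1 / real n) \<le> 2 ^ CARD('n) * (1 / real n)" by (intro mult_right_mono) simp_all
      then have "1 / real n \<le> 2 ^ CARD('n) * (1 / real n)" by simp
      moreover have "real b / real n \<le> 1 / real M" using M b by (simp add: nMb field_simps)
      then have "2 ^ CARD('n) * (real b / real n) \<le> 2 ^ CARD('n) * (1 / real M)" by (intro mult_left_mono) simp_all
      ultimately show ?thesis by (simp add: add_divide_distrib distrib_left)
    qed
    then have "Mu * speed L * ((1 + 2 ^ CARD('n) * real b) / real n) \<le> Mu * speed L * (2 ^ CARD('n) * (1 / real M + 1 / real n))"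
      using Mu_nonneg speed_nonneg[OF L \<phi>] by (intro mult_left_mono) simp_all
    then show "Mu * ((1 + 2 ^ CARD('n) * real b) * speed L) / real n \<le> Mu * speed L * 2 ^ CARD('n) * (1 / real M + 1 / real n)"
      by (simp add: mult_ac)
  qed
  finally show ?thesis using w(1) by (intro exI[of _ w]) simp
qed

text \<open>Averaging over composite cells keeps the total, which is the integral against the second marginal.\<close>

lemma trajectory_marginal:
  assumes \<phi>: "\<phi> \<in> lip01 L" and ps: "p n = \<pi>"
  shows "(\<integral>\<^sup>+ x. ennreal (LINT y|disc_kernel Y \<mu> p n t x. \<phi> y) \<partial>\<mu>) = ennreal (LINT y|\<nu>n. \<phi> y)"
proof -
  let ?k = "nat \<lfloor>real n * t\<rfloor>"
  have c0: "0 \<le> comp_average \<phi> ?k i" if i: "i \<in> idx n" for i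
    unfolding comp_average_def by (rule group_average_bounds(1)[OF even n Ml weight_bounds cell_test_bounds[OF \<phi>] i])
  have "(\<integral>\<^sup>+ x. ennreal (LINT y|disc_kernel Y \<mu> p n t x. \<phi> y) \<partial>\<mu>) = (\<integral>\<^sup>+ x. ennreal (comp_average \<phi> ?k (cell_index n x)) \<partial>\<mu>)"
    by (rule nn_integral_cong_AE, use \<mu>_generic in eventually_elim) (simp add: kernel_test[where p = p, OF \<phi> _ ps])
  also have "\<dots> = ennreal (\<Sum>i\<in>idx n. mass i * comp_average \<phi> ?k i)" by (rule nn_integral_cell_function) (rule c0)
  also have "(\<Sum>i\<in>idx n. mass i * comp_average \<phi> ?k i) = (\<Sum>J\<in>composites n ?k. \<Sum>i\<in>J. mass i * comp_average \<phi> ?k i)"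
    by (rule sum_composites[symmetric])
  also have "\<dots> = (\<Sum>J\<in>composites n ?k. \<Sum>i\<in>J. mass i * cell_test \<phi> ?k i)"
  proof (rule sum.cong[OF refl])
    fix J :: "(nat^'n) set" assume J: "J \<in> composites n ?k"
    obtain i0 where i0: "i0 \<in> idx n" "J = group n (shifted_coords ?k) i0" using composites_partition(4)[OF J] by blast
    have ne: "J \<noteq> {}" using group_self[OF i0(1)] i0(2) by blast
    have pos: "0 < (\<Sum>i\<in>J. mass i)"
      using composites_partition(1,2)[OF J] ne mass_pos by (intro sum_pos) (auto dest: subsetD)
    have "comp_average \<phi> ?k i = (\<Sum>i\<in>J. mass i * cell_test \<phi> ?k i) / (\<Sum>i\<in>J. mass i)" if i: "i \<in> J" for i
    proof -
      have "i \<in> idx n" using composites_partition(1)[OF J] i by (rule subsetD)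
      from comp_average_eq_test[OF \<phi> this, of ?k] rho_comp_test[OF \<phi> composites_partition(1)[OF J] ne, of ?k]
      show ?thesis unfolding composites_partition(3)[OF J i, symmetric] by simp
    qed
    then have "(\<Sum>i\<in>J. mass i * comp_average \<phi> ?k i)
      = (\<Sum>i\<in>J. mass i * ((\<Sum>i\<in>J. mass i * cell_test \<phi> ?k i) / (\<Sum>i\<in>J. mass i)))"
      by (intro sum.cong) simp_all
    also have "\<dots> = (\<Sum>i\<in>J. mass i * cell_test \<phi> ?k i)"
      unfolding sum_distrib_right[symmetric] using pos by simp
    finally show "(\<Sum>i\<in>J. mass i * comp_average \<phi> ?k i) = (\<Sum>i\<in>J. mass i * cell_test \<phi> ?k i)" .
  qed
  also have "\<dots> = (LINT y|\<nu>n. \<phi> y)" unfolding sum_composites by (rule total_test[OF \<phi>])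
  finally show ?thesis .
qed

end

section \<open>Compactness by colouring\<close>

text \<open>Countably many finite colourings of the natural numbers have a common subsequence on which each of
  them is eventually constant.\<close>

lemma diagonal_subsequence_of_colourings:
  fixes colour :: "nat \<Rightarrow> nat \<Rightarrow> 'c" and p0 :: "nat \<Rightarrow> nat"
  assumes fin: "\<And>c. finite (range (colour c))"
  obtains r :: "nat \<Rightarrow> nat" where "strict_mono r"
    "\<And>c. \<exists>j0. \<forall>i\<ge>j0. \<forall>j\<ge>j0. p0 c \<le> r i \<and> p0 c \<le> r j \<and> colour c (r i) = colour c (r j)"
proof -
  define P where "P c s \<longleftrightarrow> (\<forall>i j. p0 c \<le> s i \<and> colour c (s i) = colour c (s j))" for c and s :: "nat \<Rightarrow> nat"
  interpret subseqs P
  proof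
    fix c and s :: "nat \<Rightarrow> nat" assume s: "strict_mono s"
    have "finite (colour c ` s ` {p0 c..})" by (rule finite_subset[OF _ fin[of c]]) auto
    then obtain a where a: "infinite {j \<in> {p0 c..}. colour c (s j) = colour c (s a)}"
      using pigeonhole_infinite[of "{p0 c..}" "\<lambda>j. colour c (s j)"] infinite_Ici by (auto simp: image_image)
    define r' where "r' = enumerate {j \<in> {p0 c..}. colour c (s j) = colour c (s a)}"
    have r': "strict_mono r'" "r' j \<in> {j \<in> {p0 c..}. colour c (s j) = colour c (s a)}" for j
      unfolding r'_def using strict_mono_enumerate[OF a] enumerate_in_set[OF a] by auto
    have "P c (s \<circ> r')" unfolding P_def
    proof (intro allI conjI)
      fix i j
      have "p0 c \<le> r' i" using r'(2)[of i] by simp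
      also have "\<dots> \<le> s (r' i)" by (rule seq_suble[OF s])
      finally show "p0 c \<le> (s \<circ> r') i" by simp
      show "colour c ((s \<circ> r') i) = colour c ((s \<circ> r') j)" using r'(2)[of i] r'(2)[of j] by simp
    qed
    then show "\<exists>r'. strict_mono r' \<and> P c (s \<circ> r')" using r'(1) by blast
  qed
  show ?thesis
  proof (rule that[OF subseq_diagseq])
    fix c
    have "P c (diagseq \<circ> (+) (Suc c))" by (rule diagseq_holds) (auto simp: P_def)
    then have *: "p0 c \<le> diagseq (Suc c + i) \<and> colour c (diagseq (Suc c + i)) = colour c (diagseq (Suc c + j))" for i j
      by (simp add: P_def)
    show "\<exists>j0. \<forall>i\<ge>j0. \<forall>j\<ge>j0. p0 c \<le> diagseq i \<and> p0 c \<le> diagseq j \<and> colour c (diagseq i) = colour c (diagseq j)"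
    proof (intro exI[of _ "Suc c"] allI impI)
      fix i j assume "Suc c \<le> i" "Suc c \<le> j"
      then show "p0 c \<le> diagseq i \<and> p0 c \<le> diagseq j \<and> colour c (diagseq i) = colour c (diagseq j)"
        using *[of "i - Suc c" "j - Suc c"] *[of "j - Suc c" "i - Suc c"] by simp
    qed
  qed
qed

text \<open>Total boundedness as a finite colouring: the colour of \<open>p\<close> records, for finitely many times,
  rounded values of a function that is constant on coarse cells and approximates \<open>u p t\<close>. Equality
  of colours then forces closeness at all times in \<open>{0..T}\<close> by the estimate in time.\<close>

lemma finite_colouring:
  fixes \<mu> :: "(real^'n::finite) measure" and u :: "nat \<Rightarrow> real \<Rightarrow> real^'n \<Rightarrow> real"
  assumes \<mu>: "prob_space \<mu>" "sets \<mu> = sets borel" and K: "0 \<le> K"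
    and u_meas: "\<And>p t. u p t \<in> borel_measurable borel"
    and gen: "\<And>m. AE x in \<mu>. cell_index (2 ^ m) x \<in> idx (2 ^ m)"
    and ci: "\<And>m. cell_index (2 ^ m) \<in> measurable (borel :: (real^'n) measure) (count_space UNIV)"
    and time: "\<And>p s t. 0 \<le> s \<Longrightarrow> 0 \<le> t \<Longrightarrow>
      (\<integral>\<^sup>+ x. ennreal \<bar>u p s x - u p t x\<bar> \<partial>\<mu>) \<le> ennreal (K * (\<bar>s - t\<bar> + 1 / 2 ^ p))"
    and space: "\<And>p m t. m \<le> p \<Longrightarrow> 0 \<le> t \<Longrightarrow> \<exists>w. (\<forall>\<alpha>\<in>idx (2 ^ m). 0 \<le> w \<alpha> \<and> w \<alpha> \<le> 1) \<and>
      (\<integral>\<^sup>+ x. ennreal \<bar>u p t x - w (cell_index (2 ^ m) x)\<bar> \<partial>\<mu>) \<le> ennreal (K * (1 / 2 ^ m + 1 / 2 ^ p))"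
    and \<epsilon>: "0 < \<epsilon>"
  shows "\<exists>(colour :: nat \<Rightarrow> nat \<times> (nat^'n) \<Rightarrow> nat) p0. finite (range colour) \<and>
    (\<forall>p\<ge>p0. \<forall>p'\<ge>p0. colour p = colour p' \<longrightarrow>
      (\<forall>t\<in>{0..T}. (\<integral>\<^sup>+ x. ennreal \<bar>u p t x - u p' t x\<bar> \<partial>\<mu>) \<le> ennreal \<epsilon>))"
proof -
  interpret prob_space \<mu> by fact
  obtain m where m: "(8 * K + 1) / \<epsilon> < 2 ^ m" using real_arch_pow[of 2] by auto
  define h where "h = 1 / (2::real) ^ m"
  have h: "0 < h" "(8 * K + 1) * h \<le> \<epsilon>" using m \<epsilon> by (auto simp: h_def field_simps)
  define J where "J = nat \<lfloor>T * 2 ^ m\<rfloor>"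
  define Q where "Q p j v \<longleftrightarrow> (\<forall>\<alpha>\<in>idx (2 ^ m). 0 \<le> v \<alpha> \<and> v \<alpha> \<le> 1) \<and>
      (\<integral>\<^sup>+ x. ennreal \<bar>u p (real j * h) x - v (cell_index (2 ^ m) x)\<bar> \<partial>\<mu>) \<le> ennreal (K * (1 / 2 ^ m + 1 / 2 ^ p))"
    for p :: nat and j :: nat and v :: "nat^'n \<Rightarrow> real"
  define w where "w p j = (SOME v. Q p j v)" for p j
  have "Q p j (w p j)" if "m \<le> p" for p j
  proof -
    have "0 \<le> real j * h" using h(1) by simp
    from space[OF that this] have "\<exists>v. Q p j v" unfolding Q_def .
    then show ?thesis unfolding w_def by (rule someI_ex)
  qed
  then have w: "m \<le> p \<Longrightarrow> \<alpha> \<in> idx (2 ^ m) \<Longrightarrow> 0 \<le> w p j \<alpha> \<and> w p j \<alpha> \<le> 1"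
    "m \<le> p \<Longrightarrow> (\<integral>\<^sup>+ x. ennreal \<bar>u p (real j * h) x - w p j (cell_index (2 ^ m) x)\<bar> \<partial>\<mu>) \<le> ennreal (K * (1 / 2 ^ m + 1 / 2 ^ p))"
    for p j \<alpha> by (simp_all add: Q_def)
  define D where "D = {..J} \<times> (idx (2 ^ m) :: (nat^'n) set)"
  define colour where "colour p = (\<lambda>q\<in>D. min (2 ^ m) (nat \<lfloor>2 ^ m * w p (fst q) (snd q)\<rfloor>))" for p
  have "range colour \<subseteq> Pi\<^sub>E D (\<lambda>_. {..2 ^ m})" by (auto simp: colour_def)
  moreover have "finite (Pi\<^sub>E D (\<lambda>_. {..(2::nat) ^ m}))" by (intro finite_PiE) (auto simp: D_def)
  ultimately have fin: "finite (range colour)" by (rule finite_subset)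
  have [measurable]: "u p t \<in> borel_measurable \<mu>" for p t
    using u_meas unfolding measurable_cong_sets[OF \<mu>(2) refl] .
  have wm[measurable]: "(\<lambda>x. w p j (cell_index (2 ^ m) x)) \<in> borel_measurable \<mu>" for p j
    unfolding measurable_cong_sets[OF \<mu>(2) refl] by (rule measurable_compose[OF ci]) simp
  have tri: "(\<integral>\<^sup>+ x. ennreal \<bar>f x - k x\<bar> \<partial>\<mu>) \<le> ennreal (a + b)"
    if "(\<integral>\<^sup>+ x. ennreal \<bar>f x - g x\<bar> \<partial>\<mu>) \<le> ennreal a" "(\<integral>\<^sup>+ x. ennreal \<bar>g x - k x\<bar> \<partial>\<mu>) \<le> ennreal b"
      "0 \<le> a" "0 \<le> b" "f \<in> borel_measurable \<mu>" "g \<in> borel_measurable \<mu>" "k \<in> borel_measurable \<mu>"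
    for f g k :: "real^'n \<Rightarrow> real" and a b
  proof -
    have "(\<integral>\<^sup>+ x. ennreal \<bar>f x - k x\<bar> \<partial>\<mu>) \<le> (\<integral>\<^sup>+ x. ennreal \<bar>f x - g x\<bar> + ennreal \<bar>g x - k x\<bar> \<partial>\<mu>)"
      by (intro nn_integral_mono) (simp flip: ennreal_plus)
    also have "\<dots> = (\<integral>\<^sup>+ x. ennreal \<bar>f x - g x\<bar> \<partial>\<mu>) + (\<integral>\<^sup>+ x. ennreal \<bar>g x - k x\<bar> \<partial>\<mu>)"
      by (intro nn_integral_add measurable_compose[OF _ measurable_ennreal] borel_measurable_abs borel_measurable_diff that)
    also have "\<dots> \<le> ennreal a + ennreal b" using that(1,2) by (rule add_mono)
    finally show ?thesis using that(3,4) by simp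
  qed
  have sym: "(\<integral>\<^sup>+ x. ennreal \<bar>f x - g x\<bar> \<partial>\<mu>) = (\<integral>\<^sup>+ x. ennreal \<bar>g x - f x\<bar> \<partial>\<mu>)" for f g :: "real^'n \<Rightarrow> real"
    by (simp add: abs_minus_commute)
  have close: "(\<integral>\<^sup>+ x. ennreal \<bar>u p t x - w p j (cell_index (2 ^ m) x)\<bar> \<partial>\<mu>) \<le> ennreal (4 * K * h)"
    if p: "m \<le> p" and j: "j = nat \<lfloor>t * 2 ^ m\<rfloor>" and t: "0 \<le> t" for p j t
  proof -
    have hp: "1 / 2 ^ p \<le> h" using p by (simp add: h_def field_simps power_increasing)
    have "real j \<le> t * 2 ^ m" "t * 2 ^ m < real j + 1" using t by (auto simp: j)
    then have "\<bar>t * 2 ^ m - real j\<bar> * h \<le> 1 * h" using h(1) by (intro mult_right_mono) auto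
    moreover have "t - real j * h = (t * 2 ^ m - real j) * h" by (simp add: h_def diff_divide_distrib)
    ultimately have "\<bar>t - real j * h\<bar> \<le> h" using h(1) by (simp add: abs_mult)
    then have "K * (\<bar>t - real j * h\<bar> + 1 / 2 ^ p) \<le> K * (h + h)" using K hp by (intro mult_left_mono) auto
    then have 1: "(\<integral>\<^sup>+ x. ennreal \<bar>u p t x - u p (real j * h) x\<bar> \<partial>\<mu>) \<le> ennreal (K * (h + h))"
      using time[OF t, of "real j * h" p] h(1) by (auto intro: order.trans ennreal_leI)
    have "K * (1 / 2 ^ m + 1 / 2 ^ p) \<le> K * (h + h)" using K hp by (intro mult_left_mono) (auto simp: h_def)
    then have 2: "(\<integral>\<^sup>+ x. ennreal \<bar>u p (real j * h) x - w p j (cell_index (2 ^ m) x)\<bar> \<partial>\<mu>) \<le> ennreal (K * (h + h))"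
      using w(2)[OF p, of j] by (auto intro: order.trans ennreal_leI)
    show ?thesis using tri[OF 1 2] K h(1) wm by (simp add: mult.assoc)
  qed
  show ?thesis
  proof (intro exI[of _ colour] exI[of _ m] conjI fin allI impI ballI)
    fix p p' t assume p: "m \<le> p" "m \<le> p'" and c: "colour p = colour p'" and t: "t \<in> {0..T}"
    define j where "j = nat \<lfloor>t * 2 ^ m\<rfloor>"
    have j: "j \<le> J" unfolding j_def J_def using t by (intro nat_mono floor_mono mult_right_mono) auto
    have ww: "\<bar>w p j \<alpha> - w p' j \<alpha>\<bar> \<le> h" if \<alpha>: "\<alpha> \<in> idx (2 ^ m)" for \<alpha>
    proof -
      have fl: "min (2 ^ m) (nat \<lfloor>2 ^ m * w q j \<alpha>\<rfloor>) = nat \<lfloor>2 ^ m * w q j \<alpha>\<rfloor>" "0 \<le> 2 ^ m * w q j \<alpha>"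
        if "m \<le> q" for q
      proof -
        have w01: "0 \<le> w q j \<alpha>" "w q j \<alpha> \<le> 1" using w(1)[OF that \<alpha>] by auto
        then show "0 \<le> 2 ^ m * w q j \<alpha>" by simp
        have "2 ^ m * w q j \<alpha> \<le> real (2 ^ m)" using w01 by simp
        then have "nat \<lfloor>2 ^ m * w q j \<alpha>\<rfloor> \<le> nat \<lfloor>real (2 ^ m)\<rfloor>" by (intro nat_mono floor_mono)
        then show "min (2 ^ m) (nat \<lfloor>2 ^ m * w q j \<alpha>\<rfloor>) = nat \<lfloor>2 ^ m * w q j \<alpha>\<rfloor>" by (simp only: floor_of_nat nat_int min_absorb2)
      qed
      have "colour p (j, \<alpha>) = colour p' (j, \<alpha>)" using c by simp
      then have "nat \<lfloor>2 ^ m * w p j \<alpha>\<rfloor> = nat \<lfloor>2 ^ m * w p' j \<alpha>\<rfloor>"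
        using j \<alpha> fl(1)[OF p(1)] fl(1)[OF p(2)] by (simp add: colour_def D_def)
      then have "\<lfloor>2 ^ m * w p j \<alpha>\<rfloor> = \<lfloor>2 ^ m * w p' j \<alpha>\<rfloor>"
        using fl(2)[OF p(1)] fl(2)[OF p(2)] by (simp add: eq_nat_nat_iff)
      then have "\<bar>2 ^ m * w p j \<alpha> - 2 ^ m * w p' j \<alpha>\<bar> \<le> 1" by linarith
      then have "2 ^ m * \<bar>w p j \<alpha> - w p' j \<alpha>\<bar> \<le> 1" by (simp add: abs_mult flip: right_diff_distrib)
      then show ?thesis by (simp add: h_def field_simps)
    qed
    have "(\<integral>\<^sup>+ x. ennreal \<bar>w p j (cell_index (2 ^ m) x) - w p' j (cell_index (2 ^ m) x)\<bar> \<partial>\<mu>) \<le> (\<integral>\<^sup>+ x. ennreal h \<partial>\<mu>)"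
      by (rule nn_integral_mono_AE, use gen[of m] in eventually_elim) (intro ennreal_leI ww)
    then have 3: "(\<integral>\<^sup>+ x. ennreal \<bar>w p j (cell_index (2 ^ m) x) - w p' j (cell_index (2 ^ m) x)\<bar> \<partial>\<mu>) \<le> ennreal h"
      by (simp add: emeasure_space_1)
    have t0: "0 \<le> t" using t by simp
    have Kh: "0 \<le> 4 * K * h" using K h(1) by simp
    note close' = close[OF p(2) j_def t0, unfolded sym[of "u p' t"]]
    have "(\<integral>\<^sup>+ x. ennreal \<bar>u p t x - u p' t x\<bar> \<partial>\<mu>) \<le> ennreal (4 * K * h + (h + 4 * K * h))"
      using Kh h(1) by (intro tri[OF close[OF p(1) j_def t0] tri[OF 3 close']]) measurable
    also have "\<dots> \<le> ennreal \<epsilon>" using h(2) by (intro ennreal_leI) (simp add: algebra_simps)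
    finally show "(\<integral>\<^sup>+ x. ennreal \<bar>u p t x - u p' t x\<bar> \<partial>\<mu>) \<le> ennreal \<epsilon>" .
  qed
qed

section \<open>Limits of kernels\<close>

lemma lip01_mono: "\<phi> \<in> lip01 L \<Longrightarrow> L \<le> L' \<Longrightarrow> \<phi> \<in> lip01 L'"
  unfolding lip01_def by (auto intro: lipschitz_on_le)

text \<open>Lipschitz partitions of unity with mesh tending to zero. Their countably many members are the only
  tests that have to be followed to control all Lipschitz tests and the Wasserstein distance.\<close>

locale test_family =
  fixes Y :: "'b::euclidean_space set" and D :: real
    and N :: "nat \<Rightarrow> nat" and \<psi> :: "nat \<Rightarrow> nat \<Rightarrow> 'b \<Rightarrow> real" and Lc :: "nat \<Rightarrow> real"
  assumes Y: "compact Y" and D: "0 \<le> D" "\<And>y y'. y \<in> Y \<Longrightarrow> y' \<in> Y \<Longrightarrow> dist y y' \<le> D"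
    and Lc: "\<And>m. 0 < Lc m" and \<psi>: "\<And>m q. \<psi> m q \<in> lip01 (Lc m)"
    and sum1: "\<And>m y. y \<in> Y \<Longrightarrow> (\<Sum>q<N m. \<psi> m q y) = 1"
    and small: "\<And>m q y y'. \<psi> m q y \<noteq> 0 \<Longrightarrow> \<psi> m q y' \<noteq> 0 \<Longrightarrow> dist y y' \<le> 1 / real (Suc m)"
begin

lemma closed_Y: "closed Y" using Y by (rule compact_imp_closed)

text \<open>The difference is at most \<open>L\<close> times the Wasserstein distance, which in turn is bounded by the
  differences of the tests in one partition of unity.\<close>

lemma test_difference_le:
  assumes \<alpha>: "\<alpha> \<in> prob_on Y" and \<beta>: "\<beta> \<in> prob_on Y" and \<phi>: "\<phi> \<in> lip01 L" and L: "0 < L"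
  shows "\<bar>(LINT y|\<alpha>. \<phi> y) - (LINT y|\<beta>. \<phi> y)\<bar>
    \<le> L * (1 / real (Suc m) + D * (\<Sum>q<N m. \<bar>(LINT y|\<alpha>. \<psi> m q y) - (LINT y|\<beta>. \<psi> m q y)\<bar>))"
proof -
  let ?R = "1 / real (Suc m) + D * (\<Sum>q<N m. \<bar>(LINT y|\<alpha>. \<psi> m q y) - (LINT y|\<beta>. \<psi> m q y)\<bar>)"
  have R: "0 \<le> ?R" using D(1) by (intro add_nonneg_nonneg mult_nonneg_nonneg sum_nonneg) simp_all
  have "W1 \<alpha> \<beta> \<le> ennreal ?R"
    by (rule W1_le_test_differences[OF \<alpha> \<beta> closed_Y \<psi> sum1 D _ small]) simp_all
  then have "ennreal L * W1 \<alpha> \<beta> \<le> ennreal L * ennreal ?R" by (intro mult_left_mono) simp_all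
  then have "ennreal \<bar>(LINT y|\<alpha>. \<phi> y) - (LINT y|\<beta>. \<phi> y)\<bar> \<le> ennreal L * ennreal ?R"
    by (rule order.trans[OF test_difference_le_W1[OF prob_onD(3)[OF \<alpha>] \<phi> L]])
  also have "\<dots> = ennreal (L * ?R)" using L R by (intro ennreal_mult[symmetric]) simp_all
  finally show ?thesis using L R by (subst (asm) ennreal_le_iff) simp_all
qed

text \<open>Weak compactness gives a limit along a subsequence. The tests of the family have the same limits
  along the whole sequence, and they control all other Lipschitz tests.\<close>

lemma tests_convergent_imp_weakly_convergent:
  assumes \<alpha>: "\<And>k. \<alpha> k \<in> prob_on Y" and c: "\<And>m q. q < N m \<Longrightarrow> Cauchy (\<lambda>k. LINT y|\<alpha> k. \<psi> m q y)"
  shows "\<exists>\<beta>\<in>prob_on Y. \<forall>L. \<forall>\<phi>\<in>lip01 L. (\<lambda>k. LINT y|\<alpha> k. \<phi> y) \<longlonglongrightarrow> (LINT y|\<beta>. \<phi> y)"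
proof -
  obtain r \<beta> where r: "strict_mono (r :: nat \<Rightarrow> nat)" and \<beta>: "\<beta> \<in> prob_on Y"
    and lim: "\<And>L \<phi>. \<phi> \<in> lip01 L \<Longrightarrow> (\<lambda>k. LINT y|\<alpha> (r k). \<phi> y) \<longlonglongrightarrow> (LINT y|\<beta>. \<phi> y)"
    using prob_on_weakly_sequentially_compact[where \<alpha> = \<alpha>, OF Y \<alpha>] by blast
  have lim\<psi>: "(\<lambda>k. LINT y|\<alpha> k. \<psi> m q y) \<longlonglongrightarrow> (LINT y|\<beta>. \<psi> m q y)" if q: "q < N m" for m q
  proof -
    obtain a where a: "(\<lambda>k. LINT y|\<alpha> k. \<psi> m q y) \<longlonglongrightarrow> a"
      using Cauchy_convergent[OF c[OF q]] unfolding convergent_def by blast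
    from LIMSEQ_subseq_LIMSEQ[OF a r] lim[OF \<psi>] have "a = (LINT y|\<beta>. \<psi> m q y)"
      unfolding o_def by (rule LIMSEQ_unique)
    then show ?thesis using a by (simp only:)
  qed
  have "(\<lambda>k. LINT y|\<alpha> k. \<phi> y) \<longlonglongrightarrow> (LINT y|\<beta>. \<phi> y)" if \<phi>: "\<phi> \<in> lip01 L" for L \<phi>
  proof (rule tendstoI)
    fix e :: real assume e: "0 < e"
    define L' where "L' = max L 1"
    have L': "0 < L'" "\<phi> \<in> lip01 L'" using lip01_mono[OF \<phi>, of L'] by (simp_all add: L'_def)
    obtain m where m: "1 / real (Suc m) < e / (2 * L')" using nat_approx_posE[of "e / (2 * L')"] e L'(1) by auto
    have "(\<lambda>k. L' * (1 / real (Suc m) + D * (\<Sum>q<N m. \<bar>(LINT y|\<alpha> k. \<psi> m q y) - (LINT y|\<beta>. \<psi> m q y)\<bar>)))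
      \<longlonglongrightarrow> L' * (1 / real (Suc m) + D * (\<Sum>q<N m. \<bar>(LINT y|\<beta>. \<psi> m q y) - (LINT y|\<beta>. \<psi> m q y)\<bar>))"
      by (intro tendsto_intros lim\<psi>) simp_all
    moreover have "L' * (1 / real (Suc m) + D * (\<Sum>q<N m. \<bar>(LINT y|\<beta>. \<psi> m q y) - (LINT y|\<beta>. \<psi> m q y)\<bar>)) < e"
      using m L'(1) e by (simp add: field_simps)
    ultimately have "\<forall>\<^sub>F k in sequentially. L' * (1 / real (Suc m) + D * (\<Sum>q<N m. \<bar>(LINT y|\<alpha> k. \<psi> m q y) - (LINT y|\<beta>. \<psi> m q y)\<bar>)) < e"
      by (rule order_tendstoD(2))
    then show "\<forall>\<^sub>F k in sequentially. dist (LINT y|\<alpha> k. \<phi> y) (LINT y|\<beta>. \<phi> y) < e"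
    proof eventually_elim
      case (elim k)
      then show ?case
        using test_difference_le[OF \<alpha> \<beta> L'(2,1), of k m] unfolding dist_real_def by linarith
    qed
  qed
  with \<beta> show ?thesis by blast
qed

end

text \<open>A subsequence along which consecutive distances are summable converges almost everywhere.\<close>

lemma fast_L1_Cauchy_imp_AE_Cauchy:
  fixes g :: "nat \<Rightarrow> 'a \<Rightarrow> real"
  assumes g: "\<And>k. g k \<in> borel_measurable M"
    and fast: "\<And>k. m \<le> k \<Longrightarrow> (\<integral>\<^sup>+ x. ennreal \<bar>g k x - g (Suc k) x\<bar> \<partial>M) \<le> ennreal ((1 / 2) ^ k)"
  shows "AE x in M. Cauchy (\<lambda>k. g k x)"
proof -
  note [measurable] = g
  have "(\<integral>\<^sup>+ x. (\<Sum>k. ennreal \<bar>g (k + m) x - g (Suc (k + m)) x\<bar>) \<partial>M) = (\<Sum>k. \<integral>\<^sup>+ x. ennreal \<bar>g (k + m) x - g (Suc (k + m)) x\<bar> \<partial>M)"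
    by (intro nn_integral_suminf) measurable
  also have "\<dots> \<le> (\<Sum>k. ennreal ((1 / 2) ^ k))"
  proof (intro suminf_le summableI)
    fix k
    have "(1 / 2 :: real) ^ (k + m) \<le> (1 / 2) ^ k" by (intro power_decreasing) simp_all
    then show "(\<integral>\<^sup>+ x. ennreal \<bar>g (k + m) x - g (Suc (k + m)) x\<bar> \<partial>M) \<le> ennreal ((1 / 2) ^ k)"
      using fast[of "k + m"] by (auto intro: order.trans ennreal_leI)
  qed
  also have "\<dots> = ennreal (\<Sum>k. (1 / 2) ^ k)" by (intro suminf_ennreal2 summable_geometric) simp_all
  also have "\<dots> < \<infinity>" by simp
  finally have "(\<integral>\<^sup>+ x. (\<Sum>k. ennreal \<bar>g (k + m) x - g (Suc (k + m)) x\<bar>) \<partial>M) \<noteq> \<infinity>" by simp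
  then have "AE x in M. (\<Sum>k. ennreal \<bar>g (k + m) x - g (Suc (k + m)) x\<bar>) \<noteq> \<infinity>"
    by (intro nn_integral_PInf_AE) measurable
  then show ?thesis
  proof eventually_elim
    case (elim x)
    then have "summable (\<lambda>k. \<bar>g (k + m) x - g (Suc (k + m)) x\<bar>)" by (intro summable_suminf_not_top) simp_all
    then have "summable (\<lambda>k. g (k + m) x - g (Suc (k + m)) x)" by (rule summable_rabs_cancel)
    then have "convergent (\<lambda>j. \<Sum>k<j. g (k + m) x - g (Suc (k + m)) x)" by (simp add: summable_iff_convergent)
    moreover have "(\<Sum>k<j. g (k + m) x - g (Suc (k + m)) x) = g m x - g (j + m) x" for j
      by (induction j) simp_all
    ultimately have "convergent (\<lambda>j. g m x - g (j + m) x)" by (simp only:)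
    from convergent_diff[OF convergent_const this, of "g m x"] have "convergent (\<lambda>j. g (j + m) x)" by simp
    then obtain l where "(\<lambda>j. g (j + m) x) \<longlonglongrightarrow> l" unfolding convergent_def by blast
    then have "(\<lambda>j. g j x) \<longlonglongrightarrow> l" by (rule LIMSEQ_offset)
    then have "convergent (\<lambda>k. g k x)" by (rule convergentI)
    then show ?case by (rule convergent_Cauchy)
  qed
qed

context test_family
begin

context
  fixes X :: "'a::{second_countable_topology} set" and \<mu> :: "'a measure"
  assumes X: "X \<in> sets borel" and \<mu>: "prob_space \<mu>" "sets \<mu> = sets borel" "emeasure \<mu> (- X) = 0"
begin

interpretation \<mu>: prob_space \<mu> by (rule \<mu>(1))

lemma AE_X: "AE x in \<mu>. x \<in> X" by (rule AE_carrier[OF X \<mu>(2,3)])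

text \<open>Kernels whose test integrals form Cauchy sequences in \<open>L\<^sup>1\<close> converge: along a subsequence the
  test integrals converge almost everywhere, where weak compactness provides the limit measures; the
  distance to the limit is then estimated by Fatou's lemma.\<close>

lemma limit_kernel:
  fixes \<kappa> :: "nat \<Rightarrow> 'a \<Rightarrow> 'b measure"
  assumes \<kappa>: "\<And>j. kernel X Y (\<kappa> j)" and Yne: "\<nu> \<in> prob_on Y"
    and C: "\<And>m q \<epsilon>. q < N m \<Longrightarrow> 0 < \<epsilon> \<Longrightarrow> \<exists>j0. \<forall>i\<ge>j0. \<forall>j\<ge>j0.
      (\<integral>\<^sup>+ x. ennreal \<bar>(LINT y|\<kappa> i x. \<psi> m q y) - (LINT y|\<kappa> j x. \<psi> m q y)\<bar> \<partial>\<mu>) \<le> ennreal \<epsilon>"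
  shows "\<exists>\<eta>. kernel X Y \<eta> \<and> (\<forall>m q \<epsilon> j0. q < N m \<longrightarrow>
    (\<forall>i\<ge>j0. \<forall>j\<ge>j0. (\<integral>\<^sup>+ x. ennreal \<bar>(LINT y|\<kappa> i x. \<psi> m q y) - (LINT y|\<kappa> j x. \<psi> m q y)\<bar> \<partial>\<mu>) \<le> ennreal \<epsilon>) \<longrightarrow>
    (\<forall>i\<ge>j0. (\<integral>\<^sup>+ x. ennreal \<bar>(LINT y|\<kappa> i x. \<psi> m q y) - (LINT y|\<eta> x. \<psi> m q y)\<bar> \<partial>\<mu>) \<le> ennreal \<epsilon>))"
proof -
  let ?I = "\<lambda>i j m q. \<integral>\<^sup>+ x. ennreal \<bar>(LINT y|\<kappa> i x. \<psi> m q y) - (LINT y|\<kappa> j x. \<psi> m q y)\<bar> \<partial>\<mu>"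
  let ?R = "restrict_space borel X"
  have po: "\<kappa> j x \<in> prob_on Y" if "x \<in> X" for j x using \<kappa> that by (auto simp: kernel_def)
  have tm: "(\<lambda>x. LINT y|\<kappa> j x. \<phi> y) \<in> borel_measurable ?R" if "\<phi> \<in> lip01 L" for j \<phi> L
    by (rule test_kernel_measurable[OF X \<mu>(2,3) \<kappa> that])
  have "\<exists>j0. \<forall>m\<le>k. \<forall>q<N m. \<forall>i\<ge>j0. \<forall>j\<ge>j0. ?I i j m q \<le> ennreal ((1 / 2) ^ k)" for k
  proof -
    have "\<forall>\<^sub>F j0 in sequentially. \<forall>i\<ge>j0. \<forall>j\<ge>j0. ?I i j m q \<le> ennreal ((1 / 2) ^ k)" if q: "q < N m" for m q
    proof -
      obtain j0 where "\<forall>i\<ge>j0. \<forall>j\<ge>j0. ?I i j m q \<le> ennreal ((1 / 2) ^ k)" using C[OF q, of "(1 / 2) ^ k"] by auto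
      then show ?thesis unfolding eventually_sequentially by (intro exI[of _ j0]) (meson order.trans)
    qed
    then have "\<forall>\<^sub>F j0 in sequentially. \<forall>m\<in>{..k}. \<forall>q\<in>{..<N m}. \<forall>i\<ge>j0. \<forall>j\<ge>j0. ?I i j m q \<le> ennreal ((1 / 2) ^ k)"
      by (intro eventually_ball_finite ballI) simp_all
    from eventually_happens[OF this] obtain j0 where "\<forall>m\<in>{..k}. \<forall>q\<in>{..<N m}. \<forall>i\<ge>j0. \<forall>j\<ge>j0. ?I i j m q \<le> ennreal ((1 / 2) ^ k)"
      by (auto simp del: ennreal_power)
    then show ?thesis by (intro exI[of _ j0]) simp
  qed
  then have "\<forall>k. \<exists>j0. \<forall>m\<le>k. \<forall>q<N m. \<forall>i\<ge>j0. \<forall>j\<ge>j0. ?I i j m q \<le> ennreal ((1 / 2) ^ k)" by (intro allI)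
  from choice[OF this] obtain J
    where "\<forall>k. \<forall>m\<le>k. \<forall>q<N m. \<forall>i\<ge>J k. \<forall>j\<ge>J k. ?I i j m q \<le> ennreal ((1 / 2) ^ k)" ..
  then have J: "\<And>k m q i j. m \<le> k \<Longrightarrow> q < N m \<Longrightarrow> J k \<le> i \<Longrightarrow> J k \<le> j \<Longrightarrow> ?I i j m q \<le> ennreal ((1 / 2) ^ k)"
    by (simp del: ennreal_power)
  define s where "s k = (\<Sum>i\<le>k. Suc (J i))" for k
  have s: "strict_mono s" unfolding strict_mono_Suc_iff s_def by simp
  have sJ: "J k \<le> s k" for k unfolding s_def by (rule order.trans[OF _ member_le_sum[of k]]) simp_all
  have sSuc: "s k \<le> s (Suc k)" for k using s by (simp add: strict_mono_Suc_iff less_imp_le)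
  define good where "good x \<longleftrightarrow> (\<forall>m. \<forall>q\<in>{..<N m}. Cauchy (\<lambda>k. LINT y|\<kappa> (s k) x. \<psi> m q y))" for x
  have AE_good: "AE x in \<mu>. good x"
  proof -
    have "AE x in \<mu>. Cauchy (\<lambda>k. LINT y|\<kappa> (s k) x. \<psi> m q y)" if q: "q < N m" for m q
    proof -
      define g where "g k x = (LINT y|\<kappa> (s k) x. \<psi> m q y) * indicator X x" for k x
      have gm: "g k \<in> borel_measurable \<mu>" for k
      proof -
        have "g k \<in> borel_measurable borel"
          unfolding g_def[abs_def] using X tm[OF \<psi>, of "s k" m q]
          by (subst (asm) borel_measurable_restrict_space_iff) (simp_all add: mult.commute)
        then show ?thesis unfolding measurable_cong_sets[OF \<mu>(2) refl] .
      qed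
      have "AE x in \<mu>. Cauchy (\<lambda>k. g k x)"
      proof (rule fast_L1_Cauchy_imp_AE_Cauchy[OF gm, of m])
        fix k assume k: "m \<le> k"
        have "(\<integral>\<^sup>+ x. ennreal \<bar>g k x - g (Suc k) x\<bar> \<partial>\<mu>) = ?I (s k) (s (Suc k)) m q"
          by (rule nn_integral_cong_AE, use AE_X in eventually_elim) (simp add: g_def)
        also have "\<dots> \<le> ennreal ((1 / 2) ^ k)" by (rule J[OF k q sJ order.trans[OF sJ sSuc]])
        finally show "(\<integral>\<^sup>+ x. ennreal \<bar>g k x - g (Suc k) x\<bar> \<partial>\<mu>) \<le> ennreal ((1 / 2) ^ k)" .
      qed
      with AE_X show ?thesis by eventually_elim (simp add: g_def)
    qed
    then show ?thesis unfolding good_def by (intro AE_all_countable[THEN iffD2] allI AE_finite_allI) simp_all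
  qed
  define lim_of where "lim_of x \<beta> \<longleftrightarrow> \<beta> \<in> prob_on Y \<and>
    (\<forall>L. \<forall>\<phi>\<in>lip01 L. (\<lambda>k. LINT y|\<kappa> (s k) x. \<phi> y) \<longlonglongrightarrow> (LINT y|\<beta>. \<phi> y))" for x \<beta>
  define \<eta> where "\<eta> x = (if good x then SOME \<beta>. lim_of x \<beta> else \<nu>)" for x
  have lim: "lim_of x (\<eta> x)" if x: "x \<in> X" "good x" for x
  proof -
    have "\<exists>\<beta>\<in>prob_on Y. \<forall>L. \<forall>\<phi>\<in>lip01 L. (\<lambda>k. LINT y|\<kappa> (s k) x. \<phi> y) \<longlonglongrightarrow> (LINT y|\<beta>. \<phi> y)"
      using x(2) by (intro tests_convergent_imp_weakly_convergent po x(1)) (simp add: good_def)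
    then have "\<exists>\<beta>. lim_of x \<beta>" unfolding lim_of_def by blast
    then show ?thesis unfolding \<eta>_def using x(2) by (simp add: someI_ex)
  qed
  have \<eta>_po: "\<eta> x \<in> prob_on Y" if "x \<in> X" for x
    using lim[OF that] Yne by (cases "good x") (simp_all add: lim_of_def \<eta>_def)
  have good_meas: "{x \<in> space ?R. good x} \<in> sets ?R"
    unfolding good_def by (intro sets.sets_Collect_countable_All sets.sets_Collect_finite_All sets_Collect_Cauchy tm[OF \<psi>]) simp
  have \<eta>: "kernel X Y \<eta>"
    unfolding kernel_def
  proof (intro conjI ballI \<eta>_po)
    show "\<eta> \<in> measurable ?R (prob_algebra borel)"
    proof (rule measurable_prob_algebra_if_tests_measurable)
      fix \<phi> :: "'b \<Rightarrow> real" and L assume \<phi>: "\<phi> \<in> lip01 L"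
      show "(\<lambda>x. LINT y|\<eta> x. \<phi> y) \<in> borel_measurable ?R"
      proof (rule borel_measurable_LIMSEQ_real)
        show "(\<lambda>k. if good x then LINT y|\<kappa> (s k) x. \<phi> y else LINT y|\<nu>. \<phi> y) \<longlonglongrightarrow> (LINT y|\<eta> x. \<phi> y)"
          if "x \<in> space ?R" for x
          using lim[of x] that \<phi> by (cases "good x") (auto simp: lim_of_def \<eta>_def space_restrict_space)
        show "(\<lambda>x. if good x then LINT y|\<kappa> (s k) x. \<phi> y else LINT y|\<nu>. \<phi> y) \<in> borel_measurable ?R" for k
          by (intro measurable_If tm[OF \<phi>] measurable_const good_meas) simp_all
      qed
    qed (use prob_onD(1,3)[OF \<eta>_po] in \<open>simp_all add: space_restrict_space\<close>)
  qed
  show ?thesis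
  proof (intro exI[of _ \<eta>] conjI \<eta> allI impI)
    fix m q \<epsilon> j0 i
    assume q: "q < N m" and b: "\<forall>i\<ge>j0. \<forall>j\<ge>j0. ?I i j m q \<le> ennreal \<epsilon>" and i: "j0 \<le> i"
    define F where "F k x = ennreal \<bar>(LINT y|\<kappa> i x. \<psi> m q y) - (LINT y|\<kappa> (s k) x. \<psi> m q y)\<bar> * indicator X x" for k x
    have Fr: "(\<lambda>x. ennreal \<bar>(LINT y|\<kappa> i x. \<psi> m q y) - (LINT y|\<kappa> (s k) x. \<psi> m q y)\<bar>) \<in> borel_measurable ?R" for k
      by (intro measurable_compose[OF _ measurable_ennreal] borel_measurable_abs borel_measurable_diff tm[OF \<psi>])
    have Fm: "F k \<in> borel_measurable \<mu>" for k
      unfolding F_def[abs_def] by (rule nn_integral_extend_zero(1)[OF X \<mu>(2,3) Fr])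
    have Fi: "(\<integral>\<^sup>+ x. F k x \<partial>\<mu>) = ?I i (s k) m q" for k
      unfolding F_def by (rule nn_integral_extend_zero(2)[OF X \<mu>(2,3) Fr, symmetric])
    have "(\<integral>\<^sup>+ x. ennreal \<bar>(LINT y|\<kappa> i x. \<psi> m q y) - (LINT y|\<eta> x. \<psi> m q y)\<bar> \<partial>\<mu>) = (\<integral>\<^sup>+ x. liminf (\<lambda>k. F k x) \<partial>\<mu>)"
    proof (rule nn_integral_cong_AE, use AE_X AE_good in eventually_elim)
      fix x assume x: "x \<in> X" "good x"
      have "(\<lambda>k. LINT y|\<kappa> (s k) x. \<psi> m q y) \<longlonglongrightarrow> (LINT y|\<eta> x. \<psi> m q y)"
        using lim[OF x] \<psi> unfolding lim_of_def by blast
      then have "(\<lambda>k. F k x) \<longlonglongrightarrow> ennreal \<bar>(LINT y|\<kappa> i x. \<psi> m q y) - (LINT y|\<eta> x. \<psi> m q y)\<bar>"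
        unfolding F_def using x(1) by (auto intro!: tendsto_intros)
      then show "ennreal \<bar>(LINT y|\<kappa> i x. \<psi> m q y) - (LINT y|\<eta> x. \<psi> m q y)\<bar> = liminf (\<lambda>k. F k x)"
        by (intro lim_imp_Liminf[symmetric]) simp_all
    qed
    also have "\<dots> \<le> liminf (\<lambda>k. \<integral>\<^sup>+ x. F k x \<partial>\<mu>)" by (rule nn_integral_liminf[OF Fm])
    also have "\<dots> \<le> limsup (\<lambda>k. \<integral>\<^sup>+ x. F k x \<partial>\<mu>)" by (intro Liminf_le_Limsup) simp
    also have "\<dots> \<le> ennreal \<epsilon>"
    proof (rule Limsup_bounded)
      have "?I i (s k) m q \<le> ennreal \<epsilon>" if "j0 \<le> k" for k
        using b i that seq_suble[OF s, of k] by (meson order.trans)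
      then show "\<forall>\<^sub>F k in sequentially. (\<integral>\<^sup>+ x. F k x \<partial>\<mu>) \<le> ennreal \<epsilon>"
        unfolding Fi eventually_sequentially by blast
    qed
    finally show "(\<integral>\<^sup>+ x. ennreal \<bar>(LINT y|\<kappa> i x. \<psi> m q y) - (LINT y|\<eta> x. \<psi> m q y)\<bar> \<partial>\<mu>) \<le> ennreal \<epsilon>" .
  qed
qed

end

end

text \<open>The sections of a Lipschitz function of two variables are Lipschitz with the same constant, so the
  estimate for measures on \<open>Y\<close> can be applied fibrewise and integrated.\<close>

lemma joint_test_difference_le:
  fixes \<pi> \<pi>' :: "('a::{metric_space,second_countable_topology} \<times> 'b::euclidean_space) measure"
  assumes T: "test_family Y D N \<psi> Lc"
    and X: "X \<in> sets borel" and \<mu>: "prob_space \<mu>" "sets \<mu> = sets borel" "emeasure \<mu> (- X) = 0"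
    and d: "disintegration X Y \<mu> \<pi> \<kappa>" and d': "disintegration X Y \<mu> \<pi>' \<kappa>'"
    and \<phi>: "\<phi> \<in> lip01 L" and L: "0 < L" and fin: "finite_measure \<pi>" "finite_measure \<pi>'"
  shows "ennreal \<bar>(LINT z|\<pi>. \<phi> z) - (LINT z|\<pi>'. \<phi> z)\<bar> \<le> ennreal L * (ennreal (1 / real (Suc m)) + ennreal D *
    (\<Sum>q<N m. \<integral>\<^sup>+ x. ennreal \<bar>(LINT y|\<kappa> x. \<psi> m q y) - (LINT y|\<kappa>' x. \<psi> m q y)\<bar> \<partial>\<mu>))"
proof -
  interpret test_family Y D N \<psi> Lc by (rule T)
  interpret \<mu>: prob_space \<mu> by (rule \<mu>(1))
  have k: "kernel X Y \<kappa>" "kernel X Y \<kappa>'" using d d' by (simp_all add: disintegration_def)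
  have po: "\<kappa> x \<in> prob_on Y" "\<kappa>' x \<in> prob_on Y" if "x \<in> X" for x using k that by (simp_all add: kernel_def)
  have sec: "(\<lambda>y. \<phi> (x, y)) \<in> lip01 L" for x
    using lip01D[OF \<phi>] lip01D(1)[OF \<phi>, of "(x, _)" "(x, _)"] by (intro lip01I) (simp_all add: dist_Pair_Pair)
  have \<phi>m: "(\<lambda>z. ennreal (\<phi> z)) \<in> borel_measurable borel" using lip01D(6)[OF \<phi>] by simp
  define a where "a \<kappa> x = enn2real ((\<integral>\<^sup>+ y. ennreal (\<phi> (x, y)) \<partial>\<kappa> x) * indicator X x)" for \<kappa> :: "'a \<Rightarrow> 'b measure" and x
  have a_eq: "a \<eta> x = (LINT y|\<eta> x. \<phi> (x, y))" "a \<eta> x \<le> 1" "0 \<le> a \<eta> x"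
    if "x \<in> X" "\<eta> x \<in> prob_on Y" for \<eta> x
    using nn_integral_lip01[OF sec prob_space.finite_measure[OF prob_onD(3)[OF that(2)]] prob_onD(1)[OF that(2)]]
      integral_lip01_bounds[OF sec prob_onD(3)[OF that(2)] prob_onD(1)[OF that(2)]] that(1)
    by (simp_all add: a_def)
  have a_meas: "a \<eta> \<in> borel_measurable \<mu>" if "kernel X Y \<eta>" for \<eta>
    unfolding a_def[abs_def]
    using nn_integral_extend_zero(1)[OF X \<mu>(2,3) nn_integral_kernel_measurable[OF that \<phi>m]] by simp
  have rep: "(LINT z|\<rho>. \<phi> z) = (LINT x|\<mu>. a \<eta> x)" "integrable \<mu> (a \<eta>)"
    if dis: "disintegration X Y \<mu> \<rho> \<eta>" and fr: "finite_measure \<rho>" for \<rho> \<eta>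
  proof -
    have ke: "kernel X Y \<eta>" and s: "sets \<rho> = sets borel" using dis by (simp_all add: disintegration_def)
    have po: "\<eta> x \<in> prob_on Y" if "x \<in> X" for x using ke that by (simp add: kernel_def)
    have AE01: "AE x in \<mu>. 0 \<le> a \<eta> x \<and> a \<eta> x \<le> 1"
      using AE_X[OF X \<mu>] by eventually_elim (use a_eq po in auto)
    then show i: "integrable \<mu> (a \<eta>)"
      by (intro \<mu>.integrable_const_bound[of _ 1] a_meas[OF ke]) (auto elim!: AE_mp)
    have "ennreal (LINT z|\<rho>. \<phi> z) = (\<integral>\<^sup>+ z. ennreal (\<phi> z) \<partial>\<rho>)" by (rule nn_integral_lip01[OF \<phi> fr s, symmetric])
    also have "\<dots> = (\<integral>\<^sup>+ x. \<integral>\<^sup>+ y. ennreal (\<phi> (x, y)) \<partial>\<eta> x \<partial>\<mu>)" by (rule nn_integral_disintegration[OF X \<mu>(2,3) dis \<phi>m])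
    also have "\<dots> = (\<integral>\<^sup>+ x. ennreal (a \<eta> x) \<partial>\<mu>)"
    proof (rule nn_integral_cong_AE, use AE_X[OF X \<mu>] in eventually_elim)
      fix x assume x: "x \<in> X"
      have a1: "a \<eta> x = (LINT y|\<eta> x. \<phi> (x, y))" by (rule a_eq(1)) (rule x, rule po[OF x])
      show "(\<integral>\<^sup>+ y. ennreal (\<phi> (x, y)) \<partial>\<eta> x) = ennreal (a \<eta> x)"
        unfolding a1
        by (rule nn_integral_lip01[OF sec prob_space.finite_measure[OF prob_onD(3)[OF po[OF x]]] prob_onD(1)[OF po[OF x]]])
    qed
    also have "\<dots> = ennreal (LINT x|\<mu>. a \<eta> x)" using AE01 by (intro nn_integral_eq_integral i) (auto elim!: AE_mp)
    finally have e: "ennreal (LINT z|\<rho>. \<phi> z) = ennreal (LINT x|\<mu>. a \<eta> x)" .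
    have "0 \<le> (LINT z|\<rho>. \<phi> z)" using lip01D(2)[OF \<phi>] by (intro integral_nonneg_AE) simp
    moreover have "0 \<le> (LINT x|\<mu>. a \<eta> x)" using AE01 by (intro integral_nonneg_AE) (auto elim!: AE_mp)
    ultimately show "(LINT z|\<rho>. \<phi> z) = (LINT x|\<mu>. a \<eta> x)" using e by (simp only: ennreal_inj)
  qed
  note r = rep[OF d fin(1)] rep[OF d' fin(2)]
  have "\<bar>(LINT z|\<pi>. \<phi> z) - (LINT z|\<pi>'. \<phi> z)\<bar> = \<bar>LINT x|\<mu>. a \<kappa> x - a \<kappa>' x\<bar>"
    unfolding r(1,3) using r(2,4) by simp
  also have "\<dots> \<le> (LINT x|\<mu>. \<bar>a \<kappa> x - a \<kappa>' x\<bar>)" by (rule integral_abs_bound)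
  finally have "ennreal \<bar>(LINT z|\<pi>. \<phi> z) - (LINT z|\<pi>'. \<phi> z)\<bar> \<le> ennreal (LINT x|\<mu>. \<bar>a \<kappa> x - a \<kappa>' x\<bar>)" by (rule ennreal_leI)
  also have "\<dots> = (\<integral>\<^sup>+ x. ennreal \<bar>a \<kappa> x - a \<kappa>' x\<bar> \<partial>\<mu>)"
    using r(2,4) by (intro nn_integral_eq_integral[symmetric]) simp_all
  also have "\<dots> \<le> (\<integral>\<^sup>+ x. ennreal L * (ennreal (1 / real (Suc m)) + ennreal D *
    (\<Sum>q<N m. ennreal \<bar>(LINT y|\<kappa> x. \<psi> m q y) - (LINT y|\<kappa>' x. \<psi> m q y)\<bar> * indicator X x)) \<partial>\<mu>)"
  proof (rule nn_integral_mono_AE, use AE_X[OF X \<mu>] in eventually_elim)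
    fix x assume x: "x \<in> X"
    let ?S = "\<Sum>q<N m. \<bar>(LINT y|\<kappa> x. \<psi> m q y) - (LINT y|\<kappa>' x. \<psi> m q y)\<bar>"
    have S: "0 \<le> ?S" by (intro sum_nonneg) simp
    have a1: "a \<kappa> x = (LINT y|\<kappa> x. \<phi> (x, y))" by (rule a_eq(1)) (rule x, rule po(1)[OF x])
    have a2: "a \<kappa>' x = (LINT y|\<kappa>' x. \<phi> (x, y))" by (rule a_eq(1)) (rule x, rule po(2)[OF x])
    have "ennreal \<bar>a \<kappa> x - a \<kappa>' x\<bar> \<le> ennreal (L * (1 / real (Suc m) + D * ?S))"
      unfolding a1 a2
      by (intro ennreal_leI test_difference_le po x sec L)
    also have "\<dots> = ennreal L * (ennreal (1 / real (Suc m)) + ennreal D * ennreal ?S)"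
      using L D(1) S by (simp add: ennreal_mult ennreal_plus del: of_nat_Suc)
    also have "ennreal ?S = (\<Sum>q<N m. ennreal \<bar>(LINT y|\<kappa> x. \<psi> m q y) - (LINT y|\<kappa>' x. \<psi> m q y)\<bar> * indicator X x)"
      using x by (subst sum_ennreal[symmetric]) simp_all
    finally show "ennreal \<bar>a \<kappa> x - a \<kappa>' x\<bar> \<le> ennreal L * (ennreal (1 / real (Suc m)) + ennreal D *
      (\<Sum>q<N m. ennreal \<bar>(LINT y|\<kappa> x. \<psi> m q y) - (LINT y|\<kappa>' x. \<psi> m q y)\<bar> * indicator X x))" .
  qed
  also have "\<dots> = ennreal L * (ennreal (1 / real (Suc m)) + ennreal D *
    (\<Sum>q<N m. \<integral>\<^sup>+ x. ennreal \<bar>(LINT y|\<kappa> x. \<psi> m q y) - (LINT y|\<kappa>' x. \<psi> m q y)\<bar> \<partial>\<mu>))"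
  proof -
    define G where "G q x = ennreal \<bar>(LINT y|\<kappa> x. \<psi> m q y) - (LINT y|\<kappa>' x. \<psi> m q y)\<bar> * indicator X x" for q x
    have Gr: "(\<lambda>x. ennreal \<bar>(LINT y|\<kappa> x. \<psi> m q y) - (LINT y|\<kappa>' x. \<psi> m q y)\<bar>) \<in> borel_measurable (restrict_space borel X)" for q
      by (intro measurable_compose[OF _ measurable_ennreal] borel_measurable_abs borel_measurable_diff
          test_kernel_measurable[OF X \<mu>(2,3) k(1) \<psi>] test_kernel_measurable[OF X \<mu>(2,3) k(2) \<psi>])
    have Gm: "G q \<in> borel_measurable \<mu>" for q
      unfolding G_def[abs_def] by (rule nn_integral_extend_zero(1)[OF X \<mu>(2,3) Gr])
    have Gi: "(\<integral>\<^sup>+ x. ennreal \<bar>(LINT y|\<kappa> x. \<psi> m q y) - (LINT y|\<kappa>' x. \<psi> m q y)\<bar> \<partial>\<mu>) = (\<integral>\<^sup>+ x. G q x \<partial>\<mu>)" for q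
      unfolding G_def by (rule nn_integral_extend_zero(2)[OF X \<mu>(2,3) Gr])
    have Gs: "(\<lambda>x. \<Sum>q<N m. G q x) \<in> borel_measurable \<mu>" by (intro borel_measurable_sum Gm)
    show ?thesis
      unfolding Gi G_def[symmetric] nn_integral_sum[OF Gm, symmetric]
      using Gs by (simp add: nn_integral_cmult nn_integral_add \<mu>.emeasure_space_1)
  qed
  finally show ?thesis .
qed

section \<open>Limits of trajectories\<close>

context test_family
begin

context
  fixes X :: "'a::{metric_space,second_countable_topology} set" and \<mu> :: "'a measure"
  assumes X: "X \<in> sets borel" and \<mu>: "prob_space \<mu>" "sets \<mu> = sets borel" "emeasure \<mu> (- X) = 0"
begin

text \<open>One colouring for each test, time horizon and accuracy: their common subsequence is Cauchy in
  \<open>L\<^sup>1\<close> for every test, uniformly on bounded time intervals. The limit kernels exist at each time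
  separately and inherit the uniform rate.\<close>

lemma limit_trajectory:
  fixes \<kappa> :: "nat \<Rightarrow> real \<Rightarrow> 'a \<Rightarrow> 'b measure"
  assumes \<kappa>: "\<And>p t. kernel X Y (\<kappa> p t)" and \<nu>: "\<nu> \<in> prob_on Y"
    and col: "\<And>m q T \<epsilon>. 0 < \<epsilon> \<Longrightarrow> \<exists>(colour :: nat \<Rightarrow> 'c) p0. finite (range colour) \<and>
      (\<forall>p\<ge>p0. \<forall>p'\<ge>p0. colour p = colour p' \<longrightarrow> (\<forall>t\<in>{0..T}.
        (\<integral>\<^sup>+ x. ennreal \<bar>(LINT y|\<kappa> p t x. \<psi> m q y) - (LINT y|\<kappa> p' t x. \<psi> m q y)\<bar> \<partial>\<mu>) \<le> ennreal \<epsilon>))"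
  shows "\<exists>(s :: nat \<Rightarrow> nat) \<eta>. strict_mono s \<and> (\<forall>t\<ge>0. kernel X Y (\<eta> t)) \<and>
    (\<forall>m q T \<epsilon>. q < N m \<longrightarrow> 0 < \<epsilon> \<longrightarrow> (\<exists>j0. \<forall>j\<ge>j0. \<forall>t\<in>{0..T}.
      (\<integral>\<^sup>+ x. ennreal \<bar>(LINT y|\<kappa> (s j) t x. \<psi> m q y) - (LINT y|\<eta> t x. \<psi> m q y)\<bar> \<partial>\<mu>) \<le> ennreal \<epsilon>))"
proof -
  define I where "I m q t p p' = (\<integral>\<^sup>+ x. ennreal \<bar>(LINT y|\<kappa> p t x. \<psi> m q y) - (LINT y|\<kappa> p' t x. \<psi> m q y)\<bar> \<partial>\<mu>)"
    for m q t p p'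
  \<comment> \<open>The components of a code are the index of the partition, the index of the test, the time horizon
    and the accuracy.\<close>
  define code where "code c = (from_nat c :: nat \<times> nat \<times> nat \<times> nat)" for c :: nat
  define Q where "Q c z \<longleftrightarrow> finite (range (fst z)) \<and> (\<forall>p\<ge>snd z. \<forall>p'\<ge>snd z. fst z p = fst z p' \<longrightarrow>
      (\<forall>t\<in>{0..real (fst (snd (snd (code c))))}. I (fst (code c)) (fst (snd (code c))) t p p'
        \<le> ennreal (1 / real (Suc (snd (snd (snd (code c))))))))"
    for c and z :: "(nat \<Rightarrow> 'c) \<times> nat"
  have "\<exists>z. Q c z" for c
  proof -
    have pos: "0 < 1 / real (Suc (snd (snd (snd (code c)))))" by simp
    obtain colour :: "nat \<Rightarrow> 'c" and p0 where cp: "finite (range colour)"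
      "\<forall>p\<ge>p0. \<forall>p'\<ge>p0. colour p = colour p' \<longrightarrow> (\<forall>t\<in>{0..real (fst (snd (snd (code c))))}.
        I (fst (code c)) (fst (snd (code c))) t p p' \<le> ennreal (1 / real (Suc (snd (snd (snd (code c)))))))"
      using col[OF pos, of "real (fst (snd (snd (code c))))" "fst (code c)" "fst (snd (code c))"] unfolding I_def by blast
    have "Q c (colour, p0)" unfolding Q_def fst_conv snd_conv by (rule conjI[OF cp])
    then show ?thesis by (rule exI)
  qed
  then have "\<forall>c. \<exists>z. Q c z" by (intro allI)
  from choice[OF this] obtain z where z: "\<And>c. Q c (z c)" by blast
  have "finite (range (fst (z c)))" for c using z[of c] unfolding Q_def by (rule conjunct1)
  then obtain s :: "nat \<Rightarrow> nat" where s: "strict_mono s"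
    and sz: "\<And>c. \<exists>j0. \<forall>i\<ge>j0. \<forall>j\<ge>j0. snd (z c) \<le> s i \<and> snd (z c) \<le> s j \<and> fst (z c) (s i) = fst (z c) (s j)"
    using diagonal_subsequence_of_colourings[of "\<lambda>c. fst (z c)" "\<lambda>c. snd (z c)"] by blast
  have unif: "\<exists>j0. \<forall>i\<ge>j0. \<forall>j\<ge>j0. \<forall>t\<in>{0..T}. I m q t (s i) (s j) \<le> ennreal \<epsilon>" if \<epsilon>: "0 < \<epsilon>" for m q T \<epsilon>
  proof -
    obtain a where a: "T \<le> real a" using real_arch_simple by blast
    obtain e where e: "1 / real (Suc e) < \<epsilon>" using nat_approx_posE[OF \<epsilon>] by blast
    define c where "c = to_nat (m, q, a, e)"
    have c: "code c = (m, q, a, e)" by (simp add: code_def c_def)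
    obtain j0 where j0: "\<And>i j. j0 \<le> i \<Longrightarrow> j0 \<le> j \<Longrightarrow>
      snd (z c) \<le> s i \<and> snd (z c) \<le> s j \<and> fst (z c) (s i) = fst (z c) (s j)" using sz[of c] by blast
    have zc: "fst (z c) p = fst (z c) p' \<Longrightarrow> snd (z c) \<le> p \<Longrightarrow> snd (z c) \<le> p' \<Longrightarrow> t \<in> {0..real a} \<Longrightarrow>
      I m q t p p' \<le> ennreal (1 / real (Suc e))" for p p' t
      using z[of c] unfolding Q_def c fst_conv snd_conv by blast
    have "I m q t (s i) (s j) \<le> ennreal \<epsilon>" if "j0 \<le> i" "j0 \<le> j" "t \<in> {0..T}" for i j t
    proof -
      have "I m q t (s i) (s j) \<le> ennreal (1 / real (Suc e))" using j0[OF that(1,2)] that(3) a by (intro zc) auto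
      also have "\<dots> \<le> ennreal \<epsilon>" using e by (intro ennreal_leI) simp
      finally show ?thesis .
    qed
    then show ?thesis by blast
  qed
  define R where "R t \<theta> \<longleftrightarrow> kernel X Y \<theta> \<and> (\<forall>m q \<epsilon> j0. q < N m \<longrightarrow>
    (\<forall>i\<ge>j0. \<forall>j\<ge>j0. I m q t (s i) (s j) \<le> ennreal \<epsilon>) \<longrightarrow>
    (\<forall>i\<ge>j0. (\<integral>\<^sup>+ x. ennreal \<bar>(LINT y|\<kappa> (s i) t x. \<psi> m q y) - (LINT y|\<theta> x. \<psi> m q y)\<bar> \<partial>\<mu>) \<le> ennreal \<epsilon>))" for t \<theta>
  have "\<exists>\<theta>. R t \<theta>" if t: "0 \<le> t" for t
    unfolding R_def I_def
  proof (rule limit_kernel[OF X \<mu> \<kappa> \<nu>])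
    fix m q :: nat and \<epsilon> :: real assume "0 < \<epsilon>"
    from unif[OF this, of t m q] obtain j0
      where j0: "\<forall>i\<ge>j0. \<forall>j\<ge>j0. \<forall>t'\<in>{0..t}. I m q t' (s i) (s j) \<le> ennreal \<epsilon>" by blast
    have "\<forall>i\<ge>j0. \<forall>j\<ge>j0. I m q t (s i) (s j) \<le> ennreal \<epsilon>" using j0 t by simp
    then show "\<exists>j0. \<forall>i\<ge>j0. \<forall>j\<ge>j0. (\<integral>\<^sup>+ x. ennreal \<bar>(LINT y|\<kappa> (s i) t x. \<psi> m q y) - (LINT y|\<kappa> (s j) t x. \<psi> m q y)\<bar> \<partial>\<mu>) \<le> ennreal \<epsilon>"
      unfolding I_def by (rule exI)
  qed
  then have "\<forall>t. \<exists>\<theta>. 0 \<le> t \<longrightarrow> R t \<theta>" by blast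
  from choice[OF this] obtain \<eta> where \<eta>: "\<And>t. 0 \<le> t \<Longrightarrow> R t (\<eta> t)" by blast
  have "\<exists>j0. \<forall>j\<ge>j0. \<forall>t\<in>{0..T}.
      (\<integral>\<^sup>+ x. ennreal \<bar>(LINT y|\<kappa> (s j) t x. \<psi> m q y) - (LINT y|\<eta> t x. \<psi> m q y)\<bar> \<partial>\<mu>) \<le> ennreal \<epsilon>"
    if q: "q < N m" and \<epsilon>: "0 < \<epsilon>" for m q T \<epsilon>
  proof -
    obtain j0 where j0: "\<And>i j t. j0 \<le> i \<Longrightarrow> j0 \<le> j \<Longrightarrow> t \<in> {0..T} \<Longrightarrow> I m q t (s i) (s j) \<le> ennreal \<epsilon>"
      using unif[OF \<epsilon>, of T m q] by blast
    have "(\<integral>\<^sup>+ x. ennreal \<bar>(LINT y|\<kappa> (s j) t x. \<psi> m q y) - (LINT y|\<eta> t x. \<psi> m q y)\<bar> \<partial>\<mu>) \<le> ennreal \<epsilon>"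
      if j: "j0 \<le> j" and t: "t \<in> {0..T}" for j t
    proof -
      have "R t (\<eta> t)" using t by (intro \<eta>) simp
      moreover have "\<forall>i\<ge>j0. \<forall>j\<ge>j0. I m q t (s i) (s j) \<le> ennreal \<epsilon>" using j0 t by blast
      ultimately show ?thesis unfolding R_def using q j by blast
    qed
    then show ?thesis by blast
  qed
  moreover have "kernel X Y (\<eta> t)" if "0 \<le> t" for t using \<eta>[OF that] unfolding R_def by (rule conjunct1)
  ultimately show ?thesis using s by (intro exI[of _ s] exI[of _ \<eta>] conjI) simp_all
qed

context
  fixes \<kappa> :: "nat \<Rightarrow> real \<Rightarrow> 'a \<Rightarrow> 'b measure" and \<eta> :: "real \<Rightarrow> 'a \<Rightarrow> 'b measure"
    and \<pi> :: "nat \<Rightarrow> real \<Rightarrow> ('a \<times> 'b) measure" and P :: "real \<Rightarrow> ('a \<times> 'b) measure"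
  assumes d: "\<And>j t. disintegration X Y \<mu> (\<pi> j t) (\<kappa> j t)"
    and d': "\<And>t. 0 \<le> t \<Longrightarrow> disintegration X Y \<mu> (P t) (\<eta> t)"
    and lim: "\<And>m q T \<epsilon>. q < N m \<Longrightarrow> 0 < \<epsilon> \<Longrightarrow> \<exists>j0. \<forall>j\<ge>j0. \<forall>t\<in>{0..T}.
      (\<integral>\<^sup>+ x. ennreal \<bar>(LINT y|\<kappa> j t x. \<psi> m q y) - (LINT y|\<eta> t x. \<psi> m q y)\<bar> \<partial>\<mu>) \<le> ennreal \<epsilon>"
begin

text \<open>The mesh of the partition of unity is fixed before the finitely many tests in it are made close.\<close>

lemma test_error_small:
  assumes e: "0 < e"
  shows "\<exists>m j0. \<forall>j\<ge>j0. \<forall>t\<in>{0..T}. ennreal (1 / real (Suc m)) + ennreal D *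
    (\<Sum>q<N m. \<integral>\<^sup>+ x. ennreal \<bar>(LINT y|\<kappa> j t x. \<psi> m q y) - (LINT y|\<eta> t x. \<psi> m q y)\<bar> \<partial>\<mu>) \<le> ennreal e"
proof -
  obtain m where m: "1 / real (Suc m) < e / 2" using nat_approx_posE[of "e / 2"] e by auto
  define \<epsilon> where "\<epsilon> = e / (2 * (D * real (N m) + 1))"
  have DN: "0 \<le> D * real (N m)" using D(1) by simp
  have \<epsilon>: "0 < \<epsilon>" using e DN by (simp add: \<epsilon>_def)
  have "2 * (D * real (N m) + 1) * \<epsilon> = e" using DN unfolding \<epsilon>_def by simp
  then have \<epsilon>D: "D * (real (N m) * \<epsilon>) \<le> e / 2" using \<epsilon> by (simp add: algebra_simps)
  let ?I = "\<lambda>j t q. \<integral>\<^sup>+ x. ennreal \<bar>(LINT y|\<kappa> j t x. \<psi> m q y) - (LINT y|\<eta> t x. \<psi> m q y)\<bar> \<partial>\<mu>"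
  have "\<forall>\<^sub>F j in sequentially. \<forall>q\<in>{..<N m}. \<forall>t\<in>{0..T}. ?I j t q \<le> ennreal \<epsilon>"
  proof (rule eventually_ball_finite[OF finite_lessThan], rule ballI)
    fix q assume "q \<in> {..<N m}"
    then have "q < N m" by simp
    from lim[OF this \<epsilon>, of T] show "\<forall>\<^sub>F j in sequentially. \<forall>t\<in>{0..T}. ?I j t q \<le> ennreal \<epsilon>"
      unfolding eventually_sequentially .
  qed
  then obtain j0 where j0: "\<And>j q t. j0 \<le> j \<Longrightarrow> q < N m \<Longrightarrow> t \<in> {0..T} \<Longrightarrow> ?I j t q \<le> ennreal \<epsilon>"
    unfolding eventually_sequentially by blast
  have "ennreal (1 / real (Suc m)) + ennreal D * (\<Sum>q<N m. ?I j t q) \<le> ennreal e" if "j0 \<le> j" "t \<in> {0..T}" for j t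
  proof -
    have "(\<Sum>q<N m. ?I j t q) \<le> (\<Sum>q<N m. ennreal \<epsilon>)" using j0 that by (intro sum_mono) simp
    also have "\<dots> = ennreal (real (N m) * \<epsilon>)"
      using \<epsilon> by (simp add: ennreal_mult ennreal_of_nat_eq_real_of_nat)
    finally have "ennreal (1 / real (Suc m)) + ennreal D * (\<Sum>q<N m. ?I j t q)
      \<le> ennreal (1 / real (Suc m)) + ennreal D * ennreal (real (N m) * \<epsilon>)"
      by (intro add_left_mono mult_left_mono) simp_all
    also have "\<dots> = ennreal (1 / real (Suc m) + D * (real (N m) * \<epsilon>))"
      using D(1) \<epsilon> by (simp add: ennreal_mult ennreal_plus del: of_nat_Suc)
    also have "\<dots> \<le> ennreal e" using m \<epsilon>D by (intro ennreal_leI) linarith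
    finally show ?thesis .
  qed
  then show ?thesis by blast
qed

lemma vertical_W_uniform_limit: "(\<lambda>j. SUP t\<in>{0..T}. vertical_W X Y \<mu> (\<pi> j t) (P t)) \<longlonglongrightarrow> 0"
proof (rule order_tendstoI)
  fix a :: ennreal assume a: "0 < a"
  obtain b where b: "0 < b" "b < a" using dense[OF a] by blast
  then obtain e where e: "b = ennreal e" "0 < e" by (cases b) (auto simp: ennreal_less_zero_iff)
  obtain m j0 where mj: "\<And>j t. j0 \<le> j \<Longrightarrow> t \<in> {0..T} \<Longrightarrow> ennreal (1 / real (Suc m)) + ennreal D *
    (\<Sum>q<N m. \<integral>\<^sup>+ x. ennreal \<bar>(LINT y|\<kappa> j t x. \<psi> m q y) - (LINT y|\<eta> t x. \<psi> m q y)\<bar> \<partial>\<mu>) \<le> ennreal e"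
    using test_error_small[OF e(2), of T] by blast
  have "(SUP t\<in>{0..T}. vertical_W X Y \<mu> (\<pi> j t) (P t)) < a" if j: "j0 \<le> j" for j
  proof -
    have "vertical_W X Y \<mu> (\<pi> j t) (P t) \<le> ennreal e" if t: "t \<in> {0..T}" for t
    proof (rule order.trans[OF _ mj[OF j t]])
      have t0: "0 \<le> t" using t by simp
      show "vertical_W X Y \<mu> (\<pi> j t) (P t) \<le> ennreal (1 / real (Suc m)) + ennreal D *
        (\<Sum>q<N m. \<integral>\<^sup>+ x. ennreal \<bar>(LINT y|\<kappa> j t x. \<psi> m q y) - (LINT y|\<eta> t x. \<psi> m q y)\<bar> \<partial>\<mu>)"
        by (rule vertical_W_le_test_differences[where \<psi> = "\<psi> m", OF X \<mu>(2,3,1) d d'[OF t0] closed_Y \<psi> sum1 D])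
           (assumption+, simp, erule (1) small)
    qed
    then have "(SUP t\<in>{0..T}. vertical_W X Y \<mu> (\<pi> j t) (P t)) \<le> ennreal e" by (intro SUP_least)
    then show ?thesis using b(2) e(1) by simp
  qed
  then show "\<forall>\<^sub>F j in sequentially. (SUP t\<in>{0..T}. vertical_W X Y \<mu> (\<pi> j t) (P t)) < a"
    unfolding eventually_sequentially by blast
qed simp

lemma joint_tests_converge:
  assumes \<phi>: "\<phi> \<in> lip01 L" and t: "0 \<le> t" and fin: "\<And>j. finite_measure (\<pi> j t)" "finite_measure (P t)"
  shows "(\<lambda>j. LINT z|\<pi> j t. \<phi> z) \<longlonglongrightarrow> (LINT z|P t. \<phi> z)"
proof (rule tendstoI)
  fix e :: real assume e: "0 < e"
  define L' where "L' = max L 1"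
  have L': "0 < L'" "\<phi> \<in> lip01 L'" using lip01_mono[OF \<phi>, of L'] by (simp_all add: L'_def)
  have e': "0 < e / (2 * L')" using e L'(1) by simp
  obtain m j0 where mj: "\<And>j. j0 \<le> j \<Longrightarrow> ennreal (1 / real (Suc m)) + ennreal D *
    (\<Sum>q<N m. \<integral>\<^sup>+ x. ennreal \<bar>(LINT y|\<kappa> j t x. \<psi> m q y) - (LINT y|\<eta> t x. \<psi> m q y)\<bar> \<partial>\<mu>) \<le> ennreal (e / (2 * L'))"
    using test_error_small[OF e', of t] t by fastforce
  have "dist (LINT z|\<pi> j t. \<phi> z) (LINT z|P t. \<phi> z) < e" if j: "j0 \<le> j" for j
  proof -
    have "ennreal \<bar>(LINT z|\<pi> j t. \<phi> z) - (LINT z|P t. \<phi> z)\<bar> \<le> ennreal L' * ennreal (e / (2 * L'))"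
      by (rule order.trans[OF joint_test_difference_le[OF test_family_axioms X \<mu> d d'[OF t] L'(2,1) fin] mult_left_mono[OF mj[OF j]]]) simp
    also have "\<dots> = ennreal (e / 2)" using L'(1) e by (simp flip: ennreal_mult)
    finally have "\<bar>(LINT z|\<pi> j t. \<phi> z) - (LINT z|P t. \<phi> z)\<bar> \<le> e / 2" using e by (subst (asm) ennreal_le_iff) simp_all
    then show ?thesis using e by (simp add: dist_real_def)
  qed
  then show "\<forall>\<^sub>F j in sequentially. dist (LINT z|\<pi> j t. \<phi> z) (LINT z|P t. \<phi> z) < e"
    unfolding eventually_sequentially by blast
qed

end

end

end

section \<open>Measures given by a disintegration\<close>

lemma disintegration_fst:
  fixes \<mu> :: "'a::topological_space measure" and \<pi> :: "('a \<times> 'b::topological_space) measure"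
  assumes \<mu>: "\<mu> \<in> prob_on X" and X: "closed X" and d: "disintegration X Y \<mu> \<pi> \<kappa>"
  shows "distr \<pi> borel fst = \<mu>"
proof (rule measure_eqI)
  have s: "sets \<pi> = sets borel" and k: "kernel X Y \<kappa>" using d by (simp_all add: disintegration_def)
  have sp: "space \<pi> = UNIV" using sets_eq_imp_space_eq[OF s] by simp
  have m: "fst \<in> measurable \<pi> borel" using fst_snd_borel(1) by (subst measurable_cong_sets[OF s refl])
  show "sets (distr \<pi> borel fst) = sets \<mu>" by (simp add: prob_onD(1)[OF \<mu>])
  fix A assume "A \<in> sets (distr \<pi> borel fst)"
  then have A: "A \<in> sets borel" by simp
  have A': "(fst :: 'a \<times> 'b \<Rightarrow> 'a) -` A \<in> sets borel" using measurable_sets[OF m A] by (simp add: sp s)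
  have "emeasure (distr \<pi> borel fst) A = (\<integral>\<^sup>+ x. emeasure (\<kappa> x) (Pair x -` (fst -` A)) \<partial>\<mu>)"
    using d A' m A by (simp add: emeasure_distr disintegration_def sp)
  also have "\<dots> = (\<integral>\<^sup>+ x. indicator A x \<partial>\<mu>)"
  proof (rule nn_integral_cong_AE, use prob_on_AE[OF \<mu> X] in eventually_elim)
    fix x assume "x \<in> X"
    then have "\<kappa> x \<in> prob_on Y" using k by (simp add: kernel_def)
    note p = prob_onD[OF this]
    have "emeasure (\<kappa> x) UNIV = 1" using prob_space.emeasure_space_1[OF p(3)] p(2) by simp
    moreover have "Pair x -` (fst -` A) = (if x \<in> A then (UNIV :: 'b set) else {})" by auto
    ultimately show "emeasure (\<kappa> x) (Pair x -` (fst -` A)) = indicator A x" by simp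
  qed
  also have "\<dots> = emeasure \<mu> A" using A by (simp add: prob_onD(1)[OF \<mu>])
  finally show "emeasure (distr \<pi> borel fst) A = emeasure \<mu> A" .
qed

lemma kernel_emeasure_section:
  assumes k: "kernel S Z \<kappa>" and s: "s \<in> S"
  shows "emeasure (\<kappa> s) (Pair s -` (- (S \<times> Z))) = 0" "emeasure (\<kappa> s) UNIV = 1"
proof -
  have "\<kappa> s \<in> prob_on Z" using k s by (simp add: kernel_def)
  note p = prob_onD[OF this]
  have "Pair s -` (- (S \<times> Z)) = - Z" using s by auto
  then show "emeasure (\<kappa> s) (Pair s -` (- (S \<times> Z))) = 0" using p(4) by simp
  show "emeasure (\<kappa> s) UNIV = 1" using prob_space.emeasure_space_1[OF p(3)] p(2) by simp
qed

lemma disintegration_prob_on: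
  assumes \<mu>: "\<mu> \<in> prob_on X" and X: "closed X" and Y: "closed Y" and d: "disintegration X Y \<mu> \<pi> \<kappa>"
  shows "\<pi> \<in> prob_on (X \<times> Y)"
proof -
  have s: "sets \<pi> = sets borel" and k: "kernel X Y \<kappa>" using d by (simp_all add: disintegration_def)
  have sp: "space \<pi> = UNIV" using sets_eq_imp_space_eq[OF s] by simp
  interpret \<mu>: prob_space \<mu> by (rule prob_onD(3)[OF \<mu>])
  have "emeasure \<pi> UNIV = (\<integral>\<^sup>+ x. emeasure (\<kappa> x) (Pair x -` UNIV) \<partial>\<mu>)" using d by (simp add: disintegration_def)
  also have "\<dots> = (\<integral>\<^sup>+ x. 1 \<partial>\<mu>)"
    by (rule nn_integral_cong_AE, use prob_on_AE[OF \<mu> X] in eventually_elim) (simp add: kernel_emeasure_section(2)[OF k])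
  finally have "prob_space \<pi>" by (intro prob_spaceI) (simp add: sp \<mu>.emeasure_space_1)
  moreover have "emeasure \<pi> (- (X \<times> Y)) = (\<integral>\<^sup>+ x. emeasure (\<kappa> x) (Pair x -` (- (X \<times> Y))) \<partial>\<mu>)"
  proof -
    have "- (X \<times> Y) \<in> sets borel" by (intro borel_open open_Compl closed_Times X Y)
    then show ?thesis using d by (simp add: disintegration_def)
  qed
  moreover have "\<dots> = (\<integral>\<^sup>+ x. 0 \<partial>\<mu>)"
    by (rule nn_integral_cong_AE, use prob_on_AE[OF \<mu> X] in eventually_elim) (rule kernel_emeasure_section(1)[OF k])
  ultimately show ?thesis using s by (simp add: prob_on_def)
qed

text \<open>A compact set meets only a bounded time interval, and every fibre is a probability measure.\<close>

lemma trajectory_measure: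
  fixes P :: "real \<Rightarrow> 'a::{second_countable_topology,t2_space} measure"
  assumes Z: "closed Z" and k: "kernel {0..} Z P"
  shows "disintegration {0..} Z (mrestrict lborel {0..}) (semidirect (mrestrict lborel {0..}) P) P"
    and "semidirect (mrestrict lborel {0..}) P \<in> radon_on ({0..} \<times> Z)"
proof -
  let ?l = "mrestrict lborel {0::real..}"
  have sl: "sets ?l = sets borel" by simp
  have nul: "emeasure ?l (- {0..}) = 0"
    unfolding mrestrict_def by (subst emeasure_density) (auto simp: indicator_def nn_integral_0_iff_AE)
  have S: "{0::real..} \<in> sets borel" by simp
  show d: "disintegration {0..} Z ?l (semidirect ?l P) P" by (rule disintegration_semidirect[OF sl nul S k])
  have AE0: "AE t in ?l. t \<in> {0..}" by (rule AE_carrier[OF S sl nul])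
  have "emeasure (semidirect ?l P) (- ({0..} \<times> Z)) = (\<integral>\<^sup>+ t. emeasure (P t) (Pair t -` (- ({0..} \<times> Z))) \<partial>?l)"
  proof -
    have "- ({0::real..} \<times> Z) \<in> sets borel" by (intro borel_open open_Compl closed_Times Z) simp
    then show ?thesis using d by (simp add: disintegration_def)
  qed
  also have "\<dots> = (\<integral>\<^sup>+ t. 0 \<partial>?l)"
    by (rule nn_integral_cong_AE, use AE0 in eventually_elim) (rule kernel_emeasure_section(1)[OF k])
  finally have 0: "emeasure (semidirect ?l P) (- ({0..} \<times> Z)) = 0" by simp
  have "emeasure (semidirect ?l P) K < \<infinity>" if K: "compact K" for K
  proof -
    have fK: "compact (fst ` K)" by (intro compact_continuous_image K continuous_intros)
    then have fb: "fst ` K \<in> sets borel" by (intro borel_closed compact_imp_closed)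
    have "emeasure (semidirect ?l P) K = (\<integral>\<^sup>+ t. emeasure (P t) (Pair t -` K) \<partial>?l)"
      using d borel_closed[OF compact_imp_closed[OF K]] by (simp add: disintegration_def)
    also have "\<dots> \<le> (\<integral>\<^sup>+ t. indicator (fst ` K) t \<partial>?l)"
    proof (rule nn_integral_mono_AE, use AE0 in eventually_elim)
      fix t :: real assume t: "t \<in> {0..}"
      then have "P t \<in> prob_on Z" using k by (simp add: kernel_def)
      note p = prob_onD[OF this]
      show "emeasure (P t) (Pair t -` K) \<le> indicator (fst ` K) t"
      proof (cases "t \<in> fst ` K")
        case True
        then show ?thesis using prob_space.emeasure_le_1[OF p(3)] by simp
      next
        case False
        then have "Pair t -` K = {}" by force
        then show ?thesis by simp
      qed
    qed
    also have "\<dots> = (\<integral>\<^sup>+ t. indicator (fst ` K) t * indicator {0..} t \<partial>lborel)"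
      using fb by (intro nn_integral_mrestrict) simp_all
    also have "\<dots> \<le> (\<integral>\<^sup>+ t. indicator (fst ` K) t \<partial>lborel)" by (intro nn_integral_mono) (simp add: indicator_def)
    also have "\<dots> = emeasure lborel (fst ` K)" using fb by simp
    also have "\<dots> < \<infinity>" using emeasure_bounded_finite[OF compact_imp_bounded[OF fK]] by simp
    finally show ?thesis .
  qed
  then show "semidirect ?l P \<in> radon_on ({0..} \<times> Z)" using 0 d by (simp add: radon_on_def disintegration_def)
qed

section \<open>Densities that are bounded and of bounded variation\<close>

text \<open>A cell has volume \<open>1 / n ^ CARD('n)\<close>.\<close>

lemma cell_mass_of_density:
  fixes \<mu> :: "(real^'n::finite) measure"
  assumes g: "g \<in> borel_measurable borel" "\<mu> = density lborel (\<lambda>x. ennreal (g x) * indicator unit_cube x)"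
      "0 < Ml" "\<And>x. x \<in> unit_cube \<Longrightarrow> Ml \<le> g x \<and> g x \<le> Mu"
    and n: "0 < n" and i: "i \<in> idx n"
  shows "measure \<mu> (cell n i) = (LINT x:cell n i|lborel. g x)"
    and "Ml \<le> real n ^ CARD('n) * measure \<mu> (cell n i)" "real n ^ CARD('n) * measure \<mu> (cell n i) \<le> Mu"
proof -
  let ?C = "cell n i"
  have sub: "?C \<subseteq> unit_cube" by (rule cell_subset_unit_cube[OF i])
  have C: "?C \<in> sets borel" by (rule borel_cell)
  have le: "Ml \<le> Mu" using g(4)[of 0] by (auto simp: mem_unit_cube)
  have cb: "emeasure lborel ?C < \<infinity>" unfolding cell_def by (simp add: emeasure_lborel_cbox_eq)
  have int: "set_integrable lborel ?C h" if "h \<in> borel_measurable borel" "\<And>x. x \<in> unit_cube \<Longrightarrow> \<bar>h x\<bar> \<le> Mu" for h :: "real^'n \<Rightarrow> real"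
    unfolding set_integrable_def
    using that sub cb C by (intro integrableI_bounded_set_indicator[where B = Mu]) (auto intro!: AE_I2)
  have ig: "set_integrable lborel ?C g" using g(3,4) by (intro int g(1)) force
  have ic: "set_integrable lborel ?C (\<lambda>x. a)" if "\<bar>a\<bar> \<le> Mu" for a using that by (intro int) simp_all
  have ne: "?C \<noteq> {}" using n by (auto simp: cell_def interval_ne_empty_cart divide_right_mono)
  have "measure lborel ?C = (\<Prod>l\<in>(UNIV :: 'n set). 1 / real n)"
    using content_cbox_cart[OF ne[unfolded cell_def]] by (simp add: cell_def add_divide_distrib)
  then have vol: "real n ^ CARD('n) * measure lborel ?C = 1" using n by (simp add: power_divide)
  have g0: "0 \<le> g x" if "x \<in> unit_cube" for x using g(3) g(4)[OF that] by linarith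
  have "emeasure \<mu> ?C = (\<integral>\<^sup>+ x. ennreal (g x) * indicator unit_cube x * indicator ?C x \<partial>lborel)"
    unfolding g(2) using g(1) C by (intro emeasure_density) (auto simp: unit_cube_def)
  also have "\<dots> = (\<integral>\<^sup>+ x. ennreal (indicator ?C x *\<^sub>R g x) \<partial>lborel)"
    using sub by (intro nn_integral_cong) (auto simp: indicator_def)
  also have "\<dots> = ennreal (LINT x:?C|lborel. g x)"
    unfolding set_lebesgue_integral_def
  proof (rule nn_integral_eq_integral[OF ig[unfolded set_integrable_def]])
    show "AE x in lborel. 0 \<le> indicator ?C x *\<^sub>R g x" using sub g0 by (intro AE_I2) (auto simp: indicator_def)
  qed
  finally have e: "emeasure \<mu> ?C = ennreal (LINT x:?C|lborel. g x)" .
  have "0 \<le> (LINT x:?C|lborel. g x)"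
    unfolding set_lebesgue_integral_def using sub g0 by (intro integral_nonneg_AE AE_I2) (auto simp: indicator_def)
  then show m: "measure \<mu> ?C = (LINT x:?C|lborel. g x)" by (simp add: measure_def e)
  have const: "(LINT x:?C|lborel. a) = a * measure lborel ?C" for a :: real
    using C cb by (simp add: set_lebesgue_integral_def)
  have lo: "Ml * measure lborel ?C \<le> measure \<mu> ?C"
    unfolding m const[symmetric] using g(3,4) sub le by (intro set_integral_mono ig ic) auto
  have hi: "measure \<mu> ?C \<le> Mu * measure lborel ?C"
    unfolding m const[symmetric] using g(3,4) sub le by (intro set_integral_mono ig ic) auto
  have "real n ^ CARD('n) * (Ml * measure lborel ?C) \<le> real n ^ CARD('n) * measure \<mu> ?C"
    using lo by (intro mult_left_mono) simp_all
  then show "Ml \<le> real n ^ CARD('n) * measure \<mu> ?C" using vol by (simp add: mult.left_commute)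
  have "real n ^ CARD('n) * measure \<mu> ?C \<le> real n ^ CARD('n) * (Mu * measure lborel ?C)"
    using hi by (intro mult_left_mono) simp_all
  then show "real n ^ CARD('n) * measure \<mu> ?C \<le> Mu" using vol by (simp add: mult.left_commute)
qed

text \<open>The masses are the cell integrals of the density, whose step variation is of order \<open>1 / n\<close>;
  rescaling by \<open>n ^ CARD('n)\<close> gives the order \<open>n ^ (CARD('n) - 1)\<close>.\<close>

lemma dd_regular_of_density:
  fixes \<mu> :: "(real^'n::finite) measure"
  assumes it: "dd_iterates Y \<mu> \<mu>n \<nu>n n \<pi> \<pi>J" and even: "even n" and gen: "AE x in \<mu>. x \<in> generic n"
    and g: "g \<in> borel_measurable borel" "\<mu> = density lborel (\<lambda>x. ennreal (g x) * indicator unit_cube x)"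
      "0 < Ml" "\<And>x. x \<in> unit_cube \<Longrightarrow> Ml \<le> g x \<and> g x \<le> Mu"
    and V: "total_variation (interior unit_cube) g \<le> ereal V"
    and W: "0 \<le> W" "\<And>k. WTVB Y \<mu> n (\<pi> k) \<le> ennreal W"
  shows "dd_regular Y \<mu> \<mu>n \<nu>n n \<pi> \<pi>J Ml Mu (2 * 3 ^ CARD('n) * V) W"
proof -
  interpret dd_iterates Y \<mu> \<mu>n \<nu>n n \<pi> \<pi>J by (rule it)
  note cm = cell_mass_of_density[OF g n]
  show ?thesis
  proof (unfold_locales, goal_cases)
    case (6 l)
    have "step_variation n 2 l (\<lambda>i. real n ^ CARD('n) * mass i)
      = real n ^ CARD('n) * step_variation n 2 l (\<lambda>i. LINT x:cell n i|lborel. g x)"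
      unfolding step_variation_def sum_distrib_left
    proof (rule sum.cong[OF refl])
      fix i :: "nat^'n" assume i: "i \<in> idx n"
      have "\<bar>real n ^ CARD('n) * mass (i + axis l 2) - real n ^ CARD('n) * mass i\<bar>
        = real n ^ CARD('n) * \<bar>(LINT x:cell n (i + axis l 2)|lborel. g x) - (LINT x:cell n i|lborel. g x)\<bar>"
        if "i $ l + 2 < n"
      proof -
        have "i + axis l 2 \<in> idx n" using i that by (simp add: add_axis_eq_vset idx_def)
        then have "mass (i + axis l 2) = (LINT x:cell n (i + axis l 2)|lborel. g x)" "mass i = (LINT x:cell n i|lborel. g x)"
          using i by (simp_all only: mass_def cm(1))
        then show ?thesis by (simp add: abs_mult flip: right_diff_distrib)
      qed
      then show "(if i $ l + 2 < n then \<bar>real n ^ CARD('n) * mass (i + axis l 2) - real n ^ CARD('n) * mass i\<bar> else 0)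
        = real n ^ CARD('n) * (if i $ l + 2 < n then \<bar>(LINT x:cell n (i + axis l 2)|lborel. g x) - (LINT x:cell n i|lborel. g x)\<bar> else 0)"
        by simp
    qed
    also have "\<dots> \<le> real n ^ CARD('n) * (2 * 3 ^ CARD('n) * V / real n)"
    proof (intro mult_left_mono)
      show "step_variation n 2 l (\<lambda>i. LINT x:cell n i|lborel. g x) \<le> 2 * 3 ^ CARD('n) * V / real n"
        by (rule cell_integral_variation[OF n g(1) _ V, of Mu]) (use g(3,4) in force)
    qed simp
    also have "\<dots> = 2 * 3 ^ CARD('n) * V * real n ^ (CARD('n) - 1)"
      using n power_minus_mult[of "CARD('n)" "real n"] by (simp add: field_simps)
    finally show ?case .
  qed (use even gen g(3) cm(2,3) W in \<open>simp_all add: mass_def\<close>)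
qed

section \<open>Convergence of the discrete trajectories\<close>

lemma test_family_exists:
  fixes Y :: "'b::euclidean_space set"
  assumes Y: "compact Y"
  obtains N \<psi> Lc where "test_family Y (diameter Y) N \<psi> Lc"
proof -
  define Q where "Q m z \<longleftrightarrow> 0 < snd (snd z) \<and> (\<forall>q. fst (snd z) q \<in> lip01 (snd (snd z))) \<and>
    (\<forall>y\<in>Y. (\<Sum>q<fst z. fst (snd z) q y) = 1) \<and>
    (\<forall>q y y'. fst (snd z) q y \<noteq> 0 \<longrightarrow> fst (snd z) q y' \<noteq> 0 \<longrightarrow> dist y y' \<le> 1 / real (Suc m))"
    for m and z :: "nat \<times> (nat \<Rightarrow> 'b \<Rightarrow> real) \<times> real"
  have "\<exists>z. Q m z" for m
  proof -
    have pos: "0 < 1 / real (Suc m)" by simp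
    obtain N and \<psi> :: "nat \<Rightarrow> 'b \<Rightarrow> real" and L
      where p: "0 < L" "\<And>q. \<psi> q \<in> lip01 L" "\<And>y. y \<in> Y \<Longrightarrow> (\<Sum>q<N. \<psi> q y) = 1"
        "\<And>q y y'. \<psi> q y \<noteq> 0 \<Longrightarrow> \<psi> q y' \<noteq> 0 \<Longrightarrow> dist y y' \<le> 1 / real (Suc m)"
    proof (rule lipschitz_partition_of_unity[OF Y pos])
      fix N and \<psi> :: "nat \<Rightarrow> 'b \<Rightarrow> real" and L
      assume "0 < L" "\<And>q. \<psi> q \<in> lip01 L" "\<And>y. y \<in> Y \<Longrightarrow> (\<Sum>q<N. \<psi> q y) = 1"
        "\<And>q y y'. \<psi> q y \<noteq> 0 \<Longrightarrow> \<psi> q y' \<noteq> 0 \<Longrightarrow> dist y y' \<le> 1 / real (Suc m)"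
      then show thesis by (rule that)
    qed
    have "Q m (N, \<psi>, L)" unfolding Q_def fst_conv snd_conv
      using p by auto
    then show ?thesis by (rule exI)
  qed
  then have "\<forall>m. \<exists>z. Q m z" by (intro allI)
  from choice[OF this] obtain z where z: "\<And>m. Q m (z m)" by blast
  have b: "bounded Y" using Y by (rule compact_imp_bounded)
  show ?thesis
  proof (rule that[of "\<lambda>m. fst (z m)" "\<lambda>m. fst (snd (z m))" "\<lambda>m. snd (snd (z m))"], unfold_locales)
    show "compact Y" by (rule Y)
    show "0 \<le> diameter Y" by (rule diameter_ge_0[OF b])
    show "dist y y' \<le> diameter Y" if "y \<in> Y" "y' \<in> Y" for y y' by (rule diameter_bounded_bound[OF b that])
    show "0 < snd (snd (z m))" for m using z[of m] unfolding Q_def by blast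
    show "fst (snd (z m)) q \<in> lip01 (snd (snd (z m)))" for m q using z[of m] unfolding Q_def by blast
    show "(\<Sum>q<fst (z m). fst (snd (z m)) q y) = 1" if "y \<in> Y" for m y using z[of m] that unfolding Q_def by blast
    show "dist y y' \<le> 1 / real (Suc m)" if "fst (snd (z m)) q y \<noteq> 0" "fst (snd (z m)) q y' \<noteq> 0" for m q y y'
      using z[of m] that unfolding Q_def by blast
  qed
qed

text \<open>The trajectory depends on time only through an integer, which makes it measurable in time.\<close>

lemma disc_trajectory_grid_time:
  assumes n: "0 < n"
  shows "disc_trajectory Y \<mu> \<pi> n t = disc_trajectory Y \<mu> \<pi> n (real (nat \<lfloor>real n * t\<rfloor>) / real n)"
proof -
  define k where "k = nat \<lfloor>real n * t\<rfloor>"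
  have "real n * (real k / real n) = real k" using n by simp
  then have "nat \<lfloor>real n * (real k / real n)\<rfloor> = k" by (simp only: floor_of_nat nat_int)
  then have "disc_kernel Y \<mu> \<pi> n t = disc_kernel Y \<mu> \<pi> n (real k / real n)"
    unfolding disc_kernel_def[abs_def] k_def by (simp only:)
  then show ?thesis unfolding disc_trajectory_def k_def by (simp only:)
qed

lemma set_integral_prob_on:
  assumes M: "M \<in> prob_on S" and S: "closed S" and \<phi>: "\<phi> \<in> lip01 L"
  shows "(LINT y:S|M. \<phi> y) = (LINT y|M. \<phi> y)"
  unfolding set_lebesgue_integral_def
proof (rule integral_cong_AE)
  have s: "sets M = sets borel" by (rule prob_onD(1)[OF M])
  show "\<phi> \<in> borel_measurable M" using lip01D(6)[OF \<phi>] unfolding measurable_cong_sets[OF s refl] .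
  then show "(\<lambda>y. indicator S y *\<^sub>R \<phi> y) \<in> borel_measurable M"
    using S by (intro borel_measurable_scaleR borel_measurable_indicator) (simp_all add: s)
  show "AE y in M. indicator S y *\<^sub>R \<phi> y = \<phi> y" using prob_on_AE[OF M S] by eventually_elim simp
qed

theorem proposition4p15:
  fixes Y :: "(real^'n::finite) set"
    and \<mu> \<nu> :: "(real^'n) measure"
    and c :: "(real^'n) \<times> (real^'n) \<Rightarrow> real"
    and \<pi>_init :: "((real^'n) \<times> (real^'n)) measure"
    and \<mu>n \<nu>n :: "nat \<Rightarrow> (real^'n) measure"
    and \<pi>n_init :: "nat \<Rightarrow> ((real^'n) \<times> (real^'n)) measure"
    and f :: "nat \<Rightarrow> (real^'n) \<times> (real^'n) \<Rightarrow> real"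
    and \<epsilon> :: "nat \<Rightarrow> real" and \<eta> :: ennreal
    and \<pi> :: "nat \<Rightarrow> nat \<Rightarrow> ((real^'n) \<times> (real^'n)) measure"
    and \<pi>J :: "nat \<Rightarrow> nat \<Rightarrow> (nat^'n) set \<Rightarrow> ((real^'n) \<times> (real^'n)) measure"
    and g :: "real^'n \<Rightarrow> real" and M\<^sub>l M\<^sub>u :: real
  assumes Y: "compact Y"
    and \<mu>: "\<mu> \<in> prob_on unit_cube" "absolutely_continuous lborel \<mu>"
    and \<nu>: "\<nu> \<in> prob_on Y"
    and c: "C1_on (unit_cube \<times> Y) c"
    and \<pi>_init: "\<pi>_init \<in> couplings \<mu> \<nu>"
    and m_pos: "\<And>n i. n \<in> pos_even \<Longrightarrow> i \<in> idx n \<Longrightarrow> 0 < emeasure \<mu> (cell n i)"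
    and \<mu>n: "\<And>n. n \<in> pos_even \<Longrightarrow> \<mu>n n \<in> prob_on unit_cube"
      "\<And>n i. n \<in> pos_even \<Longrightarrow> i \<in> idx n \<Longrightarrow> emeasure (\<mu>n n) (cell n i) = emeasure \<mu> (cell n i)"
      "\<And>n i. n \<in> pos_even \<Longrightarrow> i \<in> idx n \<Longrightarrow> emeasure (\<mu>n n) (frontier (cell n i)) = 0"
    and \<nu>n: "\<And>n. n \<in> pos_even \<Longrightarrow> \<nu>n n \<in> prob_on Y"
      "weak_star_conv Y \<nu>n \<nu> even_sequentially"
    and \<pi>n_init: "\<And>n. n \<in> pos_even \<Longrightarrow> \<pi>n_init n \<in> couplings (\<mu>n n) (\<nu>n n)"
      "weak_star_conv (unit_cube \<times> Y) \<pi>n_init \<pi>_init even_sequentially"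
    and f: "uniform_limit (unit_cube \<times> Y) f (\<lambda>_. 0) even_sequentially"
    and cn: "\<And>n. n \<in> pos_even \<Longrightarrow> continuous_on (unit_cube \<times> Y) (\<lambda>z. c z + f n z / real n)"
    and \<epsilon>: "\<And>n. n \<in> pos_even \<Longrightarrow> 0 \<le> \<epsilon> n"
      "((\<lambda>n. ennreal (real n * \<epsilon> n)) \<longlongrightarrow> \<eta>) even_sequentially"
    and iter_0: "\<And>n. n \<in> pos_even \<Longrightarrow> \<pi> n 0 = \<pi>n_init n"
    and iter_cell: "\<And>n k J. n \<in> pos_even \<Longrightarrow> 1 \<le> k \<Longrightarrow> J \<in> composites n k \<Longrightarrow>
      is_cell_minimizer Y (\<lambda>z. c z + f n z / real n) (\<epsilon> n) (\<mu>n n) (\<nu>n n) (comp_cell n J)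
        (\<pi> n (k - 1)) (\<pi>J n k J)"
    and iter_sum: "\<And>n k. n \<in> pos_even \<Longrightarrow> 1 \<le> k \<Longrightarrow>
      \<pi> n k = sum_measure (\<pi>J n k) (composites n k)"
    and g: "g \<in> borel_measurable borel"
      "\<mu> = density lborel (\<lambda>x. ennreal (g x) * indicator unit_cube x)"
      "0 < M\<^sub>l" "M\<^sub>l \<le> M\<^sub>u" "\<And>x. x \<in> unit_cube \<Longrightarrow> M\<^sub>l \<le> g x \<and> g x \<le> M\<^sub>u"
      "bounded_variation (interior unit_cube) g"
    and WTVB: "(SUP n\<in>pos_even. SUP k. WTVB Y \<mu> n (\<pi> n k)) < \<infinity>"
  shows "\<exists>(r :: nat \<Rightarrow> nat) (P :: (real \<times> (real^'n) \<times> (real^'n)) measure)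
      (Pt :: real \<Rightarrow> ((real^'n) \<times> (real^'n)) measure).
    strict_mono r \<and> range r \<subseteq> pos_even \<and>
    P \<in> radon_on ({0..} \<times> unit_cube \<times> Y) \<and>
    disintegration {0..} (unit_cube \<times> Y) (mrestrict lborel {0..}) P Pt \<and>
    (\<forall>t\<ge>0. Pt t \<in> couplings \<mu> \<nu>) \<and>
    (\<forall>T>0. (\<lambda>j. SUP t\<in>{0..T}. vertical_W unit_cube Y \<mu> (disc_trajectory Y \<mu> \<pi> (r j) t) (Pt t))
       \<longlonglongrightarrow> 0)"
proof -
  let ?C = "unit_cube :: (real^'n) set"
  have closed_Y: "closed Y" by (rule compact_imp_closed[OF Y])
  have Cc: "closed ?C" unfolding unit_cube_def by (rule closed_cbox)
  have Cb: "?C \<in> sets borel" by (rule borel_closed[OF Cc])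
  note \<mu>D = prob_onD[OF \<mu>(1)]
  interpret \<mu>: prob_space \<mu> by (rule \<mu>D(3))
  have AE_C: "AE x in \<mu>. x \<in> ?C" by (rule prob_on_AE[OF \<mu>(1) Cc])
  have gen: "AE x in \<mu>. x \<in> generic n" for n
  proof (rule AE_generic[OF \<mu>(1)])
    fix i :: "nat^'n"
    have "frontier (cell n i) \<in> null_sets \<mu>"
      using \<mu>(2) frontier_cell_null[of n i] unfolding absolutely_continuous_def by (rule subsetD)
    then show "emeasure \<mu> (frontier (cell n i)) = 0" by (simp add: null_sets_def)
  qed
  obtain W where W: "0 \<le> W" "\<And>n k. n \<in> pos_even \<Longrightarrow> WTVB Y \<mu> n (\<pi> n k) \<le> ennreal W"
  proof -
    define w where "w = (SUP n\<in>pos_even. SUP k. WTVB Y \<mu> n (\<pi> n k))"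
    have le: "WTVB Y \<mu> n (\<pi> n k) \<le> w" if "n \<in> pos_even" for n k
      unfolding w_def by (rule order.trans[OF SUP_upper[OF UNIV_I] SUP_upper[OF that]])
    have "ennreal (enn2real w) = w" using WTVB by (intro ennreal_enn2real) (simp add: w_def)
    then show thesis using le by (intro that[of "enn2real w"]) simp_all
  qed
  obtain V where V: "total_variation (interior ?C) g \<le> ereal V"
    using g(6) unfolding bounded_variation_def by (cases "total_variation (interior ?C) g") auto
  define G where "G = 2 * 3 ^ CARD('n) * V"
  have it: "dd_iterates Y \<mu> (\<mu>n n) (\<nu>n n) n (\<pi> n) (\<pi>J n)" if n: "n \<in> pos_even" for n
  proof (unfold_locales, goal_cases)
    case 9 show ?case using \<pi>n_init(1)[OF n] iter_0[OF n] by simp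
  next
    case (10 k J) show ?case using iter_cell[OF n 10] unfolding is_cell_minimizer_def by (rule conjunct1)
  next
    case (11 k) show ?case by (rule iter_sum[OF n 11])
  qed (use n closed_Y \<mu>(1) m_pos \<mu>n \<nu>n(1) in \<open>simp_all add: pos_even_def\<close>)
  have reg: "dd_regular Y \<mu> (\<mu>n n) (\<nu>n n) n (\<pi> n) (\<pi>J n) M\<^sub>l M\<^sub>u G W" if n: "n \<in> pos_even" for n
    unfolding G_def
    by (rule dd_regular_of_density[OF it[OF n] _ gen g(1,2,3,5) V W(1) W(2)[OF n]]) (use n in \<open>simp add: pos_even_def\<close>)
  have two: "2 ^ (p + 1) \<in> pos_even" for p by (simp add: pos_even_def)
  have ker: "kernel ?C Y (disc_kernel Y \<mu> \<pi> n t)" if "n \<in> pos_even" for n t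
    by (rule dd_iterates.kernel_disc[where p = \<pi>, OF it[OF that] refl])
  \<comment> \<open>Powers of two make the grids nested: the coarse grid of side \<open>1 / 2 ^ M\<close> is a union of
    composite cells at every finer resolution \<open>2 ^ (p + 1)\<close> with \<open>M \<le> p\<close>.\<close>
  define \<kappa> where "\<kappa> p t = disc_kernel Y \<mu> \<pi> (2 ^ (p + 1)) t" for p t
  have ker\<kappa>: "kernel ?C Y (\<kappa> p t)" for p t unfolding \<kappa>_def by (rule ker[OF two])
  obtain N \<psi> Lc where T: "test_family Y (diameter Y) N \<psi> Lc" by (rule test_family_exists[OF Y])
  interpret T: test_family Y "diameter Y" N \<psi> Lc by (rule T)
  have col: "\<exists>(colour :: nat \<Rightarrow> nat \<times> (nat^'n) \<Rightarrow> nat) p0. finite (range colour) \<and>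
      (\<forall>p\<ge>p0. \<forall>p'\<ge>p0. colour p = colour p' \<longrightarrow> (\<forall>t\<in>{0..\<tau>}.
        (\<integral>\<^sup>+ x. ennreal \<bar>(LINT y|\<kappa> p t x. \<psi> m q y) - (LINT y|\<kappa> p' t x. \<psi> m q y)\<bar> \<partial>\<mu>) \<le> ennreal e))"
    if e: "0 < e" for m q :: nat and \<tau> e
  proof -
    define v where "v p t x = (LINT y|\<kappa> p t x. \<psi> m q y)" for p t x
    \<comment> \<open>Off the cube the kernel is arbitrary, so it is replaced by zero there to obtain measurability.\<close>
    define u where "u p t x = v p t x * indicator ?C x" for p t x
    have u_meas: "u p t \<in> borel_measurable borel" for p t
    proof -
      have "v p t \<in> borel_measurable (restrict_space borel ?C)"
        unfolding v_def[abs_def] by (rule test_kernel_measurable[OF Cb \<mu>D(1,4) ker\<kappa> T.\<psi>])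
      then show ?thesis unfolding u_def[abs_def] using Cb
        by (subst (asm) borel_measurable_restrict_space_iff) (simp_all add: mult.commute)
    qed
    have uv: "(\<integral>\<^sup>+ x. ennreal \<bar>u p s x - h x\<bar> \<partial>\<mu>) = (\<integral>\<^sup>+ x. ennreal \<bar>v p s x - h x\<bar> \<partial>\<mu>)" for p s h
      by (rule nn_integral_cong_AE, use AE_C in eventually_elim) (simp add: u_def)
    have uu: "(\<integral>\<^sup>+ x. ennreal \<bar>u p s x - u p' t x\<bar> \<partial>\<mu>) = (\<integral>\<^sup>+ x. ennreal \<bar>v p s x - v p' t x\<bar> \<partial>\<mu>)" for p s p' t
      by (rule nn_integral_cong_AE, use AE_C in eventually_elim) (simp add: u_def)
    define H where "H = M\<^sub>u * dd_regular.speed TYPE('n) M\<^sub>l M\<^sub>u G W (Lc m)"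
    define K where "K = H * 2 ^ CARD('n)"
    have H0: "0 \<le> H" unfolding H_def
      by (intro mult_nonneg_nonneg dd_regular.Mu_nonneg[OF reg[OF two[of 0]]] dd_regular.speed_nonneg[OF reg[OF two[of 0]] T.Lc T.\<psi>])
    have HK: "H \<le> K" unfolding K_def using mult_left_mono[OF one_le_power[of "2::real" "CARD('n)"] H0] by simp
    have half: "1 / real (2 ^ (p + 1)) \<le> 1 / 2 ^ p" for p :: nat by (simp add: field_simps)
    have "\<exists>(colour :: nat \<Rightarrow> nat \<times> (nat^'n) \<Rightarrow> nat) p0. finite (range colour) \<and>
      (\<forall>p\<ge>p0. \<forall>p'\<ge>p0. colour p = colour p' \<longrightarrow> (\<forall>t\<in>{0..\<tau>}. (\<integral>\<^sup>+ x. ennreal \<bar>u p t x - u p' t x\<bar> \<partial>\<mu>) \<le> ennreal e))"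
    proof (rule finite_colouring[where K = K, OF \<mu>D(3,1) order.trans[OF H0 HK] u_meas _ cell_index_measurable _ _ e])
      show "AE x in \<mu>. cell_index (2 ^ M) x \<in> idx (2 ^ M)" for M
        using gen[of "2 ^ M"] by eventually_elim (simp add: generic_cell_index(1))
      show "(\<integral>\<^sup>+ x. ennreal \<bar>u p s x - u p t x\<bar> \<partial>\<mu>) \<le> ennreal (K * (\<bar>s - t\<bar> + 1 / 2 ^ p))"
        if "0 \<le> s" "0 \<le> t" for p s t
      proof -
        have "(\<integral>\<^sup>+ x. ennreal \<bar>v p s x - v p t x\<bar> \<partial>\<mu>) \<le> ennreal (H * (\<bar>s - t\<bar> + 1 / real (2 ^ (p + 1))))"
          unfolding v_def \<kappa>_def H_def by (rule dd_regular.trajectory_time[where p = \<pi>, OF reg[OF two] T.\<psi> T.Lc refl that])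
        also have "\<dots> \<le> ennreal (K * (\<bar>s - t\<bar> + 1 / 2 ^ p))"
          using half[of p] H0 HK by (intro ennreal_leI mult_mono) auto
        finally show ?thesis unfolding uu .
      qed
      show "\<exists>w. (\<forall>\<alpha>\<in>idx (2 ^ M). 0 \<le> w \<alpha> \<and> w \<alpha> \<le> 1) \<and>
          (\<integral>\<^sup>+ x. ennreal \<bar>u p t x - w (cell_index (2 ^ M) x)\<bar> \<partial>\<mu>) \<le> ennreal (K * (1 / 2 ^ M + 1 / 2 ^ p))"
        if Mp: "M \<le> p" for p M t
      proof -
        have nMb: "2 ^ (p + 1) = 2 * (2 ^ M * 2 ^ (p - M) :: nat)" using Mp by (simp flip: power_add)
        have pos: "0 < (2::nat) ^ M" "0 < (2::nat) ^ (p - M)" by simp_all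
        obtain w where w: "\<forall>\<alpha>\<in>idx (2 ^ M). 0 \<le> w \<alpha> \<and> w \<alpha> \<le> 1"
          "(\<integral>\<^sup>+ x. ennreal \<bar>v p t x - w (cell_index (2 ^ M) x)\<bar> \<partial>\<mu>)
            \<le> ennreal (H * 2 ^ CARD('n) * (1 / real (2 ^ M) + 1 / real (2 ^ (p + 1))))"
          using dd_regular.trajectory_space[where p = \<pi> and t = t, OF reg[OF two] T.\<psi> T.Lc refl nMb pos]
          unfolding v_def \<kappa>_def H_def by blast
        note w(2)
        also have "ennreal (H * 2 ^ CARD('n) * (1 / real (2 ^ M) + 1 / real (2 ^ (p + 1)))) \<le> ennreal (K * (1 / 2 ^ M + 1 / 2 ^ p))"
          unfolding K_def[symmetric] using half[of p] order.trans[OF H0 HK] by (intro ennreal_leI mult_left_mono) simp_all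
        finally show ?thesis unfolding uv using w(1) by (intro exI[of _ w] conjI)
      qed
    qed
    then show ?thesis unfolding uu v_def .
  qed
  have "\<exists>(s :: nat \<Rightarrow> nat) \<eta>. strict_mono s \<and> (\<forall>t\<ge>0. kernel ?C Y (\<eta> t)) \<and>
    (\<forall>m q T \<epsilon>. q < N m \<longrightarrow> 0 < \<epsilon> \<longrightarrow> (\<exists>j0. \<forall>j\<ge>j0. \<forall>t\<in>{0..T}.
      (\<integral>\<^sup>+ x. ennreal \<bar>(LINT y|\<kappa> (s j) t x. \<psi> m q y) - (LINT y|\<eta> t x. \<psi> m q y)\<bar> \<partial>\<mu>) \<le> ennreal \<epsilon>))"
    by (rule T.limit_trajectory[where \<kappa> = \<kappa>, OF Cb \<mu>D(3,1,4) ker\<kappa> \<nu> col])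
  then obtain s :: "nat \<Rightarrow> nat" and \<theta> where s: "strict_mono s" and \<theta>: "\<And>t. 0 \<le> t \<Longrightarrow> kernel ?C Y (\<theta> t)"
    and lim: "\<And>m q T \<epsilon>. q < N m \<Longrightarrow> 0 < \<epsilon> \<Longrightarrow> \<exists>j0. \<forall>j\<ge>j0. \<forall>t\<in>{0..T}.
      (\<integral>\<^sup>+ x. ennreal \<bar>(LINT y|\<kappa> (s j) t x. \<psi> m q y) - (LINT y|\<theta> t x. \<psi> m q y)\<bar> \<partial>\<mu>) \<le> ennreal \<epsilon>"
    by blast
  define r where "r j = (2::nat) ^ (s j + 1)" for j
  define Pt where "Pt t = semidirect \<mu> (\<theta> t)" for t
  have r: "strict_mono r" using s by (simp add: strict_mono_def r_def)
  have rp: "r j \<in> pos_even" for j unfolding r_def by (rule two)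
  have dj: "disintegration ?C Y \<mu> (disc_trajectory Y \<mu> \<pi> (r j) t) (\<kappa> (s j) t)" for j t
    unfolding disc_trajectory_def \<kappa>_def r_def by (rule disintegration_semidirect[OF \<mu>D(1,4) Cb ker[OF two]])
  have dP: "disintegration ?C Y \<mu> (Pt t) (\<theta> t)" if "0 \<le> t" for t
    unfolding Pt_def by (rule disintegration_semidirect[OF \<mu>D(1,4) Cb \<theta>[OF that]])
  have pj: "disc_trajectory Y \<mu> \<pi> (r j) t \<in> prob_on (?C \<times> Y)" for j t
    by (rule disintegration_prob_on[OF \<mu>(1) Cc closed_Y dj])
  have pP: "Pt t \<in> prob_on (?C \<times> Y)" if "0 \<le> t" for t
    by (rule disintegration_prob_on[OF \<mu>(1) Cc closed_Y dP[OF that]])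
  have conv: "(\<lambda>j. LINT z|disc_trajectory Y \<mu> \<pi> (r j) t. \<phi> z) \<longlonglongrightarrow> (LINT z|Pt t. \<phi> z)"
    if \<phi>: "\<phi> \<in> lip01 L" and t: "0 \<le> t" for \<phi> L t
    by (rule T.joint_tests_converge[where \<kappa> = "\<lambda>j. \<kappa> (s j)" and \<eta> = \<theta> and \<pi> = "\<lambda>j. disc_trajectory Y \<mu> \<pi> (r j)" and P = Pt,
        OF Cb \<mu>D(3,1,4) dj dP lim \<phi> t prob_space.finite_measure[OF prob_onD(3)[OF pj]]
          prob_space.finite_measure[OF prob_onD(3)[OF pP[OF t]]]])
  \<comment> \<open>The weak convergence of the second marginals is only known along even numbers.\<close>
  have r_even: "filterlim r even_sequentially sequentially"
    unfolding even_sequentially_def filterlim_inf filterlim_principal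
    using rp filterlim_subseq[OF r] by (simp add: always_eventually)
  have coup: "Pt t \<in> couplings \<mu> \<nu>" if t: "0 \<le> t" for t
  proof -
    note p = prob_onD[OF pP[OF t]]
    have sm: "snd \<in> measurable (Pt t) borel" using fst_snd_borel(2) by (subst measurable_cong_sets[OF p(1) refl])
    have "distr (Pt t) borel snd = \<nu>"
    proof (rule prob_measures_eq_if_tests_eq[OF prob_space.prob_space_distr[OF p(3) sm] _ prob_onD(3,1)[OF \<nu>]])
      fix \<phi> :: "real^'n \<Rightarrow> real" and L assume \<phi>: "\<phi> \<in> lip01 L"
      have \<phi>2: "(\<lambda>z :: (real^'n) \<times> (real^'n). \<phi> (snd z)) \<in> lip01 L"
      proof (rule lip01I)
        fix z z' :: "(real^'n) \<times> (real^'n)"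
        have "\<bar>\<phi> (snd z) - \<phi> (snd z')\<bar> \<le> L * dist (snd z) (snd z')" by (rule lip01D(1)[OF \<phi>])
        also have "\<dots> \<le> L * dist z z'" using lip01D(4)[OF \<phi>] by (intro mult_left_mono dist_snd_le)
        finally show "\<bar>\<phi> (snd z) - \<phi> (snd z')\<bar> \<le> L * dist z z'" .
      qed (use lip01D[OF \<phi>] in simp_all)
      have eq: "(LINT z|disc_trajectory Y \<mu> \<pi> (r j) t. \<phi> (snd z)) = (LINT y|\<nu>n (r j). \<phi> y)" for j
      proof -
        have "ennreal (LINT z|disc_trajectory Y \<mu> \<pi> (r j) t. \<phi> (snd z)) = (\<integral>\<^sup>+ z. ennreal (\<phi> (snd z)) \<partial>disc_trajectory Y \<mu> \<pi> (r j) t)"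
          by (rule nn_integral_lip01[OF \<phi>2 prob_space.finite_measure[OF prob_onD(3)[OF pj]] prob_onD(1)[OF pj], symmetric])
        also have "\<dots> = (\<integral>\<^sup>+ x. \<integral>\<^sup>+ y. ennreal (\<phi> (snd (x, y))) \<partial>\<kappa> (s j) t x \<partial>\<mu>)"
          by (rule nn_integral_disintegration[OF Cb \<mu>D(1,4) dj measurable_compose[OF lip01D(6)[OF \<phi>2] measurable_ennreal]])
        also have "\<dots> = (\<integral>\<^sup>+ x. ennreal (LINT y|\<kappa> (s j) t x. \<phi> y) \<partial>\<mu>)"
        proof (rule nn_integral_cong_AE, use AE_C in eventually_elim)
          fix x assume "x \<in> ?C"
          then have "\<kappa> (s j) t x \<in> prob_on Y" using ker\<kappa>[of "s j" t] by (simp add: kernel_def)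
          note pk = prob_onD[OF this]
          show "(\<integral>\<^sup>+ y. ennreal (\<phi> (snd (x, y))) \<partial>\<kappa> (s j) t x) = ennreal (LINT y|\<kappa> (s j) t x. \<phi> y)"
            unfolding snd_conv by (rule nn_integral_lip01[OF \<phi> prob_space.finite_measure[OF pk(3)] pk(1)])
        qed
        also have "\<dots> = ennreal (LINT y|\<nu>n (r j). \<phi> y)"
          unfolding \<kappa>_def r_def by (rule dd_regular.trajectory_marginal[where p = \<pi>, OF reg[OF two] \<phi> refl])
        finally show ?thesis
          using integral_lip01_bounds(1)[OF \<phi>2 prob_onD(3,1)[OF pj]]
            integral_lip01_bounds(1)[OF \<phi> prob_onD(3,1)[OF \<nu>n(1)[OF rp]]] by (simp only: ennreal_inj)
      qed
      have "((\<lambda>n. LINT y:Y|\<nu>n n. \<phi> y) \<longlongrightarrow> (LINT y:Y|\<nu>. \<phi> y)) even_sequentially"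
        using \<nu>n(2) lip01D(5)[OF \<phi>] unfolding weak_star_conv_def by blast
      from filterlim_compose[OF this r_even] have "(\<lambda>j. LINT y|\<nu>n (r j). \<phi> y) \<longlonglongrightarrow> (LINT y|\<nu>. \<phi> y)"
        by (simp add: set_integral_prob_on[OF \<nu>n(1)[OF rp] closed_Y \<phi>] set_integral_prob_on[OF \<nu> closed_Y \<phi>])
      with conv[OF \<phi>2 t, unfolded eq] have "(LINT z|Pt t. \<phi> (snd z)) = (LINT y|\<nu>. \<phi> y)" by (rule LIMSEQ_unique)
      then show "(LINT y|distr (Pt t) borel snd. \<phi> y) = (LINT y|\<nu>. \<phi> y)"
        using lip01D(6)[OF \<phi>] by (subst integral_distr[OF sm]) simp_all
    qed simp
    then show ?thesis using disintegration_fst[OF \<mu>(1) Cc dP[OF t]] p(1) by (simp add: couplings_def)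
  qed
  have kP: "kernel {0..} (?C \<times> Y) Pt"
    unfolding kernel_def
  proof (intro conjI ballI)
    show "Pt t \<in> prob_on (?C \<times> Y)" if "t \<in> {0..}" for t using that by (intro pP) simp
    show "Pt \<in> measurable (restrict_space borel {0..}) (prob_algebra borel)"
    proof (rule measurable_prob_algebra_if_tests_measurable)
      fix \<phi> :: "(real^'n) \<times> (real^'n) \<Rightarrow> real" and L assume \<phi>: "\<phi> \<in> lip01 L"
      show "(\<lambda>t. LINT z|Pt t. \<phi> z) \<in> borel_measurable (restrict_space borel {0..})"
      proof (rule borel_measurable_LIMSEQ_real)
        show "(\<lambda>j. LINT z|disc_trajectory Y \<mu> \<pi> (r j) t. \<phi> z) \<longlonglongrightarrow> (LINT z|Pt t. \<phi> z)"
          if "t \<in> space (restrict_space borel {0..})" for t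
          using that by (intro conv[OF \<phi>]) (simp add: space_restrict_space)
        fix j
        define h where "h k = (LINT z|disc_trajectory Y \<mu> \<pi> (r j) (real k / real (r j)). \<phi> z)" for k :: nat
        have "0 < r j" using rp[of j] by (simp add: pos_even_def)
        then have "(LINT z|disc_trajectory Y \<mu> \<pi> (r j) t. \<phi> z) = h (nat \<lfloor>real (r j) * t\<rfloor>)" for t
          unfolding h_def by (subst disc_trajectory_grid_time) simp_all
        moreover have "(\<lambda>t. h (nat \<lfloor>real (r j) * t\<rfloor>)) \<in> borel_measurable (borel :: real measure)" by measurable
        ultimately show "(\<lambda>t. LINT z|disc_trajectory Y \<mu> \<pi> (r j) t. \<phi> z) \<in> borel_measurable (restrict_space borel {0..})"
          by (simp add: measurable_restrict_space1)
      qed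
    qed (use prob_onD(1,3)[OF pP] in \<open>simp_all add: space_restrict_space\<close>)
  qed
  have "(\<lambda>j. SUP t\<in>{0..T}. vertical_W ?C Y \<mu> (disc_trajectory Y \<mu> \<pi> (r j) t) (Pt t)) \<longlonglongrightarrow> 0" for T
    by (rule T.vertical_W_uniform_limit[where \<kappa> = "\<lambda>j. \<kappa> (s j)" and \<eta> = \<theta> and \<pi> = "\<lambda>j. disc_trajectory Y \<mu> \<pi> (r j)" and P = Pt,
        OF Cb \<mu>D(3,1,4) dj dP lim])
  moreover have "closed (?C \<times> Y)" by (intro closed_Times Cc closed_Y)
  note tm = trajectory_measure[OF this kP]
  moreover have "range r \<subseteq> pos_even" using rp by blast
  ultimately show ?thesis
    by (intro exI[of _ r] exI[of _ "semidirect (mrestrict lborel {0..}) Pt"] exI[of _ Pt] conjI r tm allI impI coup)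
qed

end
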